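(* Let $l>0$, $\nu>0$, $C_1\in\mathbb{R}$ and $s\ge 0$. Let $\overline{u}_0\in H^s(\mathbb{T}_l)$ and let $\zeta'_0\in H^s(\mathbb{T}_l^2)$ have zero zonal mean, i.e. $\frac1l\int_0^l\zeta_0'(x,y)\,dx=0$ for a.e. $y$. Then there exists a unique global solution $(\overline{u},\zeta')\in L^\infty\big((0,+\infty);\,H^s(\mathbb{T}_l)\times H^s(\mathbb{T}_l^2)\big)$ (with $\zeta'(t)$ of zero zonal mean) of the initial value problem $$\begin{cases}\partial_t\zeta'+C_1\,\partial_x\nabla^{-2}\zeta'-\nu\nabla^2\zeta'=F(\overline{u},\zeta'),\\ \partial_t\overline{u}-\nu\nabla^2\overline{u}=G(\zeta'),\\ \zeta'(0,x,y)=\zeta'_0(x,y),\\ \overline{u}(0,y)=\overline{u}_0(y),\end{cases}$$ where $$F(\overline{u},\zeta')=(\partial_y\nabla^{-2}\zeta')\,\zeta'_x-(\partial_x\nabla^{-2}\zeta')\,\zeta'_y-\overline{u}\,\zeta'_x+\partial_y\overline{\big[(\partial_x\nabla^{-2}\zeta')\,\zeta'\big]},\qquad G(\zeta')=\partial_y\overline{\big[\partial_x\nabla^{-2}\zeta'\,\partial_y\nabla^{-2}\zeta'\big]}.$$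
   Context: $\mathbb{T}_l=[0,l)$ and $\mathbb{T}_l^2=[0,l)^2$ with periodic boundary conditions; $\overline{u}=\overline{u}(t,y)$ depends only on $y$ in space and $\zeta'=\zeta'(t,x,y)$. The zonal mean of $f(x,y)$ is $\overline{f}(y)=\frac1l\int_0^l f(x,y)\,dx$. The $H^s$ norm is $\|f\|_{H^s}^2=\sum_k\langle k\rangle^{2s}|\widehat f(k)|^2$ with $\langle k\rangle=(1+|k|^2)^{1/2}$, the sum being over Fourier modes. $\nabla^2$ is the Laplacian ($\nabla^2\overline u=\partial_{yy}\overline u$), and $\nabla^{-2}$ is its inverse on functions on $\mathbb{T}_l^2$ with zero spatial mean. Because of the low regularity, "solution" means solution of the Duhamel integral system $$\overline{u}(t)=e^{\nu t\partial_{yy}}\overline{u}_0+\int_0^t e^{\nu(t-t')\partial_{yy}}G(\zeta')(t')\,dt',\qquad \zeta'(t)=e^{t\tilde D^2}\zeta_0'+\int_0^te^{(t-t')\tilde D^2}F(\overline{u},\zeta')(t')\,dt',$$ with $\tilde D^2=\nu\nabla^2-C_1\partial_x\nabla^{-2}$, the exponentials being Fourier multipliers. The nonlinear terms are understood as distributions in divergence form, e.g. $(\partial_y\nabla^{-2}\zeta')\zeta'_x-(\partial_x\nabla^{-2}\zeta')\zeta'_y=\partial_x[(\partial_y\nabla^{-2}\zeta')\zeta']-\partial_y[(\partial_x\nabla^{-2}\zeta')\zeta']$ and $\overline{u}\,\zeta'_x=\partial_x(\overline{u}\,\zeta')$. *)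

theory Defs
  imports "HOL-Analysis.Analysis"
begin

text \<open>A function on the torus \<open>[0,l)\<close> or \<open>[0,l)\<^sup>2\<close> is a real-valued function on \<open>real\<close> or
  \<open>real \<times> real\<close> of which only the values on the fundamental cell, up to Lebesgue null sets, matter.
  Points of the two-dimensional torus are pairs \<open>(x, y)\<close>, Fourier modes are pairs \<open>(j, k)\<close> with
  \<open>j\<close> dual to \<open>x\<close> and \<open>k\<close> dual to \<open>y\<close>.\<close>

definition torus1 :: "real \<Rightarrow> real set" where
  "torus1 l = {0..<l}"

definition torus2 :: "real \<Rightarrow> (real \<times> real) set" where
  "torus2 l = {0..<l} \<times> {0..<l}"

definition sq_integrable :: "'a::euclidean_space set \<Rightarrow> ('a \<Rightarrow> real) \<Rightarrow> bool" where
  "sq_integrable A f \<longleftrightarrow>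
     f \<in> borel_measurable (lebesgue_on A) \<and> integrable (lebesgue_on A) (\<lambda>x. (f x)\<^sup>2)"

definition wavenum :: "real \<Rightarrow> int \<Rightarrow> real" where
  "wavenum l k = 2 * pi * of_int k / l"

definition fcoeff1 :: "real \<Rightarrow> (real \<Rightarrow> real) \<Rightarrow> int \<Rightarrow> complex" where
  "fcoeff1 l f k =
     (LINT y|lebesgue_on (torus1 l). of_real (f y) * cis (- (wavenum l k * y))) / of_real l"

definition fcoeff2 :: "real \<Rightarrow> (real \<times> real \<Rightarrow> real) \<Rightarrow> int \<Rightarrow> int \<Rightarrow> complex" where
  "fcoeff2 l f j k =
     (LINT p|lebesgue_on (torus2 l).
        of_real (f p) * cis (- (wavenum l j * fst p + wavenum l k * snd p))) / of_real (l\<^sup>2)"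

text \<open>Sobolev spaces of order \<open>s \<ge> 0\<close>; the weight \<open>\<langle>k\<rangle>\<^sup>2\<^sup>s\<close> is \<open>(1 + |k|\<^sup>2) powr s\<close>, with \<open>k\<close> the
  integer mode.\<close>

definition sobolev1 :: "real \<Rightarrow> real \<Rightarrow> (real \<Rightarrow> real) set" where
  "sobolev1 l s = {f. sq_integrable (torus1 l) f \<and>
     (\<lambda>k. (1 + (of_int k)\<^sup>2) powr s * (cmod (fcoeff1 l f k))\<^sup>2) summable_on UNIV}"

definition sobolev1_norm :: "real \<Rightarrow> real \<Rightarrow> (real \<Rightarrow> real) \<Rightarrow> real" where
  "sobolev1_norm l s f =
     sqrt (\<Sum>\<^sub>\<infinity>k. (1 + (of_int k)\<^sup>2) powr s * (cmod (fcoeff1 l f k))\<^sup>2)"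

definition sobolev2 :: "real \<Rightarrow> real \<Rightarrow> (real \<times> real \<Rightarrow> real) set" where
  "sobolev2 l s = {f. sq_integrable (torus2 l) f \<and>
     (\<lambda>(j, k). (1 + (of_int j)\<^sup>2 + (of_int k)\<^sup>2) powr s * (cmod (fcoeff2 l f j k))\<^sup>2)
       summable_on UNIV}"

definition sobolev2_norm :: "real \<Rightarrow> real \<Rightarrow> (real \<times> real \<Rightarrow> real) \<Rightarrow> real" where
  "sobolev2_norm l s f =
     sqrt (\<Sum>\<^sub>\<infinity>(j, k). (1 + (of_int j)\<^sup>2 + (of_int k)\<^sup>2) powr s * (cmod (fcoeff2 l f j k))\<^sup>2)"

text \<open>\<open>u \<in> L\<^sup>\<infinity>((0,\<infinity>); V)\<close> for a space \<open>V\<close> of functions with norm \<open>N\<close>: strong (Bochner) measurability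
  and essential boundedness.\<close>

definition Linfty_time ::
    "('a \<Rightarrow> real) set \<Rightarrow> (('a \<Rightarrow> real) \<Rightarrow> real) \<Rightarrow> (real \<Rightarrow> 'a \<Rightarrow> real) \<Rightarrow> bool" where
  "Linfty_time V N u \<longleftrightarrow>
     (\<exists>S :: nat \<Rightarrow> real \<Rightarrow> 'a \<Rightarrow> real.
        (\<forall>n. simple_function (lebesgue_on {0<..}) (S n) \<and> (\<forall>t>0. S n t \<in> V)) \<and>
        (AE t in lebesgue_on {0<..}. (\<lambda>n. N (\<lambda>x. u t x - S n t x)) \<longlonglongrightarrow> 0)) \<and>
     (\<exists>B. AE t in lebesgue_on {0<..}. u t \<in> V \<and> N (u t) \<le> B)"

definition zonal_mean :: "real \<Rightarrow> (real \<times> real \<Rightarrow> real) \<Rightarrow> real \<Rightarrow> real" where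
  "zonal_mean l f y = (LINT x|lebesgue_on (torus1 l). f (x, y)) / l"

definition zero_zonal_mean :: "real \<Rightarrow> (real \<times> real \<Rightarrow> real) \<Rightarrow> bool" where
  "zero_zonal_mean l f \<longleftrightarrow> (AE y in lebesgue_on (torus1 l). zonal_mean l f y = 0)"

text \<open>The Fourier multiplier with symbol \<open>m\<close>, as an operator into square-integrable functions.
  The chosen function is unique up to null sets; it is only meaningful when \<open>m\<close> times the
  coefficients of \<open>f\<close> is square-summable and Hermitian-symmetric, as in all uses below.\<close>

definition fourier_mult :: "real \<Rightarrow> (int \<Rightarrow> int \<Rightarrow> complex) \<Rightarrow> (real \<times> real \<Rightarrow> real) \<Rightarrow> real \<times> real \<Rightarrow> real"
  where "fourier_mult l m f =
     (SOME g. sq_integrable (torus2 l) g \<and> (\<forall>j k. fcoeff2 l g j k = m j k * fcoeff2 l f j k))"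

definition lap_symbol :: "real \<Rightarrow> int \<Rightarrow> int \<Rightarrow> real" where
  "lap_symbol l j k = - ((wavenum l j)\<^sup>2 + (wavenum l k)\<^sup>2)"

text \<open>At the mode \<open>(0, 0)\<close> the following symbol is \<open>inverse 0 = 0\<close>; the operator \<open>\<nabla>\<^sup>-\<^sup>2\<close> is only
  applied to functions of zero spatial mean.\<close>

definition inv_lap_symbol :: "real \<Rightarrow> int \<Rightarrow> int \<Rightarrow> real" where
  "inv_lap_symbol l j k = inverse (lap_symbol l j k)"

definition inv_lap :: "real \<Rightarrow> (real \<times> real \<Rightarrow> real) \<Rightarrow> real \<times> real \<Rightarrow> real" where
  "inv_lap l = fourier_mult l (\<lambda>j k. of_real (inv_lap_symbol l j k))"

definition deriv_x :: "real \<Rightarrow> (real \<times> real \<Rightarrow> real) \<Rightarrow> real \<times> real \<Rightarrow> real" where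
  "deriv_x l = fourier_mult l (\<lambda>j k. \<i> * of_real (wavenum l j))"

definition deriv_y :: "real \<Rightarrow> (real \<times> real \<Rightarrow> real) \<Rightarrow> real \<times> real \<Rightarrow> real" where
  "deriv_y l = fourier_mult l (\<lambda>j k. \<i> * of_real (wavenum l k))"

text \<open>The nonlinearities are periodic distributions, given by their Fourier coefficients. They are
  in divergence form: each summand is a derivative, acting on the coefficients as \<open>\<i>\<close> times the
  wave number, of an integrable flux.\<close>

definition F_coeff ::
    "real \<Rightarrow> (real \<Rightarrow> real) \<Rightarrow> (real \<times> real \<Rightarrow> real) \<Rightarrow> int \<Rightarrow> int \<Rightarrow> complex" where
  "F_coeff l u \<zeta> j k =
     (let \<psi> = inv_lap l \<zeta>; \<psi>x = deriv_x l \<psi>; \<psi>y = deriv_y l \<psi>;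
          dx = \<i> * of_real (wavenum l j); dy = \<i> * of_real (wavenum l k)
      in dx * fcoeff2 l (\<lambda>p. \<psi>y p * \<zeta> p) j k
       - dy * fcoeff2 l (\<lambda>p. \<psi>x p * \<zeta> p) j k
       - dx * fcoeff2 l (\<lambda>p. u (snd p) * \<zeta> p) j k
       + dy * fcoeff2 l (\<lambda>p. zonal_mean l (\<lambda>q. \<psi>x q * \<zeta> q) (snd p)) j k)"

definition G_coeff :: "real \<Rightarrow> (real \<times> real \<Rightarrow> real) \<Rightarrow> int \<Rightarrow> complex" where
  "G_coeff l \<zeta> k =
     (let \<psi> = inv_lap l \<zeta>
      in \<i> * of_real (wavenum l k) *
         fcoeff1 l (zonal_mean l (\<lambda>q. deriv_x l \<psi> q * deriv_y l \<psi> q)) k)"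

definition heat_symbol :: "real \<Rightarrow> real \<Rightarrow> int \<Rightarrow> complex" where
  "heat_symbol l \<nu> k = of_real (- \<nu> * (wavenum l k)\<^sup>2)"

text \<open>The symbol of \<open>\<nu>\<nabla>\<^sup>2 - C\<^sub>1 \<partial>\<^sub>x \<nabla>\<^sup>-\<^sup>2\<close>.\<close>

definition D_symbol :: "real \<Rightarrow> real \<Rightarrow> real \<Rightarrow> int \<Rightarrow> int \<Rightarrow> complex" where
  "D_symbol l \<nu> C1 j k = of_real (\<nu> * lap_symbol l j k)
     - of_real C1 * (\<i> * of_real (wavenum l j)) * of_real (inv_lap_symbol l j k)"

text \<open>The two Duhamel identities at time \<open>t\<close>, as identities of periodic distributions, that is,
  of all Fourier coefficients.\<close>

definition duhamel_u ::
    "real \<Rightarrow> real \<Rightarrow> (real \<Rightarrow> real) \<Rightarrow> (real \<Rightarrow> real \<Rightarrow> real) \<Rightarrow> (real \<Rightarrow> real \<times> real \<Rightarrow> real) \<Rightarrow> real \<Rightarrow> bool"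
  where "duhamel_u l \<nu> u0 u \<zeta> t \<longleftrightarrow>
     (\<forall>k. set_integrable lebesgue {0..t}
            (\<lambda>r. exp (of_real (t - r) * heat_symbol l \<nu> k) * G_coeff l (\<zeta> r) k) \<and>
          fcoeff1 l (u t) k = exp (of_real t * heat_symbol l \<nu> k) * fcoeff1 l u0 k
            + (LINT r:{0..t}|lebesgue.
                 exp (of_real (t - r) * heat_symbol l \<nu> k) * G_coeff l (\<zeta> r) k))"

definition duhamel_zeta ::
    "real \<Rightarrow> real \<Rightarrow> real \<Rightarrow> (real \<times> real \<Rightarrow> real) \<Rightarrow> (real \<Rightarrow> real \<Rightarrow> real) \<Rightarrow> (real \<Rightarrow> real \<times> real \<Rightarrow> real)
      \<Rightarrow> real \<Rightarrow> bool"
  where "duhamel_zeta l \<nu> C1 \<zeta>0 u \<zeta> t \<longleftrightarrow>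
     (\<forall>j k. set_integrable lebesgue {0..t}
            (\<lambda>r. exp (of_real (t - r) * D_symbol l \<nu> C1 j k) * F_coeff l (u r) (\<zeta> r) j k) \<and>
          fcoeff2 l (\<zeta> t) j k = exp (of_real t * D_symbol l \<nu> C1 j k) * fcoeff2 l \<zeta>0 j k
            + (LINT r:{0..t}|lebesgue.
                 exp (of_real (t - r) * D_symbol l \<nu> C1 j k) * F_coeff l (u r) (\<zeta> r) j k))"

definition solves_at ::
    "real \<Rightarrow> real \<Rightarrow> real \<Rightarrow> real \<Rightarrow> (real \<Rightarrow> real) \<Rightarrow> (real \<times> real \<Rightarrow> real)
      \<Rightarrow> (real \<Rightarrow> real \<Rightarrow> real) \<Rightarrow> (real \<Rightarrow> real \<times> real \<Rightarrow> real) \<Rightarrow> real \<Rightarrow> bool"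
  where "solves_at l \<nu> C1 s u0 \<zeta>0 u \<zeta> t \<longleftrightarrow>
     u t \<in> sobolev1 l s \<and> \<zeta> t \<in> sobolev2 l s \<and> zero_zonal_mean l (\<zeta> t) \<and>
     duhamel_u l \<nu> u0 u \<zeta> t \<and> duhamel_zeta l \<nu> C1 \<zeta>0 u \<zeta> t"

text \<open>Elements of \<open>L\<^sup>\<infinity>((0,\<infinity>); H\<^sup>s \<times> H\<^sup>s)\<close> are defined up to null sets of times, hence so is the
  notion of solution.\<close>

definition global_solution ::
    "real \<Rightarrow> real \<Rightarrow> real \<Rightarrow> real \<Rightarrow> (real \<Rightarrow> real) \<Rightarrow> (real \<times> real \<Rightarrow> real)
      \<Rightarrow> (real \<Rightarrow> real \<Rightarrow> real) \<Rightarrow> (real \<Rightarrow> real \<times> real \<Rightarrow> real) \<Rightarrow> bool"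
  where "global_solution l \<nu> C1 s u0 \<zeta>0 u \<zeta> \<longleftrightarrow>
     Linfty_time (sobolev1 l s) (sobolev1_norm l s) u \<and>
     Linfty_time (sobolev2 l s) (sobolev2_norm l s) \<zeta> \<and>
     (AE t in lebesgue_on {0<..}. solves_at l \<nu> C1 s u0 \<zeta>0 u \<zeta> t)"

end

theory Submission
  imports Defs
begin

text \<open>On the Fourier side the unknowns form one sequence \<open>c\<close> on \<open>\<int>\<^sup>2\<close>: the row \<open>c (0, k)\<close> carries the
  coefficients of \<open>u\<close>, the other rows those of \<open>\<zeta>'\<close>, whose zonal modes vanish. The system becomes
  \<open>c' = L c + N(c, c)\<close> with a diagonal \<open>L\<close>, \<open>Re (L n) \<sim> - \<bar>n\<bar>\<^sup>2\<close>, and a bilinear convolution \<open>N\<close>. The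
  gain of two derivatives in the velocity and Cauchy--Schwarz bound \<open>N\<close> from \<open>\<ell>\<^sup>2 \<times> \<ell>\<^sup>2\<close> to the Sobolev
  space of order \<open>- 7/4\<close>, and the semigroup regains more than that with the integrable singularity
  \<open>t powr (- 15/16)\<close>. Hence, in the norms \<open>sup\<^sub>t exp (- \<theta> t) \<parallel>c t\<parallel>\<close> with large \<open>\<theta>\<close>, the Duhamel map
  halves distances on bounded sets, which gives uniqueness and makes the Galerkin approximations
  Cauchy. The latter are global and bounded in \<open>\<ell>\<^sup>2\<close>: the advection conserves the enstrophy of \<open>\<zeta>'\<close>,
  and \<open>u\<close> is forced by \<open>\<zeta>'\<close> alone. The bound in \<open>H\<^sup>s\<close> follows by interpolation between \<open>s\<close> and \<open>0\<close>, the
  Duhamel term gaining \<open>1/8\<close> of a derivative. Uniqueness of Fourier coefficients, the Riesz--Fischer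
  theorem and the coefficients of products translate this back to functions.\<close>

section \<open>Weighted square-summable sequences\<close>

text \<open>The obstacle is the zonal flow: it is as rough as the vorticity, and as a velocity it
  gains no derivative. What saves the quadratic estimate is that it depends on one variable only. In
  the convolution its modes fill a line, where the inverse bracket to the power 3/2 is summable,
  whereas the modes of the vorticity fill the plane but bring the smoothing of the velocity. This
  fixes the order 7/4 = 1 + 3/4: one derivative for the divergence form, and 3/4 > 1/2 for the line
  sum. The room between 7/4 and the two derivatives of the heat flow is then shared out. Duhamel's
  integral climbs from \<sigma> - 7/4 to \<sigma> + 1/8, that is 15/8 derivatives, with the
  singularity 15/16. The surplus 1/8 pays for the truncation error of the Galerkin scheme and for
  the interpolation in the bound of order s. Of the distance from 15/16 to 1, a share of 1/32 is
  traded for the small power of \<theta>. Bounds uniform in time are possible because the only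
  undamped mode, n = 0, is never forced.\<close>

text \<open>The square \<open>\<langle>n\<rangle>\<^sup>2\<close> of the bracket of the paper.\<close>

definition jap :: "int \<times> int \<Rightarrow> real" where
  "jap n = 1 + (of_int (fst n))\<^sup>2 + (of_int (snd n))\<^sup>2"

lemma jap_ge_1: "1 \<le> jap n"
  by (simp add: jap_def)

lemma jap_pos: "0 < jap n"
  using jap_ge_1[of n] by linarith

lemma jap_le_2:
  assumes "n \<noteq> 0"
  shows "jap n \<le> 2 * ((of_int (fst n))\<^sup>2 + (of_int (snd n))\<^sup>2)"
proof -
  have "fst n \<noteq> 0 \<or> snd n \<noteq> 0"
    using assms by (simp add: prod_eq_iff)
  then have "1 \<le> (fst n)\<^sup>2 + (snd n)\<^sup>2"
    by (simp add: int_one_le_iff_zero_less sum_power2_gt_zero_iff)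
  then have "of_int 1 \<le> (of_int ((fst n)\<^sup>2 + (snd n)\<^sup>2) :: real)"
    by (simp only: of_int_le_iff)
  then show ?thesis by (simp add: jap_def)
qed

text \<open>The norm of order \<open>\<sigma>\<close> is at most \<open>B\<close>, phrased through
  finite partial sums: no summability conditions arise on the way, and the bound survives
  coefficientwise limits. Since \<open>jap n\<close> is already a square,
  \<open>jap n powr \<sigma>\<close> is the squared Sobolev weight of order
  \<open>\<sigma>\<close>.\<close>

definition hbound :: "real \<Rightarrow> (int \<times> int \<Rightarrow> complex) \<Rightarrow> real \<Rightarrow> bool" where
  "hbound \<sigma> a B \<longleftrightarrow> 0 \<le> B \<and>
     (\<forall>F. finite F \<longrightarrow> (\<Sum>n\<in>F. jap n powr \<sigma> * (cmod (a n))\<^sup>2) \<le> B\<^sup>2)"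

lemma hboundI:
  assumes "0 \<le> B" "\<And>F. finite F \<Longrightarrow> (\<Sum>n\<in>F. jap n powr \<sigma> * (cmod (a n))\<^sup>2) \<le> B\<^sup>2"
  shows "hbound \<sigma> a B"
  using assms by (simp add: hbound_def)

lemma hboundD: "hbound \<sigma> a B \<Longrightarrow> finite F \<Longrightarrow> (\<Sum>n\<in>F. jap n powr \<sigma> * (cmod (a n))\<^sup>2) \<le> B\<^sup>2"
  by (simp add: hbound_def)

lemma hbound_nonneg: "hbound \<sigma> a B \<Longrightarrow> 0 \<le> B"
  by (simp add: hbound_def)

lemma hbound0: "hbound 0 a B \<longleftrightarrow> 0 \<le> B \<and> (\<forall>F. finite F \<longrightarrow> (\<Sum>n\<in>F. (cmod (a n))\<^sup>2) \<le> B\<^sup>2)"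
proof -
  have "jap n powr 0 = 1" for n using jap_pos[of n] by simp
  then show ?thesis by (simp add: hbound_def)
qed

lemma hbound_mono:
  assumes "hbound \<sigma> a A" "A \<le> B"
  shows "hbound \<sigma> a B"
proof (rule hboundI)
  show "0 \<le> B" using assms hbound_nonneg by force
  show "(\<Sum>n\<in>F. jap n powr \<sigma> * (cmod (a n))\<^sup>2) \<le> B\<^sup>2" if "finite F" for F
    using hboundD[OF assms(1) that] power_mono[OF assms(2) hbound_nonneg[OF assms(1)], of 2] by linarith
qed

lemma hbound_dominated:
  assumes "hbound \<sigma> b B" "0 \<le> c"
    and "\<And>n. jap n powr \<tau> * (cmod (a n))\<^sup>2 \<le> c\<^sup>2 * (jap n powr \<sigma> * (cmod (b n))\<^sup>2)"
  shows "hbound \<tau> a (c * B)"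
proof (rule hboundI)
  show "0 \<le> c * B" using assms hbound_nonneg by force
  fix F :: "(int \<times> int) set" assume F: "finite F"
  have "(\<Sum>n\<in>F. jap n powr \<tau> * (cmod (a n))\<^sup>2) \<le> (\<Sum>n\<in>F. c\<^sup>2 * (jap n powr \<sigma> * (cmod (b n))\<^sup>2))"
    by (intro sum_mono assms)
  also have "\<dots> \<le> c\<^sup>2 * B\<^sup>2"
    unfolding sum_distrib_left[symmetric] by (intro mult_left_mono hboundD[OF assms(1) F]) auto
  finally show "(\<Sum>n\<in>F. jap n powr \<tau> * (cmod (a n))\<^sup>2) \<le> (c * B)\<^sup>2"
    by (simp add: power_mult_distrib)
qed

lemma hbound_le_index:
  assumes "hbound \<sigma> a A" "\<tau> \<le> \<sigma>"
  shows "hbound \<tau> a A"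
proof -
  have "hbound \<tau> a (1 * A)"
    by (rule hbound_dominated[OF assms(1)])
       (auto intro!: mult_right_mono powr_mono assms jap_ge_1)
  then show ?thesis by simp
qed

lemma hbound_cmod_le:
  assumes "hbound \<sigma> b B" "\<And>n. cmod (a n) \<le> cmod (b n)"
  shows "hbound \<sigma> a B"
proof -
  have "hbound \<sigma> a (1 * B)"
    by (rule hbound_dominated[OF assms(1)])
       (auto intro!: mult_left_mono power_mono assms)
  then show ?thesis by simp
qed

lemma hbound_uminus: "hbound \<sigma> a A \<Longrightarrow> hbound \<sigma> (\<lambda>n. - a n) A"
  by (erule hbound_cmod_le) simp

lemma hbound_cmult: "hbound \<sigma> a A \<Longrightarrow> hbound \<sigma> (\<lambda>n. c * a n) (cmod c * A)"
  by (erule hbound_dominated) (auto simp: norm_mult power_mult_distrib)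

lemma hbound_L2:
  assumes "hbound \<sigma> a A" "finite F"
  shows "L2_set (\<lambda>n. jap n powr (\<sigma>/2) * cmod (a n)) F \<le> A"
proof -
  have e: "(jap n powr (\<sigma>/2) * cmod (a n))\<^sup>2 = jap n powr \<sigma> * (cmod (a n))\<^sup>2" for n
  proof -
    have "(jap n powr (\<sigma>/2))\<^sup>2 = jap n powr \<sigma>"
      using jap_pos[of n] by (simp add: power2_eq_square flip: powr_add)
    then show ?thesis by (simp add: power_mult_distrib)
  qed
  have "(\<Sum>n\<in>F. (jap n powr (\<sigma>/2) * cmod (a n))\<^sup>2) \<le> A\<^sup>2"
    unfolding e by (rule hboundD[OF assms])
  then show ?thesis
    unfolding L2_set_def using hbound_nonneg[OF assms(1)] by (intro real_le_lsqrt) auto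
qed

lemma hbound_of_L2:
  assumes "0 \<le> A" "\<And>F. finite F \<Longrightarrow> L2_set (\<lambda>n. jap n powr (\<sigma>/2) * cmod (a n)) F \<le> A"
  shows "hbound \<sigma> a A"
proof (rule hboundI)
  fix F :: "(int \<times> int) set" assume F: "finite F"
  have e: "(jap n powr (\<sigma>/2) * cmod (a n))\<^sup>2 = jap n powr \<sigma> * (cmod (a n))\<^sup>2" for n
  proof -
    have "(jap n powr (\<sigma>/2))\<^sup>2 = jap n powr \<sigma>"
      using jap_pos[of n] by (simp add: power2_eq_square flip: powr_add)
    then show ?thesis by (simp add: power_mult_distrib)
  qed
  have "(L2_set (\<lambda>n. jap n powr (\<sigma>/2) * cmod (a n)) F)\<^sup>2 \<le> A\<^sup>2"
    by (intro power_mono assms F L2_set_nonneg)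
  then show "(\<Sum>n\<in>F. jap n powr \<sigma> * (cmod (a n))\<^sup>2) \<le> A\<^sup>2"
    unfolding L2_set_def e by (simp add: sum_nonneg)
qed (use assms in auto)

lemma hbound_add:
  assumes "hbound \<sigma> a A" "hbound \<sigma> b B"
  shows "hbound \<sigma> (\<lambda>n. a n + b n) (A + B)"
proof (rule hbound_of_L2)
  show "0 \<le> A + B" using assms hbound_nonneg by fastforce
  fix F :: "(int \<times> int) set" assume F: "finite F"
  have "L2_set (\<lambda>n. jap n powr (\<sigma>/2) * cmod (a n + b n)) F
     \<le> L2_set (\<lambda>n. jap n powr (\<sigma>/2) * cmod (a n) + jap n powr (\<sigma>/2) * cmod (b n)) F"
    by (intro L2_set_mono) (auto simp: norm_triangle_ineq mult_left_mono simp flip: distrib_left)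
  also have "\<dots> \<le> A + B"
    by (rule order_trans[OF L2_set_triangle_ineq])
       (intro add_mono hbound_L2[OF assms(1) F] hbound_L2[OF assms(2) F])
  finally show "L2_set (\<lambda>n. jap n powr (\<sigma>/2) * cmod (a n + b n)) F \<le> A + B" .
qed

lemma hbound_diff:
  assumes "hbound \<sigma> a A" "hbound \<sigma> b B"
  shows "hbound \<sigma> (\<lambda>n. a n - b n) (A + B)"
  using hbound_add[OF assms(1) hbound_uminus[OF assms(2)]] by simp

lemma hbound_cmod_single:
  assumes "hbound 0 a A"
  shows "cmod (a n) \<le> A"
proof -
  have "(cmod (a n))\<^sup>2 \<le> A\<^sup>2"
    using hboundD[OF assms, of "{n}"] jap_pos[of n] by simp
  then show ?thesis
    using hbound_nonneg[OF assms] by (simp add: power2_le_iff_abs_le)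
qed

text \<open>Fatou's lemma for series: each finite sum passes to the limit, so coefficientwise
  convergence is enough.\<close>

lemma hbound_limit:
  assumes "\<And>n. (\<lambda>i. a i n) \<longlonglongrightarrow> b n" "\<And>i. hbound \<sigma> (a i) B"
  shows "hbound \<sigma> b B"
proof (rule hboundI)
  show "0 \<le> B" using assms(2) hbound_nonneg by blast
  fix F :: "(int \<times> int) set" assume F: "finite F"
  have "(\<lambda>i. \<Sum>n\<in>F. jap n powr \<sigma> * (cmod (a i n))\<^sup>2) \<longlonglongrightarrow> (\<Sum>n\<in>F. jap n powr \<sigma> * (cmod (b n))\<^sup>2)"
    by (intro tendsto_intros assms)
  then show "(\<Sum>n\<in>F. jap n powr \<sigma> * (cmod (b n))\<^sup>2) \<le> B\<^sup>2"
    by (rule LIMSEQ_le_const2) (use hboundD[OF assms(2) F] in auto)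
qed

lemma square_powr: "0 \<le> x \<Longrightarrow> (x\<^sup>2) powr a = x powr (2 * a)" for x a :: real
  by (metis powr_powr powr_numeral)

text \<open>For nonzero \<open>k\<close> the terms are at most |k| powr (-3/2), and 3/2 > 1. This is
  the line sum on which the estimate of the zonal modes rests; its square also dominates the plane
  sum.\<close>

lemma line_sum_bounded:
  "\<exists>Z>0. \<forall>G. finite G \<longrightarrow> (\<Sum>k\<in>G. (1 + (of_int k :: real)\<^sup>2) powr (-3/4)) \<le> Z"
proof -
  define f where "f n = (1 + (of_nat n :: real)\<^sup>2) powr (-3/4)" for n :: nat
  have "summable (\<lambda>n. real n powr (-3/2))"
    by (simp add: summable_real_powr_iff)
  then have "summable f"
  proof (rule summable_comparison_test')
    fix n :: nat assume n: "1 \<le> n"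
    have "f n \<le> ((of_nat n)\<^sup>2) powr (-3/4)"
      unfolding f_def using n by (intro powr_mono2') auto
    also have "\<dots> = real n powr (-3/2)"
      by (simp add: square_powr)
    finally show "norm (f n) \<le> real n powr (-3/2)" by (simp add: f_def)
  qed
  then have S: "sum f H \<le> suminf f" if "finite H" for H
    using that by (intro sum_le_suminf) (auto simp: f_def)
  \<comment> \<open>The nonnegative and the negative integers each map injectively to the naturals
    by the absolute value; the summand 1 makes the bound positive.\<close>
  have "(\<Sum>k\<in>G. (1 + (of_int k :: real)\<^sup>2) powr (-3/4)) \<le> 2 * suminf f + 1" if G: "finite G" for G :: "int set"
  proof -
    have split: "G = {k\<in>G. 0 \<le> k} \<union> {k\<in>G. k < 0}" by auto
    have *: "(1 + (of_int k :: real)\<^sup>2) powr (-3/4) = f (nat \<bar>k\<bar>)" for k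
      by (simp add: f_def)
    have "(\<Sum>k\<in>{k\<in>G. 0 \<le> k}. f (nat \<bar>k\<bar>)) = sum f ((\<lambda>k. nat \<bar>k\<bar>) ` {k\<in>G. 0 \<le> k})"
      by (subst sum.reindex) (auto simp: inj_on_def)
    moreover have "(\<Sum>k\<in>{k\<in>G. k < 0}. f (nat \<bar>k\<bar>)) = sum f ((\<lambda>k. nat \<bar>k\<bar>) ` {k\<in>G. k < 0})"
      by (subst sum.reindex) (auto simp: inj_on_def)
    moreover have "(\<Sum>k\<in>G. f (nat \<bar>k\<bar>)) = (\<Sum>k\<in>{k\<in>G. 0 \<le> k}. f (nat \<bar>k\<bar>)) + (\<Sum>k\<in>{k\<in>G. k < 0}. f (nat \<bar>k\<bar>))"
      by (subst split, subst sum.union_disjoint) (use G in auto)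
    ultimately show ?thesis
      unfolding * using S[of "(\<lambda>k. nat \<bar>k\<bar>) ` {k\<in>G. 0 \<le> k}"] S[of "(\<lambda>k. nat \<bar>k\<bar>) ` {k\<in>G. k < 0}"] G
      by simp
  qed
  moreover have "0 < 2 * suminf f + 1"
    using S[of "{}"] by simp
  ultimately show ?thesis by blast
qed

section \<open>The quadratic nonlinearity\<close>

text \<open>The squared gain from a mode to the velocity that it generates: a nonzonal mode of the
  vorticity gains one derivative, while a mode of the zonal flow is itself a velocity and gains
  nothing.\<close>

definition vweight :: "int \<times> int \<Rightarrow> real" where
  "vweight m = (if fst m = 0 then 1 else 1 / jap m)"

lemma vweight_bounds: "0 \<le> vweight m" "vweight m \<le> 1"
  using jap_ge_1[of m] by (auto simp: vweight_def)

text \<open>By (1 + x) (1 + y) \<le> (1 + x + y)^2 the plane sum splits into two line sums, once 7/4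
  is relaxed to 3/2 = 2 * 3/4.\<close>

lemma jap_powr_le_product:
  "jap n powr (-7/4) \<le> (1 + (of_int (fst n) :: real)\<^sup>2) powr (-3/4) * (1 + (of_int (snd n))\<^sup>2) powr (-3/4)"
proof -
  define x where "x = (of_int (fst n) :: real)\<^sup>2"
  define y where "y = (of_int (snd n) :: real)\<^sup>2"
  have xy: "0 \<le> x" "0 \<le> y" by (auto simp: x_def y_def)
  have j: "jap n = 1 + x + y" by (simp add: jap_def x_def y_def)
  have "(1 + x) * (1 + y) \<le> (1 + x + y)\<^sup>2"
    using xy by (simp add: power2_eq_square algebra_simps)
  then have "((1 + x + y)\<^sup>2) powr (-3/4) \<le> ((1 + x) * (1 + y)) powr (-3/4)"
    using xy by (intro powr_mono2') auto
  moreover have "((1 + x + y)\<^sup>2) powr (-3/4) = (1 + x + y) powr (-3/2)"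
    using xy by (simp add: square_powr)
  moreover have "(1 + x + y) powr (-7/4) \<le> (1 + x + y) powr (-3/2)"
    using xy by (intro powr_mono) auto
  ultimately show ?thesis
    using xy unfolding j x_def[symmetric] y_def[symmetric] by (simp add: powr_mult)
qed

text \<open>The bound is uniform in the shift \<open>p\<close>. Zonal \<open>m\<close> lie on a
  line, where dropping the first coordinate leaves a line sum. For the other \<open>m\<close> both
  weights count: their exponents 1 and 3/4 add up to 7/4, which is enough for the plane.\<close>

lemma plane_sum_bounded:
  "\<exists>Z>0. \<forall>p F. finite F \<longrightarrow> (\<Sum>m\<in>F. vweight m * jap (p + m) powr (-3/4)) \<le> Z"
proof -
  obtain Z where Z: "Z > 0" "\<And>G. finite G \<Longrightarrow> (\<Sum>k\<in>G. (1 + (of_int k :: real)\<^sup>2) powr (-3/4)) \<le> Z"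
    using line_sum_bounded by blast
  have sq: "(\<Sum>m\<in>F. jap m powr (-7/4)) \<le> Z * Z" if F: "finite F" for F
  proof -
    have "(\<Sum>m\<in>F. jap m powr (-7/4)) \<le> (\<Sum>m\<in>fst ` F \<times> snd ` F. jap m powr (-7/4))"
      by (rule sum_mono2) (use F in \<open>auto intro: rev_image_eqI\<close>)
    also have "\<dots> \<le> (\<Sum>m\<in>fst ` F \<times> snd ` F. (1 + (of_int (fst m) :: real)\<^sup>2) powr (-3/4) * (1 + (of_int (snd m))\<^sup>2) powr (-3/4))"
      by (intro sum_mono jap_powr_le_product)
    also have "\<dots> = (\<Sum>j\<in>fst ` F. (1 + (of_int j :: real)\<^sup>2) powr (-3/4)) * (\<Sum>k\<in>snd ` F. (1 + (of_int k :: real)\<^sup>2) powr (-3/4))"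
      by (simp add: sum_product sum.cartesian_product case_prod_unfold)
    also have "\<dots> \<le> Z * Z"
      using F Z by (intro mult_mono) (auto intro: sum_nonneg)
    finally show ?thesis .
  qed
  have shift: "(\<Sum>m\<in>F. jap (p + m) powr (-7/4)) \<le> Z * Z" if "finite F" for F p
    using sq[of "(+) p ` F"] that by (simp add: sum.reindex)
  have "(\<Sum>m\<in>F. vweight m * jap (p + m) powr (-3/4)) \<le> Z + 2 * (Z * Z)" if F: "finite F" for F p
  proof -
    have 1: "(\<Sum>m\<in>{m\<in>F. fst m = 0}. vweight m * jap (p + m) powr (-3/4)) \<le> Z"
    proof -
      have "(\<Sum>m\<in>{m\<in>F. fst m = 0}. vweight m * jap (p + m) powr (-3/4))
        \<le> (\<Sum>m\<in>{m\<in>F. fst m = 0}. (1 + (of_int (snd p + snd m) :: real)\<^sup>2) powr (-3/4))"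
        by (intro sum_mono) (auto simp: vweight_def jap_def add_pos_nonneg intro!: powr_mono2')
      also have "\<dots> = (\<Sum>k\<in>(\<lambda>m. snd p + snd m) ` {m\<in>F. fst m = 0}. (1 + (of_int k :: real)\<^sup>2) powr (-3/4))"
        by (subst sum.reindex) (auto simp: inj_on_def)
      also have "\<dots> \<le> Z" using F by (intro Z) auto
      finally show ?thesis .
    qed
    \<comment> \<open>The larger of the two brackets is replaced by the smaller, which then carries
      the full exponent 7/4.\<close>
    have pt: "vweight m * jap (p + m) powr (-3/4) \<le> jap m powr (-7/4) + jap (p + m) powr (-7/4)" if "fst m \<noteq> 0" for m
    proof -
      have v: "vweight m = jap m powr (-1)"
        using that jap_pos[of m] by (simp add: vweight_def powr_minus_divide)
      show ?thesis
      proof (cases "jap m \<le> jap (p + m)")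
        case True
        have "jap (p + m) powr (-3/4) \<le> jap m powr (-3/4)"
          using True jap_pos by (intro powr_mono2') auto
        then have "vweight m * jap (p + m) powr (-3/4) \<le> jap m powr (-1) * jap m powr (-3/4)"
          unfolding v by (intro mult_left_mono) auto
        then show ?thesis
          unfolding powr_add[symmetric] by (simp add: add_increasing2)
      next
        case False
        then have "jap m powr (-1) \<le> jap (p + m) powr (-1)"
          using jap_pos by (intro powr_mono2') auto
        then have "vweight m * jap (p + m) powr (-3/4) \<le> jap (p + m) powr (-1) * jap (p + m) powr (-3/4)"
          unfolding v by (intro mult_right_mono) auto
        then show ?thesis
          unfolding powr_add[symmetric] by (simp add: add_increasing)
      qed
    qed
    have 2: "(\<Sum>m\<in>{m\<in>F. fst m \<noteq> 0}. vweight m * jap (p + m) powr (-3/4)) \<le> 2 * (Z * Z)"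
    proof -
      have "(\<Sum>m\<in>{m\<in>F. fst m \<noteq> 0}. vweight m * jap (p + m) powr (-3/4))
         \<le> (\<Sum>m\<in>{m\<in>F. fst m \<noteq> 0}. jap m powr (-7/4) + jap (p + m) powr (-7/4))"
        by (intro sum_mono pt) auto
      also have "\<dots> \<le> 2 * (Z * Z)"
        unfolding sum.distrib using sq[of "{m\<in>F. fst m \<noteq> 0}"] shift[of "{m\<in>F. fst m \<noteq> 0}" p] F by simp
      finally show ?thesis .
    qed
    have split: "F = {m\<in>F. fst m = 0} \<union> {m\<in>F. fst m \<noteq> 0}" by auto
    have "(\<Sum>m\<in>F. vweight m * jap (p + m) powr (-3/4)) =
      (\<Sum>m\<in>{m\<in>F. fst m = 0}. vweight m * jap (p + m) powr (-3/4)) +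
      (\<Sum>m\<in>{m\<in>F. fst m \<noteq> 0}. vweight m * jap (p + m) powr (-3/4))"
      by (subst split, subst sum.union_disjoint) (use F in auto)
    then show ?thesis using 1 2 by linarith
  qed
  moreover have "0 < Z + 2 * (Z * Z)" using Z(1) by (simp add: add_pos_pos)
  ultimately show ?thesis by blast
qed

text \<open>Since \<open>\<psi> = \<nabla>\<^sup>-\<^sup>2 \<zeta>'\<close> has the coefficients \<open>- \<zeta>' m / (\<kappa>\<^sup>2 (jap m - 1))\<close>, where \<open>\<kappa> = 2 \<pi> / l\<close>, the
  nonzero cases below come from \<open>- u \<zeta>'\<^sub>x\<close>, from \<open>G\<close>, and from the advection of \<open>\<zeta>'\<close> by \<open>\<psi>\<close>. The last
  term of \<open>F\<close> only cancels the zonal modes of the advection, so that the row \<open>fst n = 0\<close> is free for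
  \<open>G\<close>. For \<open>fst n = fst m\<close> the mode \<open>n - m\<close> is zonal; its interaction with \<open>m\<close> is already counted by
  the term with \<open>m\<close> and \<open>n - m\<close> exchanged.\<close>

definition kern :: "real \<Rightarrow> int \<times> int \<Rightarrow> int \<times> int \<Rightarrow> complex" where
  "kern \<kappa> n m =
    (if fst n = fst m then 0
     else if fst m = 0 then - (\<i> * of_real (\<kappa> * of_int (fst n)))
     else if fst n = 0 then
       - (\<i> * of_real (of_int (snd n) * of_int (fst m) * of_int (snd n - snd m) /
           (\<kappa> * (jap m - 1) * (jap (n - m) - 1))))
     else of_real (of_int (fst n * snd m - snd n * fst m) / (jap m - 1)))"

text \<open>\<open>jap m - 1\<close> is the square of |m|. Off the axis it is comparable to
  \<open>jap m\<close>, which makes the divisions in \<open>kern\<close> harmless.\<close>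

lemma jap_minus_1_ge:
  assumes "fst m \<noteq> 0"
  shows "1 \<le> jap m - 1" "jap m / 2 \<le> jap m - 1"
proof -
  have "m \<noteq> 0" using assms by auto
  from jap_le_2[OF this] show 2: "jap m / 2 \<le> jap m - 1" by (simp add: jap_def)
  then have "1 \<le> jap m / 2 \<or> jap m < 2" by linarith
  then show "1 \<le> jap m - 1" using 2 by linarith
qed

text \<open>The factor \<open>jap n\<close> is the outer derivative of the divergence form,
  \<open>vweight m\<close> the gain of the velocity. The summands of the constant serve the three
  kinds of interaction: \<open>\<kappa>\<close> the zonal flow, 2 the advection by the stream
  function, \<open>2 / \<kappa>\<close> the forcing of the zonal flow.\<close>

lemma kern_bound:
  assumes "\<kappa> > 0"
  shows "(cmod (kern \<kappa> n m))\<^sup>2 \<le> (\<kappa> + 2 + 2 / \<kappa>)\<^sup>2 * jap n * vweight m"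
proof -
  define C where "C = \<kappa> + 2 + 2 / \<kappa>"
  have C: "\<kappa> \<le> C" "2 \<le> C" "2 / \<kappa> \<le> C" "0 \<le> C" using assms by (auto simp: C_def)
  have C2: "\<kappa>\<^sup>2 \<le> C\<^sup>2" "2\<^sup>2 \<le> C\<^sup>2" "(2/\<kappa>)\<^sup>2 \<le> C\<^sup>2"
    using C assms by (intro power_mono; simp)+
  have vn: "0 \<le> vweight m" by (rule vweight_bounds)
  have j1: "(of_int (fst n))\<^sup>2 \<le> jap n" "(of_int (snd n))\<^sup>2 \<le> jap n" by (auto simp: jap_def)
  consider (z) "fst n = fst m" | (a) "fst n \<noteq> fst m" "fst m = 0"
    | (b) "fst n \<noteq> fst m" "fst m \<noteq> 0" "fst n = 0" | (c) "fst n \<noteq> fst m" "fst m \<noteq> 0" "fst n \<noteq> 0"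
    by blast
  then have "(cmod (kern \<kappa> n m))\<^sup>2 \<le> C\<^sup>2 * (jap n * vweight m)"
  proof cases
    case z
    then show ?thesis using vn jap_pos[of n] by (simp add: kern_def)
  next
    case a
    then have "(cmod (kern \<kappa> n m))\<^sup>2 = \<kappa>\<^sup>2 * (of_int (fst n))\<^sup>2"
      by (simp add: kern_def norm_mult power_mult_distrib abs_mult)
    also have "\<dots> \<le> C\<^sup>2 * jap n"
      using C2 j1 by (intro mult_mono) auto
    finally show ?thesis using a by (simp add: vweight_def)
  next
    case b
    define p where "p = n - m"
    have q: "1 \<le> jap m - 1" "jap m / 2 \<le> jap m - 1" "1 \<le> jap p - 1"
      using b jap_minus_1_ge[of m] jap_minus_1_ge[of p] by (auto simp: p_def)
    have "(cmod (kern \<kappa> n m))\<^sup>2 = (of_int (snd n))\<^sup>2 * (of_int (fst m))\<^sup>2 * (of_int (snd p))\<^sup>2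
       / (\<kappa>\<^sup>2 * (jap m - 1)\<^sup>2 * (jap p - 1)\<^sup>2)"
    proof -
      define X where "X = of_int (snd n) * of_int (fst m) * of_int (snd p) / (\<kappa> * (jap m - 1) * (jap p - 1))"
      have "kern \<kappa> n m = - (\<i> * of_real X)"
        using b by (simp add: kern_def X_def p_def)
      then have "(cmod (kern \<kappa> n m))\<^sup>2 = X\<^sup>2"
        by (simp only: norm_minus_cancel norm_mult norm_ii norm_of_real mult_1 power2_abs)
      then show ?thesis by (simp add: X_def power_mult_distrib power_divide)
    qed
    also have "\<dots> \<le> jap n * (jap m - 1) * ((jap p - 1) * (jap p - 1)) / (\<kappa>\<^sup>2 * (jap m - 1)\<^sup>2 * (jap p - 1)\<^sup>2)"
    proof -
      \<comment> \<open>The gain of the second velocity factor is given up: all that is kept is that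
        |snd p| is at most the square of |p|, valid because |p| is at least 1.\<close>
      have "(of_int (snd p))\<^sup>2 \<le> (jap p - 1) * 1" by (simp add: jap_def)
      also have "\<dots> \<le> (jap p - 1) * (jap p - 1)" using q by (intro mult_left_mono) auto
      finally have "(of_int (snd p))\<^sup>2 \<le> (jap p - 1) * (jap p - 1)" .
      moreover have "(of_int (fst m))\<^sup>2 \<le> jap m - 1" by (simp add: jap_def)
      ultimately show ?thesis
        using q j1 jap_pos[of n] by (intro divide_right_mono mult_mono) auto
    qed
    also have "\<dots> = jap n * (1 / (jap m - 1)) / \<kappa>\<^sup>2"
      using q by (simp add: power2_eq_square)
    also have "\<dots> \<le> jap n * (2 / jap m) / \<kappa>\<^sup>2"
      using q jap_pos[of n] jap_pos[of m]
      by (intro divide_right_mono mult_left_mono) (auto simp: field_simps)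
    also have "\<dots> = (2 / \<kappa>\<^sup>2) * (jap n * (1 / jap m))" by (simp add: mult_ac)
    also have "\<dots> \<le> C\<^sup>2 * (jap n * (1 / jap m))"
    proof (rule mult_right_mono)
      have "2 / \<kappa>\<^sup>2 \<le> (2/\<kappa>)\<^sup>2" by (simp add: power_divide divide_right_mono)
      then show "2 / \<kappa>\<^sup>2 \<le> C\<^sup>2" using C2 by linarith
    qed (use jap_pos[of n] jap_pos[of m] in auto)
    finally show ?thesis using b by (simp add: vweight_def)
  next
    case c
    define n1 n2 m1 m2 :: real where "n1 = of_int (fst n)" and "n2 = of_int (snd n)"
      and "m1 = of_int (fst m)" and "m2 = of_int (snd m)"
    have q: "1 \<le> jap m - 1" "jap m / 2 \<le> jap m - 1"
      using c jap_minus_1_ge[of m] by auto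
    have "(cmod (kern \<kappa> n m))\<^sup>2 = (n1 * m2 - n2 * m1)\<^sup>2 / (jap m - 1)\<^sup>2"
      using c by (simp add: kern_def norm_divide power_divide n1_def n2_def m1_def m2_def flip: of_real_mult of_real_diff)
    also have "\<dots> \<le> (jap n * (jap m - 1)) / (jap m - 1)\<^sup>2"
    proof (rule divide_right_mono)
      have "(n1 * m2 - n2 * m1)\<^sup>2 = (n1\<^sup>2 + n2\<^sup>2) * (m1\<^sup>2 + m2\<^sup>2) - (n1 * m1 + n2 * m2)\<^sup>2"
        by (simp add: power2_eq_square algebra_simps)
      also have "\<dots> \<le> (1 + n1\<^sup>2 + n2\<^sup>2) * (m1\<^sup>2 + m2\<^sup>2)"
        by (simp add: algebra_simps add_increasing2)
      finally show "(n1 * m2 - n2 * m1)\<^sup>2 \<le> jap n * (jap m - 1)"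
        by (simp add: jap_def n1_def n2_def m1_def m2_def)
    qed simp
    also have "\<dots> = jap n * (1 / (jap m - 1))"
      using q by (simp add: power2_eq_square)
    also have "\<dots> \<le> jap n * (2 / jap m)"
      using q jap_pos[of n] jap_pos[of m] by (intro mult_left_mono) (auto simp: field_simps)
    also have "\<dots> = 2 * (jap n * (1 / jap m))" by simp
    also have "\<dots> \<le> C\<^sup>2 * (jap n * (1 / jap m))"
      using C2 jap_pos[of n] jap_pos[of m] by (intro mult_right_mono) auto
    finally show ?thesis using c by (simp add: vweight_def)
  qed
  then show ?thesis by (simp add: C_def mult.assoc)
qed

definition nonlin :: "real \<Rightarrow> (int \<times> int \<Rightarrow> complex) \<Rightarrow> (int \<times> int \<Rightarrow> complex) \<Rightarrow> int \<times> int \<Rightarrow> complex" where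
  "nonlin \<kappa> a b n = (\<Sum>\<^sub>\<infinity>m. kern \<kappa> n m * a m * b (n - m))"

text \<open>Cauchy--Schwarz in \<open>m\<close> splits off the norm of \<open>a\<close> and leaves
  the sum of the squared kernel against the squares of \<open>b\<close>. By
  \<open>kern_bound\<close> the weight \<open>jap n powr (-7/4)\<close> turns into
  \<open>jap n powr (-3/4)\<close>; after the substitution p = n - m the sum over \<open>m\<close>
  is that of \<open>plane_sum_bounded\<close>, uniformly in \<open>p\<close>. Finite sums of
  absolute values postpone every question of convergence.\<close>

lemma conv_finite_bound:
  assumes "\<kappa> > 0"
  shows "\<exists>C>0. \<forall>a b A B E F. hbound 0 a A \<longrightarrow> hbound 0 b B \<longrightarrow> finite E \<longrightarrow> finite F \<longrightarrow>
    L2_set (\<lambda>n. jap n powr (-7/8) * (\<Sum>m\<in>F. cmod (kern \<kappa> n m) * cmod (a m) * cmod (b (n - m)))) E \<le> C * (A * B)"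
proof -
  define C where "C = \<kappa> + 2 + 2 / \<kappa>"
  have C: "C > 0" using assms by (simp add: C_def add_pos_pos)
  obtain Z where Z: "Z > 0" "\<And>p F. finite F \<Longrightarrow> (\<Sum>m\<in>F. vweight m * jap (p + m) powr (-3/4)) \<le> Z"
    using plane_sum_bounded by blast
  have "L2_set (\<lambda>n. jap n powr (-7/8) * (\<Sum>m\<in>F. cmod (kern \<kappa> n m) * cmod (a m) * cmod (b (n - m)))) E
     \<le> C * sqrt Z * (A * B)"
    if a: "hbound 0 a A" and b: "hbound 0 b B" and E: "finite E" and F: "finite F" for a b A B E F
  proof -
    have A: "0 \<le> A" and B: "0 \<le> B" using a b hbound_nonneg by auto
    have term_le: "(jap n powr (-7/8) * (\<Sum>m\<in>F. cmod (kern \<kappa> n m) * cmod (a m) * cmod (b (n - m))))\<^sup>2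
        \<le> A\<^sup>2 * C\<^sup>2 * (\<Sum>m\<in>F. vweight m * (jap n powr (-3/4) * (cmod (b (n - m)))\<^sup>2))" for n
    proof -
      have "(\<Sum>m\<in>F. cmod (kern \<kappa> n m) * cmod (a m) * cmod (b (n - m)))\<^sup>2
         = (\<Sum>m\<in>F. cmod (a m) * (cmod (kern \<kappa> n m) * cmod (b (n - m))))\<^sup>2"
        by (simp add: mult_ac)
      also have "\<dots> \<le> (\<Sum>m\<in>F. (cmod (a m))\<^sup>2) * (\<Sum>m\<in>F. (cmod (kern \<kappa> n m) * cmod (b (n - m)))\<^sup>2)"
        by (rule Cauchy_Schwarz_ineq_sum)
      also have "\<dots> \<le> A\<^sup>2 * (\<Sum>m\<in>F. (C\<^sup>2 * jap n * vweight m) * (cmod (b (n - m)))\<^sup>2)"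
      proof (rule mult_mono)
        show "(\<Sum>m\<in>F. (cmod (a m))\<^sup>2) \<le> A\<^sup>2" using a F by (simp add: hbound0)
        show "(\<Sum>m\<in>F. (cmod (kern \<kappa> n m) * cmod (b (n - m)))\<^sup>2) \<le> (\<Sum>m\<in>F. (C\<^sup>2 * jap n * vweight m) * (cmod (b (n - m)))\<^sup>2)"
          unfolding power_mult_distrib C_def
          by (intro sum_mono mult_right_mono kern_bound[OF assms]) simp
      qed (auto simp: sum_nonneg)
      also have "\<dots> = A\<^sup>2 * C\<^sup>2 * jap n * (\<Sum>m\<in>F. vweight m * (cmod (b (n - m)))\<^sup>2)"
        by (simp add: sum_distrib_left mult_ac)
      finally have *: "(\<Sum>m\<in>F. cmod (kern \<kappa> n m) * cmod (a m) * cmod (b (n - m)))\<^sup>2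
         \<le> A\<^sup>2 * C\<^sup>2 * jap n * (\<Sum>m\<in>F. vweight m * (cmod (b (n - m)))\<^sup>2)" .
      have jj: "(jap n powr (-7/8))\<^sup>2 = jap n powr (-7/4)"
        unfolding power2_eq_square powr_add[symmetric] by simp
      have jk: "jap n powr (-7/4) * jap n = jap n powr (-3/4)"
        using jap_pos[of n] powr_add[of "jap n" "-7/4" 1] by (simp del: powr_minus)
      have "(jap n powr (-7/8) * (\<Sum>m\<in>F. cmod (kern \<kappa> n m) * cmod (a m) * cmod (b (n - m))))\<^sup>2
        \<le> jap n powr (-7/4) * (A\<^sup>2 * C\<^sup>2 * jap n * (\<Sum>m\<in>F. vweight m * (cmod (b (n - m)))\<^sup>2))"
        unfolding power_mult_distrib jj by (intro mult_left_mono *) simp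
      also have "\<dots> = A\<^sup>2 * C\<^sup>2 * ((jap n powr (-7/4) * jap n) * (\<Sum>m\<in>F. vweight m * (cmod (b (n - m)))\<^sup>2))"
        by (simp add: mult_ac)
      finally show ?thesis unfolding jk by (simp add: sum_distrib_left mult_ac)
    qed
    \<comment> \<open>All differences \<open>n - m\<close>, so that the inner sums range over one
      finite set and can be interchanged.\<close>
    define P where "P = (\<lambda>(n, m). n - m) ` (E \<times> F)"
    have P: "finite P" using E F by (simp add: P_def)
    have "(\<Sum>n\<in>E. \<Sum>m\<in>F. vweight m * (jap n powr (-3/4) * (cmod (b (n - m)))\<^sup>2))
       = (\<Sum>m\<in>F. vweight m * (\<Sum>n\<in>E. jap n powr (-3/4) * (cmod (b (n - m)))\<^sup>2))"
      by (subst sum.swap) (simp add: sum_distrib_left)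
    also have "\<dots> = (\<Sum>m\<in>F. vweight m * (\<Sum>p\<in>(\<lambda>n. n - m) ` E. jap (p + m) powr (-3/4) * (cmod (b p))\<^sup>2))"
      by (subst sum.reindex) (auto simp: inj_on_def)
    also have "\<dots> \<le> (\<Sum>m\<in>F. vweight m * (\<Sum>p\<in>P. jap (p + m) powr (-3/4) * (cmod (b p))\<^sup>2))"
    proof (intro sum_mono mult_left_mono sum_mono2)
      show "(\<lambda>n. n - m) ` E \<subseteq> P" if "m \<in> F" for m
        using that by (force simp: P_def)
    qed (auto simp: P vweight_bounds)
    also have "\<dots> = (\<Sum>p\<in>P. (cmod (b p))\<^sup>2 * (\<Sum>m\<in>F. vweight m * jap (p + m) powr (-3/4)))"
      unfolding sum_distrib_left by (subst sum.swap) (simp add: mult_ac)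
    also have "\<dots> \<le> (\<Sum>p\<in>P. (cmod (b p))\<^sup>2 * Z)"
      using F by (intro sum_mono mult_left_mono Z) auto
    also have "\<dots> \<le> B\<^sup>2 * Z"
      unfolding sum_distrib_right[symmetric] using b P Z by (intro mult_right_mono) (auto simp: hbound0)
    finally have main: "(\<Sum>n\<in>E. \<Sum>m\<in>F. vweight m * (jap n powr (-3/4) * (cmod (b (n - m)))\<^sup>2)) \<le> B\<^sup>2 * Z" .
    have "(\<Sum>n\<in>E. (jap n powr (-7/8) * (\<Sum>m\<in>F. cmod (kern \<kappa> n m) * cmod (a m) * cmod (b (n - m))))\<^sup>2)
        \<le> A\<^sup>2 * C\<^sup>2 * (B\<^sup>2 * Z)"
    proof -
      have "(\<Sum>n\<in>E. (jap n powr (-7/8) * (\<Sum>m\<in>F. cmod (kern \<kappa> n m) * cmod (a m) * cmod (b (n - m))))\<^sup>2)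
        \<le> (\<Sum>n\<in>E. A\<^sup>2 * C\<^sup>2 * (\<Sum>m\<in>F. vweight m * (jap n powr (-3/4) * (cmod (b (n - m)))\<^sup>2)))"
        by (intro sum_mono term_le)
      also have "\<dots> \<le> A\<^sup>2 * C\<^sup>2 * (B\<^sup>2 * Z)"
        unfolding sum_distrib_left[symmetric] by (intro mult_left_mono main) auto
      finally show ?thesis .
    qed
    also have "\<dots> = (C * sqrt Z * (A * B))\<^sup>2"
      using Z by (simp add: power_mult_distrib)
    finally show ?thesis
      unfolding L2_set_def using A B C Z by (intro real_le_lsqrt) auto
  qed
  moreover have "C * sqrt Z > 0" using C Z by simp
  ultimately show ?thesis by blast
qed

text \<open>A substitute for the Leibniz rule: the weight at \<open>n\<close> is shared between the
  factors at \<open>m\<close> and \<open>n - m\<close>. The 4 comes from jap n \<le> 2 jap m + 2 jap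
  (n - m), bounded by four times the maximum.\<close>

lemma jap_powr_triangle:
  assumes "0 \<le> \<sigma>"
  shows "jap n powr \<sigma> \<le> 4 powr \<sigma> * (jap m powr \<sigma> + jap (n - m) powr \<sigma>)"
proof -
  define M where "M = max (jap m) (jap (n - m))"
  have j: "jap n \<le> 4 * M"
  proof -
    have s: "(x::real)\<^sup>2 \<le> 2 * y\<^sup>2 + 2 * (x - y)\<^sup>2" for x y
      using zero_le_power2[of "x - 2 * y"] by (simp add: power2_eq_square algebra_simps)
    have "jap n \<le> 2 * jap m + 2 * jap (n - m)"
      using s[of "of_int (fst n)" "of_int (fst m)"] s[of "of_int (snd n)" "of_int (snd m)"]
      by (simp add: jap_def)
    then show ?thesis by (simp add: M_def)
  qed
  have M: "0 < M" using jap_pos[of m] by (simp add: M_def)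
  have "jap n powr \<sigma> \<le> (4 * M) powr \<sigma>"
    using j jap_pos[of n] assms by (intro powr_mono2) auto
  also have "\<dots> = 4 powr \<sigma> * M powr \<sigma>" using M by (simp add: powr_mult)
  also have "M powr \<sigma> \<le> jap m powr \<sigma> + jap (n - m) powr \<sigma>"
    by (simp add: M_def max_def)
  finally show ?thesis by simp
qed

lemma convolution_abs_summable:
  assumes "hbound 0 a A" "hbound 0 b B"
  shows "(\<lambda>m. cmod (a m) * cmod (b (n - m))) summable_on UNIV"
    and "finite F \<Longrightarrow> (\<Sum>m\<in>F. cmod (a m) * cmod (b (n - m))) \<le> A * B"
    and "(\<Sum>\<^sub>\<infinity>m. cmod (a m) * cmod (b (n - m))) \<le> A * B"
proof -
  have fin: "(\<Sum>m\<in>F. cmod (a m) * cmod (b (n - m))) \<le> A * B" if F: "finite F" for F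
  proof -
    have "(\<Sum>m\<in>F. cmod (a m) * cmod (b (n - m))) \<le> L2_set (\<lambda>m. cmod (a m)) F * L2_set (\<lambda>m. cmod (b (n - m))) F"
      using L2_set_mult_ineq[of "\<lambda>m. cmod (a m)" "\<lambda>m. cmod (b (n - m))" F] by simp
    also have "L2_set (\<lambda>m. cmod (b (n - m))) F = L2_set (\<lambda>m. cmod (b m)) ((\<lambda>m. n - m) ` F)"
      unfolding L2_set_def by (subst sum.reindex) (auto simp: inj_on_def)
    also have "L2_set (\<lambda>m. cmod (a m)) F * L2_set (\<lambda>m. cmod (b m)) ((\<lambda>m. n - m) ` F) \<le> A * B"
      using hbound_L2[OF assms(1), of F] hbound_L2[OF assms(2), of "(\<lambda>m. n - m) ` F"] F
        jap_pos[THEN less_imp_neq, THEN not_sym] hbound_nonneg[OF assms(1)]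
      by (intro mult_mono) (auto simp: powr_zero_eq_one)
    finally show ?thesis .
  qed
  then show "finite F \<Longrightarrow> (\<Sum>m\<in>F. cmod (a m) * cmod (b (n - m))) \<le> A * B" for F .
  show "(\<lambda>m. cmod (a m) * cmod (b (n - m))) summable_on UNIV"
    by (rule nonneg_bdd_above_summable_on) (use fin in \<open>auto simp: bdd_above_def\<close>)
  then show "(\<Sum>\<^sub>\<infinity>m. cmod (a m) * cmod (b (n - m))) \<le> A * B"
    by (rule infsum_le_finite_sums) (use fin in auto)
qed

text \<open>At fixed \<open>n\<close> the kernel is bounded in \<open>m\<close>. The growth in
  \<open>n\<close> is harmless where a single coefficient is looked at, as in the convergence of the
  convolution or in dominated convergence in time.\<close>

lemma kern_norm_le:
  assumes "\<kappa> > 0"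
  shows "cmod (kern \<kappa> n m) \<le> (\<kappa> + 2 + 2 / \<kappa>) * jap n"
proof -
  have "(cmod (kern \<kappa> n m))\<^sup>2 \<le> (\<kappa> + 2 + 2 / \<kappa>)\<^sup>2 * jap n * vweight m"
    by (rule kern_bound[OF assms])
  also have "\<dots> \<le> (\<kappa> + 2 + 2 / \<kappa>)\<^sup>2 * jap n * jap n"
    using vweight_bounds(2)[of m] jap_ge_1[of n] by (intro mult_left_mono) auto
  also have "\<dots> = ((\<kappa> + 2 + 2 / \<kappa>) * jap n)\<^sup>2"
    by (simp add: power_mult_distrib power2_eq_square mult_ac)
  finally show ?thesis
    using assms jap_pos[of n] by (intro power2_le_imp_le[OF _ mult_nonneg_nonneg]) (auto intro: add_nonneg_nonneg)
qed

lemma nonlin_summable: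
  assumes "\<kappa> > 0" "hbound 0 a A" "hbound 0 b B"
  shows "(\<lambda>m. norm (kern \<kappa> n m * a m * b (n - m))) summable_on UNIV"
    and "cmod (nonlin \<kappa> a b n) \<le> (\<kappa> + 2 + 2 / \<kappa>) * jap n * (A * B)"
proof -
  define C where "C = (\<kappa> + 2 + 2 / \<kappa>) * jap n"
  have C: "0 \<le> C" using kern_norm_le[OF assms(1), of n 0] norm_ge_zero order_trans unfolding C_def by blast
  have s: "(\<lambda>m. C * (cmod (a m) * cmod (b (n - m)))) summable_on UNIV"
    by (intro summable_on_cmult_right convolution_abs_summable(1)[OF assms(2,3)])
  have le: "norm (kern \<kappa> n m * a m * b (n - m)) \<le> C * (cmod (a m) * cmod (b (n - m)))" for m
    unfolding norm_mult mult.assoc C_def[symmetric]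
    by (rule mult_right_mono) (use kern_norm_le[OF assms(1), of n m] in \<open>auto simp: C_def\<close>)
  show abs: "(\<lambda>m. norm (kern \<kappa> n m * a m * b (n - m))) summable_on UNIV"
    by (rule Infinite_Sum.abs_summable_on_comparison_test'[OF s le])
  have "cmod (nonlin \<kappa> a b n) \<le> (\<Sum>\<^sub>\<infinity>m. norm (kern \<kappa> n m * a m * b (n - m)))"
    unfolding nonlin_def by (rule norm_infsum_bound[OF abs])
  also have "\<dots> \<le> (\<Sum>\<^sub>\<infinity>m. C * (cmod (a m) * cmod (b (n - m))))"
    by (intro infsum_mono abs s le)
  also have "\<dots> = C * (\<Sum>\<^sub>\<infinity>m. cmod (a m) * cmod (b (n - m)))"
    by (intro infsum_cmult_right convolution_abs_summable(1)[OF assms(2,3)])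
  also have "\<dots> \<le> C * (A * B)"
    by (intro mult_left_mono convolution_abs_summable(3)[OF assms(2,3)] C)
  finally show "cmod (nonlin \<kappa> a b n) \<le> (\<kappa> + 2 + 2 / \<kappa>) * jap n * (A * B)" by (simp add: C_def)
qed

lemma nonlin_diff:
  assumes "\<kappa> > 0" "hbound 0 a A" "hbound 0 b B"
  shows "nonlin \<kappa> a a n - nonlin \<kappa> b b n = nonlin \<kappa> (\<lambda>m. a m - b m) a n + nonlin \<kappa> b (\<lambda>m. a m - b m) n"
proof -
  note d = hbound_diff[OF assms(2,3)]
  note s = nonlin_summable(1)[OF assms(1), THEN abs_summable_summable]
  have 1: "nonlin \<kappa> a a n = nonlin \<kappa> (\<lambda>m. a m - b m) a n + nonlin \<kappa> b a n"
    unfolding nonlin_def infsum_add[OF s[OF d assms(2)] s[OF assms(3,2)], symmetric]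
    by (simp add: algebra_simps)
  have 2: "nonlin \<kappa> b a n = nonlin \<kappa> b (\<lambda>m. a m - b m) n + nonlin \<kappa> b b n"
    unfolding nonlin_def infsum_add[OF s[OF assms(3) d] s[OF assms(3,3)], symmetric]
    by (simp add: algebra_simps)
  show ?thesis using 1 2 by simp
qed

text \<open>A tame estimate: in each term only one factor carries the norm of order
  \<open>\<sigma>\<close>, so that the bound is linear in the high norms once those of order 0 are
  under control.\<close>

lemma nonlin_hbound:
  assumes "\<kappa> > 0" "\<sigma> \<ge> 0"
  shows "\<exists>C>0. \<forall>a b A B A' B'. hbound 0 a A \<longrightarrow> hbound 0 b B \<longrightarrow> hbound \<sigma> a A' \<longrightarrow> hbound \<sigma> b B' \<longrightarrow>
    hbound (\<sigma> - 7/4) (nonlin \<kappa> a b) (C * (A' * B + A * B'))"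
proof -
  obtain C where C: "C > 0" and C_le: "\<And>a b A B E F. hbound 0 a A \<Longrightarrow> hbound 0 b B \<Longrightarrow> finite E \<Longrightarrow> finite F \<Longrightarrow>
    L2_set (\<lambda>n. jap n powr (-7/8) * (\<Sum>m\<in>F. cmod (kern \<kappa> n m) * cmod (a m) * cmod (b (n - m)))) E \<le> C * (A * B)"
    using conv_finite_bound[OF assms(1)] by blast
  define D where "D = 4 powr (\<sigma>/2) * C"
  have D: "D > 0" using C by (simp add: D_def)
  have "hbound (\<sigma> - 7/4) (nonlin \<kappa> a b) (D * (A' * B + A * B'))"
    if a: "hbound 0 a A" and b: "hbound 0 b B" and a': "hbound \<sigma> a A'" and b': "hbound \<sigma> b B'" for a b A B A' B'
  proof (rule hbound_of_L2)
    show "0 \<le> D * (A' * B + A * B')"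
      using D hbound_nonneg[OF a] hbound_nonneg[OF b] hbound_nonneg[OF a'] hbound_nonneg[OF b'] by simp
    fix E :: "(int \<times> int) set" assume E: "finite E"
    define as bs where "as = (\<lambda>n. of_real (jap n powr (\<sigma>/2)) * a n)" and "bs = (\<lambda>n. of_real (jap n powr (\<sigma>/2)) * b n)"
    have sq: "(jap n powr (\<sigma>/2))\<^sup>2 = jap n powr \<sigma>" for n
      by (simp add: power2_eq_square flip: powr_add)
    have as: "hbound 0 as A'" and bs: "hbound 0 bs B'"
      using a' b' unfolding hbound0 unfolding hbound_def as_def bs_def by (auto simp: norm_mult power_mult_distrib sq)
    have fin: "L2_set (\<lambda>n. jap n powr ((\<sigma> - 7/4)/2) * (\<Sum>m\<in>F. cmod (kern \<kappa> n m) * cmod (a m) * cmod (b (n - m)))) E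
        \<le> D * (A' * B + A * B')" if F: "finite F" for F
    proof -
      define S1 S2 where "S1 = (\<lambda>n. jap n powr (-7/8) * (\<Sum>m\<in>F. cmod (kern \<kappa> n m) * cmod (as m) * cmod (b (n - m))))"
        and "S2 = (\<lambda>n. jap n powr (-7/8) * (\<Sum>m\<in>F. cmod (kern \<kappa> n m) * cmod (a m) * cmod (bs (n - m))))"
      have pt: "jap n powr ((\<sigma> - 7/4)/2) * (\<Sum>m\<in>F. cmod (kern \<kappa> n m) * cmod (a m) * cmod (b (n - m)))
          \<le> 4 powr (\<sigma>/2) * (S1 n + S2 n)" for n
      proof -
        have e: "jap n powr ((\<sigma> - 7/4)/2) = jap n powr (-7/8) * jap n powr (\<sigma>/2)"
          unfolding powr_add[symmetric] by (rule arg_cong[where f="\<lambda>x. jap n powr x"]) (simp add: field_simps)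
        have "jap n powr (\<sigma>/2) * (\<Sum>m\<in>F. cmod (kern \<kappa> n m) * cmod (a m) * cmod (b (n - m)))
          \<le> (\<Sum>m\<in>F. 4 powr (\<sigma>/2) * (jap m powr (\<sigma>/2) + jap (n - m) powr (\<sigma>/2)) *
               (cmod (kern \<kappa> n m) * cmod (a m) * cmod (b (n - m))))"
          unfolding sum_distrib_left using assms(2) by (intro sum_mono mult_right_mono jap_powr_triangle) auto
        also have "\<dots> = 4 powr (\<sigma>/2) * ((\<Sum>m\<in>F. cmod (kern \<kappa> n m) * cmod (as m) * cmod (b (n - m)))
           + (\<Sum>m\<in>F. cmod (kern \<kappa> n m) * cmod (a m) * cmod (bs (n - m))))"
          unfolding sum.distrib[symmetric] sum_distrib_left
          by (intro sum.cong) (auto simp: as_def bs_def norm_mult algebra_simps)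
        finally have "jap n powr (-7/8) * (jap n powr (\<sigma>/2) * (\<Sum>m\<in>F. cmod (kern \<kappa> n m) * cmod (a m) * cmod (b (n - m))))
          \<le> jap n powr (-7/8) * (4 powr (\<sigma>/2) * ((\<Sum>m\<in>F. cmod (kern \<kappa> n m) * cmod (as m) * cmod (b (n - m)))
           + (\<Sum>m\<in>F. cmod (kern \<kappa> n m) * cmod (a m) * cmod (bs (n - m)))))"
          by (intro mult_left_mono) auto
        then show ?thesis unfolding e S1_def S2_def by (simp add: algebra_simps)
      qed
      have "L2_set (\<lambda>n. jap n powr ((\<sigma> - 7/4)/2) * (\<Sum>m\<in>F. cmod (kern \<kappa> n m) * cmod (a m) * cmod (b (n - m)))) E
         \<le> L2_set (\<lambda>n. 4 powr (\<sigma>/2) * (S1 n + S2 n)) E"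
        by (intro L2_set_mono pt) (auto intro!: mult_nonneg_nonneg sum_nonneg)
      also have "\<dots> = 4 powr (\<sigma>/2) * L2_set (\<lambda>n. S1 n + S2 n) E"
        by (simp add: L2_set_right_distrib)
      also have "\<dots> \<le> 4 powr (\<sigma>/2) * (L2_set S1 E + L2_set S2 E)"
        by (intro mult_left_mono L2_set_triangle_ineq) auto
      also have "\<dots> \<le> 4 powr (\<sigma>/2) * (C * (A' * B) + C * (A * B'))"
        unfolding S1_def S2_def
        by (intro mult_left_mono add_mono C_le as bs a b E F) auto
      finally show ?thesis by (simp add: D_def algebra_simps)
    qed
    \<comment> \<open>The convolution is the limit of its finite sections, and the bound for finite
      \<open>F\<close> carries over.\<close>
    have lim: "((\<lambda>F. L2_set (\<lambda>n. jap n powr ((\<sigma> - 7/4)/2) * cmod (\<Sum>m\<in>F. kern \<kappa> n m * a m * b (n - m))) E)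
       \<longlongrightarrow> L2_set (\<lambda>n. jap n powr ((\<sigma> - 7/4)/2) * cmod (nonlin \<kappa> a b n)) E) (finite_subsets_at_top UNIV)"
      unfolding L2_set_def nonlin_def
      by (rule tendsto_real_sqrt, rule tendsto_sum, rule tendsto_power, rule tendsto_mult, rule tendsto_const,
          rule tendsto_norm, rule infsum_tendsto, rule Infinite_Sum.abs_summable_summable,
          rule nonlin_summable(1)[OF assms(1) a b])
    show "L2_set (\<lambda>n. jap n powr ((\<sigma> - 7/4)/2) * cmod (nonlin \<kappa> a b n)) E \<le> D * (A' * B + A * B')"
    proof (rule tendsto_upperbound[OF lim])
      show "\<forall>\<^sub>F F in finite_subsets_at_top UNIV.
        L2_set (\<lambda>n. jap n powr ((\<sigma> - 7/4)/2) * cmod (\<Sum>m\<in>F. kern \<kappa> n m * a m * b (n - m))) E \<le> D * (A' * B + A * B')"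
      proof (rule eventually_finite_subsets_at_top_weakI)
        fix F :: "(int \<times> int) set" assume F: "finite F"
        have "L2_set (\<lambda>n. jap n powr ((\<sigma> - 7/4)/2) * cmod (\<Sum>m\<in>F. kern \<kappa> n m * a m * b (n - m))) E
          \<le> L2_set (\<lambda>n. jap n powr ((\<sigma> - 7/4)/2) * (\<Sum>m\<in>F. cmod (kern \<kappa> n m) * cmod (a m) * cmod (b (n - m)))) E"
          by (rule L2_set_mono, rule mult_left_mono, rule sum_norm_le) (simp_all add: norm_mult)
        also have "\<dots> \<le> D * (A' * B + A * B')" by (rule fin[OF F])
        finally show "L2_set (\<lambda>n. jap n powr ((\<sigma> - 7/4)/2) * cmod (\<Sum>m\<in>F. kern \<kappa> n m * a m * b (n - m))) E \<le> D * (A' * B + A * B')" .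
      qed
    qed simp
  qed
  then show ?thesis using D by blast
qed

section \<open>Smoothing by the semigroup\<close>

text \<open>\<open>ker0\<close> majorizes the smoothing factor; \<open>ker1\<close> is a slightly worse integrable majorant, so that
  a factor \<open>exp (- \<theta> t)\<close> leaves the small constant \<open>\<theta> powr (- 1/32)\<close>.\<close>

definition ker0 :: "real \<Rightarrow> real" where
  "ker0 t = t powr (-15/16) * (1 + t) powr (-2)"

definition ker1 :: "real \<Rightarrow> real" where
  "ker1 t = t powr (-31/32) * (1 + t) powr (-33/32)"

text \<open>Both 1 and \<open>x\<close> lie below \<open>exp x\<close>, and \<open>x powr a\<close>
  is at most the larger of them.\<close>

lemma exp_minus_le_powr:
  fixes x a :: real
  assumes "0 < x" "0 \<le> a" "a \<le> 1"
  shows "exp (- x) \<le> x powr (- a)"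
proof -
  have "x powr a \<le> exp x"
  proof (cases "x \<le> 1")
    case True
    then have "x powr a \<le> 1" using assms by (simp add: powr_le1)
    also have "1 \<le> exp x" using assms by simp
    finally show ?thesis .
  next
    case False
    then have "x powr a \<le> x powr 1" using assms by (intro powr_mono) auto
    also have "\<dots> \<le> exp x" using assms exp_ge_add_one_self[of x] by (simp del: exp_ge_add_one_self) 
    finally show ?thesis .
  qed
  then show ?thesis using assms by (simp add: exp_minus powr_minus le_imp_inverse_le)
qed

text \<open>The second bound spends exp (- \<theta> t) \<le> (\<theta> t) powr (-1/32): the
  singularity worsens from 30/32 to 31/32, still below 1, and the power of \<theta> is the
  gain.\<close>

lemma ker0_le_ker1:
  assumes "0 < t"
  shows "ker0 t \<le> ker1 t" and "0 < \<theta> \<Longrightarrow> exp (- \<theta> * t) * ker0 t \<le> \<theta> powr (-1/32) * ker1 t"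
proof -
  have p2: "(1 + t) powr (-2) \<le> (1 + t) powr (-33/32)" using assms by (intro powr_mono) auto
  have "ker0 t = t powr (-31/32) * (t powr (1/32) * (1 + t) powr (-2))"
    unfolding ker0_def mult.assoc[symmetric] powr_add[symmetric] by simp
  also have "\<dots> \<le> t powr (-31/32) * ((1 + t) powr (1/32) * (1 + t) powr (-2))"
    using assms by (intro mult_left_mono mult_right_mono powr_mono2) auto
  also have "\<dots> = t powr (-31/32) * (1 + t) powr (-63/32)"
    unfolding powr_add[symmetric] by simp
  also have "\<dots> \<le> ker1 t"
    unfolding ker1_def using assms by (intro mult_left_mono powr_mono) auto
  finally show "ker0 t \<le> ker1 t" .
  assume l: "0 < \<theta>"
  have "exp (- (\<theta> * t)) \<le> (\<theta> * t) powr (- (1/32))"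
    using l assms by (intro exp_minus_le_powr) auto
  then have "exp (- \<theta> * t) * ker0 t \<le> (\<theta> powr (-1/32) * t powr (-1/32)) * ker0 t"
    using l assms by (intro mult_right_mono) (auto simp: ker0_def powr_mult)
  also have "\<dots> = \<theta> powr (-1/32) * ((t powr (-1/32) * t powr (-15/16)) * (1 + t) powr (-2))"
    by (simp add: ker0_def mult_ac)
  also have "t powr (-1/32) * t powr (-15/16) = t powr (-31/32)"
    unfolding powr_add[symmetric] by simp
  also have "\<theta> powr (-1/32) * (t powr (-31/32) * (1 + t) powr (-2)) \<le> \<theta> powr (-1/32) * ker1 t"
    unfolding ker1_def using p2 by (intro mult_left_mono) auto
  finally show "exp (- \<theta> * t) * ker0 t \<le> \<theta> powr (-1/32) * ker1 t" .
qed

text \<open>\<open>jap n powr (15/16)\<close> stands for 15/8 derivatives. The mode 0 is undamped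
  and has to be left out; the others decay exponentially, which yields the factor (1 + t) powr (-2)
  of \<open>ker0\<close> and, after integration, bounds that do not grow with time.\<close>

lemma smoothing_factor:
  assumes "d > 0"
  shows "\<exists>C>0. \<forall>t>0. \<forall>n. n \<noteq> 0 \<longrightarrow> jap n powr (15/16) * exp (- (d * t * (jap n - 1))) \<le> C * ker0 t"
proof -
  \<comment> \<open>Half of the rate \<open>d\<close> goes into
    \<open>jap n / 2 \<le> jap n - 1\<close>. The rest is split evenly between smoothing,
    \<open>exp (- (c * t * jap n))\<close>, and decay in time,
    \<open>exp (- (c * t))\<close>.\<close>
  define c where "c = d / 4"
  have c: "c > 0" using assms by (simp add: c_def)
  \<comment> \<open>Large enough for \<open>1 + t \<le> D * (1 + c * t / 2)\<close>, which by 1 + x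
    \<le> exp x and squaring turns the exponential into a decay of order 2.\<close>
  define D where "D = max 1 (2 / c)"
  have D: "1 \<le> D" "2 / c \<le> D" by (auto simp: D_def)
  have "jap n powr (15/16) * exp (- (d * t * (jap n - 1))) \<le> (c powr (-15/16) * D\<^sup>2) * ker0 t"
    if t: "t > 0" and n: "n \<noteq> 0" for t n
  proof -
    have j: "jap n / 2 \<le> jap n - 1" using jap_le_2[OF n] by (simp add: jap_def)
    have x: "0 < c * t * jap n" using c t jap_pos[of n] by simp
    have "exp (- (d * t * (jap n - 1))) \<le> exp (- (c * t * jap n) + - (c * t))"
    proof -
      have "c * t * jap n + c * t \<le> c * t * (2 * jap n)"
        using c t jap_ge_1[of n] unfolding distrib_left[symmetric]
        by (simp add: algebra_simps)
      also have "\<dots> = d * t * (jap n / 2)" by (simp add: c_def)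
      also have "\<dots> \<le> d * t * (jap n - 1)" using assms t j by (intro mult_left_mono) auto
      finally show ?thesis by simp
    qed
    also have "\<dots> = exp (- (c * t * jap n)) * exp (- (c * t))" by (rule exp_add)
    also have "exp (- (c * t * jap n)) \<le> (c * t * jap n) powr (- (15/16))"
      using x by (intro exp_minus_le_powr) auto
    also have "exp (- (c * t)) \<le> D\<^sup>2 * (1 + t) powr (-2)"
    proof -
      have "1 + t \<le> D * (1 + c * t / 2)"
      proof -
        have "D * (1 + c * t / 2) = D + (D * (c / 2)) * t" by (simp add: algebra_simps)
        moreover have "1 \<le> D * (c / 2)" using D(2) c by (simp add: field_simps)
        then have "1 * t \<le> (D * (c / 2)) * t" using t by (intro mult_right_mono) auto
        ultimately show ?thesis using D(1) by linarith
      qed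
      also have "\<dots> \<le> D * exp (c * t / 2)"
        using D(1) by (intro mult_left_mono exp_ge_add_one_self) auto
      finally have "(1 + t)\<^sup>2 \<le> (D * exp (c * t / 2))\<^sup>2" using t by (intro power_mono) auto
      also have "\<dots> = D\<^sup>2 * exp (c * t)"
        by (simp add: power_mult_distrib power2_eq_square flip: exp_add)
      finally have "(1 + t)\<^sup>2 \<le> D\<^sup>2 * exp (c * t)" .
      moreover have e: "(1 + t) powr (-2) = 1 / (1 + t)\<^sup>2"
        using t by (simp add: powr_minus_divide)
      ultimately show ?thesis using t unfolding e exp_minus by (simp add: divide_simps mult_ac)
    qed
    finally have "exp (- (d * t * (jap n - 1))) \<le> (c * t * jap n) powr (- (15/16)) * (D\<^sup>2 * (1 + t) powr (-2))"
      by (simp add: mult_right_mono mult_left_mono)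
    then have "jap n powr (15/16) * exp (- (d * t * (jap n - 1)))
      \<le> jap n powr (15/16) * ((c * t * jap n) powr (- (15/16)) * (D\<^sup>2 * (1 + t) powr (-2)))"
      by (intro mult_left_mono) auto
    also have "\<dots> = (jap n powr (15/16) * jap n powr (- (15/16))) * (c powr (- (15/16)) * D\<^sup>2 * (t powr (- (15/16)) * (1 + t) powr (-2)))"
      using c t jap_pos[of n] by (simp add: powr_mult mult_ac)
    also have "jap n powr (15/16) * jap n powr (- (15/16)) = 1"
      using jap_pos[of n] unfolding powr_add[symmetric] by simp
    finally show ?thesis by (simp add: ker0_def)
  qed
  moreover have "c powr (-15/16) * D\<^sup>2 > 0" using c D by simp
  ultimately show ?thesis by blast
qed

text \<open>The exponents of \<open>ker1\<close> add up to - 2, so that it is the derivative of 32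
  (s / (1 + s)) powr (1/32). This antiderivative stays below 32, uniformly in
  \<open>t\<close>.\<close>

lemma ker1_integrable:
  assumes "0 \<le> t"
  shows "set_integrable lebesgue {0..t} (\<lambda>r. ker1 (t - r))"
    and "(LINT r:{0..t}|lebesgue. ker1 (t - r)) \<le> 32"
proof -
  define H where "H s = 32 * (s / (1 + s)) powr (1/32)" for s :: real
  have cont: "continuous_on {0..t} (\<lambda>r. - H (t - r))"
    unfolding H_def by (intro continuous_intros continuous_on_powr') auto
  have der: "((\<lambda>r. - H (t - r)) has_vector_derivative ker1 (t - r)) (at r)" if "r \<in> {0<..<t}" for r
  proof -
    define s where "s = t - r"
    have s: "0 < s" using that by (simp add: s_def)
    have "(H has_real_derivative 32 * ((1/32) * (s / (1 + s)) powr (1/32 - 1) * (1 / (1 + s)\<^sup>2))) (at s)"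
      unfolding H_def using s
      by (auto intro!: derivative_eq_intros DERIV_fun_powr simp: power2_eq_square field_simps)
    also have "32 * ((1/32) * (s / (1 + s)) powr (1/32 - 1) * (1 / (1 + s)\<^sup>2)) = ker1 s"
    proof -
      have "(1 + s) powr (31/32) / (1 + s)\<^sup>2 = (1 + s) powr (31/32) * (1 + s) powr (-2)"
        using s by (simp add: powr_minus_divide)
      also have "\<dots> = (1 + s) powr (-33/32)" unfolding powr_add[symmetric] by simp
      finally show ?thesis
        using s by (simp add: ker1_def powr_divide powr_minus_divide divide_simps)
    qed
    finally have "(H has_real_derivative ker1 (t - r)) (at (t - r))" by (simp add: s_def)
    then have "((\<lambda>r. H (t - r)) has_real_derivative ker1 (t - r) * (0 - 1)) (at r)"
      by (intro DERIV_chain2[of H]) (auto intro!: derivative_eq_intros)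
    then have "((\<lambda>r. - H (t - r)) has_real_derivative ker1 (t - r)) (at r)"
      by (auto dest: DERIV_minus)
    then show ?thesis by (simp add: has_real_derivative_iff_has_vector_derivative)
  qed
  have hi: "((\<lambda>r. ker1 (t - r)) has_integral (- H (t - t) - - H (t - 0))) {0..t}"
    by (rule fundamental_theorem_of_calculus_interior[OF assms cont der])
  have nn: "0 \<le> ker1 x" for x by (simp add: ker1_def)
  have "(\<lambda>r. ker1 (t - r)) absolutely_integrable_on {0..t}"
    using hi nn by (intro nonnegative_absolutely_integrable_1) (auto simp: integrable_on_def)
  then show I: "set_integrable lebesgue {0..t} (\<lambda>r. ker1 (t - r))" .
  have "(LINT r:{0..t}|lebesgue. ker1 (t - r)) = integral {0..t} (\<lambda>r. ker1 (t - r))"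
    by (rule set_lebesgue_integral_eq_integral(2)[OF I])
  also have "\<dots> = H t" using integral_unique[OF hi] by (simp add: H_def)
  also have "H t \<le> 32 * 1" unfolding H_def using assms by (intro mult_left_mono powr_le1) auto
  finally show "(LINT r:{0..t}|lebesgue. ker1 (t - r)) \<le> 32" by simp
qed

text \<open>Minkowski's integral inequality by duality: pairing with the integral itself turns the
  norm into one scalar integral. In this way all integrals are taken coefficient by
  coefficient.\<close>

lemma hbound_integral:
  fixes f :: "real \<Rightarrow> int \<times> int \<Rightarrow> complex"
  assumes f: "\<And>n. set_integrable lebesgue S (\<lambda>r. f r n)"
    and g: "set_integrable lebesgue S g"
    and le: "AE r in lebesgue. r \<in> S \<longrightarrow> hbound \<sigma> (f r) (g r)"
  shows "hbound \<sigma> (\<lambda>n. LINT r:S|lebesgue. f r n) (LINT r:S|lebesgue. g r)"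
proof (rule hboundI)
  have "AE r in lebesgue. 0 \<le> indicator S r *\<^sub>R g r"
    using le by eventually_elim (auto simp: indicator_def dest: hbound_nonneg)
  then show G0: "0 \<le> (LINT r:S|lebesgue. g r)"
    unfolding set_lebesgue_integral_def by (rule integral_nonneg_AE)
  fix F :: "(int \<times> int) set" assume F: "finite F"
  define w where "w n = jap n powr \<sigma>" for n
  have w: "0 \<le> w n" for n by (simp add: w_def)
  define x where "x n = (LINT r:S|lebesgue. f r n)" for n
  define Q where "Q = (\<Sum>n\<in>F. w n * (cmod (x n))\<^sup>2)"
  have Q: "0 \<le> Q" unfolding Q_def by (intro sum_nonneg mult_nonneg_nonneg w) auto
  \<comment> \<open>The weighted pairing with \<open>x\<close>. Its integral is the squared norm
    \<open>Q\<close>, while pointwise it is at most \<open>sqrt Q * g r\<close> by Cauchy--Schwarz;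
    dividing by \<open>sqrt Q\<close> gives the claim.\<close>
  define \<phi> where "\<phi> r = (\<Sum>n\<in>F. of_real (w n) * cnj (x n) * (indicator S r *\<^sub>R f r n))" for r
  have int\<phi>: "integrable lebesgue \<phi>"
    unfolding \<phi>_def using f by (intro Bochner_Integration.integrable_sum integrable_mult_right) (auto simp: set_integrable_def)
  have "integral\<^sup>L lebesgue \<phi> = (\<Sum>n\<in>F. of_real (w n) * cnj (x n) * x n)"
  proof -
    have i: "integrable lebesgue (\<lambda>r. indicator S r *\<^sub>R f r n)" for n
      using f by (simp add: set_integrable_def)
    have "integral\<^sup>L lebesgue \<phi> = (\<Sum>n\<in>F. LINT r|lebesgue. of_real (w n) * cnj (x n) * (indicator S r *\<^sub>R f r n))"
      unfolding \<phi>_def by (intro Bochner_Integration.integral_sum integrable_mult_right i)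
    also have "\<dots> = (\<Sum>n\<in>F. of_real (w n) * cnj (x n) * x n)"
      unfolding x_def set_lebesgue_integral_def by (intro sum.cong refl Bochner_Integration.integral_mult_right i)
    finally show ?thesis .
  qed
  also have "\<dots> = of_real Q"
  proof -
    have "cnj z * z = of_real ((cmod z)\<^sup>2)" for z by (metis complex_norm_square mult.commute)
    then show ?thesis by (simp add: Q_def mult.assoc)
  qed
  finally have eq: "integral\<^sup>L lebesgue \<phi> = of_real Q" .
  have pt: "cmod (\<phi> r) \<le> sqrt Q * (indicator S r *\<^sub>R g r)" if "r \<in> S \<longrightarrow> hbound \<sigma> (f r) (g r)" for r
  proof (cases "r \<in> S")
    case True
    then have h: "hbound \<sigma> (f r) (g r)" using that by simp
    have "cmod (\<phi> r) \<le> (\<Sum>n\<in>F. \<bar>sqrt (w n) * cmod (x n)\<bar> * \<bar>sqrt (w n) * cmod (f r n)\<bar>)"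
      unfolding \<phi>_def
    proof (rule order_trans[OF norm_sum], rule sum_mono)
      fix n
      have s: "sqrt (w n) * (sqrt (w n) * c) = w n * c" for c
        using w[of n] by (simp add: mult.assoc[symmetric])
      show "cmod (of_real (w n) * cnj (x n) * (indicator S r *\<^sub>R f r n))
        \<le> \<bar>sqrt (w n) * cmod (x n)\<bar> * \<bar>sqrt (w n) * cmod (f r n)\<bar>"
        using True w[of n] by (simp add: norm_mult abs_mult mult_ac s)
    qed
    also have "\<dots> \<le> L2_set (\<lambda>n. sqrt (w n) * cmod (x n)) F * L2_set (\<lambda>n. sqrt (w n) * cmod (f r n)) F"
      by (rule L2_set_mult_ineq)
    also have "L2_set (\<lambda>n. sqrt (w n) * cmod (x n)) F = sqrt Q"
      using w by (simp add: L2_set_def Q_def power_mult_distrib)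
    also have "L2_set (\<lambda>n. sqrt (w n) * cmod (f r n)) F \<le> g r"
      unfolding L2_set_def using w hboundD[OF h F] hbound_nonneg[OF h]
      by (intro real_le_lsqrt) (auto simp: power_mult_distrib w_def)
    finally show ?thesis using True Q by (simp add: mult_left_mono)
  qed (simp add: \<phi>_def)
  have "Q = cmod (integral\<^sup>L lebesgue \<phi>)" using Q by (simp add: eq)
  also have "\<dots> \<le> (LINT r|lebesgue. cmod (\<phi> r))"
    by (rule integral_norm_bound)
  also have "\<dots> \<le> (LINT r|lebesgue. sqrt Q * (indicator S r *\<^sub>R g r))"
  proof (rule integral_mono_AE[OF integrable_norm[OF int\<phi>]])
    show "integrable lebesgue (\<lambda>r. sqrt Q * (indicator S r *\<^sub>R g r))"
      using g by (intro integrable_mult_right) (simp add: set_integrable_def)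
    show "AE r in lebesgue. cmod (\<phi> r) \<le> sqrt Q * (indicator S r *\<^sub>R g r)"
      using le by eventually_elim (rule pt)
  qed
  also have "\<dots> = sqrt Q * (LINT r:S|lebesgue. g r)"
    by (simp add: set_lebesgue_integral_def)
  finally have "sqrt Q * sqrt Q \<le> sqrt Q * (LINT r:S|lebesgue. g r)" using Q by simp
  then have "sqrt Q \<le> (LINT r:S|lebesgue. g r)"
    using Q G0 by (cases "Q = 0") (auto dest!: mult_left_le_imp_le simp del: real_sqrt_mult_self)
  then have "(sqrt Q)\<^sup>2 \<le> (LINT r:S|lebesgue. g r)\<^sup>2" using Q by (intro power_mono) auto
  then show "(\<Sum>n\<in>F. jap n powr \<sigma> * (cmod (LINT r:S|lebesgue. f r n))\<^sup>2) \<le> (LINT r:S|lebesgue. g r)\<^sup>2"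
    using Q by (simp add: Q_def w_def x_def)
qed

text \<open>The imaginary part of \<open>L\<close> is left free: the dispersive term with
  \<open>C1\<close> only rotates phases, and the estimates see no more than the modulus of exp (t
  L).\<close>

definition damping :: "real \<Rightarrow> (int \<times> int \<Rightarrow> complex) \<Rightarrow> bool" where
  "damping d L \<longleftrightarrow> 0 < d \<and> (\<forall>n. Re (L n) = - d * (jap n - 1))"

lemma damping_exp_norm:
  "damping d L \<Longrightarrow> cmod (exp (of_real t * L n)) = exp (- (d * t * (jap n - 1)))"
  by (simp add: damping_def norm_exp_eq_Re mult_ac del: split_paired_All)

lemma damping_exp_le_1:
  assumes "damping d L" "0 \<le> t"
  shows "cmod (exp (of_real t * L n)) \<le> 1"
  using assms jap_ge_1[of n] unfolding damping_exp_norm[OF assms(1)] by (simp add: damping_def)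

lemma hbound_semigroup:
  assumes "damping d L" "0 \<le> t" "hbound \<sigma> a A"
  shows "hbound \<sigma> (\<lambda>n. exp (of_real t * L n) * a n) A"
proof (rule hbound_cmod_le[OF assms(3)])
  fix n
  show "cmod (exp (of_real t * L n) * a n) \<le> cmod (a n)"
    unfolding norm_mult by (intro mult_left_le_one_le damping_exp_le_1[OF assms(1,2)]) auto
qed

text \<open>One statement for two uses: \<theta> = 0 with c = 1 gives bounds uniform in time, a
  large \<theta> with c = \<theta> powr (-1/32) gives a contraction. The forcing has to vanish at
  the mode 0, which the semigroup does not damp.\<close>

lemma hbound_duhamel:
  assumes "d > 0"
  shows "\<exists>C>0. \<forall>L \<sigma> z t M \<theta> c. damping d L \<longrightarrow> 0 \<le> t \<longrightarrow> 0 \<le> M \<longrightarrow> 0 \<le> c \<longrightarrow>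
     (\<forall>s>0. exp (- \<theta> * s) * ker0 s \<le> c * ker1 s) \<longrightarrow>
     (\<forall>n. set_integrable lebesgue {0..t} (\<lambda>r. exp (of_real (t - r) * L n) * z r n)) \<longrightarrow>
     (AE r in lebesgue. r \<in> {0..t} \<longrightarrow> z r 0 = 0 \<and> hbound (\<sigma> - 7/4) (z r) (M * exp (\<theta> * r))) \<longrightarrow>
     hbound (\<sigma> + 1/8) (\<lambda>n. LINT r:{0..t}|lebesgue. exp (of_real (t - r) * L n) * z r n) (C * c * M * exp (\<theta> * t))"
proof -
  obtain C where C: "C > 0"
    "\<And>t n. t > 0 \<Longrightarrow> n \<noteq> 0 \<Longrightarrow> jap n powr (15/16) * exp (- (d * t * (jap n - 1))) \<le> C * ker0 t"
    using smoothing_factor[OF assms] by blast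
  have "hbound (\<sigma> + 1/8) (\<lambda>n. LINT r:{0..t}|lebesgue. exp (of_real (t - r) * L n) * z r n) (C * 32 * c * M * exp (\<theta> * t))"
    if L: "damping d L" and t: "0 \<le> t" and M: "0 \<le> M" and c0: "0 \<le> c"
      and c: "\<And>s. s > 0 \<Longrightarrow> exp (- \<theta> * s) * ker0 s \<le> c * ker1 s"
      and int: "\<And>n. set_integrable lebesgue {0..t} (\<lambda>r. exp (of_real (t - r) * L n) * z r n)"
      and ae: "AE r in lebesgue. r \<in> {0..t} \<longrightarrow> z r 0 = 0 \<and> hbound (\<sigma> - 7/4) (z r) (M * exp (\<theta> * r))"
    for L \<sigma> z t M \<theta> c
  proof -
    define g where "g r = (C * c * M * exp (\<theta> * t)) * ker1 (t - r)" for r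
    have gi: "set_integrable lebesgue {0..t} g"
      unfolding g_def using ker1_integrable(1)[OF t] by (rule set_integrable_mult_right)
    have pt: "hbound (\<sigma> + 1/8) (\<lambda>n. exp (of_real (t - r) * L n) * z r n) (g r)"
      if r: "r < t" and z0: "z r 0 = 0" and zb: "hbound (\<sigma> - 7/4) (z r) (M * exp (\<theta> * r))" for r
    proof -
      have "hbound (\<sigma> + 1/8) (\<lambda>n. exp (of_real (t - r) * L n) * z r n) ((C * ker0 (t - r)) * (M * exp (\<theta> * r)))"
      proof (rule hbound_dominated[OF zb])
        show "0 \<le> C * ker0 (t - r)" using C by (simp add: ker0_def)
        fix n
        show "jap n powr (\<sigma> + 1/8) * (cmod (exp (of_real (t - r) * L n) * z r n))\<^sup>2
          \<le> (C * ker0 (t - r))\<^sup>2 * (jap n powr (\<sigma> - 7/4) * (cmod (z r n))\<^sup>2)"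
        proof (cases "n = 0")
          case True then show ?thesis using z0 by simp
        next
          case False
          define e where "e = exp (- (d * (t - r) * (jap n - 1)))"
          have "jap n powr (\<sigma> + 1/8) = jap n powr (\<sigma> - 7/4) * (jap n powr (15/16))\<^sup>2"
            unfolding power2_eq_square powr_add[symmetric]
            by (rule arg_cong[where f="\<lambda>x. jap n powr x"]) simp
          then have "jap n powr (\<sigma> + 1/8) * (cmod (exp (of_real (t - r) * L n) * z r n))\<^sup>2
            = (jap n powr (15/16) * e)\<^sup>2 * (jap n powr (\<sigma> - 7/4) * (cmod (z r n))\<^sup>2)"
            unfolding norm_mult damping_exp_norm[OF L] e_def[symmetric]
            by (simp add: power_mult_distrib mult_ac)
          also have "\<dots> \<le> (C * ker0 (t - r))\<^sup>2 * (jap n powr (\<sigma> - 7/4) * (cmod (z r n))\<^sup>2)"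
            using C(2)[of "t - r" n] r False unfolding e_def
            by (intro mult_right_mono power_mono) auto
          finally show ?thesis .
        qed
      qed
      moreover have "(C * ker0 (t - r)) * (M * exp (\<theta> * r)) \<le> g r"
      proof -
        have "exp (\<theta> * r) = exp (\<theta> * t) * exp (- \<theta> * (t - r))"
          by (simp add: algebra_simps flip: exp_add)
        then have "(C * ker0 (t - r)) * (M * exp (\<theta> * r)) = (C * M * exp (\<theta> * t)) * (exp (- \<theta> * (t - r)) * ker0 (t - r))"
          by (simp add: mult_ac)
        also have "\<dots> \<le> (C * M * exp (\<theta> * t)) * (c * ker1 (t - r))"
          using C M r by (intro mult_left_mono c) auto
        finally show ?thesis by (simp add: g_def mult_ac)
      qed
      ultimately show ?thesis by (rule hbound_mono)
    qed
    \<comment> \<open>The smoothing bound requires a positive time \<open>t - r\<close>; the end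
      point is a null set.\<close>
    have "AE r in lebesgue. r \<noteq> t"
      by (rule AE_I'[of "{t}"]) (auto simp: null_sets_def)
    with ae have "AE r in lebesgue. r \<in> {0..t} \<longrightarrow> hbound (\<sigma> + 1/8) (\<lambda>n. exp (of_real (t - r) * L n) * z r n) (g r)"
    proof eventually_elim
      case (elim r)
      show ?case
      proof
        assume "r \<in> {0..t}"
        with elim show "hbound (\<sigma> + 1/8) (\<lambda>n. exp (of_real (t - r) * L n) * z r n) (g r)"
          by (intro pt) auto
      qed
    qed
    from hbound_integral[OF int gi this]
    have "hbound (\<sigma> + 1/8) (\<lambda>n. LINT r:{0..t}|lebesgue. exp (of_real (t - r) * L n) * z r n) (LINT r:{0..t}|lebesgue. g r)" .
    moreover have "(LINT r:{0..t}|lebesgue. g r) \<le> C * 32 * c * M * exp (\<theta> * t)"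
    proof -
      have "(LINT r:{0..t}|lebesgue. g r) = (C * c * M * exp (\<theta> * t)) * (LINT r:{0..t}|lebesgue. ker1 (t - r))"
        unfolding g_def by (rule set_integral_mult_right)
      also have "\<dots> \<le> (C * c * M * exp (\<theta> * t)) * 32"
        using C M c0 by (intro mult_left_mono ker1_integrable(2)[OF t]) auto
      finally show ?thesis by (simp add: mult_ac)
    qed
    ultimately show ?thesis by (rule hbound_mono)
  qed
  moreover have "C * 32 > 0" using C by simp
  ultimately show ?thesis by blast
qed

section \<open>Globally Lipschitz differential equations in a Banach space\<close>

lemma lipschitz_ode_exists:
  fixes f :: "'a::banach \<Rightarrow> 'a"
  assumes lip: "\<And>x y. norm (f x - f y) \<le> K * norm (x - y)"
  shows "\<exists>x. x 0 = x0 \<and> continuous_on {0..} x \<and>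
    (\<forall>t>0. (x has_vector_derivative f (x t)) (at t))"
proof -
  \<comment> \<open>With the weight exp (- \<theta> t) the Picard map contracts on the whole
    half-line at once: the integral of exp (\<theta> r) up to \<open>t\<close> is at most exp
    (\<theta> t) / \<theta>, and \<theta> \<ge> 2 |K| yields the factor 1/2. The fixed point is the
    weighted solution, which is bounded.\<close>
  define \<theta> where "\<theta> = 2 * \<bar>K\<bar> + 1"
  have \<theta>: "\<theta> > 0" "\<bar>K\<bar> \<le> \<theta> / 2" by (auto simp: \<theta>_def)
  have lip': "norm (f x - f y) \<le> \<bar>K\<bar> * norm (x - y)" for x y
    by (rule order_trans[OF lip]) (auto intro: mult_right_mono)
  have cf: "continuous_on UNIV f"
    by (rule lipschitz_on_continuous_on[of "\<bar>K\<bar>"]) (auto simp: lipschitz_on_def dist_norm intro: lip')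
  have fcont: "continuous_on S (\<lambda>r. f (exp (\<theta> * r) *\<^sub>R apply_bcontfun y r))" for y :: "real \<Rightarrow>\<^sub>C 'a" and S
    by (rule continuous_on_compose2[OF cf]) (auto intro!: continuous_intros)
  have fint: "(\<lambda>r. f (exp (\<theta> * r) *\<^sub>R apply_bcontfun y r)) integrable_on {0..t}" for y :: "real \<Rightarrow>\<^sub>C 'a" and t
    by (rule integrable_continuous_real[OF fcont])
  have expint: "((\<lambda>r. exp (\<theta> * r)) has_integral (exp (\<theta> * t) / \<theta> - 1 / \<theta>)) {0..t}" if "0 \<le> t" for t
  proof -
    have "((\<lambda>r. exp (\<theta> * r)) has_integral (exp (\<theta> * t) / \<theta> - exp (\<theta> * 0) / \<theta>)) {0..t}"
    proof (rule fundamental_theorem_of_calculus[OF that])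
      fix x assume "x \<in> {0..t}"
      have "((\<lambda>r. exp (\<theta> * r) / \<theta>) has_real_derivative exp (\<theta> * x)) (at x within {0..t})"
        using \<theta> by (auto intro!: derivative_eq_intros)
      then show "((\<lambda>r. exp (\<theta> * r) / \<theta>) has_vector_derivative exp (\<theta> * x)) (at x within {0..t})"
        by (simp add: has_real_derivative_iff_has_vector_derivative)
    qed
    then show ?thesis by simp
  qed
  define g where "g y t = exp (- \<theta> * t) *\<^sub>R (x0 + integral {0..t} (\<lambda>r. f (exp (\<theta> * r) *\<^sub>R apply_bcontfun y r)))"
    for y :: "real \<Rightarrow>\<^sub>C 'a" and t
  have gcont: "continuous_on {0..} (g y)" for y
  proof -
    have "continuous_on {0..} (\<lambda>t. integral {0..t} (\<lambda>r. f (exp (\<theta> * r) *\<^sub>R apply_bcontfun y r)))"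
    proof -
      have "continuous (at t within {0..}) (\<lambda>t. integral {0..t} (\<lambda>r. f (exp (\<theta> * r) *\<^sub>R apply_bcontfun y r)))"
        if t: "0 \<le> t" for t
      proof -
        have "continuous_on {0..t+1} (\<lambda>t. integral {0..t} (\<lambda>r. f (exp (\<theta> * r) *\<^sub>R apply_bcontfun y r)))"
          by (rule indefinite_integral_continuous_1[OF fint])
        then have "continuous (at t within {0..t+1}) (\<lambda>t. integral {0..t} (\<lambda>r. f (exp (\<theta> * r) *\<^sub>R apply_bcontfun y r)))"
          using t by (simp add: continuous_on_eq_continuous_within)
        moreover have "at t within {0..t+1} = at t within {0..}"
          by (rule at_within_nhd[where S="{..<t+1}"]) auto
        ultimately show ?thesis by simp
      qed
      then show ?thesis by (simp add: continuous_on_eq_continuous_within)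
    qed
    then show ?thesis unfolding g_def by (intro continuous_intros)
  qed
  \<comment> \<open>Negative times are sent to 0, because the Banach space consists of bounded
    continuous functions on the whole line.\<close>
  define \<Phi> where "\<Phi> y t = g y (max 0 t)" for y :: "real \<Rightarrow>\<^sub>C 'a" and t
  have \<Phi>cont: "continuous_on UNIV (\<Phi> y)" for y
    unfolding \<Phi>_def by (rule continuous_on_compose2[OF gcont]) (auto intro!: continuous_intros)
  have diff: "norm (g y1 t - g y2 t) \<le> norm (y1 - y2) / 2" if t: "0 \<le> t" for y1 y2 t
  proof -
    have "norm (integral {0..t} (\<lambda>r. f (exp (\<theta> * r) *\<^sub>R apply_bcontfun y1 r) - f (exp (\<theta> * r) *\<^sub>R apply_bcontfun y2 r)))
       \<le> integral {0..t} (\<lambda>r. (\<bar>K\<bar> * norm (y1 - y2)) * exp (\<theta> * r))"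
    proof (rule integral_norm_bound_integral)
      show "(\<lambda>r. f (exp (\<theta> * r) *\<^sub>R apply_bcontfun y1 r) - f (exp (\<theta> * r) *\<^sub>R apply_bcontfun y2 r)) integrable_on {0..t}"
        by (intro integrable_diff fint)
      show "(\<lambda>r. \<bar>K\<bar> * norm (y1 - y2) * exp (\<theta> * r)) integrable_on {0..t}"
        by (intro integrable_continuous_real continuous_intros)
      fix r
      have "norm (f (exp (\<theta> * r) *\<^sub>R apply_bcontfun y1 r) - f (exp (\<theta> * r) *\<^sub>R apply_bcontfun y2 r))
        \<le> \<bar>K\<bar> * norm (exp (\<theta> * r) *\<^sub>R apply_bcontfun y1 r - exp (\<theta> * r) *\<^sub>R apply_bcontfun y2 r)"
        by (rule lip')
      also have "exp (\<theta> * r) *\<^sub>R apply_bcontfun y1 r - exp (\<theta> * r) *\<^sub>R apply_bcontfun y2 r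
         = exp (\<theta> * r) *\<^sub>R apply_bcontfun (y1 - y2) r"
        by (simp add: scaleR_diff_right)
      also have "\<bar>K\<bar> * norm \<dots> \<le> \<bar>K\<bar> * (exp (\<theta> * r) * norm (y1 - y2))"
        by (intro mult_left_mono) (auto intro!: norm_bounded simp del: minus_bcontfun.rep_eq)
      finally show "norm (f (exp (\<theta> * r) *\<^sub>R apply_bcontfun y1 r) - f (exp (\<theta> * r) *\<^sub>R apply_bcontfun y2 r))
        \<le> \<bar>K\<bar> * norm (y1 - y2) * exp (\<theta> * r)" by (simp add: mult_ac)
    qed
    also have "\<dots> = (\<bar>K\<bar> * norm (y1 - y2)) * (exp (\<theta> * t) / \<theta> - 1 / \<theta>)"
      by (rule integral_unique[OF has_integral_mult_right[OF expint[OF t]]])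
    also have "\<dots> \<le> (\<theta> / 2 * norm (y1 - y2)) * (exp (\<theta> * t) / \<theta>)"
      using \<theta> t by (intro mult_mono mult_right_mono) (auto simp: divide_right_mono simp flip: diff_divide_distrib)
    also have "\<dots> = exp (\<theta> * t) * (norm (y1 - y2) / 2)" using \<theta> by simp
    finally have I: "norm (integral {0..t} (\<lambda>r. f (exp (\<theta> * r) *\<^sub>R apply_bcontfun y1 r) - f (exp (\<theta> * r) *\<^sub>R apply_bcontfun y2 r)))
       \<le> exp (\<theta> * t) * (norm (y1 - y2) / 2)" .
    have "g y1 t - g y2 t = exp (- \<theta> * t) *\<^sub>R integral {0..t} (\<lambda>r. f (exp (\<theta> * r) *\<^sub>R apply_bcontfun y1 r) - f (exp (\<theta> * r) *\<^sub>R apply_bcontfun y2 r))"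
      unfolding g_def Henstock_Kurzweil_Integration.integral_diff[OF fint fint] by (simp add: algebra_simps)
    then have "norm (g y1 t - g y2 t) \<le> exp (- \<theta> * t) * (exp (\<theta> * t) * (norm (y1 - y2) / 2))"
      using I by (simp add: mult_left_mono)
    also have "\<dots> = norm (y1 - y2) / 2" by (simp add: exp_minus)
    finally show ?thesis .
  qed
  have g0: "norm (g 0 t) \<le> norm x0 + norm (f 0) / \<theta>" if t: "0 \<le> t" for t
  proof -
    have "g 0 t = exp (- \<theta> * t) *\<^sub>R (x0 + t *\<^sub>R f 0)"
      using t by (simp add: g_def)
    then have "norm (g 0 t) \<le> exp (- \<theta> * t) * (norm x0 + t * norm (f 0))"
      using t norm_triangle_ineq[of x0 "t *\<^sub>R f 0"] by (simp add: mult_left_mono)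
    also have "\<dots> = exp (- \<theta> * t) * norm x0 + (exp (- \<theta> * t) * t) * norm (f 0)"
      by (simp add: algebra_simps)
    also have "\<dots> \<le> 1 * norm x0 + (1 / \<theta>) * norm (f 0)"
    proof (intro add_mono mult_right_mono)
      have "\<theta> * t \<le> exp (\<theta> * t)" using exp_ge_add_one_self[of "\<theta> * t"] by linarith
      then show "exp (- \<theta> * t) * t \<le> 1 / \<theta>"
        using \<theta> by (simp add: exp_minus divide_simps mult_ac)
    qed (use \<theta> t in auto)
    finally show ?thesis by simp
  qed
  have bnd: "\<Phi> y \<in> bcontfun" for y
  proof (rule bcontfun_normI[OF \<Phi>cont])
    fix t :: real
    show "norm (\<Phi> y t) \<le> norm y / 2 + (norm x0 + norm (f 0) / \<theta>)"
      using diff[of "max 0 t" y 0] g0[of "max 0 t"] norm_triangle_sub[of "g y (max 0 t)" "g 0 (max 0 t)"]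
      by (simp add: \<Phi>_def)
  qed
  have "\<exists>!y. Bcontfun (\<Phi> y) = y"
  proof (rule banach_fix_type[of "1/2"])
    show "\<forall>y1 y2. dist (Bcontfun (\<Phi> y1)) (Bcontfun (\<Phi> y2)) \<le> 1/2 * dist y1 y2"
    proof (intro allI dist_bound)
      fix y1 y2 t
      show "dist (apply_bcontfun (Bcontfun (\<Phi> y1)) t) (apply_bcontfun (Bcontfun (\<Phi> y2)) t) \<le> 1/2 * dist y1 y2"
        using diff[of "max 0 t" y1 y2] by (simp add: Bcontfun_inverse[OF bnd] \<Phi>_def dist_norm)
    qed
  qed auto
  then obtain y where y: "Bcontfun (\<Phi> y) = y" by blast
  then have yt: "apply_bcontfun y t = g y t" if "0 \<le> t" for t
    using Bcontfun_inverse[OF bnd[of y]] that by (metis \<Phi>_def max.absorb2)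
  define x where "x t = exp (\<theta> * t) *\<^sub>R apply_bcontfun y t" for t
  have xt: "x t = x0 + integral {0..t} (\<lambda>r. f (x r))" if "0 \<le> t" for t
  proof -
    have "x t = exp (\<theta> * t) *\<^sub>R g y t" by (simp add: x_def yt[OF that])
    also have "\<dots> = x0 + integral {0..t} (\<lambda>r. f (exp (\<theta> * r) *\<^sub>R apply_bcontfun y r))"
      unfolding g_def by (simp flip: exp_add)
    finally show ?thesis by (simp add: x_def)
  qed
  have "x 0 = x0" using xt[of 0] by simp
  moreover have "continuous_on S x" for S
    unfolding x_def by (intro continuous_intros continuous_on_apply_bcontfun)
  moreover have "(x has_vector_derivative f (x t)) (at t)" if t: "0 < t" for t
  proof -
    have fxc: "continuous_on {0..t+1} (\<lambda>r. f (x r))"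
      unfolding x_def by (rule fcont)
    have "((\<lambda>t. integral {0..t} (\<lambda>r. f (x r))) has_vector_derivative f (x t)) (at t within {0..t+1})"
      by (rule integral_has_vector_derivative[OF fxc]) (use t in auto)
    then have "((\<lambda>t. x0 + integral {0..t} (\<lambda>r. f (x r))) has_vector_derivative f (x t)) (at t within {0..t+1})"
      by (auto intro!: derivative_eq_intros)
    then have "(x has_vector_derivative f (x t)) (at t within {0..t+1})"
      by (rule has_vector_derivative_transform[rotated 2]) (use t xt in auto)
    moreover have "at t within {0..t+1} = at t"
      using t by (intro at_within_interior) (auto simp: interior_atLeastAtMost_real)
    ultimately show ?thesis by simp
  qed
  ultimately show ?thesis by blast
qed

section \<open>Galerkin approximations\<close>

text \<open>The symmetry under \<open>n \<mapsto> - n\<close> lets truncation preserve reality, and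
  lets the cancellation in the enstrophy survive it.\<close>

definition modes :: "nat \<Rightarrow> (int \<times> int) set" where
  "modes M = {- int M..int M} \<times> {- int M..int M}"

lemma finite_modes [simp]: "finite (modes M)"
  by (simp add: modes_def)

lemma uminus_in_modes [simp]: "- n \<in> modes M \<longleftrightarrow> n \<in> modes M"
  by (cases n) (auto simp: modes_def)

lemma modes_mono: "M \<le> N \<Longrightarrow> modes M \<subseteq> modes N"
  by (auto simp: modes_def)

definition trunc :: "nat \<Rightarrow> (int \<times> int \<Rightarrow> complex) \<Rightarrow> int \<times> int \<Rightarrow> complex" where
  "trunc M a n = (if n \<in> modes M then a n else 0)"

definition hermitian :: "(int \<times> int \<Rightarrow> complex) \<Rightarrow> bool" where
  "hermitian a \<longleftrightarrow> (\<forall>n. a (- n) = cnj (a n))"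

text \<open>The real-linear projection onto the coefficient sequences of real functions.\<close>

definition herm :: "(int \<times> int \<Rightarrow> complex) \<Rightarrow> int \<times> int \<Rightarrow> complex" where
  "herm a n = (a n + cnj (a (- n))) / 2"

lemma hermitian_herm: "hermitian (herm a)"
  by (simp add: hermitian_def herm_def add.commute)

lemma herm_hermitian: "hermitian a \<Longrightarrow> herm a = a"
  by (auto simp: hermitian_def herm_def fun_eq_iff)

lemma hermitian_trunc: "hermitian a \<Longrightarrow> hermitian (trunc M a)"
  unfolding hermitian_def trunc_def by (simp del: split_paired_All)

lemma nonlin_supported:
  assumes "\<And>m. m \<notin> modes M \<Longrightarrow> a m = 0"
  shows "nonlin \<kappa> a b n = (\<Sum>m\<in>modes M. kern \<kappa> n m * a m * b (n - m))"
proof -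
  have "nonlin \<kappa> a b n = (\<Sum>\<^sub>\<infinity>m\<in>modes M. kern \<kappa> n m * a m * b (n - m))"
    unfolding nonlin_def by (rule infsum_cong_neutral) (use assms in auto)
  then show ?thesis by simp
qed

lemma jap_uminus [simp]: "jap (- n) = jap n"
  by (simp add: jap_def)

lemma kern_uminus: "kern \<kappa> (- n) (- m) = cnj (kern \<kappa> n m)"
proof -
  have "jap (m - n) = jap (n - m)" using jap_uminus[of "n - m"] by simp
  then show ?thesis by (simp add: kern_def algebra_simps)
qed

lemma nonlin_hermitian:
  assumes "hermitian a" "\<And>m. m \<notin> modes M \<Longrightarrow> a m = 0"
  shows "hermitian (nonlin \<kappa> a a)"
proof -
  have "nonlin \<kappa> a a (- n) = cnj (nonlin \<kappa> a a n)" for n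
  proof -
    have "nonlin \<kappa> a a (- n) = (\<Sum>m\<in>modes M. kern \<kappa> (- n) m * a m * a (- n - m))"
      by (rule nonlin_supported[OF assms(2)])
    also have "\<dots> = (\<Sum>m\<in>modes M. kern \<kappa> (- n) (- m) * a (- m) * a (- n - (- m)))"
      by (rule sum.reindex_bij_witness[of _ uminus uminus]) auto
    also have "\<dots> = (\<Sum>m\<in>modes M. cnj (kern \<kappa> n m * a m * a (n - m)))"
    proof (rule sum.cong[OF refl])
      fix m
      have "a (- n - - m) = a (- (n - m))" by simp
      also have "\<dots> = cnj (a (n - m))"
        using assms(1) by (simp add: hermitian_def del: split_paired_All minus_diff_eq)
      finally have "a (- n - - m) = cnj (a (n - m))" .
      then show "kern \<kappa> (- n) (- m) * a (- m) * a (- n - - m) = cnj (kern \<kappa> n m * a m * a (n - m))"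
        using assms(1) by (simp add: kern_uminus hermitian_def del: split_paired_All)
    qed
    also have "\<dots> = cnj (nonlin \<kappa> a a n)"
      by (simp add: nonlin_supported[OF assms(2)])
    finally show ?thesis .
  qed
  then show ?thesis by (simp add: hermitian_def del: split_paired_All)
qed

text \<open>The kernel changes sign under the substitution \<open>n \<mapsto> m - n\<close>, because the velocity is
  divergence-free.\<close>

lemma nonlin_orthogonal:
  assumes "hermitian a" "\<And>m. m \<notin> modes M \<Longrightarrow> a m = 0"
  shows "(\<Sum>n\<in>{n\<in>modes M. fst n \<noteq> 0}. cnj (a n) * nonlin \<kappa> a a n) = 0"
proof -
  define T where "T = (\<lambda>(n, m). a (- n) * kern \<kappa> n m * a m * a (n - m))"
  define B where "B = {n\<in>modes M. fst n \<noteq> 0}"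
  \<comment> \<open>The map (n, m) \<mapsto> (m - n, m) exchanges the conditions on \<open>n\<close>
    and on \<open>n - m\<close>, and likewise \<open>fst n \<noteq> 0\<close> and
    \<open>fst n \<noteq> fst m\<close>. It is thus an involution of \<open>S\<close>, while
    \<open>T\<close> vanishes on the rest of the product.\<close>
  define S where "S = {(n, m). n \<in> B \<and> m \<in> modes M \<and> n - m \<in> modes M \<and> fst n \<noteq> fst m}"
  have S: "S \<subseteq> B \<times> modes M" by (auto simp: S_def)
  have "(\<Sum>n\<in>B. cnj (a n) * nonlin \<kappa> a a n) = (\<Sum>n\<in>B. \<Sum>m\<in>modes M. T (n, m))"
  proof (rule sum.cong[OF refl])
    fix n
    have "a (- n) = cnj (a n)" using assms(1) by (simp add: hermitian_def del: split_paired_All)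
    moreover have "nonlin \<kappa> a a n = (\<Sum>m\<in>modes M. kern \<kappa> n m * a m * a (n - m))"
      by (rule nonlin_supported[OF assms(2)])
    ultimately show "cnj (a n) * nonlin \<kappa> a a n = (\<Sum>m\<in>modes M. T (n, m))"
      by (simp add: T_def sum_distrib_left mult.assoc)
  qed
  also have "\<dots> = sum T (B \<times> modes M)"
    by (simp add: sum.cartesian_product)
  also have "\<dots> = sum T S"
  proof (rule sum.mono_neutral_right)
    show "\<forall>i\<in>B \<times> modes M - S. T i = 0"
    proof
      fix i assume i: "i \<in> B \<times> modes M - S"
      obtain n m where nm: "i = (n, m)" by (cases i)
      have "fst n = fst m \<or> n - m \<notin> modes M" using i by (auto simp: S_def nm)
      then have "kern \<kappa> n m = 0 \<or> a (n - m) = 0"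
        using assms(2)[of "n - m"] by (metis kern_def)
      then show "T i = 0" by (auto simp: T_def nm)
    qed
  qed (use S in \<open>auto simp: B_def\<close>)
  also have "sum T S = 0"
  proof -
    have "sum T S = (\<Sum>x\<in>S. - T x)"
    proof (rule sum.reindex_bij_witness[of _ "\<lambda>(n, m). (m - n, m)" "\<lambda>(n, m). (m - n, m)"])
      fix x assume "x \<in> S"
      then obtain n m where x: "x = (n, m)" "n \<in> B" "m \<in> modes M" "n - m \<in> modes M" "fst n \<noteq> fst m"
        by (auto simp: S_def)
      have "m - n \<in> modes M" using x(4) uminus_in_modes[of "n - m" M] by simp
      moreover have "m - n - m \<in> modes M" using x(2) uminus_in_modes[of n M] by (simp add: B_def)
      ultimately show "(case x of (n, m) \<Rightarrow> (m - n, m)) \<in> S"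
        using x by (auto simp: S_def B_def)
      then show "(case x of (n, m) \<Rightarrow> (m - n, m)) \<in> S" .
      show "(case case x of (n, m) \<Rightarrow> (m - n, m) of (n, m) \<Rightarrow> (m - n, m)) = x"
        using x(1) by simp
      then show "(case case x of (n, m) \<Rightarrow> (m - n, m) of (n, m) \<Rightarrow> (m - n, m)) = x" .
      have n0: "fst n \<noteq> 0" using x(2) by (simp add: B_def)
      \<comment> \<open>The case of \<open>kern\<close> that forces the zonal flow occurs at neither
        of the two arguments. The other two expressions are linear in \<open>n\<close> and vanish
        for n = m, so passing to \<open>m - n\<close> changes their sign.\<close>
      have k: "kern \<kappa> (m - n) m = - kern \<kappa> n m"
        using n0 x(5) by (simp add: kern_def minus_divide_left algebra_simps)
      have "- (m - n) = n - m" "m - n - m = - n" by auto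
      then show "- T (case x of (n, m) \<Rightarrow> (m - n, m)) = T x"
        unfolding x(1) T_def by (simp add: k mult_ac)
    qed
    then show ?thesis by (simp add: sum_negf)
  qed
  finally show ?thesis by (simp add: B_def)
qed

text \<open>The difference splits into a change of the point at a fixed factor and a change of the
  factor at a fixed point; each part is at most \<open>norm (x - y)\<close>, whence the constant
  2.\<close>

lemma radial_retraction:
  fixes x y :: "'a::real_normed_vector"
  assumes "R > 0"
  defines "\<rho> \<equiv> \<lambda>x::'a. (R / max R (norm x)) *\<^sub>R x"
  shows "norm (\<rho> x) \<le> R" and "norm (\<rho> x - \<rho> y) \<le> 2 * norm (x - y)"
proof -
  show "norm (\<rho> x) \<le> R"
    unfolding \<rho>_def using assms(1) by (simp add: divide_simps max_def mult_ac)
  define a b where "a = max R (norm x)" and "b = max R (norm y)"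
  have ab: "0 < a" "0 < b" "R \<le> a" "norm y \<le> b" using assms(1) by (auto simp: a_def b_def)
  have "\<rho> x - \<rho> y = (R / a) *\<^sub>R (x - y) + (R / a - R / b) *\<^sub>R y"
    by (simp add: \<rho>_def a_def b_def algebra_simps)
  then have "norm (\<rho> x - \<rho> y) \<le> norm ((R / a) *\<^sub>R (x - y)) + norm ((R / a - R / b) *\<^sub>R y)"
    by (simp only: norm_triangle_ineq)
  also have "norm ((R / a) *\<^sub>R (x - y)) \<le> norm (x - y)"
    using ab assms(1) mult_right_mono[of "R / a" 1 "norm (x - y)"] by simp
  also have "norm ((R / a - R / b) *\<^sub>R y) \<le> norm (x - y)"
  proof -
    have "R / a - R / b = (R / a) * ((b - a) / b)" using ab by (simp add: field_simps)
    then have "norm ((R / a - R / b) *\<^sub>R y) = (R / a) * (\<bar>b - a\<bar> * (norm y / b))"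
      using ab assms(1) by (simp add: abs_mult)
    also have "\<dots> \<le> 1 * (norm (x - y) * 1)"
    proof (intro mult_mono)
      show "\<bar>b - a\<bar> \<le> norm (x - y)"
        using norm_triangle_ineq3[of x y] by (auto simp: a_def b_def)
    qed (use ab assms(1) in auto)
    finally show ?thesis by simp
  qed
  finally show "norm (\<rho> x - \<rho> y) \<le> 2 * norm (x - y)" by simp
qed

instance bcontfun :: (metric_space, banach) banach ..

text \<open>A discrete copy of the lattice, so that bounded families indexed by it form a Banach space.\<close>

datatype mode = Mode (mode_index: "int \<times> int")

instantiation mode :: metric_space
begin

definition dist_mode :: "mode \<Rightarrow> mode \<Rightarrow> real" where
  "dist_mode x y = (if x = y then 0 else 1)"

definition uniformity_mode :: "(mode \<times> mode) filter" where
  "uniformity_mode = (INF e\<in>{0 <..}. principal {(x, y). dist x y < e})"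

definition open_mode :: "mode set \<Rightarrow> bool" where
  "open_mode U \<longleftrightarrow> (\<forall>x\<in>U. eventually (\<lambda>(x', y). x' = x \<longrightarrow> y \<in> U) uniformity)"

instance
  by standard (auto simp: dist_mode_def uniformity_mode_def open_mode_def)

end

lemma continuous_on_mode: "continuous_on S (f :: mode \<Rightarrow> 'b::topological_space)"
proof -
  have "open U" for U :: "mode set"
    unfolding open_dist by (intro ballI exI[of _ 1]) (auto simp: dist_mode_def split: if_splits)
  then have "continuous_on UNIV f"
    by (simp add: continuous_on_open_vimage)
  then show ?thesis by (rule continuous_on_subset) simp
qed

lemma scalar_duhamel:
  fixes y w :: "real \<Rightarrow> complex"
  assumes "continuous_on {0..} y" "continuous_on {0..} w"
    and der: "\<And>t. t > 0 \<Longrightarrow> (y has_vector_derivative (c * y t + w t)) (at t)"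
    and t: "0 \<le> t"
  shows "set_integrable lebesgue {0..t} (\<lambda>r. exp (of_real (t - r) * c) * w r)"
    and "y t = exp (of_real t * c) * y 0 + (LINT r:{0..t}|lebesgue. exp (of_real (t - r) * c) * w r)"
proof -
  have cy: "continuous_on {0..t} y" and cw: "continuous_on {0..t} w"
    using assms(1,2) by (auto intro: continuous_on_subset)
  show I: "set_integrable lebesgue {0..t} (\<lambda>r. exp (of_real (t - r) * c) * w r)"
    by (rule absolutely_integrable_continuous_real) (intro continuous_intros cw)
  have "((\<lambda>r. exp (of_real (t - r) * c) * w r) has_integral
      (exp (of_real (t - t) * c) * y t - exp (of_real (t - 0) * c) * y 0)) {0..t}"
  proof (rule fundamental_theorem_of_calculus_interior[OF t])
    show "continuous_on {0..t} (\<lambda>r. exp (of_real (t - r) * c) * y r)"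
      by (intro continuous_intros cy)
    fix r assume r: "r \<in> {0<..<t}"
    have e: "((\<lambda>r. exp (of_real (t - r) * c)) has_vector_derivative - (c * exp (of_real (t - r) * c))) (at r)"
    proof -
      have "((\<lambda>z. exp ((of_real t - z) * c)) has_field_derivative - (c * exp (of_real (t - r) * c))) (at (of_real r))"
        by (auto intro!: derivative_eq_intros simp: mult_ac)
      from has_vector_derivative_real_field[OF this] show ?thesis by simp
    qed
    have "((\<lambda>r. exp (of_real (t - r) * c) * y r) has_vector_derivative
       (exp (of_real (t - r) * c) * (c * y r + w r) + - (c * exp (of_real (t - r) * c)) * y r)) (at r)"
      using r by (intro has_vector_derivative_mult e der) auto
    then show "((\<lambda>r. exp (of_real (t - r) * c) * y r) has_vector_derivative exp (of_real (t - r) * c) * w r) (at r)"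
      by (simp add: algebra_simps)
  qed
  from integral_unique[OF this] set_lebesgue_integral_eq_integral(2)[OF I]
  show "y t = exp (of_real t * c) * y 0 + (LINT r:{0..t}|lebesgue. exp (of_real (t - r) * c) * w r)"
    by simp
qed

text \<open>What the analysis of sequences uses of the equation: the scale of the kernel, the
  damping, and the reality of the linear operator.\<close>

locale spectral_system =
  fixes \<kappa> d :: real and L :: "int \<times> int \<Rightarrow> complex"
  assumes \<kappa>: "\<kappa> > 0" and damping: "damping d L" and L_uminus: "L (- n) = cnj (L n)"
begin

text \<open>The radial cutoff \<open>\<eta>\<close> makes the vector field globally Lipschitz; as it is a scalar factor, it
  does not disturb the conservation of enstrophy, so a large \<open>R\<close> keeps it inactive.\<close>

lemma galerkin_cutoff:
  assumes a0: "hermitian a0" and R: "R > 0"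
  shows "\<exists>x \<eta>. x 0 = trunc M a0 \<and> (\<forall>t\<ge>0. hermitian (x t)) \<and>
    (\<forall>t\<ge>0. \<forall>n. n \<notin> modes M \<longrightarrow> x t n = 0) \<and>
    (\<forall>n. continuous_on {0..} (\<lambda>t. x t n)) \<and> continuous_on {0..} \<eta> \<and>
    (\<forall>t. 0 \<le> \<eta> t \<and> \<eta> t \<le> (1::real)) \<and>
    (\<forall>t. (\<forall>n. cmod (x t n) \<le> R) \<longrightarrow> \<eta> t = 1) \<and>
    (\<forall>t>0. \<forall>n\<in>modes M. ((\<lambda>t. x t n) has_vector_derivative
        L n * x t n + of_real (\<eta> t) * nonlin \<kappa> (x t) (x t) n) (at t))"
proof -
  define rd where "rd X n = apply_bcontfun X (Mode n)" for X :: "mode \<Rightarrow>\<^sub>C complex" and n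
  have tb: "(\<lambda>k. trunc M a (mode_index k)) \<in> bcontfun" for a
  proof (rule bcontfun_normI[OF continuous_on_mode])
    fix k show "norm (trunc M a (mode_index k)) \<le> (\<Sum>m\<in>modes M. norm (a m))"
      by (auto simp: trunc_def intro!: member_le_sum sum_nonneg)
  qed
  define emb where "emb a = Bcontfun (\<lambda>k. trunc M a (mode_index k))" for a
  have emb: "rd (emb a) = trunc M a" for a
    unfolding emb_def rd_def Bcontfun_inverse[OF tb] by simp
  have rd_le: "norm (rd X n) \<le> norm X" for X n
    by (simp add: rd_def norm_bounded)
  have rd_bound: "norm X \<le> c" if "\<And>n. norm (rd X n) \<le> c" for X c
  proof (rule norm_bound)
    show "norm (apply_bcontfun X k) \<le> c" for k
      using that[of "mode_index k"] by (simp add: rd_def)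
  qed
  have rd_lin: "rd (X - Y) n = rd X n - rd Y n" "rd (X + Y) n = rd X n + rd Y n"
    "rd (r *\<^sub>R X) n = r *\<^sub>R rd X n" for X Y n r
    by (simp_all add: rd_def)
  define \<rho> where "\<rho> x = (R / max R (norm x)) *\<^sub>R x" for x :: "mode \<Rightarrow>\<^sub>C complex"
  \<comment> \<open>Projecting first onto hermitian sequences supported in \<open>modes M\<close>
    makes the vector field hermitian at every point. Reality of the solution then follows from a
    derivative that vanishes identically.\<close>
  define H where "H x = herm (trunc M (rd x))" for x :: "mode \<Rightarrow>\<^sub>C complex"
  \<comment> \<open>The retraction enters only the quadratic part; the linear part is globally
    Lipschitz as it stands.\<close>
  define f where "f x = emb (\<lambda>n. L n * H x n + nonlin \<kappa> (H (\<rho> x)) (H (\<rho> x)) n)" for x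
  have Hsupp: "H x n = 0" if "n \<notin> modes M" for x n
    using that by (simp add: H_def herm_def trunc_def)
  have Hherm: "hermitian (H x)" for x unfolding H_def by (rule hermitian_herm)
  have trunc_le: "norm (trunc M (rd x) n) \<le> norm x" for x n
    by (simp add: trunc_def rd_le)
  have half: "norm ((u + cnj v) / 2) \<le> C" if "norm u \<le> C" "norm v \<le> C" for u v C
  proof -
    have "norm (u + cnj v) \<le> C + C" using that norm_triangle_ineq[of u "cnj v"] by simp
    then show ?thesis by (simp add: norm_divide)
  qed
  have H_le: "norm (H x n) \<le> norm x" for x n
    unfolding H_def herm_def by (intro half trunc_le)
  have H_diff: "H x n - H y n = H (x - y) n" for x y n
    by (simp add: H_def herm_def trunc_def rd_lin flip: diff_divide_distrib)
  have H_diff_le: "norm (H x n - H y n) \<le> norm (x - y)" for x y n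
    unfolding H_diff by (rule H_le)
  note \<rho> = radial_retraction[OF R, where 'a="mode \<Rightarrow>\<^sub>C complex", folded \<rho>_def]
  \<comment> \<open>In the difference of two products each of the two terms contributes the bound
    \<open>R\<close> times the Lipschitz constant 2 of the retraction, hence 4 R. The sum over
    \<open>n\<close> stands in for a maximum.\<close>
  define K where "K = (\<Sum>n\<in>modes M. cmod (L n) + (\<Sum>m\<in>modes M. cmod (kern \<kappa> n m) * (4 * R)))"
  have lip: "norm (f x - f y) \<le> K * norm (x - y)" for x y
  proof (rule rd_bound)
    fix n
    define g g' where "g = H (\<rho> x)" and "g' = H (\<rho> y)"
    have g: "cmod (g m) \<le> R" "cmod (g' m) \<le> R" "cmod (g m - g' m) \<le> 2 * norm (x - y)" for m
      unfolding g_def g'_def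
      using H_le[of "\<rho> x" m] H_le[of "\<rho> y" m] H_diff_le[of "\<rho> x" m "\<rho> y"] \<rho>(1)[of x] \<rho>(1)[of y] \<rho>(2)[of x y]
      by linarith+
    show "norm (rd (f x - f y) n) \<le> K * norm (x - y)"
    proof (cases "n \<in> modes M")
      case False
      have "0 \<le> K * norm (x - y)"
        unfolding K_def using R by (intro mult_nonneg_nonneg sum_nonneg add_nonneg_nonneg) auto
      then show ?thesis using False by (simp add: f_def emb trunc_def rd_lin)
    next
      case True
      have N: "nonlin \<kappa> (H z) (H z) n = (\<Sum>m\<in>modes M. kern \<kappa> n m * H z m * H z (n - m))" for z
        by (rule nonlin_supported[OF Hsupp])
      have nl: "cmod (nonlin \<kappa> g g n - nonlin \<kappa> g' g' n) \<le> (\<Sum>m\<in>modes M. cmod (kern \<kappa> n m) * (4 * R)) * norm (x - y)"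
      proof -
        have "nonlin \<kappa> g g n - nonlin \<kappa> g' g' n
           = (\<Sum>m\<in>modes M. kern \<kappa> n m * ((g m - g' m) * g (n - m) + g' m * (g (n - m) - g' (n - m))))"
          unfolding g_def g'_def N sum_subtractf[symmetric]
          by (intro sum.cong) (auto simp: algebra_simps)
        also have "cmod \<dots> \<le> (\<Sum>m\<in>modes M. cmod (kern \<kappa> n m) * (4 * R) * norm (x - y))"
        proof (rule sum_norm_le)
          fix m
          have "cmod ((g m - g' m) * g (n - m) + g' m * (g (n - m) - g' (n - m)))
            \<le> cmod (g m - g' m) * cmod (g (n - m)) + cmod (g' m) * cmod (g (n - m) - g' (n - m))"
            by (rule order_trans[OF norm_triangle_ineq]) (simp add: norm_mult)
          also have "\<dots> \<le> (2 * norm (x - y)) * R + R * (2 * norm (x - y))"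
            using R by (intro add_mono mult_mono g) auto
          finally have "cmod ((g m - g' m) * g (n - m) + g' m * (g (n - m) - g' (n - m))) \<le> (4 * R) * norm (x - y)"
            by simp
          then show "cmod (kern \<kappa> n m * ((g m - g' m) * g (n - m) + g' m * (g (n - m) - g' (n - m))))
             \<le> cmod (kern \<kappa> n m) * (4 * R) * norm (x - y)"
            unfolding norm_mult mult.assoc by (intro mult_left_mono) (auto simp: mult.assoc)
        qed
        finally show ?thesis by (simp add: sum_distrib_right)
      qed
      have "rd (f x - f y) n = L n * (H x n - H y n) + (nonlin \<kappa> g g n - nonlin \<kappa> g' g' n)"
        using True by (simp add: f_def emb trunc_def rd_lin g_def g'_def algebra_simps)
      then have "norm (rd (f x - f y) n) \<le> cmod (L n) * norm (x - y) + (\<Sum>m\<in>modes M. cmod (kern \<kappa> n m) * (4 * R)) * norm (x - y)"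
        using nl H_diff_le[of x n y]
        by (auto intro!: order_trans[OF norm_triangle_ineq] add_mono mult_left_mono simp: norm_mult)
      also have "\<dots> = (cmod (L n) + (\<Sum>m\<in>modes M. cmod (kern \<kappa> n m) * (4 * R))) * norm (x - y)"
        by (simp add: algebra_simps)
      also have "\<dots> \<le> K * norm (x - y)"
        unfolding K_def using True R
        by (intro mult_right_mono member_le_sum) (auto intro!: add_nonneg_nonneg sum_nonneg)
      finally show ?thesis .
    qed
  qed
  obtain X where X: "X 0 = emb a0" "continuous_on {0..} X"
    and dX: "\<And>t. t > 0 \<Longrightarrow> (X has_vector_derivative f (X t)) (at t)"
    using lipschitz_ode_exists[of f K "emb a0"] lip by blast
  define x where "x t n = rd (X t) n" for t n
  have bl: "bounded_linear (\<lambda>z. rd z n)" for n :: "int \<times> int"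
    by (rule bounded_linear_intro[of _ 1]) (auto simp: rd_le rd_lin)
  have cx: "continuous_on {0..} (\<lambda>t. x t n)" for n
    unfolding x_def by (rule bounded_linear.continuous_on[OF bl X(2)])
  have dx: "((\<lambda>t. x t n) has_vector_derivative rd (f (X t)) n) (at t)" if "t > 0" for t n
    unfolding x_def by (rule bounded_linear.has_vector_derivative[OF bl dX[OF that]])
  have const: "y t = y 0" if "continuous_on {0..} y" "\<And>t. t > 0 \<Longrightarrow> (y has_vector_derivative 0) (at t)" "0 \<le> t"
    for y :: "real \<Rightarrow> complex" and t
  proof -
    have "((\<lambda>_. 0) has_integral (y t - y 0)) {0..t}"
      using that by (intro fundamental_theorem_of_calculus_interior) (auto intro: continuous_on_subset)
    then show ?thesis using has_integral_unique[of "\<lambda>_. 0"] has_integral_0 by fastforce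
  qed
  have supp: "x t n = 0" if "n \<notin> modes M" "0 \<le> t" for t n
  proof -
    have "x t n = x 0 n"
    proof (rule const[OF cx _ that(2)])
      show "((\<lambda>t. x t n) has_vector_derivative 0) (at t)" if "t > 0" for t
        using dx[OF that, of n] \<open>n \<notin> modes M\<close> by (simp add: f_def emb trunc_def)
    qed
    then show ?thesis using that(1) by (simp add: x_def X(1) emb trunc_def)
  qed
  have f_herm: "rd (f z) (- n) = cnj (rd (f z) n)" for z n
    using Hherm[of z] nonlin_hermitian[OF Hherm[of "\<rho> z"] Hsupp, where \<kappa>=\<kappa>]
    by (simp add: f_def emb trunc_def L_uminus hermitian_def del: split_paired_All)
  have xherm: "hermitian (x t)" if "0 \<le> t" for t
  proof -
    have "x t (- n) = cnj (x t n)" for n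
    proof -
      have "x t (- n) - cnj (x t n) = x 0 (- n) - cnj (x 0 n)"
      proof (rule const[OF _ _ that, where y="\<lambda>t. x t (- n) - cnj (x t n)"])
        show "continuous_on {0..} (\<lambda>t. x t (- n) - cnj (x t n))"
          by (intro continuous_intros cx)
        show "((\<lambda>t. x t (- n) - cnj (x t n)) has_vector_derivative 0) (at t)" if "t > 0" for t
          using has_vector_derivative_diff[OF dx[OF that, of "- n"]
              bounded_linear.has_vector_derivative[OF bounded_linear_cnj dx[OF that, of n]]]
          by (simp add: f_herm)
      qed
      also have "\<dots> = 0"
        using hermitian_trunc[OF a0, of M] by (simp add: x_def X(1) emb hermitian_def del: split_paired_All)
      finally show ?thesis by simp
    qed
    then show ?thesis by (simp add: hermitian_def del: split_paired_All)
  qed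
  have tr: "trunc M (x t) = x t" if "0 \<le> t" for t
    using supp[OF _ that] by (auto simp: trunc_def fun_eq_iff)
  have HX: "H (X t) = x t" if "0 \<le> t" for t
  proof -
    have "H (X t) = herm (trunc M (x t))" by (simp add: H_def x_def[abs_def])
    then show ?thesis using tr[OF that] herm_hermitian[OF xherm[OF that]] by simp
  qed
  \<comment> \<open>The retraction scales both arguments of a quadratic map, hence the
    square.\<close>
  define \<eta> where "\<eta> t = (R / max R (norm (X t)))\<^sup>2" for t
  have H\<rho>: "H (\<rho> z) n = of_real (R / max R (norm z)) * H z n" for z n
    by (simp add: H_def \<rho>_def herm_def trunc_def rd_lin scaleR_conv_of_real algebra_simps)
  have fX: "rd (f (X t)) n = L n * x t n + of_real (\<eta> t) * nonlin \<kappa> (x t) (x t) n"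
    if "0 \<le> t" "n \<in> modes M" for t n
  proof -
    define s where "s = R / max R (norm (X t))"
    have H: "H (\<rho> (X t)) = (\<lambda>m. of_real s * x t m)"
      using HX[OF that(1)] H\<rho>[of "X t"] by (simp add: s_def fun_eq_iff del: split_paired_All)
    have "nonlin \<kappa> (H (\<rho> (X t))) (H (\<rho> (X t))) n = (\<Sum>m\<in>modes M. kern \<kappa> n m * H (\<rho> (X t)) m * H (\<rho> (X t)) (n - m))"
      by (rule nonlin_supported[OF Hsupp])
    also have "\<dots> = of_real (s\<^sup>2) * (\<Sum>m\<in>modes M. kern \<kappa> n m * x t m * x t (n - m))"
      unfolding H sum_distrib_left by (intro sum.cong) (auto simp: power2_eq_square algebra_simps)
    also have "(\<Sum>m\<in>modes M. kern \<kappa> n m * x t m * x t (n - m)) = nonlin \<kappa> (x t) (x t) n"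
      by (rule nonlin_supported[symmetric]) (use supp that in auto)
    finally show ?thesis using that by (simp add: f_def emb trunc_def HX \<eta>_def s_def)
  qed
  have c\<eta>: "continuous_on {0..} \<eta>"
    unfolding \<eta>_def using R X(2) by (intro continuous_intros) auto
  have \<eta>01: "0 \<le> \<eta> t \<and> \<eta> t \<le> 1" for t
  proof -
    have "0 \<le> R / max R (norm (X t))" "R / max R (norm (X t)) \<le> 1" using R by (auto simp: divide_simps)
    then show ?thesis unfolding \<eta>_def by (simp add: power_le_one)
  qed
  have \<eta>1: "\<eta> t = 1" if "\<And>n. cmod (x t n) \<le> R" for t
  proof -
    have "norm (X t) \<le> R" by (rule rd_bound) (use that in \<open>simp add: x_def\<close>)
    then show ?thesis using R by (simp add: \<eta>_def max_def)
  qed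
  have "x 0 = trunc M a0" by (simp add: x_def[abs_def] X(1) emb)
  moreover have "((\<lambda>t. x t n) has_vector_derivative L n * x t n + of_real (\<eta> t) * nonlin \<kappa> (x t) (x t) n) (at t)"
    if "t > 0" "n \<in> modes M" for t n
    using dx[OF that(1), of n] fX[of t n] that by simp
  ultimately show ?thesis
    using xherm supp cx c\<eta> \<eta>01 \<eta>1 by blast
qed

end

lemma hbound_limit_bound:
  assumes "\<And>k. hbound \<sigma> a (B k)" "B \<longlonglongrightarrow> b"
  shows "hbound \<sigma> a b"
proof (rule hboundI)
  show "0 \<le> b"
    by (rule LIMSEQ_le_const[OF assms(2)]) (use hbound_nonneg[OF assms(1)] in auto)
  fix F :: "(int \<times> int) set" assume F: "finite F"
  show "(\<Sum>n\<in>F. jap n powr \<sigma> * (cmod (a n))\<^sup>2) \<le> b\<^sup>2"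
    by (rule LIMSEQ_le_const[OF tendsto_power[OF assms(2)]]) (use hboundD[OF assms(1) F] in auto)
qed

text \<open>A bound that improves itself from y to A + y / 2 ends at the fixed point 2 A, whatever
  crude bound starts it. This takes the place of absorbing a supremum, and it works equally for
  bounds that hold at almost every time.\<close>

lemma halving_iteration:
  fixes P :: "real \<Rightarrow> bool"
  assumes "P y0" "0 \<le> y0" "0 \<le> A" "\<And>y. 0 \<le> y \<Longrightarrow> P y \<Longrightarrow> P (A + y / 2)"
  shows "\<exists>Y. (\<forall>k. P (Y k)) \<and> Y \<longlonglongrightarrow> 2 * A"
proof (intro exI conjI allI)
  define Y where "Y k = 2 * A + (y0 - 2 * A) * (1/2) ^ k" for k :: nat
  have "0 \<le> Y k \<and> P (Y k)" for k
  proof (induction k)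
    case (Suc k)
    have "Y (Suc k) = A + Y k / 2" by (simp add: Y_def)
    then show ?case using Suc assms by auto
  qed (use assms in \<open>simp add: Y_def\<close>)
  then show "P (Y k)" for k by blast
  have "Y \<longlonglongrightarrow> 2 * A + (y0 - 2 * A) * 0"
    unfolding Y_def by (intro tendsto_intros LIMSEQ_power_zero) auto
  then show "Y \<longlonglongrightarrow> 2 * A" by simp
qed

section \<open>Bounds for the Galerkin solutions, uniform in the truncation\<close>

lemma kern_0_left [simp]: "kern \<kappa> 0 m = 0"
  by (simp add: kern_def)

text \<open>Every nonlinear term is a divergence, so the undamped mode 0 is never forced.\<close>

lemma nonlin_0 [simp]: "nonlin \<kappa> a b 0 = 0"
  by (simp add: nonlin_def)

definition nonzonal :: "(int \<times> int \<Rightarrow> complex) \<Rightarrow> int \<times> int \<Rightarrow> complex" where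
  "nonzonal a n = (if fst n = 0 then 0 else a n)"

text \<open>For \<open>fst n = 0\<close> the kernel vanishes at zonal \<open>m\<close>, and
  otherwise both \<open>m\<close> and \<open>n - m\<close> are nonzonal: the zonal flow is forced by
  the vorticity alone.\<close>

lemma nonlin_zonal_mode:
  assumes "fst n = 0"
  shows "nonlin \<kappa> a a n = nonlin \<kappa> (nonzonal a) (nonzonal a) n"
  unfolding nonlin_def by (intro infsum_cong) (use assms in \<open>auto simp: kern_def nonzonal_def\<close>)

context spectral_system
begin

text \<open>The forcing \<open>w\<close> is a separate argument, which makes the relation linear:
  differences of mild solutions and their zonal rows are mild again. A solution of the system is the
  case where \<open>w\<close> is the nonlinearity of the trajectory itself.\<close>

definition mild :: "(int \<times> int \<Rightarrow> complex) \<Rightarrow> (real \<Rightarrow> int \<times> int \<Rightarrow> complex) \<Rightarrow> real \<Rightarrow> (int \<times> int \<Rightarrow> complex) \<Rightarrow> bool"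
  where "mild a w t y \<longleftrightarrow> (\<forall>n.
     set_integrable lebesgue {0..t} (\<lambda>r. exp (of_real (t - r) * L n) * w r n) \<and>
     y n = exp (of_real t * L n) * a n + (LINT r:{0..t}|lebesgue. exp (of_real (t - r) * L n) * w r n))"

lemma mild_diff:
  assumes "mild a w t y" "mild a' w' t y'"
  shows "mild (\<lambda>n. a n - a' n) (\<lambda>r n. w r n - w' r n) t (\<lambda>n. y n - y' n)"
  using assms unfolding mild_def
  by (auto simp: right_diff_distrib set_integral_diff simp del: split_paired_All)

lemma mild_hbound:
  "\<exists>C>0. \<forall>a w t y \<sigma> A M \<theta> c. mild a w t y \<longrightarrow> 0 \<le> t \<longrightarrow> 0 \<le> M \<longrightarrow> 0 \<le> c \<longrightarrow>
     (\<forall>s>0. exp (- \<theta> * s) * ker0 s \<le> c * ker1 s) \<longrightarrow> hbound (\<sigma> + 1/8) a A \<longrightarrow>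
     (AE r in lebesgue. r \<in> {0..t} \<longrightarrow> w r 0 = 0 \<and> hbound (\<sigma> - 7/4) (w r) (M * exp (\<theta> * r))) \<longrightarrow>
     hbound (\<sigma> + 1/8) y (A + C * c * M * exp (\<theta> * t))"
proof -
  have d: "d > 0" using damping by (simp add: damping_def)
  obtain C where C: "C > 0" and est: "\<forall>L \<sigma> z t M \<theta> c. damping d L \<longrightarrow> 0 \<le> t \<longrightarrow> 0 \<le> M \<longrightarrow> 0 \<le> c \<longrightarrow>
     (\<forall>s>0. exp (- \<theta> * s) * ker0 s \<le> c * ker1 s) \<longrightarrow>
     (\<forall>n. set_integrable lebesgue {0..t} (\<lambda>r. exp (of_real (t - r) * L n) * z r n)) \<longrightarrow>
     (AE r in lebesgue. r \<in> {0..t} \<longrightarrow> z r 0 = 0 \<and> hbound (\<sigma> - 7/4) (z r) (M * exp (\<theta> * r))) \<longrightarrow>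
     hbound (\<sigma> + 1/8) (\<lambda>n. LINT r:{0..t}|lebesgue. exp (of_real (t - r) * L n) * z r n) (C * c * M * exp (\<theta> * t))"
    using hbound_duhamel[OF d] by blast
  note est = est[THEN spec, THEN spec, THEN spec, THEN spec, THEN spec, THEN spec, THEN spec,
      THEN mp, THEN mp, THEN mp, THEN mp, THEN mp, THEN mp, THEN mp]
  have "hbound (\<sigma> + 1/8) y (A + C * c * M * exp (\<theta> * t))"
    if m: "mild a w t y" and t: "0 \<le> t" and M: "0 \<le> M" and c: "0 \<le> c"
     and k: "\<forall>s>0. exp (- \<theta> * s) * ker0 s \<le> c * ker1 s" and a: "hbound (\<sigma> + 1/8) a A"
     and ae: "AE r in lebesgue. r \<in> {0..t} \<longrightarrow> w r 0 = 0 \<and> hbound (\<sigma> - 7/4) (w r) (M * exp (\<theta> * r))"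
    for a w t y \<sigma> A M \<theta> c
  proof -
    have int: "\<forall>n. set_integrable lebesgue {0..t} (\<lambda>r. exp (of_real (t - r) * L n) * w r n)"
      and eq: "y = (\<lambda>n. exp (of_real t * L n) * a n + (LINT r:{0..t}|lebesgue. exp (of_real (t - r) * L n) * w r n))"
      using m unfolding mild_def by blast+
    show ?thesis
      unfolding eq by (intro hbound_add hbound_semigroup[OF damping t a] est[OF damping t M c k int ae])
  qed
  with C show ?thesis by blast
qed

text \<open>The enstrophy of the nonzonal part never grows. The forcing of the zonal part is
  quadratic in the nonzonal part, so Duhamel's formula bounds it too. Both bounds hold with the
  cutoff present, and \<open>R\<close> is fixed from them beforehand; hence the cutoff turns out to
  be inactive.\<close>

lemma galerkin_exists:
  "\<exists>R>0. \<forall>a0 M. hermitian a0 \<longrightarrow> hbound 0 a0 U \<longrightarrow>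
    (\<exists>x. (\<forall>n. continuous_on {0..} (\<lambda>t. x t n)) \<and>
      (\<forall>t\<ge>0. hermitian (x t) \<and> (\<forall>n. n \<notin> modes M \<longrightarrow> x t n = 0) \<and> hbound 0 (x t) R \<and>
         mild (trunc M a0) (\<lambda>r. trunc M (nonlin \<kappa> (x r) (x r))) t (x t)))"
proof -
  obtain C1 where C1: "C1 > 0" and nl0: "\<forall>a b A B A' B'. hbound 0 a A \<longrightarrow> hbound 0 b B \<longrightarrow> hbound 0 a A' \<longrightarrow> hbound 0 b B' \<longrightarrow>
    hbound (0 - 7/4) (nonlin \<kappa> a b) (C1 * (A' * B + A * B'))"
    using nonlin_hbound[OF \<kappa> order_refl] by blast
  have nl: "hbound (-7/4) (nonlin \<kappa> a b) (C1 * (A * B + A * B))" if "hbound 0 a A" "hbound 0 b B" for a b A B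
    using nl0[rule_format, OF that that] by simp
  obtain C2 where C2: "C2 > 0" and mh: "\<forall>a w t y \<sigma> A M \<theta> c. mild a w t y \<longrightarrow> 0 \<le> t \<longrightarrow> 0 \<le> M \<longrightarrow> 0 \<le> c \<longrightarrow>
     (\<forall>s>0. exp (- \<theta> * s) * ker0 s \<le> c * ker1 s) \<longrightarrow> hbound (\<sigma> + 1/8) a A \<longrightarrow>
     (AE r in lebesgue. r \<in> {0..t} \<longrightarrow> w r 0 = 0 \<and> hbound (\<sigma> - 7/4) (w r) (M * exp (\<theta> * r))) \<longrightarrow>
     hbound (\<sigma> + 1/8) y (A + C2 * c * M * exp (\<theta> * t))"
    using mild_hbound by blast
  note mh = mh[THEN spec, THEN spec, THEN spec, THEN spec, THEN spec, THEN spec, THEN spec, THEN spec, THEN spec,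
      THEN mp, THEN mp, THEN mp, THEN mp, THEN mp, THEN mp, THEN mp]
  \<comment> \<open>The nonzonal part contributes \<open>U\<close>, the zonal part another
    \<open>U\<close> and a Duhamel term. The absolute value and the final 1 make \<open>R\<close>
    positive for every real \<open>U\<close>.\<close>
  define R where "R = 2 * \<bar>U\<bar> + C2 * (C1 * (U * U + U * U)) + 1"
  have "0 \<le> C2 * (C1 * (U * U + U * U))" using C1 C2 by (intro mult_nonneg_nonneg) auto
  then have R: "R > 0" unfolding R_def by linarith
  have "\<exists>x. (\<forall>n. continuous_on {0..} (\<lambda>t. x t n)) \<and>
      (\<forall>t\<ge>0. hermitian (x t) \<and> (\<forall>n. n \<notin> modes M \<longrightarrow> x t n = 0) \<and> hbound 0 (x t) R \<and>
         mild (trunc M a0) (\<lambda>r. trunc M (nonlin \<kappa> (x r) (x r))) t (x t))"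
    if a0: "hermitian a0" and U: "hbound 0 a0 U" for a0 M
  proof -
    have U0: "0 \<le> U" using U by (rule hbound_nonneg)
    from galerkin_cutoff[OF a0 R, of M] show ?thesis
    proof (elim exE conjE)
      fix x \<eta>
      assume x0: "x 0 = trunc M a0" and "\<forall>t\<ge>0. hermitian (x t)"
        and "\<forall>t\<ge>0. \<forall>n. n \<notin> modes M \<longrightarrow> x t n = 0"
        and "\<forall>n. continuous_on {0..} (\<lambda>t. x t n)" and c\<eta>: "continuous_on {0..} \<eta>"
        and "\<forall>t. 0 \<le> \<eta> t \<and> \<eta> t \<le> (1::real)"
        and "\<forall>t. (\<forall>n. cmod (x t n) \<le> R) \<longrightarrow> \<eta> t = 1"
        and "\<forall>t>0. \<forall>n\<in>modes M. ((\<lambda>t. x t n) has_vector_derivative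
          L n * x t n + of_real (\<eta> t) * nonlin \<kappa> (x t) (x t) n) (at t)"
      note xh = this(2)[rule_format] and supp = this(3)[rule_format] and cx = this(4)[rule_format]
        and \<eta> = this(6)[rule_format, THEN conjunct1] this(6)[rule_format, THEN conjunct2]
        and \<eta>1 = this(7)[rule_format] and dx = this(8)[rule_format]
    define w where "w t = trunc M (\<lambda>n. of_real (\<eta> t) * nonlin \<kappa> (x t) (x t) n)" for t
    have cw: "continuous_on {0..} (\<lambda>t. w t n)" for n
    proof (cases "n \<in> modes M")
      case True
      have "continuous_on {0..} (\<lambda>t. of_real (\<eta> t) * (\<Sum>m\<in>modes M. kern \<kappa> n m * x t m * x t (n - m)))"
        by (intro continuous_intros cx c\<eta>)
      moreover have "of_real (\<eta> t) * (\<Sum>m\<in>modes M. kern \<kappa> n m * x t m * x t (n - m)) = w t n" if "t \<in> {0..}" for t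
      proof -
        have "nonlin \<kappa> (x t) (x t) n = (\<Sum>m\<in>modes M. kern \<kappa> n m * x t m * x t (n - m))"
          by (rule nonlin_supported) (use supp that in auto)
        then show ?thesis using True by (simp add: w_def trunc_def)
      qed
      ultimately show ?thesis by (rule continuous_on_eq)
    qed (simp add: w_def trunc_def)
    have mild_w: "mild (trunc M a0) w t (x t)" if t: "0 \<le> t" for t
      unfolding mild_def
    proof (intro allI)
      fix n
      show "set_integrable lebesgue {0..t} (\<lambda>r. exp (of_real (t - r) * L n) * w r n) \<and>
        x t n = exp (of_real t * L n) * trunc M a0 n + (LINT r:{0..t}|lebesgue. exp (of_real (t - r) * L n) * w r n)"
      proof (cases "n \<in> modes M")
        case True
        have "((\<lambda>t. x t n) has_vector_derivative L n * x t n + w t n) (at t)" if "t > 0" for t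
          using dx[OF that True] True by (simp add: w_def trunc_def)
        from scalar_duhamel[OF cx cw this t] show ?thesis unfolding x0 by blast
      next
        case False
        then show ?thesis using supp[OF t False]
          by (simp add: w_def trunc_def set_integrable_def)
      qed
    qed
    \<comment> \<open>By Parseval this is the enstrophy of the truncated vorticity, up to a constant
      factor.\<close>
    define E where "E t = (\<Sum>n\<in>{n\<in>modes M. fst n \<noteq> 0}. (cmod (x t n))\<^sup>2)" for t
    have E_le: "E t \<le> U\<^sup>2" if t: "0 \<le> t" for t
    proof -
      have cm: "(cmod z)\<^sup>2 = Re (cnj z * z)" for z
        unfolding cmod_power2 by (simp add: power2_eq_square)
      have cE: "continuous_on {0..t} E"
        unfolding E_def by (intro continuous_intros continuous_on_subset[OF cx]) auto
      have dE: "\<exists>y. (E has_real_derivative y) (at r) \<and> y \<le> 0" if r: "0 < r" "r < t" for r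
      proof (intro exI conjI)
        define v where "v n = L n * x r n + of_real (\<eta> r) * nonlin \<kappa> (x r) (x r) n" for n
        show "(E has_real_derivative (\<Sum>n\<in>{n\<in>modes M. fst n \<noteq> 0}. 2 * Re (cnj (x r n) * v n))) (at r)"
          unfolding E_def has_real_derivative_iff_has_vector_derivative
        proof (rule has_vector_derivative_sum)
          fix n assume n: "n \<in> {n\<in>modes M. fst n \<noteq> 0}"
          have d1: "((\<lambda>t. x t n) has_vector_derivative v n) (at r)"
            using dx[OF r(1), of n] n by (simp add: v_def)
          have d2: "((\<lambda>t. cnj (x t n) * x t n) has_vector_derivative (cnj (x r n) * v n + cnj (v n) * x r n)) (at r)"
            by (intro has_vector_derivative_mult d1 bounded_linear.has_vector_derivative[OF bounded_linear_cnj d1])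
          have "((\<lambda>t. Re (cnj (x t n) * x t n)) has_vector_derivative Re (cnj (x r n) * v n + cnj (v n) * x r n)) (at r)"
            by (rule bounded_linear.has_vector_derivative[OF bounded_linear_Re d2])
          moreover have "Re (cnj (x r n) * v n + cnj (v n) * x r n) = 2 * Re (cnj (x r n) * v n)"
            by (simp add: algebra_simps)
          ultimately show "((\<lambda>t. (cmod (x t n))\<^sup>2) has_vector_derivative 2 * Re (cnj (x r n) * v n)) (at r)"
            unfolding cm by (simp only:)
        qed
        have "(\<Sum>n\<in>{n\<in>modes M. fst n \<noteq> 0}. cnj (x r n) * v n)
          = (\<Sum>n\<in>{n\<in>modes M. fst n \<noteq> 0}. L n * of_real ((cmod (x r n))\<^sup>2))
            + of_real (\<eta> r) * (\<Sum>n\<in>{n\<in>modes M. fst n \<noteq> 0}. cnj (x r n) * nonlin \<kappa> (x r) (x r) n)"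
          unfolding sum_distrib_left sum.distrib[symmetric] complex_norm_square
          by (intro sum.cong) (auto simp: v_def algebra_simps)
        also have "(\<Sum>n\<in>{n\<in>modes M. fst n \<noteq> 0}. cnj (x r n) * nonlin \<kappa> (x r) (x r) n) = 0"
          by (rule nonlin_orthogonal) (use xh supp r in auto)
        finally have S: "(\<Sum>n\<in>{n\<in>modes M. fst n \<noteq> 0}. cnj (x r n) * v n)
          = (\<Sum>n\<in>{n\<in>modes M. fst n \<noteq> 0}. L n * of_real ((cmod (x r n))\<^sup>2))" by simp
        have "(\<Sum>n\<in>{n\<in>modes M. fst n \<noteq> 0}. 2 * Re (cnj (x r n) * v n))
           = 2 * Re (\<Sum>n\<in>{n\<in>modes M. fst n \<noteq> 0}. cnj (x r n) * v n)"
          by (simp only: Re_sum sum_distrib_left)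
        also have "\<dots> = 2 * (\<Sum>n\<in>{n\<in>modes M. fst n \<noteq> 0}. Re (L n) * (cmod (x r n))\<^sup>2)"
          unfolding S Re_sum by (intro arg_cong[where f="(*) 2"] sum.cong) (auto simp del: of_real_power)
        also have "\<dots> \<le> 0"
        proof -
          have "Re (L n) \<le> 0" for n
            using damping jap_ge_1[of n] by (simp add: damping_def del: split_paired_All)
          then show ?thesis by (simp add: sum_nonpos mult_nonpos_nonneg)
        qed
        finally show "(\<Sum>n\<in>{n\<in>modes M. fst n \<noteq> 0}. 2 * Re (cnj (x r n) * v n)) \<le> 0" .
      qed
      have "E t \<le> E 0"
      proof (cases "t = 0")
        case False
        then show ?thesis using t by (intro DERIV_nonpos_imp_decreasing_open[OF t dE cE]) auto
      qed simp
      also have "E 0 \<le> U\<^sup>2"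
      proof -
        have "E 0 = (\<Sum>n\<in>{n\<in>modes M. fst n \<noteq> 0}. (cmod (a0 n))\<^sup>2)"
          unfolding E_def x0 by (intro sum.cong) (auto simp: trunc_def)
        also have "\<dots> \<le> U\<^sup>2" using U by (simp add: hbound0)
        finally show ?thesis .
      qed
      finally show ?thesis .
    qed
    have z_bound: "hbound 0 (nonzonal (x t)) U" if t: "0 \<le> t" for t
      unfolding hbound0
    proof (intro conjI allI impI U0)
      fix F :: "(int \<times> int) set" assume F: "finite F"
      have "(\<Sum>n\<in>F. (cmod (nonzonal (x t) n))\<^sup>2) = (\<Sum>n\<in>F \<inter> {n\<in>modes M. fst n \<noteq> 0}. (cmod (x t n))\<^sup>2)"
        by (rule sum.mono_neutral_cong_right) (use F supp[OF t] in \<open>auto simp: nonzonal_def\<close>)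
      also have "\<dots> \<le> E t"
        unfolding E_def by (rule sum_mono2) auto
      finally show "(\<Sum>n\<in>F. (cmod (nonzonal (x t) n))\<^sup>2) \<le> U\<^sup>2" using E_le[OF t] by linarith
    qed
    define u where "u t n = (if fst n = 0 then x t n else 0)" for t n
    define wu where "wu t n = (if fst n = 0 then w t n else 0)" for t n
    have u_bound: "hbound 0 (u t) (U + C2 * (C1 * (U * U + U * U)))" if t: "0 \<le> t" for t
    proof -
      \<comment> \<open>The linear operator is diagonal, so the zonal row satisfies a mild equation
        of its own.\<close>
      have m: "mild (\<lambda>n. if fst n = 0 then trunc M a0 n else 0) wu t (u t)"
        using mild_w[OF t] unfolding mild_def wu_def u_def
        by (auto simp: set_integrable_def simp del: split_paired_All)
      \<comment> \<open>The order - 1/8 is chosen so that the smoothing, with its surplus of 1/8,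
        ends at order 0.\<close>
      have wb: "hbound (-1/8 - 7/4) (wu r) (C1 * (U * U + U * U) * exp (0 * r))" if r: "0 \<le> r" for r
      proof -
        have "hbound (-7/4) (wu r) (C1 * (U * U + U * U))"
        proof (rule hbound_cmod_le[OF nl[OF z_bound[OF r] z_bound[OF r]]])
          fix n
          show "cmod (wu r n) \<le> cmod (nonlin \<kappa> (nonzonal (x r)) (nonzonal (x r)) n)"
            using \<eta>[of r] by (auto simp: wu_def w_def trunc_def norm_mult nonlin_zonal_mode[of n \<kappa> "x r"] mult_left_le_one_le)
        qed
        then show ?thesis using hbound_le_index[where \<tau>="-1/8 - 7/4"] by simp
      qed
      have "hbound (-1/8 + 1/8) (u t) (U + C2 * 1 * (C1 * (U * U + U * U)) * exp (0 * t))"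
      proof (rule mh[OF m t])
        show "\<forall>s>0. exp (- 0 * s) * ker0 s \<le> 1 * ker1 s" using ker0_le_ker1(1) by simp
        have "hbound 0 (\<lambda>n. if fst n = 0 then trunc M a0 n else 0) U"
          by (rule hbound_cmod_le[OF U]) (simp add: trunc_def)
        then show "hbound (-1/8 + 1/8) (\<lambda>n. if fst n = 0 then trunc M a0 n else 0) U" by simp
        show "AE r in lebesgue. r \<in> {0..t} \<longrightarrow> wu r 0 = 0 \<and> hbound (-1/8 - 7/4) (wu r) (C1 * (U * U + U * U) * exp (0 * r))"
        proof (rule AE_I2, intro impI conjI)
          fix r assume "r \<in> {0..t}"
          then show "hbound (-1/8 - 7/4) (wu r) (C1 * (U * U + U * U) * exp (0 * r))" by (intro wb) auto
          show "wu r 0 = 0" by (simp add: wu_def w_def trunc_def)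
        qed
      qed (use C1 U0 in auto)
      then show ?thesis by simp
    qed
    have x_bound: "hbound 0 (x t) R" if t: "0 \<le> t" for t
    proof -
      have "x t = (\<lambda>n. nonzonal (x t) n + u t n)" by (auto simp: nonzonal_def u_def)
      then have "hbound 0 (x t) (U + (U + C2 * (C1 * (U * U + U * U))))"
        using hbound_add[OF z_bound[OF t] u_bound[OF t]] by simp
      then show ?thesis by (rule hbound_mono) (use U0 in \<open>simp add: R_def\<close>)
    qed
    \<comment> \<open>The bound was derived from 0 \<le> \<eta> \<le> 1 alone, so it holds at all
      times and no continuation argument is involved.\<close>
    have "\<eta> t = 1" if "0 \<le> t" for t
      by (rule \<eta>1) (rule hbound_cmod_single[OF x_bound[OF that]])
    then have w_eq: "w r = trunc M (nonlin \<kappa> (x r) (x r))" if "0 \<le> r" for r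
      using that by (simp add: w_def)
    have "mild (trunc M a0) (\<lambda>r. trunc M (nonlin \<kappa> (x r) (x r))) t (x t)" if t: "0 \<le> t" for t
    proof -
      have e: "indicator {0..t} r *\<^sub>R (exp (of_real (t - r) * L n) * trunc M (nonlin \<kappa> (x r) (x r)) n)
        = indicator {0..t} r *\<^sub>R (exp (of_real (t - r) * L n) * w r n)" for r n
        by (auto simp: indicator_def w_eq)
      show ?thesis using mild_w[OF t]
        unfolding mild_def set_integrable_def set_lebesgue_integral_def e .
    qed
    with cx xh supp x_bound show ?thesis by blast
    qed
  qed
  with R show ?thesis by blast
qed

end

section \<open>Interpolation and truncation errors\<close>

lemma hbound_trunc: "hbound \<sigma> a A \<Longrightarrow> hbound \<sigma> (trunc M a) A"
  by (erule hbound_cmod_le) (simp add: trunc_def)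

text \<open>Modes with \<open>jap n > q\<close> gain the factor \<open>jap n powr (-1/8)\<close>, at
  most \<epsilon>^2 by the choice of \<open>q\<close>; the others are controlled by the norm of
  order 0 at the price of a large \<open>K\<close>. The maximum with 0 keeps the order nonnegative,
  as \<open>nonlin_hbound\<close> demands.\<close>

lemma hbound_interpolate:
  assumes "0 < \<epsilon>" "0 \<le> s"
  shows "\<exists>K\<ge>0. \<forall>a A B. hbound s a A \<longrightarrow> hbound 0 a B \<longrightarrow> hbound (max (s - 1/8) 0) a (\<epsilon> * A + K * B)"
proof -
  define \<sigma> where "\<sigma> = max (s - 1/8) 0"
  define q where "q = max 1 ((1 / \<epsilon>\<^sup>2) powr 8)"
  have q: "1 \<le> q" "(1 / \<epsilon>\<^sup>2) powr 8 \<le> q" by (auto simp: q_def)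
  define K where "K = sqrt (q powr \<sigma>)"
  have K: "0 \<le> K" "K\<^sup>2 = q powr \<sigma>" by (auto simp: K_def)
  have \<sigma>: "0 \<le> \<sigma>" by (simp add: \<sigma>_def)
  have pt: "jap n powr \<sigma> \<le> \<epsilon>\<^sup>2 * jap n powr s + K\<^sup>2" for n
  proof (cases "jap n \<le> q")
    case True
    then have "jap n powr \<sigma> \<le> K\<^sup>2" unfolding K using \<sigma> jap_pos[of n] by (intro powr_mono2) auto
    then show ?thesis by (simp add: add_increasing)
  next
    case False
    show ?thesis
    proof (cases "s \<le> 1/8")
      case True
      then have "\<sigma> = 0" by (simp add: \<sigma>_def)
      then show ?thesis using jap_pos[of n] q by (simp add: K(2) add_increasing)
    next
      case s: False
      have "jap n powr \<sigma> = jap n powr (-1/8) * jap n powr s"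
        using s unfolding powr_add[symmetric] \<sigma>_def by (simp add: max_def)
      also have "jap n powr (-1/8) \<le> ((1 / \<epsilon>\<^sup>2) powr 8) powr (-1/8)"
        using False q assms by (intro powr_mono2') auto
      also have "\<dots> = \<epsilon>\<^sup>2" using assms by (simp add: powr_powr powr_minus_divide del: powr_numeral)
      finally have "jap n powr \<sigma> \<le> \<epsilon>\<^sup>2 * jap n powr s" by (simp add: mult_right_mono)
      then show ?thesis by (rule order_trans) simp
    qed
  qed
  have "hbound \<sigma> a (\<epsilon> * A + K * B)" if a: "hbound s a A" and b: "hbound 0 a B" for a A B
  proof (rule hboundI)
    have AB: "0 \<le> A" "0 \<le> B" using a b hbound_nonneg by auto
    then show "0 \<le> \<epsilon> * A + K * B" using assms K by simp
    fix F :: "(int \<times> int) set" assume F: "finite F"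
    have "(\<Sum>n\<in>F. jap n powr \<sigma> * (cmod (a n))\<^sup>2) \<le> (\<Sum>n\<in>F. (\<epsilon>\<^sup>2 * jap n powr s + K\<^sup>2) * (cmod (a n))\<^sup>2)"
      by (intro sum_mono mult_right_mono pt) auto
    also have "\<dots> = \<epsilon>\<^sup>2 * (\<Sum>n\<in>F. jap n powr s * (cmod (a n))\<^sup>2) + K\<^sup>2 * (\<Sum>n\<in>F. (cmod (a n))\<^sup>2)"
      by (simp add: distrib_right sum.distrib sum_distrib_left mult.assoc)
    also have "\<dots> \<le> \<epsilon>\<^sup>2 * A\<^sup>2 + K\<^sup>2 * B\<^sup>2"
      using hboundD[OF a F] b F by (intro add_mono mult_left_mono) (auto simp: hbound0)
    also have "\<dots> \<le> (\<epsilon> * A + K * B)\<^sup>2"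
      using assms K(1) AB by (simp add: power2_sum power_mult_distrib)
    finally show "(\<Sum>n\<in>F. jap n powr \<sigma> * (cmod (a n))\<^sup>2) \<le> (\<epsilon> * A + K * B)\<^sup>2" .
  qed
  with K(1) show ?thesis unfolding \<sigma>_def by blast
qed

lemma jap_modes_le:
  assumes "n \<in> modes M"
  shows "jap n \<le> 1 + 2 * (real M)\<^sup>2"
proof -
  have "(of_int (fst n) :: real)\<^sup>2 \<le> (real M)\<^sup>2" "(of_int (snd n) :: real)\<^sup>2 \<le> (real M)\<^sup>2"
    using assms by (auto simp: modes_def intro!: power2_le_iff_abs_le[THEN iffD2])
  then show ?thesis by (simp add: jap_def)
qed

text \<open>A bound that depends badly on \<open>M\<close>: its mere finiteness starts the iteration
  in \<open>mild_sobolev_bound\<close>.\<close>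

lemma hbound_supported:
  assumes "hbound 0 a A" "\<And>n. n \<notin> modes M \<Longrightarrow> a n = 0" "0 \<le> s"
  shows "hbound s a (sqrt ((1 + 2 * (real M)\<^sup>2) powr s) * A)"
proof (rule hbound_dominated[OF assms(1)])
  fix n
  show "jap n powr s * (cmod (a n))\<^sup>2 \<le> (sqrt ((1 + 2 * (real M)\<^sup>2) powr s))\<^sup>2 * (jap n powr 0 * (cmod (a n))\<^sup>2)"
  proof (cases "n \<in> modes M")
    case True
    have "jap n powr s \<le> (1 + 2 * (real M)\<^sup>2) powr s"
      using jap_modes_le[OF True] jap_pos[of n] assms(3) by (intro powr_mono2) auto
    then show ?thesis using jap_pos[of n] by (simp add: mult_right_mono)
  qed (simp add: assms)
qed simp

lemma jap_outside_modes:
  assumes "n \<notin> modes M"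
  shows "(real M)\<^sup>2 \<le> jap n"
proof -
  have "int M \<le> \<bar>fst n\<bar> \<or> int M \<le> \<bar>snd n\<bar>"
    using assms by (cases n) (auto simp: modes_def)
  then have "real M \<le> \<bar>of_int (fst n)\<bar> \<or> real M \<le> \<bar>of_int (snd n)\<bar>"
    by (metis of_int_abs of_int_le_iff of_int_of_nat_eq)
  then have "(real M)\<^sup>2 \<le> (of_int (fst n))\<^sup>2 \<or> (real M)\<^sup>2 \<le> (of_int (snd n))\<^sup>2"
    by (metis power_mono of_nat_0_le_iff power2_abs)
  then show ?thesis
    by (auto simp: jap_def intro: order_trans add_increasing add_increasing2)
qed

text \<open>All but \<epsilon>^2 of the squared norm sits in a finite set \<open>F0\<close>, and two
  truncations whose modes include \<open>F0\<close> agree there.\<close>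

lemma hbound_tail:
  assumes "hbound 0 a A" "\<epsilon> > 0"
  shows "\<exists>M0. \<forall>M N. M0 \<le> M \<longrightarrow> M0 \<le> N \<longrightarrow> hbound 0 (\<lambda>n. trunc M a n - trunc N a n) \<epsilon>"
proof -
  define f where "f n = (cmod (a n))\<^sup>2" for n
  have "f summable_on UNIV"
    by (rule nonneg_bdd_above_summable_on) (use assms(1) in \<open>auto simp: hbound0 f_def bdd_above_def\<close>)
  then have "(sum f \<longlongrightarrow> infsum f UNIV) (finite_subsets_at_top UNIV)" by (rule infsum_tendsto)
  then have "\<forall>\<^sub>F F in finite_subsets_at_top UNIV. infsum f UNIV - \<epsilon>\<^sup>2 < sum f F"
    using assms(2) by (intro order_tendstoD) auto
  then obtain F0 where F0: "finite F0" "infsum f UNIV - \<epsilon>\<^sup>2 < sum f F0"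
    by (auto simp: eventually_finite_subsets_at_top)
  have "\<exists>M0. F0 \<subseteq> modes M0"
    using F0(1)
  proof (induction F0)
    case (insert n F)
    then obtain M1 where M1: "F \<subseteq> modes M1" by blast
    define M where "M = M1 + nat \<bar>fst n\<bar> + nat \<bar>snd n\<bar>"
    have "n \<in> modes M" by (cases n) (auto simp: modes_def M_def)
    moreover have "F \<subseteq> modes M" using M1 modes_mono[of M1 M] by (auto simp: M_def)
    ultimately show ?case by blast
  qed auto
  then obtain M0 where M0: "F0 \<subseteq> modes M0" by blast
  have "hbound 0 (\<lambda>n. trunc M a n - trunc N a n) \<epsilon>" if "M0 \<le> M" "M0 \<le> N" for M N
    unfolding hbound0
  proof (intro conjI allI impI)
    fix F :: "(int \<times> int) set" assume F: "finite F"
    have sub: "F0 \<subseteq> modes M" "F0 \<subseteq> modes N" using M0 modes_mono that by blast+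
    have "(\<Sum>n\<in>F. (cmod (trunc M a n - trunc N a n))\<^sup>2) = (\<Sum>n\<in>F - F0. (cmod (trunc M a n - trunc N a n))\<^sup>2)"
      by (rule sum.mono_neutral_right) (use F sub in \<open>auto simp: trunc_def\<close>)
    also have "\<dots> \<le> sum f (F - F0)"
      by (intro sum_mono) (auto simp: trunc_def f_def)
    also have "\<dots> = sum f ((F - F0) \<union> F0) - sum f F0"
      using F F0(1) by (subst sum.union_disjoint) auto
    also have "\<dots> \<le> infsum f UNIV - sum f F0"
      using F F0(1) \<open>f summable_on UNIV\<close>
      by (intro diff_right_mono finite_sum_le_infsum) (auto simp: f_def)
    also have "\<dots> \<le> \<epsilon>\<^sup>2" using F0(2) by simp
    finally show "(\<Sum>n\<in>F. (cmod (trunc M a n - trunc N a n))\<^sup>2) \<le> \<epsilon>\<^sup>2" .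
  qed (use assms in auto)
  then show ?thesis by blast
qed

lemma inverse_modes_tendsto_0: "(\<lambda>M. (real M)\<^sup>2 powr (-1/16)) \<longlonglongrightarrow> 0"
proof -
  have "filterlim (\<lambda>M. (real M)\<^sup>2) at_top sequentially"
    by (intro filterlim_pow_at_top filterlim_real_sequentially) simp
  then show ?thesis by (intro tendsto_neg_powr) auto
qed

text \<open>At order - 7/4 the tail of the nonlinearity is bounded but not small uniformly in time;
  giving up a further 1/8 of a derivative makes it small at the rate M powr (-1/8). For M = 0 the
  stated factor would vanish, because \<open>0 powr x = 0\<close>.\<close>

lemma hbound_tail_gain:
  assumes "hbound (-7/4) z B" "M \<le> N" "0 < M"
  shows "hbound (-1/8 - 7/4) (\<lambda>n. trunc M z n - trunc N z n) ((real M)\<^sup>2 powr (-1/16) * B)"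
proof (rule hbound_dominated[OF assms(1)])
  fix n
  have sub: "modes M \<subseteq> modes N" by (rule modes_mono[OF assms(2)])
  show "jap n powr (-1/8 - 7/4) * (cmod (trunc M z n - trunc N z n))\<^sup>2
    \<le> ((real M)\<^sup>2 powr (-1/16))\<^sup>2 * (jap n powr (-7/4) * (cmod (z n))\<^sup>2)"
  proof (cases "n \<in> modes M")
    case True
    then show ?thesis using sub by (auto simp: trunc_def)
  next
    case False
    have "jap n powr (-1/8) \<le> (real M)\<^sup>2 powr (-1/8)"
      using jap_outside_modes[OF False] assms(3) by (intro powr_mono2') auto
    also have "\<dots> = ((real M)\<^sup>2 powr (-1/16))\<^sup>2"
      unfolding power2_eq_square[of "_ powr _"] powr_add[symmetric] by simp
    finally have e: "jap n powr (-1/8) \<le> ((real M)\<^sup>2 powr (-1/16))\<^sup>2" .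
    have "jap n powr (-1/8 - 7/4) * (cmod (trunc M z n - trunc N z n))\<^sup>2
      = jap n powr (-1/8) * (jap n powr (-7/4) * (cmod (trunc M z n - trunc N z n))\<^sup>2)"
      unfolding mult.assoc[symmetric] powr_add[symmetric] by simp
    also have "\<dots> \<le> ((real M)\<^sup>2 powr (-1/16))\<^sup>2 * (jap n powr (-7/4) * (cmod (z n))\<^sup>2)"
      by (intro mult_mono e mult_left_mono power_mono) (auto simp: trunc_def)
    finally show ?thesis .
  qed
qed simp

lemma kernel_rate_small:
  fixes e :: real
  assumes "0 < e"
  shows "\<exists>\<theta>>0. \<theta> powr (-1/32) \<le> e"
proof (intro exI conjI)
  show "0 < e powr (-32)" using assms by simp
  show "(e powr (-32)) powr (-1/32) \<le> e" using assms by (simp add: powr_powr)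
qed

context spectral_system
begin

text \<open>Forcing of order - 1/8 - 7/4 ends at order 0, and the factor
  \<open>\<theta> powr (-1/32)\<close> is what makes differences contract in the two proofs that
  follow.\<close>

lemma mild_constants:
  "\<exists>C1 C2. 0 < C1 \<and> 0 < C2 \<and>
    (\<forall>a b A B. hbound 0 a A \<longrightarrow> hbound 0 b B \<longrightarrow> hbound (-7/4) (nonlin \<kappa> a b) (C1 * (A * B))) \<and>
    (\<forall>a w t y A M \<theta>. mild a w t y \<longrightarrow> 0 \<le> t \<longrightarrow> 0 \<le> M \<longrightarrow> 0 < \<theta> \<longrightarrow> hbound 0 a A \<longrightarrow>
      (AE r in lebesgue. r \<in> {0..t} \<longrightarrow> w r 0 = 0 \<and> hbound (-1/8 - 7/4) (w r) (M * exp (\<theta> * r))) \<longrightarrow>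
      hbound 0 y (A + C2 * \<theta> powr (-1/32) * M * exp (\<theta> * t)))"
proof -
  obtain C1 where C1: "C1 > 0" and nl0: "\<forall>a b A B A' B'. hbound 0 a A \<longrightarrow> hbound 0 b B \<longrightarrow> hbound 0 a A' \<longrightarrow> hbound 0 b B' \<longrightarrow>
    hbound (0 - 7/4) (nonlin \<kappa> a b) (C1 * (A' * B + A * B'))"
    using nonlin_hbound[OF \<kappa> order_refl] by blast
  have nl: "hbound (-7/4) (nonlin \<kappa> a b) (2 * C1 * (A * B))" if "hbound 0 a A" "hbound 0 b B" for a b A B
    using nl0[rule_format, OF that that] by (simp add: mult_ac)
  obtain C2 where C2: "C2 > 0" and mh: "\<forall>a w t y \<sigma> A M \<theta> c. mild a w t y \<longrightarrow> 0 \<le> t \<longrightarrow> 0 \<le> M \<longrightarrow> 0 \<le> c \<longrightarrow>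
     (\<forall>s>0. exp (- \<theta> * s) * ker0 s \<le> c * ker1 s) \<longrightarrow> hbound (\<sigma> + 1/8) a A \<longrightarrow>
     (AE r in lebesgue. r \<in> {0..t} \<longrightarrow> w r 0 = 0 \<and> hbound (\<sigma> - 7/4) (w r) (M * exp (\<theta> * r))) \<longrightarrow>
     hbound (\<sigma> + 1/8) y (A + C2 * c * M * exp (\<theta> * t))"
    using mild_hbound by blast
  note mh = mh[THEN spec, THEN spec, THEN spec, THEN spec, THEN spec, THEN spec, THEN spec, THEN spec, THEN spec,
      THEN mp, THEN mp, THEN mp, THEN mp, THEN mp, THEN mp, THEN mp]
  have "hbound 0 y (A + C2 * \<theta> powr (-1/32) * M * exp (\<theta> * t))"
    if m: "mild a w t y" and t: "0 \<le> t" and M: "0 \<le> M" and \<theta>: "0 < \<theta>" and a: "hbound 0 a A"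
     and ae: "AE r in lebesgue. r \<in> {0..t} \<longrightarrow> w r 0 = 0 \<and> hbound (-1/8 - 7/4) (w r) (M * exp (\<theta> * r))"
    for a w t y A M \<theta>
  proof -
    have "hbound (-1/8 + 1/8) y (A + C2 * \<theta> powr (-1/32) * M * exp (\<theta> * t))"
    proof (rule mh[OF m t M _ _ _ ae])
      show "\<forall>s>0. exp (- \<theta> * s) * ker0 s \<le> \<theta> powr (-1/32) * ker1 s"
        using ker0_le_ker1(2)[OF _ \<theta>] by blast
      show "hbound (-1/8 + 1/8) a A" using a by simp
    qed simp
    then show ?thesis by simp
  qed
  then show ?thesis
    by (intro exI[of _ "2 * C1"] exI[of _ C2] conjI) (use C1 C2 nl in \<open>auto simp del: split_paired_All\<close>)
qed

lemma nonlin_diff_hbound: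
  assumes nl: "\<And>a b A B. hbound 0 a A \<Longrightarrow> hbound 0 b B \<Longrightarrow> hbound \<sigma> (nonlin \<kappa> a b) (C1 * (A * B))"
    and a: "hbound 0 a R" and b: "hbound 0 b R" and d: "hbound 0 (\<lambda>n. a n - b n) D"
  shows "hbound \<sigma> (\<lambda>n. nonlin \<kappa> a a n - nonlin \<kappa> b b n) (2 * C1 * R * D)"
proof -
  have "(\<lambda>n. nonlin \<kappa> a a n - nonlin \<kappa> b b n)
    = (\<lambda>n. nonlin \<kappa> (\<lambda>m. a m - b m) a n + nonlin \<kappa> b (\<lambda>m. a m - b m) n)"
    by (rule ext) (rule nonlin_diff[OF \<kappa> a b])
  moreover have "hbound \<sigma> (\<lambda>n. nonlin \<kappa> (\<lambda>m. a m - b m) a n + nonlin \<kappa> b (\<lambda>m. a m - b m) n)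
     (C1 * (D * R) + C1 * (R * D))"
    by (intro hbound_add nl a b d)
  ultimately show ?thesis by (simp add: algebra_simps)
qed

text \<open>For the bound of order \<open>s\<close> the nonlinearity is estimated at order s - 1/8
  (or 0) only, and interpolation makes this a small multiple of the norm of order \<open>s\<close>
  plus a multiple of \<open>R\<close>. The bound thus improves itself as in
  \<open>halving_iteration\<close>, and the result depends neither on \<open>M\<close> nor on
  time.\<close>

lemma mild_sobolev_bound:
  assumes s: "0 \<le> s" and S0: "0 \<le> S0" and R: "0 \<le> R"
  shows "\<exists>B. \<forall>a0 x M. hbound s a0 S0 \<longrightarrow>
    (\<forall>t\<ge>0. (\<forall>n. n \<notin> modes M \<longrightarrow> x t n = 0) \<and> hbound 0 (x t) R \<and>
         mild (trunc M a0) (\<lambda>r. trunc M (nonlin \<kappa> (x r) (x r))) t (x t)) \<longrightarrow>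
    (\<forall>t\<ge>0. hbound s (x t) B)"
proof -
  define \<sigma> where "\<sigma> = max (s - 1/8) 0"
  have \<sigma>: "0 \<le> \<sigma>" "s \<le> \<sigma> + 1/8" by (auto simp: \<sigma>_def)
  obtain C1 where C1: "C1 > 0" and nl: "\<forall>a b A B A' B'. hbound 0 a A \<longrightarrow> hbound 0 b B \<longrightarrow> hbound \<sigma> a A' \<longrightarrow> hbound \<sigma> b B' \<longrightarrow>
    hbound (\<sigma> - 7/4) (nonlin \<kappa> a b) (C1 * (A' * B + A * B'))"
    using nonlin_hbound[OF \<kappa> \<sigma>(1)] by blast
  obtain C2 where C2: "C2 > 0" and mh: "\<forall>a w t y \<sigma> A M \<theta> c. mild a w t y \<longrightarrow> 0 \<le> t \<longrightarrow> 0 \<le> M \<longrightarrow> 0 \<le> c \<longrightarrow>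
     (\<forall>s>0. exp (- \<theta> * s) * ker0 s \<le> c * ker1 s) \<longrightarrow> hbound (\<sigma> + 1/8) a A \<longrightarrow>
     (AE r in lebesgue. r \<in> {0..t} \<longrightarrow> w r 0 = 0 \<and> hbound (\<sigma> - 7/4) (w r) (M * exp (\<theta> * r))) \<longrightarrow>
     hbound (\<sigma> + 1/8) y (A + C2 * c * M * exp (\<theta> * t))"
    using mild_hbound by blast
  note mh = mh[THEN spec, THEN spec, THEN spec, THEN spec, THEN spec, THEN spec, THEN spec, THEN spec, THEN spec,
      THEN mp, THEN mp, THEN mp, THEN mp, THEN mp, THEN mp, THEN mp]
  \<comment> \<open>Makes the feedback \<open>C2 * (C1 * (2 * R * (\<epsilon> * y)))\<close> at most
    y / 2; R + 1 avoids a division by 0.\<close>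
  define \<epsilon> where "\<epsilon> = 1 / (4 * (C2 * C1 * (R + 1)))"
  have \<epsilon>: "\<epsilon> > 0" using C1 C2 R by (simp add: \<epsilon>_def)
  obtain K where K: "K \<ge> 0" and interp: "\<forall>a A B. hbound s a A \<longrightarrow> hbound 0 a B \<longrightarrow> hbound \<sigma> a (\<epsilon> * A + K * B)"
    using hbound_interpolate[OF \<epsilon> s] unfolding \<sigma>_def by blast
  define A where "A = S0 + C2 * (C1 * (2 * R * (K * R)))"
  have A0: "0 \<le> A" using S0 C1 C2 K R by (simp add: A_def)
  have "hbound s (x t) (2 * A)"
    if a0: "hbound s a0 S0"
      and supp: "\<And>t n. 0 \<le> t \<Longrightarrow> n \<notin> modes M \<Longrightarrow> x t n = 0"
      and xR: "\<And>t. 0 \<le> t \<Longrightarrow> hbound 0 (x t) R"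
      and m: "\<And>t. 0 \<le> t \<Longrightarrow> mild (trunc M a0) (\<lambda>r. trunc M (nonlin \<kappa> (x r) (x r))) t (x t)"
      and t: "0 \<le> t" for a0 x M t
  proof -
    define P where "P y \<longleftrightarrow> (\<forall>t\<ge>0. hbound s (x t) y)" for y
    define y0 where "y0 = sqrt ((1 + 2 * (real M)\<^sup>2) powr s) * R"
    have "\<exists>Y. (\<forall>k. P (Y k)) \<and> Y \<longlonglongrightarrow> 2 * A"
    proof (rule halving_iteration)
      show "P y0" unfolding P_def y0_def by (intro allI impI hbound_supported[OF xR _ s] supp)
      show "0 \<le> y0" using R by (simp add: y0_def)
      show "0 \<le> A" by (rule A0)
      fix y assume y: "0 \<le> y" and P: "P y"
      show "P (A + y / 2)"
        unfolding P_def
      proof (intro allI impI)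
        fix t :: real assume t: "0 \<le> t"
        define Q where "Q = \<epsilon> * y + K * R"
        have Q: "0 \<le> Q" using \<epsilon> y K R by (simp add: Q_def)
        have wb: "hbound (\<sigma> - 7/4) (trunc M (nonlin \<kappa> (x r) (x r))) (C1 * (2 * R * Q) * exp (0 * r))" if r: "0 \<le> r" for r
        proof -
          have x\<sigma>: "hbound \<sigma> (x r) Q"
            using interp[rule_format, OF _ xR[OF r]] P r unfolding P_def Q_def by blast
          have "hbound (\<sigma> - 7/4) (nonlin \<kappa> (x r) (x r)) (C1 * (Q * R + R * Q))"
            using nl xR[OF r] x\<sigma> by blast
          then show ?thesis by (intro hbound_trunc) (simp add: algebra_simps)
        qed
        \<comment> \<open>The initial datum is only in the space of order \<open>s\<close>, so the linear part is split off.\<close>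
        have lin: "hbound s (\<lambda>n. exp (of_real t * L n) * trunc M a0 n) S0"
          by (rule hbound_semigroup[OF damping t hbound_trunc[OF a0]])
        have "mild (\<lambda>_. 0) (\<lambda>r. trunc M (nonlin \<kappa> (x r) (x r))) t (\<lambda>n. x t n - exp (of_real t * L n) * trunc M a0 n)"
          using m[OF t] by (simp add: mild_def del: split_paired_All)
        then have "hbound (\<sigma> + 1/8) (\<lambda>n. x t n - exp (of_real t * L n) * trunc M a0 n) (0 + C2 * 1 * (C1 * (2 * R * Q)) * exp (0 * t))"
        proof (rule mh[OF _ t])
          show "\<forall>s>0. exp (- 0 * s) * ker0 s \<le> 1 * ker1 s" using ker0_le_ker1(1) by simp
          show "hbound (\<sigma> + 1/8) (\<lambda>_. 0) 0" by (rule hboundI) auto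
          show "AE r in lebesgue. r \<in> {0..t} \<longrightarrow> trunc M (nonlin \<kappa> (x r) (x r)) 0 = 0 \<and>
             hbound (\<sigma> - 7/4) (trunc M (nonlin \<kappa> (x r) (x r))) (C1 * (2 * R * Q) * exp (0 * r))"
            using wb by (intro AE_I2) (auto simp: trunc_def)
        qed (use C1 R Q in auto)
        from hbound_add[OF lin hbound_le_index[OF this \<sigma>(2)]]
        have "hbound s (x t) (S0 + C2 * (C1 * (2 * R * Q)))" by (simp add: algebra_simps)
        moreover have "S0 + C2 * (C1 * (2 * R * Q)) \<le> A + y / 2"
        proof -
          have "C2 * (C1 * (2 * R * (\<epsilon> * y))) \<le> y / 2"
          proof -
            have "C2 * (C1 * (2 * R * (\<epsilon> * y))) \<le> C2 * (C1 * (2 * (R + 1) * (\<epsilon> * y)))"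
              using C1 C2 \<epsilon> y by (intro mult_left_mono mult_right_mono) auto
            also have "\<dots> = 2 * (C2 * C1 * (R + 1) * \<epsilon>) * y" by (simp add: mult_ac)
            also have "C2 * C1 * (R + 1) * \<epsilon> = 1 / 4"
              using C1 C2 R unfolding \<epsilon>_def by (simp add: divide_simps)
            also have "2 * (1 / 4) * y = y / 2" by simp
            finally show ?thesis .
          qed
          then show ?thesis by (simp add: A_def Q_def algebra_simps)
        qed
        ultimately show "hbound s (x t) (A + y / 2)" by (rule hbound_mono)
      qed
    qed
    then obtain Y where "\<And>k. P (Y k)" "Y \<longlonglongrightarrow> 2 * A" by blast
    then have "hbound s (x t) (Y k)" for k using t unfolding P_def by blast
    then show ?thesis using \<open>Y \<longlonglongrightarrow> 2 * A\<close> by (rule hbound_limit_bound)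
  qed
  note main = this
  show ?thesis
  proof (intro exI[of _ "2 * A"] allI impI)
    fix a0 x M and t :: real
    assume a0: "hbound s a0 S0" and t: "0 \<le> t"
      and x: "\<forall>t\<ge>0. (\<forall>n. n \<notin> modes M \<longrightarrow> x t n = 0) \<and> hbound 0 (x t) R \<and>
         mild (trunc M a0) (\<lambda>r. trunc M (nonlin \<kappa> (x r) (x r))) t (x t)"
    show "hbound s (x t) (2 * A)"
      by (rule main[OF a0 _ _ _ t]) (use x in blast)+
  qed
qed

end

section \<open>Existence and uniqueness of mild solutions\<close>

lemma eventually_in_modes: "\<forall>\<^sub>F M in sequentially. n \<in> modes M"
proof -
  have "n \<in> modes M" if "nat \<bar>fst n\<bar> + nat \<bar>snd n\<bar> \<le> M" for M
    using that by (cases n) (auto simp: modes_def)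
  then show ?thesis by (auto simp: eventually_sequentially)
qed

lemma trunc_tendsto:
  assumes "(\<lambda>M. a M n) \<longlonglongrightarrow> c"
  shows "(\<lambda>M. trunc M (a M) n) \<longlonglongrightarrow> c"
  by (rule Lim_transform_eventually[OF assms])
     (use eventually_in_modes[of n] in eventually_elim, simp add: trunc_def)

lemma continuous_on_atLeast_0:
  fixes f :: "real \<Rightarrow> 'a::topological_space"
  assumes "\<And>T. continuous_on {0..T} f"
  shows "continuous_on {0..} f"
  unfolding continuous_on_eq_continuous_within
proof
  fix t :: real assume t: "t \<in> {0..}"
  have "continuous (at t within {0..t+1}) f"
    using assms[of "t+1"] t by (simp add: continuous_on_eq_continuous_within)
  moreover have "at t within {0..t+1} = at t within {0..}"
    by (rule at_within_nhd[where S="{..<t+1}"]) auto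
  ultimately show "continuous (at t within {0..}) f" by simp
qed

lemma hbound_eq_0:
  assumes "hbound 0 a 0"
  shows "a n = 0"
  using hbound_cmod_single[OF assms, of n] by simp

context spectral_system
begin

text \<open>Polarization and the bound at fixed \<open>n\<close>: convergence of the sequences at
  order 0 suffices for each single coefficient.\<close>

lemma nonlin_tendsto:
  assumes a: "\<And>i. hbound 0 (a i) R" and b: "hbound 0 b R"
    and d: "\<And>\<epsilon>. \<epsilon> > 0 \<Longrightarrow> \<forall>\<^sub>F i in sequentially. hbound 0 (\<lambda>n. a i n - b n) \<epsilon>"
  shows "(\<lambda>i. nonlin \<kappa> (a i) (a i) n) \<longlonglongrightarrow> nonlin \<kappa> b b n"
proof (rule tendstoI)
  fix e :: real assume e: "e > 0"
  have R: "0 \<le> R" using b by (rule hbound_nonneg)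
  define K where "K = (\<kappa> + 2 + 2 / \<kappa>) * jap n"
  have K: "0 \<le> K" using kern_norm_le[OF \<kappa>, of n 0] norm_ge_zero order_trans unfolding K_def by blast
  define \<epsilon> where "\<epsilon> = e / (2 * K * R + 1)"
  have den: "0 < 2 * K * R + 1" using K R by (simp add: add_nonneg_pos)
  have \<epsilon>: "\<epsilon> > 0" using e den by (simp add: \<epsilon>_def)
  show "\<forall>\<^sub>F i in sequentially. dist (nonlin \<kappa> (a i) (a i) n) (nonlin \<kappa> b b n) < e"
    using d[OF \<epsilon>]
  proof eventually_elim
    case (elim i)
    have "cmod (nonlin \<kappa> (a i) (a i) n - nonlin \<kappa> b b n)
      = cmod (nonlin \<kappa> (\<lambda>m. a i m - b m) (a i) n + nonlin \<kappa> b (\<lambda>m. a i m - b m) n)"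
      by (simp only: nonlin_diff[OF \<kappa> a b])
    also have "\<dots> \<le> K * (\<epsilon> * R) + K * (R * \<epsilon>)"
      unfolding K_def
      by (intro order_trans[OF norm_triangle_ineq] add_mono nonlin_summable(2)[OF \<kappa>] elim a b)
    also have "\<dots> = \<epsilon> * (2 * K * R)" by (simp add: algebra_simps)
    also have "\<dots> < \<epsilon> * (2 * K * R + 1)" using \<epsilon> by simp
    also have "\<dots> = e" using den by (simp add: \<epsilon>_def)
    finally show ?case by (simp add: dist_norm)
  qed
qed

text \<open>Both trajectories satisfy the equation at almost every time only, so the iterated bound
  \<open>P\<close> is itself a statement almost everywhere; the integrals do not see the exceptional
  times. The start is the trivial bound 2 R.\<close>

lemma mild_unique:
  assumes x: "AE t in lebesgue. 0 < t \<longrightarrow> hbound 0 (x t) R \<and> mild a (\<lambda>r. nonlin \<kappa> (x r) (x r)) t (x t)"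
    and y: "AE t in lebesgue. 0 < t \<longrightarrow> hbound 0 (y t) R \<and> mild a (\<lambda>r. nonlin \<kappa> (y r) (y r)) t (y t)"
    and R: "0 < R"
  shows "AE t in lebesgue. 0 < t \<longrightarrow> x t = y t"
proof -
  obtain C1 C2 where C: "0 < C1" "0 < C2"
    and nl: "\<forall>a b A B. hbound 0 a A \<longrightarrow> hbound 0 b B \<longrightarrow> hbound (-7/4) (nonlin \<kappa> a b) (C1 * (A * B))"
    and mb: "\<forall>a w t y A M \<theta>. mild a w t y \<longrightarrow> 0 \<le> t \<longrightarrow> 0 \<le> M \<longrightarrow> 0 < \<theta> \<longrightarrow> hbound 0 a A \<longrightarrow>
      (AE r in lebesgue. r \<in> {0..t} \<longrightarrow> w r 0 = 0 \<and> hbound (-1/8 - 7/4) (w r) (M * exp (\<theta> * r))) \<longrightarrow>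
      hbound 0 y (A + C2 * \<theta> powr (-1/32) * M * exp (\<theta> * t))"
    using mild_constants by blast
  note mb = mb[THEN spec, THEN spec, THEN spec, THEN spec, THEN spec, THEN spec, THEN spec,
      THEN mp, THEN mp, THEN mp, THEN mp, THEN mp, THEN mp]
  \<comment> \<open>On the ball of radius \<open>R\<close> the nonlinearity has the Lipschitz
    constant 2 C1 R. This \<open>e\<close> makes its product with C2 \<theta> powr (-1/32) at most
    1/2.\<close>
  define e where "e = 1 / (4 * C1 * C2 * R)"
  have "0 < e" using C R by (simp add: e_def)
  then obtain \<theta> where \<theta>: "\<theta> > 0" "\<theta> powr (-1/32) \<le> e" using kernel_rate_small by blast
  have half: "C2 * \<theta> powr (-1/32) * (2 * C1 * R * z) \<le> z / 2" if "0 \<le> z" for z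
  proof -
    have "C2 * \<theta> powr (-1/32) * (2 * C1 * R * z) \<le> C2 * e * (2 * C1 * R * z)"
      using C R that \<theta> by (intro mult_right_mono mult_left_mono) auto
    also have "\<dots> = z / 2" using C R by (simp add: e_def)
    finally show ?thesis .
  qed
  define P where "P z \<longleftrightarrow> (AE t in lebesgue. 0 < t \<longrightarrow> hbound 0 (\<lambda>n. x t n - y t n) (z * exp (\<theta> * t)))" for z
  have AE0: "AE r in lebesgue. r \<noteq> (0::real)"
    by (rule AE_I'[of "{0}"]) (auto simp: null_sets_def)
  have "\<exists>Y. (\<forall>k. P (Y k)) \<and> Y \<longlonglongrightarrow> 2 * 0"
  proof (rule halving_iteration)
    show "P (R + R)"
      unfolding P_def using x y
    proof eventually_elim
      case (elim t)
      show ?case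
      proof
        assume t: "0 < t"
        have "hbound 0 (\<lambda>n. x t n - y t n) (R + R)" using elim t by (intro hbound_diff) auto
        then show "hbound 0 (\<lambda>n. x t n - y t n) ((R + R) * exp (\<theta> * t))"
          by (rule hbound_mono) (use R \<theta> t in auto)
      qed
    qed
    fix z :: real assume z: "0 \<le> z" and P: "P z"
    have ae: "AE r in lebesgue. 0 \<le> r \<longrightarrow> nonlin \<kappa> (x r) (x r) 0 - nonlin \<kappa> (y r) (y r) 0 = 0 \<and>
        hbound (-1/8 - 7/4) (\<lambda>n. nonlin \<kappa> (x r) (x r) n - nonlin \<kappa> (y r) (y r) n) (2 * C1 * R * z * exp (\<theta> * r))"
      using P[unfolded P_def] x y AE0
    proof eventually_elim
      case (elim r)
      show ?case
      proof (intro impI conjI)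
        assume "0 \<le> r"
        then have r: "0 < r" using elim by simp
        have "hbound (-7/4) (\<lambda>n. nonlin \<kappa> (x r) (x r) n - nonlin \<kappa> (y r) (y r) n) (2 * C1 * R * (z * exp (\<theta> * r)))"
          by (rule nonlin_diff_hbound[OF nl[rule_format]]) (use elim r in auto)
        then show "hbound (-1/8 - 7/4) (\<lambda>n. nonlin \<kappa> (x r) (x r) n - nonlin \<kappa> (y r) (y r) n) (2 * C1 * R * z * exp (\<theta> * r))"
          using hbound_le_index[where \<tau>="-1/8 - 7/4"] by (simp add: mult.assoc)
      qed simp
    qed
    show "P (0 + z / 2)"
      unfolding P_def using x y
    proof eventually_elim
      case (elim t)
      show ?case
      proof
        assume t: "0 < t"
        have m: "mild (\<lambda>n. a n - a n) (\<lambda>r n. nonlin \<kappa> (x r) (x r) n - nonlin \<kappa> (y r) (y r) n) t (\<lambda>n. x t n - y t n)"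
          using elim t by (intro mild_diff) auto
        have "hbound 0 (\<lambda>n. x t n - y t n) (0 + C2 * \<theta> powr (-1/32) * (2 * C1 * R * z) * exp (\<theta> * t))"
        proof (rule mb[OF m])
          show "hbound 0 (\<lambda>n. a n - a n) 0" by (simp add: hbound0)
          show "AE r in lebesgue. r \<in> {0..t} \<longrightarrow> nonlin \<kappa> (x r) (x r) 0 - nonlin \<kappa> (y r) (y r) 0 = 0 \<and>
             hbound (-1/8 - 7/4) (\<lambda>n. nonlin \<kappa> (x r) (x r) n - nonlin \<kappa> (y r) (y r) n) (2 * C1 * R * z * exp (\<theta> * r))"
            using ae by eventually_elim auto
        qed (use C R z t \<theta> in auto)
        then show "hbound 0 (\<lambda>n. x t n - y t n) ((0 + z / 2) * exp (\<theta> * t))"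
          by (rule hbound_mono) (use mult_right_mono[OF half[OF z], of "exp (\<theta> * t)"] in simp)
      qed
    qed
  qed (use R in auto)
  then obtain Y where Y: "\<And>k. P (Y k)" "Y \<longlonglongrightarrow> 0" by auto
  \<comment> \<open>One null set for all \<open>k\<close>, so that \<open>k\<close> can tend to
    infinity at a fixed time.\<close>
  have "AE t in lebesgue. \<forall>k. 0 < t \<longrightarrow> hbound 0 (\<lambda>n. x t n - y t n) (Y k * exp (\<theta> * t))"
    unfolding AE_all_countable using Y(1) by (simp add: P_def)
  then show ?thesis
  proof eventually_elim
    case (elim t)
    show ?case
    proof (intro impI ext)
      fix n assume t: "0 < t"
      have "(\<lambda>k. Y k * exp (\<theta> * t)) \<longlonglongrightarrow> 0 * exp (\<theta> * t)" by (intro tendsto_intros Y(2))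
      then have lim: "(\<lambda>k. Y k * exp (\<theta> * t)) \<longlonglongrightarrow> 0" by simp
      have "hbound 0 (\<lambda>n. x t n - y t n) (Y k * exp (\<theta> * t))" for k using elim t by blast
      from hbound_limit_bound[OF this lim]
      have "hbound 0 (\<lambda>n. x t n - y t n) 0" .
      from hbound_eq_0[OF this, of n] show "x t n = y t n" by simp
    qed
  qed
qed

text \<open>The contraction of \<open>mild_unique\<close> with two sources added: the difference
  \<tau> of the truncated data and the truncation error \<delta> of the nonlinearity. The weighted
  difference is at most 2 (\<tau> + C2 \<theta> powr (-1/32) \<delta>), and both sources vanish as
  the truncations grow.\<close>

lemma galerkin_cauchy:
  assumes a0: "hbound 0 a0 U" and R: "0 < R"
    and X: "\<And>M t. 0 \<le> t \<Longrightarrow> hbound 0 (X M t) R"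
    and m: "\<And>M t. 0 \<le> t \<Longrightarrow> mild (trunc M a0) (\<lambda>r. trunc M (nonlin \<kappa> (X M r) (X M r))) t (X M t)"
  shows "\<exists>\<theta>. \<forall>\<epsilon>>0. \<exists>M0. \<forall>M N t. M0 \<le> M \<longrightarrow> M0 \<le> N \<longrightarrow> 0 \<le> t \<longrightarrow>
    hbound 0 (\<lambda>n. X M t n - X N t n) (\<epsilon> * exp (\<theta> * t))"
proof -
  obtain C1 C2 where C: "0 < C1" "0 < C2"
    and nl: "\<forall>a b A B. hbound 0 a A \<longrightarrow> hbound 0 b B \<longrightarrow> hbound (-7/4) (nonlin \<kappa> a b) (C1 * (A * B))"
    and mb: "\<forall>a w t y A M \<theta>. mild a w t y \<longrightarrow> 0 \<le> t \<longrightarrow> 0 \<le> M \<longrightarrow> 0 < \<theta> \<longrightarrow> hbound 0 a A \<longrightarrow>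
      (AE r in lebesgue. r \<in> {0..t} \<longrightarrow> w r 0 = 0 \<and> hbound (-1/8 - 7/4) (w r) (M * exp (\<theta> * r))) \<longrightarrow>
      hbound 0 y (A + C2 * \<theta> powr (-1/32) * M * exp (\<theta> * t))"
    using mild_constants by blast
  note mb = mb[THEN spec, THEN spec, THEN spec, THEN spec, THEN spec, THEN spec, THEN spec,
      THEN mp, THEN mp, THEN mp, THEN mp, THEN mp, THEN mp]
  define e where "e = 1 / (4 * C1 * C2 * R)"
  have "0 < e" using C R by (simp add: e_def)
  then obtain \<theta> where \<theta>: "\<theta> > 0" "\<theta> powr (-1/32) \<le> e" using kernel_rate_small by blast
  have half: "C2 * \<theta> powr (-1/32) * (2 * C1 * R * z) \<le> z / 2" if "0 \<le> z" for z
  proof -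
    have "C2 * \<theta> powr (-1/32) * (2 * C1 * R * z) \<le> C2 * e * (2 * C1 * R * z)"
      using C R that \<theta> by (intro mult_right_mono mult_left_mono) auto
    also have "\<dots> = z / 2" using C R by (simp add: e_def)
    finally show ?thesis .
  qed
  have step: "hbound 0 (\<lambda>n. X M t n - X N t n)
      (2 * (\<tau> + C2 * \<theta> powr (-1/32) * ((real M)\<^sup>2 powr (-1/16) * (C1 * (R * R)))) * exp (\<theta> * t))"
    if MN: "M \<le> N" "0 < M" and tail: "hbound 0 (\<lambda>n. trunc M a0 n - trunc N a0 n) \<tau>" and t: "0 \<le> t" for M N \<tau> t
  proof -
    define \<delta> where "\<delta> = (real M)\<^sup>2 powr (-1/16) * (C1 * (R * R))"
    have \<delta>: "0 \<le> \<delta>" using C R by (simp add: \<delta>_def)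
    define A where "A = \<tau> + C2 * \<theta> powr (-1/32) * \<delta>"
    have \<tau>: "0 \<le> \<tau>" using tail by (rule hbound_nonneg)
    have A: "0 \<le> A" using \<tau> \<delta> C by (simp add: A_def)
    define P where "P z \<longleftrightarrow> (\<forall>t\<ge>0. hbound 0 (\<lambda>n. X M t n - X N t n) (z * exp (\<theta> * t)))" for z
    have "\<exists>Y. (\<forall>k. P (Y k)) \<and> Y \<longlonglongrightarrow> 2 * A"
    proof (rule halving_iteration)
      show "P (R + R)"
        unfolding P_def
      proof (intro allI impI)
        fix t :: real assume t: "0 \<le> t"
        have "hbound 0 (\<lambda>n. X M t n - X N t n) (R + R)" by (intro hbound_diff X t)
        then show "hbound 0 (\<lambda>n. X M t n - X N t n) ((R + R) * exp (\<theta> * t))"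
          by (rule hbound_mono) (use R \<theta> t in auto)
      qed
      fix z :: real assume z: "0 \<le> z" and P: "P z"
      define w where "w r n = trunc M (nonlin \<kappa> (X M r) (X M r)) n - trunc N (nonlin \<kappa> (X N r) (X N r)) n" for r n
      have wb: "hbound (-1/8 - 7/4) (w r) ((2 * C1 * R * z + \<delta>) * exp (\<theta> * r))" if r: "0 \<le> r" for r
      proof -
        have "hbound (-7/4) (\<lambda>n. nonlin \<kappa> (X M r) (X M r) n - nonlin \<kappa> (X N r) (X N r) n) (2 * C1 * R * (z * exp (\<theta> * r)))"
          by (rule nonlin_diff_hbound[OF nl[rule_format]]) (use P r X[OF r] in \<open>auto simp: P_def\<close>)
        then have 1: "hbound (-1/8 - 7/4) (trunc M (\<lambda>n. nonlin \<kappa> (X M r) (X M r) n - nonlin \<kappa> (X N r) (X N r) n)) (2 * C1 * R * (z * exp (\<theta> * r)))"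
          by (intro hbound_trunc hbound_le_index[where \<tau>="-1/8 - 7/4"]) auto
        have 2: "hbound (-1/8 - 7/4) (\<lambda>n. trunc M (nonlin \<kappa> (X N r) (X N r)) n - trunc N (nonlin \<kappa> (X N r) (X N r)) n) \<delta>"
          unfolding \<delta>_def using nl[rule_format, OF X[OF r] X[OF r]] by (rule hbound_tail_gain[OF _ MN])
        \<comment> \<open>The nonlinearities are compared at equal truncation first, then the
          truncations at equal argument.\<close>
        have "w r = (\<lambda>n. trunc M (\<lambda>n. nonlin \<kappa> (X M r) (X M r) n - nonlin \<kappa> (X N r) (X N r) n) n
           + (trunc M (nonlin \<kappa> (X N r) (X N r)) n - trunc N (nonlin \<kappa> (X N r) (X N r)) n))"
          by (auto simp: w_def trunc_def fun_eq_iff)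
        then have "hbound (-1/8 - 7/4) (w r) (2 * C1 * R * (z * exp (\<theta> * r)) + \<delta>)"
          using hbound_add[OF 1 2] by simp
        moreover have "2 * C1 * R * (z * exp (\<theta> * r)) + \<delta> \<le> (2 * C1 * R * z + \<delta>) * exp (\<theta> * r)"
        proof -
          have "\<delta> * 1 \<le> \<delta> * exp (\<theta> * r)" using \<delta> \<theta> r by (intro mult_left_mono) auto
          then show ?thesis by (simp add: algebra_simps)
        qed
        ultimately show ?thesis by (rule hbound_mono)
      qed
      show "P (A + z / 2)"
        unfolding P_def
      proof (intro allI impI)
        fix t :: real assume t: "0 \<le> t"
        have md: "mild (\<lambda>n. trunc M a0 n - trunc N a0 n) w t (\<lambda>n. X M t n - X N t n)"
          using mild_diff[OF m[OF t, of M] m[OF t, of N]] unfolding w_def .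
        have "hbound 0 (\<lambda>n. X M t n - X N t n) (\<tau> + C2 * \<theta> powr (-1/32) * (2 * C1 * R * z + \<delta>) * exp (\<theta> * t))"
        proof (rule mb[OF md t _ _ tail])
          show "AE r in lebesgue. r \<in> {0..t} \<longrightarrow> w r 0 = 0 \<and> hbound (-1/8 - 7/4) (w r) ((2 * C1 * R * z + \<delta>) * exp (\<theta> * r))"
            using wb by (intro AE_I2) (auto simp: w_def trunc_def)
        qed (use C R z \<delta> \<theta> in auto)
        then show "hbound 0 (\<lambda>n. X M t n - X N t n) ((A + z / 2) * exp (\<theta> * t))"
        proof (rule hbound_mono)
          have "\<tau> * 1 \<le> \<tau> * exp (\<theta> * t)" using \<tau> \<theta> t by (intro mult_left_mono) auto
          moreover have "C2 * \<theta> powr (-1/32) * (2 * C1 * R * z + \<delta>) \<le> z / 2 + C2 * \<theta> powr (-1/32) * \<delta>"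
            using half[OF z] by (simp add: algebra_simps)
          then have "C2 * \<theta> powr (-1/32) * (2 * C1 * R * z + \<delta>) * exp (\<theta> * t) \<le> (z / 2 + C2 * \<theta> powr (-1/32) * \<delta>) * exp (\<theta> * t)"
            by (rule mult_right_mono) simp
          ultimately show "\<tau> + C2 * \<theta> powr (-1/32) * (2 * C1 * R * z + \<delta>) * exp (\<theta> * t) \<le> (A + z / 2) * exp (\<theta> * t)"
            by (simp add: A_def algebra_simps)
        qed
      qed
    qed (use R A in auto)
    then obtain Y where Y: "\<And>k. P (Y k)" "Y \<longlonglongrightarrow> 2 * A" by blast
    have lim: "(\<lambda>k. Y k * exp (\<theta> * t)) \<longlonglongrightarrow> 2 * A * exp (\<theta> * t)" by (intro tendsto_intros Y(2))
    have "hbound 0 (\<lambda>n. X M t n - X N t n) (Y k * exp (\<theta> * t))" for k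
      using Y(1)[of k] t unfolding P_def by blast
    from hbound_limit_bound[OF this lim]
    have "hbound 0 (\<lambda>n. X M t n - X N t n) (2 * A * exp (\<theta> * t))" .
    then show ?thesis by (simp add: A_def \<delta>_def)
  qed
  show ?thesis
  proof (intro exI[of _ \<theta>] allI impI)
    fix \<epsilon> :: real assume \<epsilon>: "\<epsilon> > 0"
    have "0 < \<epsilon> / 4" using \<epsilon> by simp
    from hbound_tail[OF a0 this] obtain M1 where M1:
      "\<And>M N. M1 \<le> M \<Longrightarrow> M1 \<le> N \<Longrightarrow> hbound 0 (\<lambda>n. trunc M a0 n - trunc N a0 n) (\<epsilon> / 4)" by blast
    have "(\<lambda>M. C2 * \<theta> powr (-1/32) * ((real M)\<^sup>2 powr (-1/16) * (C1 * (R * R)))) \<longlonglongrightarrow> C2 * \<theta> powr (-1/32) * (0 * (C1 * (R * R)))"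
      by (intro tendsto_intros inverse_modes_tendsto_0)
    then have "\<forall>\<^sub>F M in sequentially. C2 * \<theta> powr (-1/32) * ((real M)\<^sup>2 powr (-1/16) * (C1 * (R * R))) < \<epsilon> / 4"
      using \<epsilon> by (intro order_tendstoD(2)) auto
    then obtain M2 where M2: "\<And>M. M2 \<le> M \<Longrightarrow> C2 * \<theta> powr (-1/32) * ((real M)\<^sup>2 powr (-1/16) * (C1 * (R * R))) < \<epsilon> / 4"
      by (auto simp: eventually_sequentially)
    \<comment> \<open>At least 1, because the tail bound requires a positive truncation
      level.\<close>
    define M0 where "M0 = max 1 (max M1 M2)"
    have le: "hbound 0 (\<lambda>n. X M t n - X N t n) (\<epsilon> * exp (\<theta> * t))" if "M \<le> N" "M0 \<le> M" "0 \<le> t" for M N t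
    proof (rule hbound_mono[OF step[OF that(1) _ M1 that(3)]])
      show "2 * (\<epsilon> / 4 + C2 * \<theta> powr (-1/32) * ((real M)\<^sup>2 powr (-1/16) * (C1 * (R * R)))) * exp (\<theta> * t) \<le> \<epsilon> * exp (\<theta> * t)"
        using M2[of M] that by (intro mult_right_mono) (auto simp: M0_def)
    qed (use that in \<open>auto simp: M0_def\<close>)
    show "\<exists>M0. \<forall>M N t. M0 \<le> M \<longrightarrow> M0 \<le> N \<longrightarrow> 0 \<le> t \<longrightarrow> hbound 0 (\<lambda>n. X M t n - X N t n) (\<epsilon> * exp (\<theta> * t))"
    proof (intro exI[of _ M0] allI impI)
      fix M N and t :: real assume MN: "M0 \<le> M" "M0 \<le> N" "0 \<le> t"
      show "hbound 0 (\<lambda>n. X M t n - X N t n) (\<epsilon> * exp (\<theta> * t))"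
      proof (cases "M \<le> N")
        case False
        then have "hbound 0 (\<lambda>n. - (X N t n - X M t n)) (\<epsilon> * exp (\<theta> * t))"
          using MN by (intro hbound_uminus le) auto
        then show ?thesis by simp
      qed (use le MN in auto)
    qed
  qed
qed

text \<open>The Galerkin solutions converge at order 0, uniformly on bounded time intervals. Bounds
  of order \<open>s\<close> survive by \<open>hbound_limit\<close>, continuity of each mode by
  uniformity, and Duhamel's formula by dominated convergence mode by mode.\<close>

lemma mild_solution_exists:
  assumes a0: "hermitian a0" "hbound s a0 S0" and s: "0 \<le> s"
  shows "\<exists>x R B. 0 < R \<and> (\<forall>n. continuous_on {0..} (\<lambda>t. x t n)) \<and>
    (\<forall>t\<ge>0. hermitian (x t) \<and> hbound 0 (x t) R \<and> hbound s (x t) B \<and>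
       mild a0 (\<lambda>r. nonlin \<kappa> (x r) (x r)) t (x t))"
proof -
  have a00: "hbound 0 a0 S0" using a0(2) s by (rule hbound_le_index)
  obtain R where R: "R > 0" and ex: "\<forall>a0 M. hermitian a0 \<longrightarrow> hbound 0 a0 S0 \<longrightarrow>
    (\<exists>x. (\<forall>n. continuous_on {0..} (\<lambda>t. x t n)) \<and>
      (\<forall>t\<ge>0. hermitian (x t) \<and> (\<forall>n. n \<notin> modes M \<longrightarrow> x t n = 0) \<and> hbound 0 (x t) R \<and>
         mild (trunc M a0) (\<lambda>r. trunc M (nonlin \<kappa> (x r) (x r))) t (x t)))"
    using galerkin_exists by blast
  have "\<forall>M. \<exists>x. (\<forall>n. continuous_on {0..} (\<lambda>t. x t n)) \<and>
      (\<forall>t\<ge>0. hermitian (x t) \<and> (\<forall>n. n \<notin> modes M \<longrightarrow> x t n = 0) \<and> hbound 0 (x t) R \<and>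
         mild (trunc M a0) (\<lambda>r. trunc M (nonlin \<kappa> (x r) (x r))) t (x t))"
    using ex a0(1) a00 by blast
  from choice[OF this] obtain X where
    XX: "\<forall>M. (\<forall>n. continuous_on {0..} (\<lambda>t. X M t n)) \<and>
      (\<forall>t\<ge>0. hermitian (X M t) \<and> (\<forall>n. n \<notin> modes M \<longrightarrow> X M t n = 0) \<and> hbound 0 (X M t) R \<and>
         mild (trunc M a0) (\<lambda>r. trunc M (nonlin \<kappa> (X M r) (X M r))) t (X M t))" ..
  have Xc: "continuous_on {0..} (\<lambda>t. X M t n)" for M n using XX by blast
  have Xh: "hermitian (X M t)" and Xs: "n \<notin> modes M \<Longrightarrow> X M t n = 0" and XR: "hbound 0 (X M t) R"
    and Xm: "mild (trunc M a0) (\<lambda>r. trunc M (nonlin \<kappa> (X M r) (X M r))) t (X M t)" if "0 \<le> t" for M t n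
    using XX that by blast+
  obtain B where B: "\<forall>a0 x M. hbound s a0 S0 \<longrightarrow>
    (\<forall>t\<ge>0. (\<forall>n. n \<notin> modes M \<longrightarrow> x t n = 0) \<and> hbound 0 (x t) R \<and>
         mild (trunc M a0) (\<lambda>r. trunc M (nonlin \<kappa> (x r) (x r))) t (x t)) \<longrightarrow>
    (\<forall>t\<ge>0. hbound s (x t) B)"
    using mild_sobolev_bound[OF s hbound_nonneg[OF a0(2)] less_imp_le[OF R]] by blast
  have XB: "hbound s (X M t) B" if "0 \<le> t" for M t
    using B[rule_format, OF a0(2), of M "X M" t] Xs XR Xm that by blast
  obtain \<theta> where cau: "\<And>\<epsilon>. \<epsilon> > 0 \<Longrightarrow> \<exists>M0. \<forall>M N t. M0 \<le> M \<longrightarrow> M0 \<le> N \<longrightarrow> 0 \<le> t \<longrightarrow>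
    hbound 0 (\<lambda>n. X M t n - X N t n) (\<epsilon> * exp (\<theta> * t))"
    using galerkin_cauchy[OF a00 R XR Xm] by blast
  define x where "x t n = lim (\<lambda>M. X M t n)" for t n
  have lim: "(\<lambda>M. X M t n) \<longlonglongrightarrow> x t n" if t: "0 \<le> t" for t n
  proof -
    have "Cauchy (\<lambda>M. X M t n)"
    proof (rule CauchyI)
      fix e :: real assume e: "e > 0"
      define \<epsilon> where "\<epsilon> = e / 2 / exp (\<theta> * t)"
      have \<epsilon>: "\<epsilon> > 0" using e by (simp add: \<epsilon>_def)
      from cau[OF \<epsilon>] obtain M0 where
        M0: "\<And>M N t. M0 \<le> M \<Longrightarrow> M0 \<le> N \<Longrightarrow> 0 \<le> t \<Longrightarrow> hbound 0 (\<lambda>n. X M t n - X N t n) (\<epsilon> * exp (\<theta> * t))"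
        by blast
      have "norm (X m t n - X k t n) < e" if "M0 \<le> m" "M0 \<le> k" for m k
      proof -
        have "norm (X m t n - X k t n) \<le> \<epsilon> * exp (\<theta> * t)"
          by (rule hbound_cmod_single[OF M0[OF that t]])
        also have "\<dots> < e" using e by (simp add: \<epsilon>_def)
        finally show ?thesis .
      qed
      then show "\<exists>M0. \<forall>m\<ge>M0. \<forall>k\<ge>M0. norm (X m t n - X k t n) < e" by blast
    qed
    then show ?thesis unfolding x_def by (simp add: Cauchy_convergent_iff convergent_LIMSEQ_iff)
  qed
  have diff: "\<exists>M0. \<forall>M\<ge>M0. \<forall>t\<ge>0. hbound 0 (\<lambda>n. X M t n - x t n) (\<epsilon> * exp (\<theta> * t))" if \<epsilon>: "\<epsilon> > 0" for \<epsilon>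
  proof -
    obtain M0 where M0: "\<And>M N t. M0 \<le> M \<Longrightarrow> M0 \<le> N \<Longrightarrow> 0 \<le> t \<Longrightarrow>
        hbound 0 (\<lambda>n. X M t n - X N t n) (\<epsilon> * exp (\<theta> * t))"
      using cau[OF \<epsilon>] by blast
    have "hbound 0 (\<lambda>n. X M t n - x t n) (\<epsilon> * exp (\<theta> * t))" if "M0 \<le> M" "0 \<le> t" for M t
    proof (rule hbound_limit[where a="\<lambda>i n. X M t n - X (i + M0) t n"])
      show "(\<lambda>i. X M t n - X (i + M0) t n) \<longlonglongrightarrow> X M t n - x t n" for n
        by (intro tendsto_intros LIMSEQ_ignore_initial_segment lim that)
    qed (use M0 that in auto)
    then show ?thesis by blast
  qed
  have xR: "hbound 0 (x t) R" and xB: "hbound s (x t) B" if "0 \<le> t" for t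
    by (rule hbound_limit[OF lim[OF that] XR[OF that]], rule hbound_limit[OF lim[OF that] XB[OF that]])
  have xh: "hermitian (x t)" if t: "0 \<le> t" for t
  proof -
    have "x t (- n) = cnj (x t n)" for n
    proof (rule LIMSEQ_unique[OF lim[OF t]])
      have "X M t (- n) = cnj (X M t n)" for M
        using Xh[OF t] by (simp add: hermitian_def del: split_paired_All)
      then show "(\<lambda>M. X M t (- n)) \<longlonglongrightarrow> cnj (x t n)"
        using tendsto_cnj[OF lim[OF t, of n]] by simp
    qed
    then show ?thesis by (simp add: hermitian_def del: split_paired_All)
  qed
  have xc: "continuous_on {0..} (\<lambda>t. x t n)" for n
  proof (rule continuous_on_atLeast_0)
    fix T :: real
    show "continuous_on {0..T} (\<lambda>t. x t n)"
    proof (rule uniform_limit_theorem)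
      show "\<forall>\<^sub>F M in sequentially. continuous_on {0..T} (\<lambda>t. X M t n)"
        using Xc by (intro always_eventually allI continuous_on_subset[OF Xc]) auto
      show "uniform_limit {0..T} (\<lambda>M t. X M t n) (\<lambda>t. x t n) sequentially"
      proof (rule uniform_limitI)
        fix e :: real assume e: "e > 0"
        \<comment> \<open>Absorbs the weight exp (\<theta> t) on the whole interval; the signs of
          \<theta> and \<open>T\<close> are not fixed, hence the absolute values.\<close>
        define \<epsilon> where "\<epsilon> = e / 2 / exp (\<bar>\<theta>\<bar> * \<bar>T\<bar>)"
        have \<epsilon>: "\<epsilon> > 0" using e by (simp add: \<epsilon>_def)
        obtain M0 where M0: "\<forall>M\<ge>M0. \<forall>t\<ge>0. hbound 0 (\<lambda>n. X M t n - x t n) (\<epsilon> * exp (\<theta> * t))"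
          using diff[OF \<epsilon>] by blast
        have "dist (X M t n) (x t n) < e" if "M0 \<le> M" "t \<in> {0..T}" for M t
        proof -
          have "dist (X M t n) (x t n) \<le> \<epsilon> * exp (\<theta> * t)"
            using hbound_cmod_single[of "\<lambda>n. X M t n - x t n" _ n] M0 that by (simp add: dist_norm)
          also have "\<dots> \<le> \<epsilon> * exp (\<bar>\<theta>\<bar> * \<bar>T\<bar>)"
          proof -
            have "\<theta> * t \<le> \<bar>\<theta>\<bar> * \<bar>T\<bar>" using that by (intro mult_mono) auto
            then show ?thesis using \<epsilon> by simp
          qed
          also have "\<dots> < e" using e by (simp add: \<epsilon>_def)
          finally show ?thesis .
        qed
        then show "\<forall>\<^sub>F M in sequentially. \<forall>t\<in>{0..T}. dist (X M t n) (x t n) < e"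
          unfolding eventually_sequentially by blast
      qed
    qed simp
  qed
  have xm: "mild a0 (\<lambda>r. nonlin \<kappa> (x r) (x r)) t (x t)" if t: "0 \<le> t" for t
    unfolding mild_def
  proof (intro allI)
    fix n
    define f where "f M r = indicator {0..t} r *\<^sub>R (exp (of_real (t - r) * L n) * trunc M (nonlin \<kappa> (X M r) (X M r)) n)" for M r
    define g where "g r = indicator {0..t} r *\<^sub>R (exp (of_real (t - r) * L n) * nonlin \<kappa> (x r) (x r) n)" for r
    \<comment> \<open>A constant majorant for one fixed mode on a bounded interval, where its growth
      in \<open>n\<close> is harmless.\<close>
    define K where "K = (\<kappa> + 2 + 2 / \<kappa>) * jap n * (R * R)"
    have fi: "integrable lebesgue (f M)" for M
      using Xm[OF t, of M] unfolding mild_def set_integrable_def f_def by blast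
    have fg: "(\<lambda>M. f M r) \<longlonglongrightarrow> g r" for r
    proof (cases "r \<in> {0..t}")
      case True
      have "(\<lambda>M. nonlin \<kappa> (X M r) (X M r) n) \<longlonglongrightarrow> nonlin \<kappa> (x r) (x r) n"
      proof (rule nonlin_tendsto)
        fix \<epsilon> :: real assume "\<epsilon> > 0"
        then have "\<epsilon> / exp (\<theta> * r) > 0" by simp
        from diff[OF this] obtain M0 where
          "\<forall>M\<ge>M0. \<forall>t\<ge>0. hbound 0 (\<lambda>n. X M t n - x t n) (\<epsilon> / exp (\<theta> * r) * exp (\<theta> * t))" by blast
        then have "\<forall>M\<ge>M0. hbound 0 (\<lambda>n. X M r n - x r n) (\<epsilon> / exp (\<theta> * r) * exp (\<theta> * r))"
          using True by (meson atLeastAtMost_iff)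
        moreover have "\<epsilon> / exp (\<theta> * r) * exp (\<theta> * r) = \<epsilon>" by simp
        ultimately show "\<forall>\<^sub>F M in sequentially. hbound 0 (\<lambda>n. X M r n - x r n) \<epsilon>"
          unfolding eventually_sequentially by metis
      qed (use XR xR True in auto)
      then show ?thesis unfolding f_def g_def by (intro tendsto_intros trunc_tendsto)
    qed (simp add: f_def g_def)
    have fb: "norm (f M r) \<le> indicator {0..t} r *\<^sub>R K" for M r
    proof (cases "r \<in> {0..t}")
      case True
      have "cmod (trunc M (nonlin \<kappa> (X M r) (X M r)) n) \<le> cmod (nonlin \<kappa> (X M r) (X M r) n)"
        by (simp add: trunc_def)
      also have "\<dots> \<le> K"
        unfolding K_def using True by (intro nonlin_summable(2)[OF \<kappa>] XR) auto
      finally have "cmod (exp (of_real (t - r) * L n)) * cmod (trunc M (nonlin \<kappa> (X M r) (X M r)) n) \<le> 1 * K"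
        using True by (intro mult_mono damping_exp_le_1[OF damping]) auto
      then show ?thesis using True by (simp add: f_def norm_mult)
    qed (simp add: f_def)
    have ki: "integrable lebesgue (\<lambda>r. indicator {0..t} r *\<^sub>R K)"
      by (intro integrable_scaleR_left) (simp add: integrable_indicator_iff emeasure_lborel_Icc_eq)
    have gm: "g \<in> borel_measurable lebesgue"
      by (rule borel_measurable_LIMSEQ_metric[OF borel_measurable_integrable[OF fi] fg])
    have gi: "integrable lebesgue g"
      by (rule integrable_dominated_convergence[OF gm borel_measurable_integrable[OF fi] ki]) (rule AE_I2, rule fg, rule AE_I2, rule fb)
    have il: "(\<lambda>M. integral\<^sup>L lebesgue (f M)) \<longlonglongrightarrow> integral\<^sup>L lebesgue g"
      by (rule integral_dominated_convergence[OF gm borel_measurable_integrable[OF fi] ki]) (rule AE_I2, rule fg, rule AE_I2, rule fb)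
    have "X M t n = exp (of_real t * L n) * trunc M a0 n + integral\<^sup>L lebesgue (f M)" for M
      using Xm[OF t, of M] unfolding mild_def set_lebesgue_integral_def f_def by blast
    moreover have "(\<lambda>M. exp (of_real t * L n) * trunc M a0 n + integral\<^sup>L lebesgue (f M))
       \<longlonglongrightarrow> exp (of_real t * L n) * a0 n + integral\<^sup>L lebesgue g"
      by (intro tendsto_intros trunc_tendsto il)
    ultimately have "x t n = exp (of_real t * L n) * a0 n + integral\<^sup>L lebesgue g"
      using LIMSEQ_unique[OF lim[OF t, of n]] by simp
    then show "set_integrable lebesgue {0..t} (\<lambda>r. exp (of_real (t - r) * L n) * nonlin \<kappa> (x r) (x r) n) \<and>
      x t n = exp (of_real t * L n) * a0 n + (LINT r:{0..t}|lebesgue. exp (of_real (t - r) * L n) * nonlin \<kappa> (x r) (x r) n)"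
      using gi unfolding set_integrable_def set_lebesgue_integral_def g_def by simp
  qed
  show ?thesis using R xc xh xR xB xm by blast
qed

end

section \<open>Fourier series on the torus\<close>

lemma torus2_borel [simp]: "torus2 l \<in> sets borel"
  unfolding torus2_def by (intro borel_Times) auto

lemma torus1_borel [simp]: "torus1 l \<in> sets borel"
  by (auto simp: torus1_def)

lemma torus2_lebesgue [simp]: "torus2 l \<in> sets lebesgue" "torus2 l \<inter> space lebesgue \<in> sets lebesgue"
  by (auto intro: sets_completionI_sets)

lemma torus1_lebesgue [simp]: "torus1 l \<in> sets lebesgue" "torus1 l \<inter> space lebesgue \<in> sets lebesgue"
  by (auto intro: sets_completionI_sets)

definition wave :: "real \<Rightarrow> int \<times> int \<Rightarrow> real \<times> real \<Rightarrow> complex" where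
  "wave l n p = cis (wavenum l (fst n) * fst p + wavenum l (snd n) * snd p)"

lemma norm_wave [simp]: "norm (wave l n p) = 1"
  by (simp add: wave_def)

lemma wavenum_add: "wavenum l (j + k) = wavenum l j + wavenum l k"
  by (simp add: wavenum_def add_divide_distrib algebra_simps)

lemma wavenum_uminus: "wavenum l (- k) = - wavenum l k"
  by (simp add: wavenum_def)

lemma wave_add: "wave l (m + n) p = wave l m p * wave l n p"
  by (simp add: wave_def wavenum_add cis_mult algebra_simps)

lemma wave_uminus: "wave l (- n) p = cnj (wave l n p)"
  by (simp add: wave_def wavenum_uminus cis_cnj algebra_simps)

lemma wave_0 [simp]: "wave l 0 p = 1"
  by (simp add: wave_def wavenum_def)

lemma continuous_on_wave: "continuous_on S (wave l n)"
  unfolding wave_def by (intro continuous_intros)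

section \<open>Uniqueness of Fourier coefficients\<close>

locale torus =
  fixes l :: real
  assumes l_pos: "l > 0"
begin

abbreviation "TT \<equiv> lebesgue_on (torus2 l)"

lemma bounded_torus2: "bounded (torus2 l)"
  unfolding torus2_def by (intro bounded_Times bounded_subset[OF bounded_closed_interval[of 0 l]]) auto

lemma finite_measure_TT: "finite_measure TT"
proof
  have "emeasure lebesgue (torus2 l) < \<infinity>"
    using fmeasurableD2[OF bounded_set_imp_lmeasurable[OF bounded_torus2 torus2_lebesgue(1)]] by (simp add: less_top)
  then show "emeasure TT (space TT) \<noteq> \<infinity>"
    by (simp add: emeasure_restrict_space space_restrict_space)
qed

lemma measurable_TT:
  fixes f :: "real \<times> real \<Rightarrow> 'a::euclidean_space"
  assumes "continuous_on UNIV f"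
  shows "f \<in> borel_measurable TT"
  by (rule continuous_imp_measurable_on_sets_lebesgue) (auto intro: continuous_on_subset[OF assms])

lemma integrable_TT_mult:
  fixes h g :: "real \<times> real \<Rightarrow> complex"
  assumes "integrable TT h" "g \<in> borel_measurable TT" "\<And>p. norm (g p) \<le> B"
  shows "integrable TT (\<lambda>p. h p * g p)"
proof (rule Bochner_Integration.integrable_bound)
  show "integrable TT (\<lambda>p. B * norm (h p))" using assms by auto
  show "(\<lambda>p. h p * g p) \<in> borel_measurable TT"
    using assms by (intro borel_measurable_times) auto
  have "norm (h p * g p) \<le> norm (B * norm (h p))" for p
  proof -
    have "norm (h p) * norm (g p) \<le> norm (h p) * B" by (intro mult_left_mono assms) auto
    then show ?thesis by (simp add: norm_mult mult.commute)
  qed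
  then show "AE p in TT. norm (h p * g p) \<le> norm (B * norm (h p))" by simp
qed

lemma integrable_TT_bounded:
  fixes g :: "real \<times> real \<Rightarrow> complex"
  assumes "g \<in> borel_measurable TT" "\<And>p. norm (g p) \<le> B"
  shows "integrable TT g"
  using finite_measure.integrable_const_bound[OF finite_measure_TT, of g B] assms by auto

lemma wave_measurable [measurable]: "wave l n \<in> borel_measurable TT"
  by (intro measurable_TT continuous_on_wave)

lemma integrable_TT_wave: "integrable TT h \<Longrightarrow> integrable TT (\<lambda>p. h p * wave l n p)"
  by (rule integrable_TT_mult[where B=1]) auto

text \<open>Integrable functions all of whose Fourier coefficients vanish; the aim is that they
  vanish almost everywhere. Multiplication by waves preserves the class, which makes the
  approximation argument algebraic.\<close>

definition annihilates :: "(real \<times> real \<Rightarrow> complex) \<Rightarrow> bool" where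
  "annihilates h \<longleftrightarrow> integrable TT h \<and> (\<forall>n. (LINT p|TT. h p * wave l n p) = 0)"

lemma annihilates_add:
  assumes "annihilates h" "annihilates g"
  shows "annihilates (\<lambda>p. h p + g p)"
  using assms by (simp add: annihilates_def distrib_right integrable_TT_wave del: split_paired_All)

lemma annihilates_cmult:
  assumes "annihilates h"
  shows "annihilates (\<lambda>p. c * h p)"
  using assms by (simp add: annihilates_def mult.assoc integrable_TT_wave del: split_paired_All)

lemma annihilates_wave:
  assumes "annihilates h"
  shows "annihilates (\<lambda>p. h p * wave l n p)"
  using assms by (simp add: annihilates_def integrable_TT_wave mult.assoc wave_add[symmetric] del: split_paired_All)

text \<open>The half-open cell is not compact, and its topology misses the periodicity.
  \<open>circ\<close> carries it injectively into a product of two circles, where Stone--Weierstrass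
  applies.\<close>

definition circ :: "real \<times> real \<Rightarrow> complex \<times> complex" where
  "circ p = (cis (2 * pi / l * fst p), cis (2 * pi / l * snd p))"

lemma continuous_on_circ: "continuous_on S circ"
  unfolding circ_def by (intro continuous_intros)

lemma circ_wave:
  "fst (circ p) = wave l (1, 0) p" "snd (circ p) = wave l (0, 1) p"
  by (simp_all add: circ_def wave_def wavenum_def)

definition circle2 :: "(complex \<times> complex) set" where
  "circle2 = sphere 0 1 \<times> sphere 0 1"

lemma circ_in_circle2: "circ p \<in> circle2"
  by (simp add: circ_def circle2_def)

lemma cis_inj_period:
  assumes "cis (2 * pi / l * x) = cis (2 * pi / l * y)" "x \<in> {0..<l}" "y \<in> {0..<l}"
  shows "x = y"
proof -
  have "sin (2 * pi / l * x) = sin (2 * pi / l * y) \<and> cos (2 * pi / l * x) = cos (2 * pi / l * y)"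
    using assms(1) by (simp add: complex_eq_iff)
  then obtain n :: int where n: "2 * pi / l * x = 2 * pi / l * y + 2 * pi * of_int n"
    by (auto simp: sin_cos_eq_iff)
  also have "\<dots> = 2 * pi / l * (y + l * of_int n)"
    using l_pos by (simp add: distrib_left)
  finally have "x = y + l * of_int n" using l_pos by simp
  moreover have "\<bar>x - y\<bar> < l" using assms by auto
  ultimately have "l * \<bar>of_int n\<bar> < l * 1" using l_pos by (simp add: abs_mult)
  then have "\<bar>of_int n :: real\<bar> < 1" using l_pos by (simp only: mult_less_cancel_left_pos)
  then have "n = 0" by linarith
  then show ?thesis using \<open>x = y + l * of_int n\<close> by simp
qed

lemma inj_on_circ: "inj_on circ (torus2 l)"
proof (rule inj_onI)
  fix p q assume "p \<in> torus2 l" "q \<in> torus2 l" "circ p = circ q"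
  then show "p = q"
    by (auto simp: torus2_def circ_def intro!: prod_eqI cis_inj_period)
qed

text \<open>Stone--Weierstrass on the product of circles: its coordinate functions are combinations
  of waves, and uniform approximation passes to integrals against an integrable function.\<close>

lemma annihilates_continuous:
  assumes h: "annihilates h" and q: "continuous_on circle2 (q :: complex \<times> complex \<Rightarrow> real)"
  shows "(LINT p|TT. h p * of_real (q (circ p))) = 0"
proof -
  \<comment> \<open>Multipliers are asked to preserve annihilating functions, which is more than a
    vanishing integral but makes closure under products immediate.\<close>
  define R where "R = {q :: complex \<times> complex \<Rightarrow> real. continuous_on circle2 q \<and>
    (\<forall>h. annihilates h \<longrightarrow> annihilates (\<lambda>p. h p * of_real (q (circ p))))}"
  have Re: "of_real (Re (wave l n p)) = (wave l n p + wave l (- n) p) / 2" for n p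
    by (simp add: wave_uminus complex_add_cnj)
  have Im: "of_real (Im (wave l n p)) = (wave l n p - wave l (- n) p) / (2 * \<i>)" for n p
    by (simp add: wave_uminus complex_eq_iff)
  have aRe: "annihilates (\<lambda>p. h p * of_real (Re (wave l n p)))" if "annihilates h" for h n
  proof -
    have "annihilates (\<lambda>p. (1/2) * (h p * wave l n p + h p * wave l (- n) p))"
      by (intro annihilates_cmult annihilates_add annihilates_wave that)
    then show ?thesis unfolding Re by (simp add: algebra_simps add_divide_distrib)
  qed
  have aIm: "annihilates (\<lambda>p. h p * of_real (Im (wave l n p)))" if "annihilates h" for h n
  proof -
    have "annihilates (\<lambda>p. (1 / (2 * \<i>)) * (h p * wave l n p + (-1) * (h p * wave l (- n) p)))"
      by (intro annihilates_cmult annihilates_add annihilates_wave that)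
    then show ?thesis unfolding Im by (simp add: algebra_simps diff_divide_distrib)
  qed
  have coord: "(\<lambda>z. Re (fst z)) \<in> R" "(\<lambda>z. Im (fst z)) \<in> R" "(\<lambda>z. Re (snd z)) \<in> R" "(\<lambda>z. Im (snd z)) \<in> R"
    unfolding R_def by (auto simp: circ_wave intro!: continuous_intros aRe aIm)
  interpret function_ring_on R circle2
  proof
    show "compact circle2" unfolding circle2_def by (intro compact_Times) auto
    show "continuous_on circle2 f" if "f \<in> R" for f using that by (simp add: R_def)
    show "(\<lambda>z. f z + g z) \<in> R" if "f \<in> R" "g \<in> R" for f g
      using that by (auto simp: R_def distrib_left intro!: continuous_intros annihilates_add)
    show "(\<lambda>z. f z * g z) \<in> R" if "f \<in> R" "g \<in> R" for f g
    proof -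
      have "annihilates (\<lambda>p. h p * of_real (f (circ p)) * of_real (g (circ p)))" if "annihilates h" for h
        using \<open>f \<in> R\<close> \<open>g \<in> R\<close> that unfolding R_def by blast
      then show ?thesis using that by (auto simp: R_def mult.assoc intro!: continuous_intros)
    qed
    show "(\<lambda>_. c) \<in> R" for c
      using annihilates_cmult[where c="of_real c"] by (auto simp: R_def mult.commute)
    fix x y :: "complex \<times> complex" assume "x \<noteq> y"
    then have "Re (fst x) \<noteq> Re (fst y) \<or> Im (fst x) \<noteq> Im (fst y) \<or> Re (snd x) \<noteq> Re (snd y) \<or> Im (snd x) \<noteq> Im (snd y)"
      by (auto simp: prod_eq_iff complex_eq_iff)
    then show "\<exists>f\<in>R. f x \<noteq> f y" using coord by metis
  qed
  have hi: "integrable TT h" using h by (simp add: annihilates_def)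
  have meas: "(\<lambda>p. of_real (f (circ p)) :: complex) \<in> borel_measurable TT" if "continuous_on circle2 f" for f :: "complex \<times> complex \<Rightarrow> real"
    by (intro measurable_TT continuous_on_of_real continuous_on_compose2[OF that continuous_on_circ])
       (auto simp: circ_in_circle2)
  have qi: "integrable TT (\<lambda>p. h p * of_real (q (circ p)))"
  proof -
    have "bounded (q ` circle2)" by (intro compact_imp_bounded compact_continuous_image q compact)
    then obtain B where "\<And>z. z \<in> circle2 \<Longrightarrow> \<bar>q z\<bar> \<le> B" by (auto simp: bounded_iff)
    then show ?thesis by (intro integrable_TT_mult[OF hi meas[OF q], of B]) (auto simp: circ_in_circle2)
  qed
  have small: "norm (LINT p|TT. h p * of_real (q (circ p))) \<le> e * (LINT p|TT. norm (h p))" if e: "e > 0" for e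
  proof -
    obtain f where f: "f \<in> R" "\<And>z. z \<in> circle2 \<Longrightarrow> \<bar>q z - f z\<bar> < e"
      using Stone_Weierstrass_basic[OF q e] by blast
    have fh: "annihilates (\<lambda>p. h p * of_real (f (circ p)))" using f(1) h unfolding R_def by blast
    then have fi: "integrable TT (\<lambda>p. h p * of_real (f (circ p)))" by (simp add: annihilates_def)
    have "(LINT p|TT. h p * of_real (f (circ p)) * wave l 0 p) = 0"
      using fh unfolding annihilates_def by blast
    then have f0: "(LINT p|TT. h p * of_real (f (circ p))) = 0" by simp
    have "(LINT p|TT. h p * of_real (q (circ p))) = (LINT p|TT. h p * of_real (q (circ p)) - h p * of_real (f (circ p)))"
      using Bochner_Integration.integral_diff[OF qi fi] f0 by simp
    also have "norm \<dots> \<le> (LINT p|TT. norm (h p * of_real (q (circ p)) - h p * of_real (f (circ p))))"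
      by (rule integral_norm_bound)
    also have "\<dots> \<le> (LINT p|TT. e * norm (h p))"
    proof (rule integral_mono)
      fix p
      have "norm (h p * of_real (q (circ p)) - h p * of_real (f (circ p))) = norm (h p) * \<bar>q (circ p) - f (circ p)\<bar>"
        unfolding right_diff_distrib[symmetric] norm_mult by (simp flip: of_real_diff)
      also have "\<dots> \<le> norm (h p) * e"
        using f(2)[OF circ_in_circle2[of p]] by (intro mult_left_mono) auto
      finally show "norm (h p * of_real (q (circ p)) - h p * of_real (f (circ p))) \<le> e * norm (h p)"
        by (simp add: mult.commute)
    qed (use hi qi fi in auto)
    finally show ?thesis by simp
  qed
  define I where "I = (LINT p|TT. norm (h p))"
  have I: "0 \<le> I" by (simp add: I_def)
  have "norm (LINT p|TT. h p * of_real (q (circ p))) \<le> 0"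
  proof (rule field_le_epsilon)
    fix e :: real assume "e > 0"
    then have "norm (LINT p|TT. h p * of_real (q (circ p))) \<le> e / (I + 1) * I"
      unfolding I_def by (intro small) (use I in \<open>auto simp: I_def add_nonneg_pos\<close>)
    also have "\<dots> \<le> e" using I \<open>e > 0\<close> by (simp add: divide_simps) 
    finally show "norm (LINT p|TT. h p * of_real (q (circ p))) \<le> 0 + e" by simp
  qed
  then show ?thesis by simp
qed

text \<open>The indicator of \<open>D\<close> is the limit of continuous bumps \<open>\<phi>\<close>
  in the distance to the image of \<open>D\<close>. Injectivity of \<open>circ\<close> on the cell
  ensures that the limit is 0 off \<open>D\<close>.\<close>

lemma annihilates_compact:
  assumes h: "annihilates h" and D: "compact D" "D \<subseteq> torus2 l"
  shows "(LINT p|TT. h p * indicator D p) = 0"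
proof (cases "D = {}")
  case False
  have hi: "integrable TT h" using h by (simp add: annihilates_def)
  define C where "C = circ ` D"
  have C: "closed C" "C \<noteq> {}"
    unfolding C_def using D False by (auto intro!: compact_imp_closed compact_continuous_image continuous_on_circ)
  define \<phi> where "\<phi> k z = max 0 (1 - real k * infdist z C)" for k z
  have \<phi>c: "continuous_on S (\<phi> k)" for S k
    unfolding \<phi>_def by (intro continuous_intros)
  have zero: "(LINT p|TT. h p * of_real (\<phi> k (circ p))) = 0" for k
    by (rule annihilates_continuous[OF h \<phi>c])
  have ind: "(\<lambda>k. \<phi> k (circ p)) \<longlonglongrightarrow> indicator D p" if p: "p \<in> torus2 l" for p
  proof (cases "p \<in> D")
    case True
    then have "circ p \<in> C" by (simp add: C_def)
    then show ?thesis using True by (simp add: \<phi>_def)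
  next
    case False
    then have "circ p \<notin> C"
      using inj_on_circ D(2) p unfolding C_def inj_on_def by blast
    then have pos: "0 < infdist (circ p) C"
      using C by (simp add: infdist_pos_not_in_closed)
    obtain k0 :: nat where k0: "1 / infdist (circ p) C < real k0" using reals_Archimedean2 by blast
    have "\<phi> k (circ p) = 0" if "k0 \<le> k" for k
    proof -
      have "1 / infdist (circ p) C < real k" using k0 that by linarith
      then have "1 < real k * infdist (circ p) C" using pos by (simp add: field_simps)
      then show ?thesis by (simp add: \<phi>_def)
    qed
    then have "\<forall>\<^sub>F k in sequentially. \<phi> k (circ p) = 0" by (auto simp: eventually_sequentially)
    then show ?thesis using False by (simp add: tendsto_eventually)
  qed
  have D_sets: "D \<in> sets lebesgue" using D(1) by (simp add: compact_imp_closed sets_completionI_sets borel_closed)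
  have indm: "(\<lambda>p. indicator D p :: complex) \<in> borel_measurable TT"
    using D_sets D(2) by (intro borel_measurable_indicator) (auto simp: sets_restrict_space image_iff)
  have "(\<lambda>k. LINT p|TT. h p * of_real (\<phi> k (circ p))) \<longlonglongrightarrow> (LINT p|TT. h p * indicator D p)"
  proof (rule integral_dominated_convergence[where w="\<lambda>p. norm (h p)"])
    show "(\<lambda>p. h p * indicator D p) \<in> borel_measurable TT"
      using hi indm by (intro borel_measurable_times) auto
    show "(\<lambda>p. h p * of_real (\<phi> k (circ p))) \<in> borel_measurable TT" for k
      by (intro borel_measurable_times[OF borel_measurable_integrable[OF hi]] measurable_TT continuous_on_of_real
          continuous_on_compose2[OF \<phi>c continuous_on_circ, of UNIV]) auto
    show "AE p in TT. (\<lambda>k. h p * of_real (\<phi> k (circ p))) \<longlonglongrightarrow> h p * indicator D p"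
    proof (rule AE_I2)
      fix p assume "p \<in> space TT"
      then have "(\<lambda>k. of_real (\<phi> k (circ p)) :: complex) \<longlonglongrightarrow> of_real (indicator D p)"
        by (intro tendsto_of_real ind) (simp add: space_restrict_space)
      then show "(\<lambda>k. h p * of_real (\<phi> k (circ p))) \<longlonglongrightarrow> h p * indicator D p"
        by (intro tendsto_mult tendsto_const) (simp add: indicator_def of_bool_def split: if_splits)
    qed
    have "\<bar>\<phi> k z\<bar> \<le> 1" for k z by (simp add: \<phi>_def infdist_nonneg)
    then show "AE p in TT. norm (h p * of_real (\<phi> k (circ p))) \<le> norm (h p)" for k
      by (intro AE_I2) (simp add: norm_mult mult_left_le)
  qed (use hi in auto)
  then show ?thesis using zero by (simp add: LIMSEQ_const_iff)
qed simp

text \<open>Inner regularity gives closed subsets \<open>D\<close> that nearly exhaust the set of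
  positive real part. The integral over such a \<open>D\<close> vanishes although the integrand is
  positive there, so \<open>D\<close> is null.\<close>

lemma annihilates_Re_nonpos:
  assumes h: "annihilates h"
  shows "AE p in TT. Re (h p) \<le> 0"
proof -
  have hi: "integrable TT h" using h by (simp add: annihilates_def)
  define S where "S = {p \<in> torus2 l. 0 < Re (h p)}"
  have "S \<in> sets TT"
  proof -
    have "{p \<in> space TT. 0 < Re (h p)} \<in> sets TT" using hi by measurable
    then show ?thesis by (simp add: S_def space_restrict_space)
  qed
  then have S: "S \<in> sets lebesgue" "S \<subseteq> torus2 l"
    by (simp_all add: sets_restrict_space_iff[OF torus2_lebesgue(2)] del: space_completion)
  have "emeasure lebesgue S \<le> 0"
  proof (rule ennreal_le_epsilon)
    fix e :: real assume "0 < e"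
    then obtain D where D: "closed D" "D \<subseteq> S" "S - D \<in> lmeasurable" "emeasure lebesgue (S - D) < ennreal e"
      using sets_lebesgue_inner_closed[OF S(1)] by blast
    have comp: "compact D"
      using D S(2) bounded_torus2 by (meson bounded_subset compact_eq_bounded_closed order_trans)
    have Dl: "D \<in> sets lebesgue" using D(1) by (simp add: sets_completionI_sets borel_closed)
    have indm: "(\<lambda>p. indicator D p :: complex) \<in> borel_measurable TT"
      using Dl D(2) S(2) by (intro borel_measurable_indicator) (auto simp: sets_restrict_space image_iff)
    have int: "integrable TT (\<lambda>p. h p * indicator D p)"
      by (rule integrable_TT_mult[OF hi indm, of 1]) (simp add: indicator_def)
    have eq: "Re (h p * indicator D p) = Re (h p) * indicator D p" for p
      by (simp add: indicator_def)
    have "(LINT p|TT. Re (h p) * indicator D p) = Re (LINT p|TT. h p * indicator D p)"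
      unfolding eq[symmetric] by (rule integral_Re[OF int])
    also have "\<dots> = 0"
      using annihilates_compact[OF h comp] D(2) S(2) by simp
    finally have "(LINT p|TT. Re (h p) * indicator D p) = 0" .
    moreover have "integrable TT (\<lambda>p. Re (h p) * indicator D p)"
      using integrable_Re[OF int] by (simp only: eq)
    moreover have "AE p in TT. 0 \<le> Re (h p) * indicator D p"
      using D(2) by (intro AE_I2) (auto simp: S_def indicator_def)
    ultimately have "AE p in TT. Re (h p) * indicator D p = 0"
      by (simp add: integral_nonneg_eq_0_iff_AE)
    then have "AE p in TT. p \<notin> D"
      by eventually_elim (use D(2) in \<open>auto simp: S_def indicator_def split: if_splits\<close>)
    then have "AE p in lebesgue. p \<notin> D"
      using D(2) S(2) by (subst (asm) AE_restrict_space_iff) auto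
    then have "emeasure lebesgue D = 0"
      using Dl by (subst (asm) AE_iff_measurable[of D]) auto
    moreover have "emeasure lebesgue S \<le> emeasure lebesgue D + emeasure lebesgue (S - D)"
      using Dl S(1) D(2) by (metis Un_Diff_cancel Un_absorb1 emeasure_subadditive sets.Diff)
    ultimately show "emeasure lebesgue S \<le> 0 + ennreal e" using D(4) by auto
  qed
  then have "S \<in> null_sets lebesgue" using S(1) by (auto simp: null_sets_def)
  then have "AE p in lebesgue. p \<notin> S" by (rule AE_not_in)
  then have "AE p in lebesgue. p \<in> torus2 l \<longrightarrow> Re (h p) \<le> 0"
    by eventually_elim (auto simp: S_def)
  then show ?thesis by (subst AE_restrict_space_iff) auto
qed

lemma annihilates_AE_0:
  assumes h: "annihilates h"
  shows "AE p in TT. h p = 0"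
proof -
  have "AE p in TT. Re (c * h p) \<le> 0" for c
    by (intro annihilates_Re_nonpos annihilates_cmult h)
  from this[of 1] this[of "-1"] this[of "\<i>"] this[of "-\<i>"] show ?thesis
    by eventually_elim (simp add: complex_eq_iff)
qed

end

lemma integral_cis_period:
  assumes "l > 0"
  shows "(LINT x|lborel. indicator {0..<l} x *\<^sub>R cis (wavenum l k * x)) = (if k = 0 then of_real l else 0)"
proof -
  have "(LINT x|lborel. indicator {0..<l} x *\<^sub>R cis (wavenum l k * x)) = (LINT x|lborel. indicator {0..l} x *\<^sub>R cis (wavenum l k * x))"
  proof (rule integral_cong_AE)
    show "AE x in lborel. indicator {0..<l} x *\<^sub>R cis (wavenum l k * x) = indicator {0..l} x *\<^sub>R cis (wavenum l k * x)"
      using AE_lborel_singleton[of l] by eventually_elim (auto simp: indicator_def)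
    have "(\<lambda>x. cis (wavenum l k * x)) \<in> borel_measurable borel"
      by (intro borel_measurable_continuous_onI continuous_intros)
    then show "(\<lambda>x. indicator {0..<l} x *\<^sub>R cis (wavenum l k * x)) \<in> borel_measurable lborel"
      "(\<lambda>x. indicator {0..l} x *\<^sub>R cis (wavenum l k * x)) \<in> borel_measurable lborel"
      by auto
  qed
  also have "\<dots> = (LINT x:{0..l}|lborel. cis (wavenum l k * x))"
    by (simp add: set_lebesgue_integral_def)
  also have "\<dots> = integral {0..l} (\<lambda>x. cis (wavenum l k * x))"
    by (rule set_borel_integral_eq_integral(2))
       (simp add: set_integrable_def, rule borel_integrable_compact, auto intro!: continuous_intros)
  also have "\<dots> = (if k = 0 then of_real l else 0)"
  proof (cases "k = 0")
    case True
    then show ?thesis using assms by (simp add: wavenum_def scaleR_conv_of_real)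
  next
    case False
    define w where "w = wavenum l k"
    have w: "w \<noteq> 0" using assms False by (simp add: w_def wavenum_def)
    have "((\<lambda>x. cis (w * x)) has_integral (cis (w * l) / (\<i> * of_real w) - cis (w * 0) / (\<i> * of_real w))) {0..l}"
    proof (rule fundamental_theorem_of_calculus)
      fix x assume "x \<in> {0..l}"
      have "((\<lambda>z. exp (\<i> * of_real w * z) / (\<i> * of_real w)) has_field_derivative exp (\<i> * of_real w * of_real x)) (at (of_real x))"
        using w by (auto intro!: derivative_eq_intros)
      from has_vector_derivative_real_field[OF this]
      show "((\<lambda>x. cis (w * x) / (\<i> * of_real w)) has_vector_derivative cis (w * x)) (at x within {0..l})"
        by (auto simp: cis_conv_exp mult.assoc intro: has_vector_derivative_at_within)
    qed (use assms in simp)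
    moreover have "cis (w * l) = 1"
    proof -
      have "w * l = 2 * pi * of_int k" using assms by (simp add: w_def wavenum_def)
      then show ?thesis by (simp add: cis_multiple_2pi)
    qed
    ultimately have "((\<lambda>x. cis (w * x)) has_integral 0) {0..l}" by simp
    then show ?thesis using False by (simp add: integral_unique w_def)
  qed
  finally show ?thesis .
qed

section \<open>Fourier coefficients, trigonometric polynomials and Bessel's inequality\<close>

context torus
begin

text \<open>Lebesgue measure on the plane is the completion of a product. For Borel functions the
  integral can be moved to the product itself, where Fubini's theorem is available.\<close>

lemma TT_borel:
  fixes h :: "real \<times> real \<Rightarrow> 'a::{banach, second_countable_topology}"
  assumes "h \<in> borel_measurable borel"
  shows "integrable TT h \<longleftrightarrow> integrable (lborel \<Otimes>\<^sub>M lborel) (\<lambda>p. indicator (torus2 l) p *\<^sub>R h p)"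
    and "integral\<^sup>L TT h = integral\<^sup>L (lborel \<Otimes>\<^sub>M lborel) (\<lambda>p. indicator (torus2 l) p *\<^sub>R h p)"
proof -
  have m: "(\<lambda>p. indicator (torus2 l) p *\<^sub>R h p) \<in> borel_measurable lborel"
    using assms by (auto intro!: borel_measurable_scaleR borel_measurable_indicator)
  show "integrable TT h \<longleftrightarrow> integrable (lborel \<Otimes>\<^sub>M lborel) (\<lambda>p. indicator (torus2 l) p *\<^sub>R h p)"
    by (subst integrable_restrict_space[OF torus2_lebesgue(2)]) (simp add: integrable_completion[OF m] lborel_prod)
  show "integral\<^sup>L TT h = integral\<^sup>L (lborel \<Otimes>\<^sub>M lborel) (\<lambda>p. indicator (torus2 l) p *\<^sub>R h p)"
    by (subst integral_restrict_space[OF torus2_lebesgue(2)]) (simp add: integral_completion[OF m] lborel_prod)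
qed

lemma integral_wave: "(LINT p|TT. wave l n p) = (if n = 0 then of_real (l\<^sup>2) else 0)"
proof -
  define a where "a k x = indicator {0..<l} x *\<^sub>R cis (wavenum l k * x)" for k x
  have e: "indicator (torus2 l) p *\<^sub>R wave l n p = (case p of (x, y) \<Rightarrow> a (fst n) x * a (snd n) y)" for p
    by (cases p) (auto simp: a_def torus2_def wave_def indicator_def cis_mult)
  have bm: "wave l n \<in> borel_measurable borel"
    by (intro borel_measurable_continuous_onI continuous_on_wave)
  have "integrable TT (wave l n)" by (rule integrable_TT_bounded[of _ 1]) auto
  then have i: "integrable (lborel \<Otimes>\<^sub>M lborel) (\<lambda>(x, y). a (fst n) x * a (snd n) y)"
    unfolding TT_borel(1)[OF bm] e by (simp add: case_prod_unfold)
  have "(LINT p|TT. wave l n p) = integral\<^sup>L (lborel \<Otimes>\<^sub>M lborel) (\<lambda>(x, y). a (fst n) x * a (snd n) y)"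
    unfolding TT_borel(2)[OF bm] e by (simp add: case_prod_unfold)
  also have "\<dots> = (LINT y|lborel. LINT x|lborel. a (fst n) x * a (snd n) y)"
    by (rule lborel_pair.integral_snd[OF i, symmetric])
  also have "\<dots> = integral\<^sup>L lborel (a (fst n)) * integral\<^sup>L lborel (a (snd n))"
    by simp
  also have "\<dots> = (if n = 0 then of_real (l\<^sup>2) else 0)"
    unfolding a_def integral_cis_period[OF l_pos] by (auto simp: power2_eq_square prod_eq_iff)
  finally show ?thesis .
qed

definition fc :: "(real \<times> real \<Rightarrow> complex) \<Rightarrow> int \<times> int \<Rightarrow> complex" where
  "fc h n = (LINT p|TT. h p * wave l (- n) p) / of_real (l\<^sup>2)"

definition coef :: "(real \<times> real \<Rightarrow> real) \<Rightarrow> int \<times> int \<Rightarrow> complex" where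
  "coef f n = fcoeff2 l f (fst n) (snd n)"

lemma coef_eq_fc: "coef f n = fc (\<lambda>p. of_real (f p)) n"
  unfolding coef_def fc_def fcoeff2_def wave_def by (simp add: wavenum_uminus)

lemma integral_mult_wave: "(LINT p|TT. h p * wave l (- n) p) = of_real (l\<^sup>2) * fc h n"
  using l_pos by (simp add: fc_def)

lemma integrable_of_real_TT: "integrable TT f \<Longrightarrow> integrable TT (\<lambda>p. of_real (f p) :: complex)"
  by (rule integrable_of_real)

lemma fc_add: "integrable TT g \<Longrightarrow> integrable TT h \<Longrightarrow> fc (\<lambda>p. g p + h p) n = fc g n + fc h n"
  by (simp add: fc_def distrib_right integrable_TT_wave add_divide_distrib)

lemma fc_diff: "integrable TT g \<Longrightarrow> integrable TT h \<Longrightarrow> fc (\<lambda>p. g p - h p) n = fc g n - fc h n"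
  by (simp add: fc_def left_diff_distrib integrable_TT_wave diff_divide_distrib)

lemma coef_diff: "integrable TT f \<Longrightarrow> integrable TT g \<Longrightarrow> coef (\<lambda>p. f p - g p) n = coef f n - coef g n"
  unfolding coef_eq_fc using fc_diff[of "\<lambda>p. of_real (f p)" "\<lambda>p. of_real (g p)"] by (simp add: integrable_of_real_TT)

lemma fc_AE_cong:
  assumes "AE p in TT. g p = h p" "g \<in> borel_measurable TT" "h \<in> borel_measurable TT"
  shows "fc g n = fc h n"
proof -
  have "(LINT p|TT. g p * wave l (- n) p) = (LINT p|TT. h p * wave l (- n) p)"
    by (rule integral_cong_AE) (use assms in \<open>auto intro!: borel_measurable_times\<close>)
  then show ?thesis by (simp add: fc_def)
qed

lemma coef_hermitian: "hermitian (coef f)"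
proof -
  have "coef f (- n) = cnj (coef f n)" for n
    unfolding coef_eq_fc fc_def by (simp add: wave_uminus flip: Bochner_Integration.integral_cnj)
  then show ?thesis by (simp add: hermitian_def del: split_paired_All)
qed

lemma coef_unique:
  assumes f: "integrable TT f" and g: "integrable TT g" and eq: "\<And>n. coef f n = coef g n"
  shows "AE p in TT. f p = g p"
proof -
  have "annihilates (\<lambda>p. of_real (f p - g p))"
    unfolding annihilates_def
  proof (intro conjI allI)
    show "integrable TT (\<lambda>p. of_real (f p - g p) :: complex)" using f g by (intro integrable_of_real_TT) auto
    fix n
    have "(LINT p|TT. of_real (f p - g p) * wave l (- (- n)) p) = of_real (l\<^sup>2) * coef (\<lambda>p. f p - g p) (- n)"
      unfolding coef_eq_fc by (rule integral_mult_wave)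
    then show "(LINT p|TT. of_real (f p - g p) * wave l n p) = 0"
      using coef_diff[OF f g] eq by simp
  qed
  from annihilates_AE_0[OF this] show ?thesis by eventually_elim simp
qed

definition trig :: "(int \<times> int \<Rightarrow> complex) \<Rightarrow> (int \<times> int) set \<Rightarrow> real \<times> real \<Rightarrow> complex" where
  "trig c F p = (\<Sum>n\<in>F. c n * wave l n p)"

lemma continuous_on_trig: "continuous_on S (trig c F)"
  unfolding trig_def by (intro continuous_intros continuous_on_wave)

lemma trig_measurable [measurable]: "trig c F \<in> borel_measurable TT"
  by (intro measurable_TT continuous_on_trig)

lemma norm_trig_le: "norm (trig c F p) \<le> (\<Sum>n\<in>F. cmod (c n))"
  unfolding trig_def by (rule order_trans[OF norm_sum]) (simp add: norm_mult)

lemma integrable_trig: "integrable TT (trig c F)"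
  by (rule integrable_TT_bounded[OF trig_measurable norm_trig_le])

lemma integral_mult_trig:
  assumes "integrable TT h"
  shows "(LINT p|TT. h p * cnj (trig c F p)) = of_real (l\<^sup>2) * (\<Sum>n\<in>F. fc h n * cnj (c n))"
proof -
  have "(LINT p|TT. h p * cnj (trig c F p)) = (LINT p|TT. (\<Sum>n\<in>F. cnj (c n) * (h p * wave l (- n) p)))"
    by (simp add: trig_def sum_distrib_left wave_uminus mult_ac)
  also have "\<dots> = (\<Sum>n\<in>F. LINT p|TT. cnj (c n) * (h p * wave l (- n) p))"
    by (intro Bochner_Integration.integral_sum integrable_mult_right integrable_TT_wave assms)
  also have "\<dots> = (\<Sum>n\<in>F. cnj (c n) * (LINT p|TT. h p * wave l (- n) p))"
    by simp
  also have "\<dots> = of_real (l\<^sup>2) * (\<Sum>n\<in>F. fc h n * cnj (c n))"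
    unfolding integral_mult_wave by (simp add: sum_distrib_left mult_ac)
  finally show ?thesis .
qed

lemma fc_trig:
  assumes "finite F"
  shows "fc (trig c F) n = (if n \<in> F then c n else 0)"
proof -
  have "(LINT p|TT. trig c F p * wave l (- n) p) = (LINT p|TT. (\<Sum>m\<in>F. c m * wave l (m + - n) p))"
    unfolding wave_add by (simp add: trig_def sum_distrib_right mult.assoc)
  also have "\<dots> = (\<Sum>m\<in>F. LINT p|TT. c m * wave l (m + - n) p)"
    by (intro Bochner_Integration.integral_sum integrable_mult_right integrable_TT_bounded[of _ 1]) auto
  also have "\<dots> = (\<Sum>m\<in>F. c m * (LINT p|TT. wave l (m + - n) p))"
    by simp
  also have "\<dots> = (\<Sum>m\<in>F. if m = n then c m * of_real (l\<^sup>2) else 0)"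
    by (intro sum.cong) (auto simp: integral_wave)
  also have "\<dots> = (if n \<in> F then c n * of_real (l\<^sup>2) else 0)"
    using assms by simp
  finally show ?thesis using l_pos by (simp add: fc_def)
qed

lemma integral_norm_trig:
  assumes "finite F"
  shows "(LINT p|TT. (cmod (trig c F p))\<^sup>2) = l\<^sup>2 * (\<Sum>n\<in>F. (cmod (c n))\<^sup>2)"
proof -
  have "of_real (LINT p|TT. (cmod (trig c F p))\<^sup>2) = (LINT p|TT. trig c F p * cnj (trig c F p))"
    by (simp only: integral_complex_of_real[symmetric] complex_norm_square)
  also have "\<dots> = of_real (l\<^sup>2) * (\<Sum>n\<in>F. c n * cnj (c n))"
    unfolding integral_mult_trig[OF integrable_trig] by (simp add: fc_trig[OF assms])
  also have "\<dots> = of_real (l\<^sup>2 * (\<Sum>n\<in>F. (cmod (c n))\<^sup>2))"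
    by (simp only: of_real_mult of_real_sum complex_norm_square)
  finally show ?thesis by (simp only: of_real_eq_iff)
qed

lemma sq_integrable_TT:
  "sq_integrable (torus2 l) f \<longleftrightarrow> f \<in> borel_measurable TT \<and> integrable TT (\<lambda>p. (f p)\<^sup>2)"
  by (simp add: sq_integrable_def)

lemma sq_integrable_imp_integrable:
  assumes "sq_integrable (torus2 l) f"
  shows "integrable TT f"
proof (rule Bochner_Integration.integrable_bound)
  show "integrable TT (\<lambda>p. 1 + (f p)\<^sup>2)"
    using assms Bochner_Integration.integrable_add[OF finite_measure.integrable_const[OF finite_measure_TT, of "1::real"], of "\<lambda>p. (f p)\<^sup>2"]
    by (simp add: sq_integrable_TT)
  have "\<bar>x\<bar> \<le> 1 + x\<^sup>2" for x :: real
  proof -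
    have "2 * \<bar>x\<bar> \<le> x\<^sup>2 + 1"
      using zero_le_power2[of "\<bar>x\<bar> - 1"] by (simp add: power2_diff)
    then show ?thesis by linarith
  qed
  then show "AE p in TT. norm (f p) \<le> norm (1 + (f p)\<^sup>2)" by simp
qed (use assms in \<open>simp add: sq_integrable_TT\<close>)

lemma sq_integrable_mult:
  assumes "sq_integrable (torus2 l) f" "sq_integrable (torus2 l) g"
  shows "integrable TT (\<lambda>p. f p * g p)"
proof (rule Bochner_Integration.integrable_bound)
  show "integrable TT (\<lambda>p. (f p)\<^sup>2 + (g p)\<^sup>2)" using assms by (auto simp: sq_integrable_TT)
  have "\<bar>x * y\<bar> \<le> x\<^sup>2 + y\<^sup>2" for x y :: real
  proof -
    have "2 * (\<bar>x\<bar> * \<bar>y\<bar>) \<le> x\<^sup>2 + y\<^sup>2"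
      using zero_le_power2[of "\<bar>x\<bar> - \<bar>y\<bar>"] by (simp add: power2_diff)
    moreover have "0 \<le> \<bar>x\<bar> * \<bar>y\<bar>" by simp
    ultimately show ?thesis unfolding abs_mult by linarith
  qed
  then show "AE p in TT. norm (f p * g p) \<le> norm ((f p)\<^sup>2 + (g p)\<^sup>2)" by simp
qed (use assms in \<open>auto simp: sq_integrable_TT\<close>)

lemma sq_integrable_diff:
  assumes "sq_integrable (torus2 l) f" "sq_integrable (torus2 l) g"
  shows "sq_integrable (torus2 l) (\<lambda>p. f p - g p)"
proof -
  have "(\<lambda>p. (f p - g p)\<^sup>2) = (\<lambda>p. (f p)\<^sup>2 + (g p)\<^sup>2 - 2 * (f p * g p))"
    by (simp add: power2_diff algebra_simps)
  then show ?thesis using assms sq_integrable_mult[OF assms] by (auto simp: sq_integrable_TT)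
qed

lemma bessel:
  assumes f: "sq_integrable (torus2 l) f" and F: "finite F"
  shows "l\<^sup>2 * (\<Sum>n\<in>F. (cmod (coef f n))\<^sup>2) \<le> (LINT p|TT. (f p)\<^sup>2)"
proof -
  define c where "c = coef f"
  define P where "P = trig c F"
  define \<Sigma> where "\<Sigma> = (\<Sum>n\<in>F. (cmod (c n))\<^sup>2)"
  have fi: "integrable TT (\<lambda>p. of_real (f p) :: complex)"
    by (intro integrable_of_real_TT sq_integrable_imp_integrable f)
  have Pc: "integrable TT (\<lambda>p. of_real (f p) * cnj (P p))"
    unfolding P_def
    by (rule integrable_TT_mult[OF fi _ , of _ "\<Sum>n\<in>F. cmod (c n)"])
       (auto simp: norm_trig_le intro!: measurable_TT continuous_intros continuous_on_trig)
  have P2: "integrable TT (\<lambda>p. (cmod (P p))\<^sup>2)"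
  proof (rule finite_measure.integrable_const_bound[OF finite_measure_TT, of _ "(\<Sum>n\<in>F. cmod (c n))\<^sup>2"])
    show "AE p in TT. norm ((cmod (P p))\<^sup>2) \<le> (\<Sum>n\<in>F. cmod (c n))\<^sup>2"
      by (auto simp: P_def intro!: power_mono norm_trig_le)
  qed (simp add: P_def)
  have e: "(cmod (of_real (f p) - P p))\<^sup>2 = (f p)\<^sup>2 - 2 * Re (of_real (f p) * cnj (P p)) + (cmod (P p))\<^sup>2" for p
    unfolding cmod_power2 by (simp add: power2_eq_square algebra_simps)
  have "0 \<le> (LINT p|TT. (cmod (of_real (f p) - P p))\<^sup>2)" by simp
  also have "\<dots> = (LINT p|TT. (f p)\<^sup>2) - 2 * (LINT p|TT. Re (of_real (f p) * cnj (P p))) + (LINT p|TT. (cmod (P p))\<^sup>2)"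
    unfolding e using f P2 integrable_Re[OF Pc] by (simp add: sq_integrable_TT)
  also have "(LINT p|TT. Re (of_real (f p) * cnj (P p))) = Re (LINT p|TT. of_real (f p) * cnj (P p))"
    by (rule integral_Re[OF Pc])
  also have "(LINT p|TT. of_real (f p) * cnj (P p)) = of_real (l\<^sup>2) * (\<Sum>n\<in>F. c n * cnj (c n))"
    unfolding P_def integral_mult_trig[OF fi] by (simp add: c_def coef_eq_fc)
  also have "\<dots> = of_real (l\<^sup>2 * \<Sigma>)" by (simp only: \<Sigma>_def of_real_mult of_real_sum complex_norm_square)
  also have "(LINT p|TT. (cmod (P p))\<^sup>2) = l\<^sup>2 * \<Sigma>"
    unfolding P_def \<Sigma>_def by (rule integral_norm_trig[OF F])
  finally show ?thesis by (simp add: \<Sigma>_def c_def)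
qed

lemma coef_hbound:
  assumes "sq_integrable (torus2 l) f"
  shows "hbound 0 (coef f) (sqrt (LINT p|TT. (f p)\<^sup>2) / l)"
  unfolding hbound0
proof (intro conjI allI impI)
  fix F :: "(int \<times> int) set" assume "finite F"
  from bessel[OF assms this] have "(\<Sum>n\<in>F. (cmod (coef f n))\<^sup>2) \<le> (LINT p|TT. (f p)\<^sup>2) / l\<^sup>2"
    using l_pos by (simp add: field_simps)
  then show "(\<Sum>n\<in>F. (cmod (coef f n))\<^sup>2) \<le> (sqrt (LINT p|TT. (f p)\<^sup>2) / l)\<^sup>2"
    by (simp add: power_divide)
qed (use l_pos in simp)

end

section \<open>The Riesz--Fischer theorem and the coefficients of products\<close>

lemma filterlim_modes: "filterlim modes (finite_subsets_at_top UNIV) sequentially"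
  unfolding filterlim_finite_subsets_at_top
proof (intro allI impI)
  fix F :: "(int \<times> int) set" assume F: "finite F \<and> F \<subseteq> UNIV"
  then have "\<forall>\<^sub>F M in sequentially. \<forall>n\<in>F. n \<in> modes M"
    by (intro eventually_ball_finite) (auto simp: eventually_in_modes)
  then show "\<forall>\<^sub>F M in sequentially. finite (modes M) \<and> F \<subseteq> modes M \<and> modes M \<subseteq> UNIV"
    by eventually_elim auto
qed

context torus
begin

text \<open>For hermitian \<open>b\<close> the symmetric sum is real already, so the real part only
  adjusts the type.\<close>

definition partial :: "(int \<times> int \<Rightarrow> complex) \<Rightarrow> nat \<Rightarrow> real \<times> real \<Rightarrow> real" where
  "partial b M p = Re (trig b (modes M) p)"

lemma of_real_partial:
  assumes "hermitian b"
  shows "of_real (partial b M p) = trig b (modes M) p"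
proof -
  have "cnj (trig b (modes M) p) = (\<Sum>n\<in>modes M. b (- n) * wave l (- n) p)"
    using assms by (simp add: trig_def hermitian_def wave_uminus del: split_paired_All)
  also have "\<dots> = trig b (modes M) p"
    unfolding trig_def by (rule sum.reindex_bij_witness[of _ uminus uminus]) auto
  finally have "Im (trig b (modes M) p) = 0" by (metis Im_complex_of_real Reals_cnj_iff complex_is_Real_iff)
  then show ?thesis by (simp add: partial_def complex_eq_iff)
qed

lemma partial_measurable [measurable]: "partial b M \<in> borel_measurable TT"
  unfolding partial_def by (intro measurable_TT continuous_intros continuous_on_trig)

lemma partial_bounded: "\<bar>partial b M p\<bar> \<le> (\<Sum>n\<in>modes M. cmod (b n))"
  unfolding partial_def using abs_Re_le_cmod norm_trig_le order_trans by blast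

lemma sq_integrable_partial: "sq_integrable (torus2 l) (partial b M)"
  unfolding sq_integrable_TT
proof
  show "integrable TT (\<lambda>p. (partial b M p)\<^sup>2)"
  proof (rule finite_measure.integrable_const_bound[OF finite_measure_TT, of _ "(\<Sum>n\<in>modes M. cmod (b n))\<^sup>2"])
    show "AE p in TT. norm ((partial b M p)\<^sup>2) \<le> (\<Sum>n\<in>modes M. cmod (b n))\<^sup>2"
    proof (rule AE_I2)
      fix p
      have "\<bar>partial b M p\<bar>\<^sup>2 \<le> (\<Sum>n\<in>modes M. cmod (b n))\<^sup>2" by (intro power_mono partial_bounded) auto
      then show "norm ((partial b M p)\<^sup>2) \<le> (\<Sum>n\<in>modes M. cmod (b n))\<^sup>2" by simp
    qed
  qed simp
qed simp

lemma coef_partial: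
  assumes "hermitian b"
  shows "coef (partial b M) n = trunc M b n"
  unfolding coef_eq_fc of_real_partial[OF assms] by (simp add: fc_trig trunc_def)

lemma integral_partial_sq:
  assumes "hermitian b"
  shows "(LINT p|TT. (partial b M p)\<^sup>2) = l\<^sup>2 * (\<Sum>n\<in>modes M. (cmod (b n))\<^sup>2)"
proof -
  have "(partial b M p)\<^sup>2 = (cmod (trig b (modes M) p))\<^sup>2" for p
    unfolding of_real_partial[OF assms, symmetric] by simp
  then show ?thesis by (simp add: integral_norm_trig)
qed

text \<open>Partial sums along a sparse sequence \<open>N\<close> differ by powers of 1/2 in mean
  square, hence in mean, so the telescoping series converges absolutely almost everywhere. Fatou's
  lemma bounds the square integral of the limit, and termwise integration of the series identifies
  its coefficients.\<close>

lemma riesz_fischer: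
  assumes b: "hermitian b" "hbound 0 b B"
  shows "\<exists>g. sq_integrable (torus2 l) g \<and> coef g = b \<and> (LINT p|TT. (g p)\<^sup>2) \<le> l\<^sup>2 * B\<^sup>2"
proof -
  have "\<forall>k::nat. \<exists>M0. \<forall>M N. M0 \<le> M \<longrightarrow> M0 \<le> N \<longrightarrow> hbound 0 (\<lambda>n. trunc M b n - trunc N b n) ((1/2)^k)"
    by (intro allI hbound_tail[OF b(2)]) simp
  from choice[OF this] obtain N0 where N0:
    "\<And>k M N. N0 k \<le> M \<Longrightarrow> N0 k \<le> N \<Longrightarrow> hbound 0 (\<lambda>n. trunc M b n - trunc N b n) ((1/2)^k)" by blast
  \<comment> \<open>The sum over all earlier \<open>N0\<close> makes \<open>N\<close> increasing and
    places it beyond each \<open>N0 k\<close>; the summand \<open>k\<close> makes it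
    unbounded.\<close>
  define N where "N k = k + (\<Sum>i\<le>k. N0 i)" for k
  have N: "N0 k \<le> N k" "N0 k \<le> N (Suc k)" "k \<le> N k" "N k \<le> N (Suc k)" for k
  proof -
    have "N0 k \<le> (\<Sum>i\<le>k. N0 i)" by (intro member_le_sum) auto
    then show "N0 k \<le> N k" "N0 k \<le> N (Suc k)" "k \<le> N k" "N k \<le> N (Suc k)"
      by (auto simp: N_def)
  qed
  define S where "S k = partial b (N k)" for k
  define d where "d k p = S (Suc k) p - S k p" for k p
  have Sq: "sq_integrable (torus2 l) (S k)" for k unfolding S_def by (rule sq_integrable_partial)
  have dq: "sq_integrable (torus2 l) (d k)" for k unfolding d_def by (intro sq_integrable_diff Sq)
  have di: "integrable TT (d k)" for k by (rule sq_integrable_imp_integrable[OF dq])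
  have Si: "integrable TT (S k)" for k by (rule sq_integrable_imp_integrable[OF Sq])
  have d2: "(LINT p|TT. (d k p)\<^sup>2) \<le> l\<^sup>2 * ((1/2)^k)\<^sup>2" for k
  proof -
    define c where "c n = trunc (N (Suc k)) b n - trunc (N k) b n" for n
    have cb: "hbound 0 c ((1/2)^k)" unfolding c_def by (intro N0 N)
    have ch: "hermitian c"
      using hermitian_trunc[OF b(1), of "N (Suc k)"] hermitian_trunc[OF b(1), of "N k"]
      by (simp add: c_def hermitian_def del: split_paired_All)
    have sub: "modes (N k) \<subseteq> modes (N (Suc k))" by (intro modes_mono N)
    have "of_real (d k p) = (of_real (partial c (N (Suc k)) p) :: complex)" for p
    proof -
      have "trig c (modes (N (Suc k))) p = trig (trunc (N (Suc k)) b) (modes (N (Suc k))) p - trig (trunc (N k) b) (modes (N (Suc k))) p"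
        by (simp add: trig_def c_def left_diff_distrib sum_subtractf)
      also have "trig (trunc (N (Suc k)) b) (modes (N (Suc k))) p = trig b (modes (N (Suc k))) p"
        unfolding trig_def by (intro sum.cong) (auto simp: trunc_def)
      also have "trig (trunc (N k) b) (modes (N (Suc k))) p = trig b (modes (N k)) p"
        unfolding trig_def by (rule sum.mono_neutral_cong_right) (use sub in \<open>auto simp: trunc_def\<close>)
      finally show ?thesis
        by (simp add: d_def S_def of_real_partial[OF b(1)] of_real_partial[OF ch])
    qed
    then have "d k p = partial c (N (Suc k)) p" for p by (simp only: of_real_eq_iff)
    then have "(LINT p|TT. (d k p)\<^sup>2) = l\<^sup>2 * (\<Sum>n\<in>modes (N (Suc k)). (cmod (c n))\<^sup>2)"
      by (simp add: integral_partial_sq[OF ch])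
    also have "\<dots> \<le> l\<^sup>2 * ((1/2)^k)\<^sup>2"
      using cb unfolding hbound0 by (intro mult_left_mono) auto
    finally show ?thesis .
  qed
  have d1: "(LINT p|TT. \<bar>d k p\<bar>) \<le> l\<^sup>2 * (1/2)^k" for k
  proof -
    define \<epsilon> :: real where "\<epsilon> = (1/2)^k"
    have \<epsilon>: "\<epsilon> > 0" by (simp add: \<epsilon>_def)
    have ci: "integrable TT (\<lambda>_. c)" for c :: real by (rule finite_measure.integrable_const[OF finite_measure_TT])
    have m: "measure TT (space TT) = l\<^sup>2"
    proof -
      have "(LINT p|TT. wave l 0 p) = of_real (measure TT (space TT))"
        by (simp add: scaleR_conv_of_real)
      then have "of_real (measure TT (space TT)) = (of_real (l\<^sup>2) :: complex)"
        unfolding integral_wave by simp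
      then show ?thesis by (simp only: of_real_eq_iff)
    qed
    \<comment> \<open>Used in place of Cauchy--Schwarz: with \<epsilon> equal to the gap in mean
      square, both terms integrate to at most l^2 \<epsilon>.\<close>
    have pt: "\<bar>d k p\<bar> \<le> ((d k p)\<^sup>2 / \<epsilon> + \<epsilon>) / 2" for p
    proof -
      have "0 \<le> (\<bar>d k p\<bar> - \<epsilon>)\<^sup>2" by simp
      then have "2 * \<bar>d k p\<bar> * \<epsilon> \<le> (d k p)\<^sup>2 + \<epsilon>\<^sup>2" by (simp add: power2_diff)
      then show ?thesis using \<epsilon> by (simp add: field_simps power2_eq_square)
    qed
    have i: "integrable TT (\<lambda>p. ((d k p)\<^sup>2 / \<epsilon> + \<epsilon>) / 2)"
      using dq[of k] ci by (auto simp: sq_integrable_TT)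
    have "(LINT p|TT. \<bar>d k p\<bar>) \<le> (LINT p|TT. ((d k p)\<^sup>2 / \<epsilon> + \<epsilon>) / 2)"
      using di[of k] i pt by (intro integral_mono) auto
    also have "\<dots> = ((LINT p|TT. (d k p)\<^sup>2) / \<epsilon> + \<epsilon> * l\<^sup>2) / 2"
      using dq[of k] ci[of \<epsilon>] m by (simp add: sq_integrable_TT)
    also have "\<dots> \<le> (l\<^sup>2 * \<epsilon>\<^sup>2 / \<epsilon> + \<epsilon> * l\<^sup>2) / 2"
      using d2[of k] \<epsilon> by (intro divide_right_mono add_right_mono) (auto simp: \<epsilon>_def)
    also have "\<dots> = l\<^sup>2 * \<epsilon>" using \<epsilon> by (simp add: power2_eq_square)
    finally show ?thesis by (simp add: \<epsilon>_def)
  qed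
  have geo: "summable (\<lambda>k. l\<^sup>2 * (1/2)^k :: real)" by (intro summable_mult summable_geometric) simp
  have s1: "summable (\<lambda>k. LINT p|TT. norm (d k p))"
    by (rule summable_comparison_test'[OF geo]) (use d1 in auto)
  have AEs: "AE p in TT. summable (\<lambda>k. norm (d k p))"
  proof -
    have "(\<integral>\<^sup>+ p. (\<Sum>k. ennreal (norm (d k p))) \<partial>TT) = (\<Sum>k. \<integral>\<^sup>+ p. ennreal (norm (d k p)) \<partial>TT)"
      by (intro nn_integral_suminf) (use di in auto)
    also have "\<dots> = (\<Sum>k. ennreal (LINT p|TT. norm (d k p)))"
      by (intro suminf_cong nn_integral_eq_integral) (use di in auto)
    also have "\<dots> \<noteq> \<infinity>"
      using s1 by (subst suminf_ennreal2) auto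
    finally have "AE p in TT. (\<Sum>k. ennreal (norm (d k p))) \<noteq> \<infinity>"
      by (intro nn_integral_PInf_AE) (use di in auto)
    then show ?thesis
      by eventually_elim (auto intro: summable_suminf_not_top)
  qed
  define D where "D p = (\<Sum>k. d k p)" for p
  define g where "g p = S 0 p + D p" for p
  have Di: "integrable TT D"
    unfolding D_def using di AEs s1 by (intro integrable_suminf) auto
  have gi: "integrable TT g" unfolding g_def using Si Di by auto
  have telescope: "(\<Sum>i<k. d i p) = S k p - S 0 p" for k p
    unfolding d_def by (rule sum_lessThan_telescope)
  have limS: "AE p in TT. (\<lambda>k. S k p) \<longlonglongrightarrow> g p"
    using AEs
  proof eventually_elim
    case (elim p)
    then have "(\<lambda>k. d k p) sums D p"
      unfolding D_def by (intro summable_sums) (auto intro: summable_norm_cancel)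
    then have "(\<lambda>k. S 0 p + (S k p - S 0 p)) \<longlonglongrightarrow> S 0 p + D p"
      unfolding sums_def telescope by (intro tendsto_intros)
    then show ?case by (simp add: g_def)
  qed
  have S2: "(\<integral>\<^sup>+ p. ennreal ((S k p)\<^sup>2) \<partial>TT) \<le> ennreal (l\<^sup>2 * B\<^sup>2)" for k
  proof -
    have "(\<integral>\<^sup>+ p. ennreal ((S k p)\<^sup>2) \<partial>TT) = ennreal (LINT p|TT. (S k p)\<^sup>2)"
      using Sq[of k] by (intro nn_integral_eq_integral) (auto simp: sq_integrable_TT)
    also have "(LINT p|TT. (S k p)\<^sup>2) = l\<^sup>2 * (\<Sum>n\<in>modes (N k). (cmod (b n))\<^sup>2)"
      unfolding S_def by (rule integral_partial_sq[OF b(1)])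
    also have "ennreal \<dots> \<le> ennreal (l\<^sup>2 * B\<^sup>2)"
      using b(2) unfolding hbound0 by (intro ennreal_leI mult_left_mono) auto
    finally show ?thesis .
  qed
  have gm: "g \<in> borel_measurable TT" using gi by auto
  have g2: "(\<integral>\<^sup>+ p. ennreal ((g p)\<^sup>2) \<partial>TT) \<le> ennreal (l\<^sup>2 * B\<^sup>2)"
  proof -
    have "(\<integral>\<^sup>+ p. ennreal ((g p)\<^sup>2) \<partial>TT) = (\<integral>\<^sup>+ p. liminf (\<lambda>k. ennreal ((S k p)\<^sup>2)) \<partial>TT)"
    proof (rule nn_integral_cong_AE)
      show "AE p in TT. ennreal ((g p)\<^sup>2) = liminf (\<lambda>k. ennreal ((S k p)\<^sup>2))"
        using limS
      proof eventually_elim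
        case (elim p)
        have "(\<lambda>k. ennreal ((S k p)\<^sup>2)) \<longlonglongrightarrow> ennreal ((g p)\<^sup>2)"
          by (intro tendsto_ennrealI tendsto_power elim)
        from lim_imp_Liminf[OF _ this] show ?case by simp
      qed
    qed
    also have "\<dots> \<le> liminf (\<lambda>k. \<integral>\<^sup>+ p. ennreal ((S k p)\<^sup>2) \<partial>TT)"
      by (rule nn_integral_liminf) (use Si in auto)
    also have "\<dots> \<le> liminf (\<lambda>k. ennreal (l\<^sup>2 * B\<^sup>2))"
      using S2 by (intro Liminf_mono always_eventually) blast
    also have "\<dots> = ennreal (l\<^sup>2 * B\<^sup>2)" by (simp add: Liminf_const)
    finally show ?thesis .
  qed
  have g2i: "integrable TT (\<lambda>p. (g p)\<^sup>2)"
  proof (rule integrableI_bounded)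
    show "(\<integral>\<^sup>+ p. ennreal (norm ((g p)\<^sup>2)) \<partial>TT) < \<infinity>" using g2 by (simp add: le_less_trans)
  qed (use gm in auto)
  have g2le: "(LINT p|TT. (g p)\<^sup>2) \<le> l\<^sup>2 * B\<^sup>2"
    using g2 nn_integral_eq_integral[OF g2i] by simp
  have "coef g n = b n" for n
  proof -
    have "(\<lambda>k. LINT p|TT. of_real (d k p) * wave l (- n) p) sums (LINT p|TT. (\<Sum>k. of_real (d k p) * wave l (- n) p))"
    proof (rule sums_integral)
      show "integrable TT (\<lambda>p. of_real (d k p) * wave l (- n) p)" for k
        by (intro integrable_TT_wave integrable_of_real_TT di)
    qed (use AEs s1 in \<open>simp_all add: norm_mult\<close>)
    also have "(LINT p|TT. (\<Sum>k. of_real (d k p) * wave l (- n) p)) = (LINT p|TT. of_real (D p) * wave l (- n) p)"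
    proof (rule integral_cong_AE)
      show "AE p in TT. (\<Sum>k. of_real (d k p) * wave l (- n) p) = of_real (D p) * wave l (- n) p"
        using AEs
      proof eventually_elim
        case (elim p)
        then have "summable (\<lambda>k. d k p)" by (auto intro: summable_norm_cancel)
        then show ?case
          unfolding D_def by (simp add: suminf_mult2[symmetric] suminf_of_real summable_of_real)
      qed
      then have "(\<lambda>p. of_real (D p) * wave l (- n) p) \<in> borel_measurable TT"
        using Di by (intro borel_measurable_times) auto
      then show "(\<lambda>p. of_real (D p) * wave l (- n) p) \<in> borel_measurable TT" .
      have "integrable TT (\<lambda>p. \<Sum>k. of_real (d k p) * wave l (- n) p)"
      proof (rule integrable_suminf)
        show "integrable TT (\<lambda>p. of_real (d k p) * wave l (- n) p)" for k
          by (intro integrable_TT_wave integrable_of_real_TT di)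
      qed (use AEs s1 in \<open>simp_all add: norm_mult\<close>)
      then show "(\<lambda>p. \<Sum>k. of_real (d k p) * wave l (- n) p) \<in> borel_measurable TT" by auto
    qed
    finally have "(\<lambda>k. \<Sum>i<k. LINT p|TT. of_real (d i p) * wave l (- n) p) \<longlonglongrightarrow> (LINT p|TT. of_real (D p) * wave l (- n) p)"
      by (simp add: sums_def)
    moreover have "(\<Sum>i<k. LINT p|TT. of_real (d i p) * wave l (- n) p) = of_real (l\<^sup>2) * (trunc (N k) b n - coef (S 0) n)" for k
    proof -
      have e: "(LINT p|TT. of_real (d i p) * wave l (- n) p) = of_real (l\<^sup>2) * coef (S (Suc i)) n - of_real (l\<^sup>2) * coef (S i) n" for i
      proof -
        have "(LINT p|TT. of_real (d i p) * wave l (- n) p) = of_real (l\<^sup>2) * coef (\<lambda>p. S (Suc i) p - S i p) n"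
          unfolding coef_eq_fc d_def by (rule integral_mult_wave)
        then show ?thesis unfolding coef_diff[OF Si Si] by (simp add: right_diff_distrib)
      qed
      have "(\<Sum>i<k. LINT p|TT. of_real (d i p) * wave l (- n) p) = of_real (l\<^sup>2) * coef (S k) n - of_real (l\<^sup>2) * coef (S 0) n"
        unfolding e by (rule sum_lessThan_telescope)
      then show ?thesis by (simp add: S_def coef_partial[OF b(1)] right_diff_distrib)
    qed
    ultimately have 1: "(\<lambda>k. of_real (l\<^sup>2) * (trunc (N k) b n - coef (S 0) n)) \<longlonglongrightarrow> (LINT p|TT. of_real (D p) * wave l (- n) p)"
      by simp
    have "filterlim N sequentially sequentially"
      by (rule filterlim_at_top_mono[OF filterlim_ident]) (use N(3) in auto)
    then have "\<forall>\<^sub>F k in sequentially. n \<in> modes (N k)"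
      by (rule eventually_compose_filterlim[OF eventually_in_modes])
    then have "\<forall>\<^sub>F k in sequentially. b n = trunc (N k) b n" by eventually_elim (simp add: trunc_def)
    then have "(\<lambda>k. trunc (N k) b n) \<longlonglongrightarrow> b n" by (intro Lim_transform_eventually[OF tendsto_const])
    then have 2: "(\<lambda>k. of_real (l\<^sup>2) * (trunc (N k) b n - coef (S 0) n)) \<longlonglongrightarrow> of_real (l\<^sup>2) * (b n - coef (S 0) n)"
      by (intro tendsto_intros)
    have 3: "(LINT p|TT. of_real (D p) * wave l (- n) p) = of_real (l\<^sup>2) * (b n - coef (S 0) n)"
      by (rule LIMSEQ_unique[OF 1 2])
    have "(LINT p|TT. of_real (D p) * wave l (- n) p) = of_real (l\<^sup>2) * coef D n"
      unfolding coef_eq_fc by (rule integral_mult_wave)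
    then have "coef D n = b n - coef (S 0) n" using 3 l_pos by simp
    moreover have "coef g n = coef (S 0) n + coef D n"
      unfolding coef_eq_fc g_def using fc_add[of "\<lambda>p. of_real (S 0 p)" "\<lambda>p. of_real (D p)" n] Si Di
      by (simp add: integrable_of_real_TT)
    ultimately show ?thesis by simp
  qed
  then have "coef g = b" by (rule ext)
  moreover have "sq_integrable (torus2 l) g" using gm g2i by (simp add: sq_integrable_TT)
  ultimately show ?thesis using g2le by blast
qed

text \<open>Riesz--Fischer produces a function with the same coefficients and this bound, and
  uniqueness identifies it with \<open>f\<close>. Together with Bessel's inequality this is
  Parseval's identity.\<close>

lemma parseval_le:
  assumes f: "sq_integrable (torus2 l) f" and b: "hbound 0 (coef f) B"
  shows "(LINT p|TT. (f p)\<^sup>2) \<le> l\<^sup>2 * B\<^sup>2"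
proof -
  obtain g where g: "sq_integrable (torus2 l) g" "coef g = coef f" "(LINT p|TT. (g p)\<^sup>2) \<le> l\<^sup>2 * B\<^sup>2"
    using riesz_fischer[OF coef_hermitian b] by blast
  have "AE p in TT. f p = g p"
    using g(2) by (intro coef_unique sq_integrable_imp_integrable f g) simp
  then have "(LINT p|TT. (f p)\<^sup>2) = (LINT p|TT. (g p)\<^sup>2)"
    using f g by (intro integral_cong_AE) (auto simp: sq_integrable_TT elim: eventually_mono)
  then show ?thesis using g(3) by simp
qed

text \<open>For a partial sum of \<open>f\<close> the convolution is finite. As the partial sums
  grow, the convolutions converge by absolute summability, and the products with \<open>g\<close>
  converge in mean.\<close>

lemma coef_mult:
  assumes f: "sq_integrable (torus2 l) f" and g: "sq_integrable (torus2 l) g"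
  shows "coef (\<lambda>p. f p * g p) n = (\<Sum>\<^sub>\<infinity>m. coef f m * coef g (n - m))"
proof -
  note hf = coef_hbound[OF f] and hg = coef_hbound[OF g]
  have fi: "integrable TT f" and gi: "integrable TT g" using f g by (auto intro: sq_integrable_imp_integrable)
  define P where "P M = partial (coef f) M" for M
  have Pq: "sq_integrable (torus2 l) (P M)" for M unfolding P_def by (rule sq_integrable_partial)
  have Pc: "coef (\<lambda>p. P M p * g p) n = (\<Sum>m\<in>modes M. coef f m * coef g (n - m))" for M
  proof -
    have "of_real (P M p * g p) * wave l (- n) p = (\<Sum>m\<in>modes M. coef f m * (of_real (g p) * wave l (- (n - m)) p))" for p
    proof -
      have "- (n - m) = m + - n" for m by simp
      then show ?thesis
        unfolding of_real_mult P_def of_real_partial[OF coef_hermitian]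
        by (simp only: trig_def sum_distrib_right wave_add) (simp add: mult_ac)
    qed
    then have "(LINT p|TT. of_real (P M p * g p) * wave l (- n) p) = (LINT p|TT. (\<Sum>m\<in>modes M. coef f m * (of_real (g p) * wave l (- (n - m)) p)))"
      by (simp only:)
    also have "\<dots> = (\<Sum>m\<in>modes M. LINT p|TT. coef f m * (of_real (g p) * wave l (- (n - m)) p))"
      by (intro Bochner_Integration.integral_sum integrable_mult_right integrable_TT_wave integrable_of_real_TT gi)
    also have "\<dots> = (\<Sum>m\<in>modes M. coef f m * (LINT p|TT. of_real (g p) * wave l (- (n - m)) p))"
      by (intro sum.cong refl Bochner_Integration.integral_mult_right integrable_TT_wave integrable_of_real_TT gi)
    also have "\<dots> = of_real (l\<^sup>2) * (\<Sum>m\<in>modes M. coef f m * coef g (n - m))"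
      unfolding integral_mult_wave coef_eq_fc[of g] by (simp add: sum_distrib_left mult_ac)
    finally show ?thesis
      unfolding coef_eq_fc[of "\<lambda>p. P M p * g p"] fc_def using l_pos by simp
  qed
  have "(\<lambda>m. norm (coef f m * coef g (n - m))) summable_on UNIV"
    unfolding norm_mult by (rule convolution_abs_summable(1)[OF hf hg])
  then have "(\<lambda>m. coef f m * coef g (n - m)) summable_on UNIV"
    by (rule Infinite_Sum.abs_summable_summable)
  from filterlim_compose[OF infsum_tendsto[OF this] filterlim_modes]
  have lim1: "(\<lambda>M. coef (\<lambda>p. P M p * g p) n) \<longlonglongrightarrow> (\<Sum>\<^sub>\<infinity>m. coef f m * coef g (n - m))"
    unfolding Pc .
  have lim2: "(\<lambda>M. coef (\<lambda>p. P M p * g p) n) \<longlonglongrightarrow> coef (\<lambda>p. f p * g p) n"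
  proof (rule LIMSEQ_I)
    fix e :: real assume e: "e > 0"
    define G where "G = (LINT p|TT. (g p)\<^sup>2)"
    have G: "0 \<le> G" by (simp add: G_def)
    \<comment> \<open>The error comes out as (l^2 \<epsilon> + \<epsilon> G) / (2 l^2), which this
      choice makes equal to e / 2.\<close>
    define \<epsilon> where "\<epsilon> = e * l\<^sup>2 / (l\<^sup>2 + G)"
    have den: "0 < l\<^sup>2 + G" using l_pos G by (simp add: add_pos_nonneg)
    have \<epsilon>: "\<epsilon> > 0" using e den l_pos by (simp add: \<epsilon>_def)
    obtain M0 where M0: "\<And>M N. M0 \<le> M \<Longrightarrow> M0 \<le> N \<Longrightarrow> hbound 0 (\<lambda>n. trunc M (coef f) n - trunc N (coef f) n) \<epsilon>"
      using hbound_tail[OF hf \<epsilon>] by blast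
    have "norm (coef (\<lambda>p. P M p * g p) n - coef (\<lambda>p. f p * g p) n) < e" if M: "M0 \<le> M" for M
    proof -
      define r where "r p = P M p - f p" for p
      have rq: "sq_integrable (torus2 l) r" unfolding r_def by (intro sq_integrable_diff Pq f)
      have "hbound 0 (coef r) \<epsilon>"
      proof (rule hbound_limit[where a="\<lambda>i n. trunc M (coef f) n - trunc (i + M0) (coef f) n"])
        fix m
        have "(\<lambda>i. trunc (i + M0) (coef f) m) \<longlonglongrightarrow> coef f m"
          by (rule LIMSEQ_ignore_initial_segment) (rule trunc_tendsto, rule tendsto_const)
        then have "(\<lambda>i. trunc M (coef f) m - trunc (i + M0) (coef f) m) \<longlonglongrightarrow> trunc M (coef f) m - coef f m"
          by (intro tendsto_intros)
        moreover have "coef r m = trunc M (coef f) m - coef f m"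
          unfolding r_def coef_diff[OF sq_integrable_imp_integrable[OF Pq] fi]
          by (simp add: P_def coef_partial[OF coef_hermitian])
        ultimately show "(\<lambda>i. trunc M (coef f) m - trunc (i + M0) (coef f) m) \<longlonglongrightarrow> coef r m" by simp
      qed (use M0 M in auto)
      from parseval_le[OF rq this] have r2: "(LINT p|TT. (r p)\<^sup>2) \<le> l\<^sup>2 * \<epsilon>\<^sup>2" .
      have rg: "integrable TT (\<lambda>p. r p * g p)" by (rule sq_integrable_mult[OF rq g])
      have "coef (\<lambda>p. P M p * g p) n - coef (\<lambda>p. f p * g p) n = coef (\<lambda>p. r p * g p) n"
        using coef_diff[OF sq_integrable_mult[OF Pq g] sq_integrable_mult[OF f g], of M n]
        by (simp add: r_def left_diff_distrib)
      also have "norm \<dots> = norm (LINT p|TT. of_real (r p * g p) * wave l (- n) p) / l\<^sup>2"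
        unfolding coef_eq_fc fc_def by (simp add: norm_divide norm_power)
      also have "\<dots> \<le> (l\<^sup>2 * \<epsilon> + \<epsilon> * G) / 2 / l\<^sup>2"
      proof (rule divide_right_mono)
        have "norm (LINT p|TT. of_real (r p * g p) * wave l (- n) p) \<le> (LINT p|TT. norm (of_real (r p * g p) * wave l (- n) p))"
          by (rule integral_norm_bound)
        also have "\<dots> = (LINT p|TT. \<bar>r p * g p\<bar>)" by (simp add: norm_mult abs_mult)
        also have "\<dots> \<le> (LINT p|TT. ((r p)\<^sup>2 / \<epsilon> + \<epsilon> * (g p)\<^sup>2) / 2)"
        proof (rule integral_mono)
          fix p
          have "0 \<le> (\<bar>r p\<bar> - \<epsilon> * \<bar>g p\<bar>)\<^sup>2" by simp
          then have "2 * \<epsilon> * \<bar>r p * g p\<bar> \<le> (r p)\<^sup>2 + \<epsilon>\<^sup>2 * (g p)\<^sup>2"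
            by (simp add: power2_diff abs_mult power_mult_distrib mult_ac)
          then show "\<bar>r p * g p\<bar> \<le> ((r p)\<^sup>2 / \<epsilon> + \<epsilon> * (g p)\<^sup>2) / 2"
            using \<epsilon> by (simp add: field_simps power2_eq_square)
        qed (use rg rq g in \<open>auto simp: sq_integrable_TT\<close>)
        also have "\<dots> = ((LINT p|TT. (r p)\<^sup>2) / \<epsilon> + \<epsilon> * G) / 2"
          using rq g by (simp add: sq_integrable_TT G_def)
        also have "\<dots> \<le> (l\<^sup>2 * \<epsilon>\<^sup>2 / \<epsilon> + \<epsilon> * G) / 2"
          using r2 \<epsilon> by (intro divide_right_mono add_right_mono) auto
        also have "\<dots> = (l\<^sup>2 * \<epsilon> + \<epsilon> * G) / 2" using \<epsilon> by (simp add: power2_eq_square)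
        finally show "norm (LINT p|TT. of_real (r p * g p) * wave l (- n) p) \<le> (l\<^sup>2 * \<epsilon> + \<epsilon> * G) / 2" .
      qed simp
      also have "(l\<^sup>2 * \<epsilon> + \<epsilon> * G) / 2 / l\<^sup>2 = e / 2"
      proof -
        have "l\<^sup>2 * \<epsilon> + \<epsilon> * G = \<epsilon> * (l\<^sup>2 + G)" by (simp add: algebra_simps)
        also have "\<dots> = e * l\<^sup>2" using den by (simp add: \<epsilon>_def)
        finally show ?thesis using l_pos by simp
      qed
      also have "e / 2 < e" using e by simp
      finally show ?thesis .
    qed
    then show "\<exists>no. \<forall>M\<ge>no. norm (coef (\<lambda>p. P M p * g p) n - coef (\<lambda>p. f p * g p) n) < e" by blast
  qed
  show ?thesis by (rule LIMSEQ_unique[OF lim2 lim1])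
qed

end

section \<open>Zonal means and functions of one variable on the plane torus\<close>

lemma lebesgue_measurable_AE:
  fixes f g :: "'a::euclidean_space \<Rightarrow> 'b::topological_space"
  assumes g: "g \<in> borel_measurable lebesgue" and ae: "AE x in lebesgue. f x = g x"
  shows "f \<in> borel_measurable lebesgue"
proof (rule measurableI)
  fix A :: "'b set" assume A: "A \<in> sets borel"
  show "f -` A \<inter> space lebesgue \<in> sets lebesgue"
  proof (rule completion.in_sets_AE[OF _ measurable_sets[OF g A]])
    show "AE x in lebesgue. x \<in> g -` A \<inter> space lebesgue \<longleftrightarrow> x \<in> f -` A \<inter> space lebesgue"
      using ae by eventually_elim auto
  qed auto
qed simp

lemma lebesgue_on_measurable_AE:
  fixes f g :: "'a::euclidean_space \<Rightarrow> real"
  assumes S: "S \<in> sets lebesgue" and g: "g \<in> borel_measurable lebesgue"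
    and ae: "AE x in lebesgue. x \<in> S \<longrightarrow> f x = g x"
  shows "f \<in> borel_measurable (lebesgue_on S)"
proof -
  have "(\<lambda>x. if x \<in> S then f x else g x) \<in> borel_measurable lebesgue"
    by (rule lebesgue_measurable_AE[OF g]) (use ae in eventually_elim, auto)
  then have "(\<lambda>x. if x \<in> S then f x else g x) \<in> borel_measurable (lebesgue_on S)"
    by (rule measurable_restrict_space1)
  then show ?thesis
    by (rule measurable_cong[THEN iffD1, rotated]) (auto simp: space_restrict_space)
qed

text \<open>Reflecting the plane at the diagonal makes the second coordinate the outer one.\<close>

lemma AE_lborel_swap:
  fixes P :: "real \<times> real \<Rightarrow> bool"
  assumes "AE p in lborel \<Otimes>\<^sub>M lborel. P p"
  shows "AE y in lborel. AE x in lborel. P (x, y)"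
proof -
  have "AE p in distr (lborel \<Otimes>\<^sub>M lborel) (lborel \<Otimes>\<^sub>M lborel) (\<lambda>(x, y). (y, x)). P (p :: real \<times> real)"
    using assms unfolding lborel_pair.distr_pair_swap[symmetric] .
  then have "AE p in lborel \<Otimes>\<^sub>M lborel. P (case p of (x, y) \<Rightarrow> (y, x))"
    by (rule AE_distrD[rotated]) simp
  from lborel_pair.AE_pair[OF this] show ?thesis by simp
qed

context torus
begin

abbreviation "T1 \<equiv> lebesgue_on (torus1 l)"

lemma finite_measure_T1: "finite_measure T1"
proof
  have "bounded (torus1 l)"
    unfolding torus1_def by (rule bounded_subset[OF bounded_closed_interval[of 0 l]]) auto
  then have "emeasure lebesgue (torus1 l) < \<infinity>"
    using fmeasurableD2[OF bounded_set_imp_lmeasurable[OF _ torus1_lebesgue(1)]] by (simp add: less_top)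
  then show "emeasure T1 (space T1) \<noteq> \<infinity>"
    by (simp add: emeasure_restrict_space space_restrict_space)
qed

lemma zonal_mean_const: "zonal_mean l (\<lambda>p. w (snd p)) y = w y"
proof -
  have "measure T1 (space T1) = l"
    using l_pos by (simp add: measure_restrict_space space_restrict_space torus1_def)
  then show ?thesis using l_pos by (simp add: zonal_mean_def)
qed

text \<open>Sections of a Lebesgue measurable function need not be measurable, so \<open>h\<close>
  is first replaced by a Borel function \<open>g\<close> that agrees with it almost everywhere.
  Fubini's theorem is applied to \<open>g\<close>, and the result is carried back to
  \<open>h\<close> on almost every section.\<close>

lemma zonal_coef:
  assumes h: "integrable TT h"
  shows "integrable T1 (zonal_mean l h)" and "fcoeff1 l (zonal_mean l h) k = coef h (0, k)"
proof -
  define f where "f p = indicator (torus2 l) p *\<^sub>R h p" for p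
  have fi: "integrable lebesgue f"
    unfolding f_def using h by (subst integrable_restrict_space[OF torus2_lebesgue(2), symmetric])
  obtain g where g: "g \<in> borel_measurable lborel" and fg: "AE p in lborel. f p = g p"
    using completion_ex_borel_measurable_real[OF borel_measurable_integrable[OF fi]] by blast
  have gl: "g \<in> borel_measurable lebesgue" by (rule measurable_completion[OF g])
  have "integrable lebesgue g"
    by (rule integrable_cong_AE_imp[OF fi gl]) (use AE_completion[OF fg] in eventually_elim, simp)
  then have gi: "integrable (lborel \<Otimes>\<^sub>M lborel) g"
    by (simp add: integrable_completion[OF g] lborel_prod)
  then have gi': "integrable (lborel \<Otimes>\<^sub>M lborel) (\<lambda>(x, y). g (x, y))" by simp
  define Z where "Z y = (LINT x|lborel. g (x, y)) / l" for y
  have Zi: "integrable lborel Z"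
    unfolding Z_def using lborel_pair.integrable_snd[OF gi'] by auto
  have Zm: "Z \<in> borel_measurable lebesgue" by (rule measurable_completion) (use Zi in auto)
  have sec: "AE y in lborel. AE x in lborel. f (x, y) = g (x, y)"
    by (rule AE_lborel_swap) (simp only: lborel_prod fg)
  \<comment> \<open>The vanishing of \<open>Z\<close> off the cell is what removes the indicator of
    the cell from the integral over \<open>y\<close>.\<close>
  have zZ: "AE y in lborel. (y \<in> torus1 l \<longrightarrow> zonal_mean l h y = Z y) \<and> (y \<notin> torus1 l \<longrightarrow> Z y = 0)"
    using sec
  proof eventually_elim
    case (elim y)
    have gy: "(\<lambda>x. g (x, y)) \<in> borel_measurable lborel" using g by simp
    have gyl: "(\<lambda>x. g (x, y)) \<in> borel_measurable lebesgue" by (rule measurable_completion[OF gy])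
    have ae: "AE x in lebesgue. f (x, y) = g (x, y)" by (rule AE_completion[OF elim])
    have fyl: "(\<lambda>x. f (x, y)) \<in> borel_measurable lebesgue" by (rule lebesgue_measurable_AE[OF gyl ae])
    have eq: "(LINT x|lebesgue. f (x, y)) = (LINT x|lborel. g (x, y))"
    proof -
      have "(LINT x|lebesgue. f (x, y)) = (LINT x|lebesgue. g (x, y))"
        by (rule integral_cong_AE[OF fyl gyl ae])
      then show ?thesis by (simp add: integral_completion[OF gy])
    qed
    show ?case
    proof (intro conjI impI)
      assume y: "y \<in> torus1 l"
      have "(LINT x|T1. h (x, y)) = (LINT x|lebesgue. indicator (torus1 l) x *\<^sub>R h (x, y))"
        by (rule integral_restrict_space[OF torus1_lebesgue(2)])
      also have "\<dots> = (LINT x|lebesgue. f (x, y))"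
        using y by (intro Bochner_Integration.integral_cong) (auto simp: f_def torus1_def torus2_def indicator_def)
      finally show "zonal_mean l h y = Z y" by (simp add: zonal_mean_def Z_def eq)
    next
      assume y: "y \<notin> torus1 l"
      have "f (x, y) = 0" for x using y by (auto simp: f_def torus1_def torus2_def indicator_def)
      then show "Z y = 0" using eq by (simp add: Z_def)
    qed
  qed
  have zm: "zonal_mean l h \<in> borel_measurable T1"
    by (rule lebesgue_on_measurable_AE[OF torus1_lebesgue(1) Zm]) (use AE_completion[OF zZ] in eventually_elim, blast)
  have ZiT: "integrable T1 Z"
  proof -
    have "integrable lebesgue Z" using Zi by (simp add: integrable_completion)
    then show ?thesis
      by (subst integrable_restrict_space[OF torus1_lebesgue(2)]) (rule integrable_mult_indicator[OF torus1_lebesgue(1)])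
  qed
  have zZ1: "AE y in T1. zonal_mean l h y = Z y"
    by (subst AE_restrict_space_iff) (use AE_completion[OF zZ] in \<open>auto elim: eventually_mono\<close>)
  show zi: "integrable T1 (zonal_mean l h)"
    by (rule integrable_cong_AE_imp[OF ZiT zm]) (use zZ1 in eventually_elim, simp)
  define w where "w y = cis (- (wavenum l k * y))" for y
  have wb: "w \<in> borel_measurable borel"
    unfolding w_def by (intro borel_measurable_continuous_onI continuous_intros)
  have wT: "w \<in> borel_measurable T1"
    by (rule measurable_restrict_space1, rule measurable_completion) (use wb in simp)
  have fm: "f \<in> borel_measurable lebesgue" using fi by auto
  have "fcoeff1 l (zonal_mean l h) k * of_real l = (LINT y|T1. of_real (zonal_mean l h y) * w y)"
    using l_pos by (simp add: fcoeff1_def w_def)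
  also have "\<dots> = (LINT y|T1. of_real (Z y) * w y)"
    by (rule integral_cong_AE) (use zm ZiT wT zZ1 in \<open>auto elim: eventually_mono intro!: borel_measurable_times borel_measurable_of_real\<close>)
  also have "\<dots> = (LINT y|lebesgue. indicator (torus1 l) y *\<^sub>R (of_real (Z y) * w y))"
    by (rule integral_restrict_space[OF torus1_lebesgue(2)])
  also have "\<dots> = (LINT y|lborel. indicator (torus1 l) y *\<^sub>R (of_real (Z y) * w y))"
    by (rule integral_completion) (use Zi wb in \<open>auto intro!: borel_measurable_scaleR borel_measurable_times borel_measurable_of_real borel_measurable_indicator\<close>)
  also have "\<dots> = (LINT y|lborel. of_real (Z y) * w y)"
  proof (rule integral_cong_AE)
    show "AE y in lborel. indicator (torus1 l) y *\<^sub>R (of_real (Z y) * w y) = of_real (Z y) * w y"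
      using zZ by eventually_elim (auto simp: indicator_def)
  qed (use Zi wb in \<open>auto intro!: borel_measurable_scaleR borel_measurable_times borel_measurable_of_real borel_measurable_indicator\<close>)
  also have "\<dots> = (LINT y|lborel. LINT x|lborel. of_real (g (x, y)) * w y) / of_real l"
    unfolding Z_def by (simp add: of_real_divide flip: integral_complex_of_real)
  also have "(LINT y|lborel. LINT x|lborel. of_real (g (x, y)) * w y) = integral\<^sup>L (lborel \<Otimes>\<^sub>M lborel) (\<lambda>(x, y). of_real (g (x, y)) * w y)"
  proof (rule lborel_pair.integral_snd)
    have "integrable (lborel \<Otimes>\<^sub>M lborel) (\<lambda>p. of_real (g p) * w (snd p))"
    proof (rule Bochner_Integration.integrable_bound[OF gi])
      have "(\<lambda>p. w (snd p)) \<in> borel_measurable borel"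
        unfolding w_def by (intro borel_measurable_continuous_onI continuous_intros)
      then show "(\<lambda>p. of_real (g p) * w (snd p)) \<in> borel_measurable (lborel \<Otimes>\<^sub>M lborel)"
        using g unfolding lborel_prod by (intro borel_measurable_times borel_measurable_of_real) auto
    qed (simp add: norm_mult w_def)
    then show "integrable (lborel \<Otimes>\<^sub>M lborel) (\<lambda>(x, y). of_real (g (x, y)) * w y)"
      by (simp add: case_prod_unfold)
  qed
  also have "\<dots> = (LINT p|lborel. of_real (g p) * w (snd p))"
    by (simp add: case_prod_unfold lborel_prod)
  also have "\<dots> = (LINT p|lebesgue. of_real (g p) * w (snd p))"
  proof (rule integral_completion[symmetric])
    have "(\<lambda>p. w (snd p)) \<in> borel_measurable borel"
      unfolding w_def by (intro borel_measurable_continuous_onI continuous_intros)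
    then show "(\<lambda>p. of_real (g p) * w (snd p)) \<in> borel_measurable lborel"
      using g by (intro borel_measurable_times borel_measurable_of_real) auto
  qed
  also have "\<dots> = (LINT p|lebesgue. of_real (f p) * w (snd p))"
  proof (rule integral_cong_AE)
    have "(\<lambda>p. w (snd p)) \<in> borel_measurable lborel"
      unfolding w_def by (simp, intro borel_measurable_continuous_onI continuous_intros)
    then have wl: "(\<lambda>p. w (snd p)) \<in> borel_measurable lebesgue" by (rule measurable_completion)
    show "(\<lambda>p. of_real (g p) * w (snd p)) \<in> borel_measurable lebesgue" "(\<lambda>p. of_real (f p) * w (snd p)) \<in> borel_measurable lebesgue"
      using gl fm wl by (auto intro!: borel_measurable_times borel_measurable_of_real)
    show "AE p in lebesgue. of_real (g p) * w (snd p) = of_real (f p) * w (snd p)"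
      using AE_completion[OF fg] by eventually_elim simp
  qed
  also have "\<dots> = (LINT p|lebesgue. indicator (torus2 l) p *\<^sub>R (of_real (h p) * w (snd p)))"
    by (intro Bochner_Integration.integral_cong) (auto simp: f_def indicator_def)
  also have "\<dots> = (LINT p|TT. of_real (h p) * w (snd p))"
    by (rule integral_restrict_space[OF torus2_lebesgue(2), symmetric])
  also have "\<dots> = of_real (l\<^sup>2) * coef h (0, k)"
    using l_pos by (simp add: coef_def fcoeff2_def w_def wavenum_def)
  finally have "fcoeff1 l (zonal_mean l h) k * of_real l = of_real (l\<^sup>2) * coef h (0, k) / of_real l" .
  then show "fcoeff1 l (zonal_mean l h) k = coef h (0, k)"
    using l_pos by (simp add: power2_eq_square field_simps)
qed

text \<open>An exceptional null set \<open>N\<close> of the line becomes a null strip in the plane,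
  so a Borel representative of \<open>v\<close> yields one of its extension. For the representative
  the integral factorizes.\<close>

lemma integrable_snd_TT:
  assumes v: "integrable T1 v"
  shows "integrable TT (\<lambda>p. v (snd p))"
    and "coef (\<lambda>p. v (snd p)) (j, k) = (if j = 0 then fcoeff1 l v k else 0)"
proof -
  define f where "f y = indicator (torus1 l) y *\<^sub>R v y" for y
  have fi: "integrable lebesgue f"
    unfolding f_def using v by (subst integrable_restrict_space[OF torus1_lebesgue(2), symmetric])
  obtain g where g: "g \<in> borel_measurable lborel" and fg: "AE y in lborel. f y = g y"
    using completion_ex_borel_measurable_real[OF borel_measurable_integrable[OF fi]] by blast
  have gl: "g \<in> borel_measurable lebesgue" by (rule measurable_completion[OF g])
  have "integrable lebesgue g"
    by (rule integrable_cong_AE_imp[OF fi gl]) (use AE_completion[OF fg] in eventually_elim, simp)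
  then have gi: "integrable lborel g" by (simp add: integrable_completion[OF g])
  obtain N where N: "N \<in> null_sets lborel" "{y. f y \<noteq> g y} \<subseteq> N"
    using fg by (auto simp: eventually_ae_filter)
  have "AE p in lborel \<Otimes>\<^sub>M lborel. snd p \<notin> N"
  proof (rule lborel_pair.AE_pair_measure)
    have e: "{p \<in> space (lborel \<Otimes>\<^sub>M lborel). snd p \<notin> N} = space lborel \<times> (space lborel - N)"
      by (auto simp: space_pair_measure)
    show "{p \<in> space (lborel \<Otimes>\<^sub>M lborel). snd p \<notin> N} \<in> sets (lborel \<Otimes>\<^sub>M lborel)"
      unfolding e by (rule pair_measureI) (use N(1) in auto)
    show "AE x in lborel. AE y in lborel. snd (x, y) \<notin> N"
      using AE_not_in[OF N(1)] by simp
  qed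
  then have ae: "AE p in lborel. p \<in> torus2 l \<longrightarrow> v (snd p) = g (snd p)"
    unfolding lborel_prod
  proof eventually_elim
    case (elim p)
    then have "f (snd p) = g (snd p)" using N(2) by blast
    then show ?case by (auto simp: f_def torus1_def torus2_def)
  qed
  define G where "G p = g (snd p)" for p :: "real \<times> real"
  have Gm: "G \<in> borel_measurable borel"
    unfolding G_def using g
    by (intro measurable_compose[OF borel_measurable_continuous_onI[OF continuous_on_snd[OF continuous_on_id]]]) auto
  have Gl: "G \<in> borel_measurable lebesgue" by (rule measurable_completion) (use Gm in simp)
  have ae': "AE p in lebesgue. p \<in> torus2 l \<longrightarrow> v (snd p) = G p"
    using AE_completion[OF ae] by (simp add: G_def)
  have vm: "(\<lambda>p. v (snd p)) \<in> borel_measurable TT"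
    by (rule lebesgue_on_measurable_AE[OF torus2_lebesgue(1) Gl ae'])
  have aeT: "AE p in TT. G p = v (snd p)"
    by (subst AE_restrict_space_iff) (use ae' in \<open>auto elim: eventually_mono\<close>)
  have prod_int: "integrable (lborel \<Otimes>\<^sub>M lborel) (\<lambda>(x, y). a x * b y)"
    if a: "integrable lborel a" and b: "integrable lborel b" for a b :: "real \<Rightarrow> complex"
  proof (rule lborel_pair.Fubini_integrable)
    show "(\<lambda>(x, y). a x * b y) \<in> borel_measurable (lborel \<Otimes>\<^sub>M lborel)"
      using a b by measurable
    show "integrable lborel (\<lambda>x. LINT y|lborel. norm (case (x, y) of (x, y) \<Rightarrow> a x * b y))"
      using a by (simp add: norm_mult)
    show "AE x in lborel. integrable lborel (\<lambda>y. case (x, y) of (x, y) \<Rightarrow> a x * b y)"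
      using b by simp
  qed
  define a where "a j x = indicator {0..<l} x *\<^sub>R cis (wavenum l j * x)" for j x
  have cism: "(\<lambda>x. cis (c * x)) \<in> borel_measurable borel" for c
    by (intro borel_measurable_continuous_onI continuous_intros)
  have ai: "integrable lborel (a j)" for j
  proof -
    have "integrable lborel (\<lambda>x. indicator {0..l} x *\<^sub>R cis (wavenum l j * x))"
      by (rule borel_integrable_compact) (auto intro!: continuous_intros)
    then show ?thesis
    proof (rule Bochner_Integration.integrable_bound)
      show "a j \<in> borel_measurable lborel"
        unfolding a_def[abs_def] using cism by (auto intro!: borel_measurable_scaleR borel_measurable_indicator)
    qed (auto simp: a_def indicator_def)
  qed
  define b where "b k y = of_real (g y) * (indicator (torus1 l) y *\<^sub>R cis (wavenum l k * y))" for k y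
  have bi: "integrable lborel (b k)" for k
  proof (rule Bochner_Integration.integrable_bound[OF gi])
    show "b k \<in> borel_measurable lborel"
      unfolding b_def[abs_def] using g cism
      by (auto intro!: borel_measurable_times borel_measurable_of_real borel_measurable_scaleR borel_measurable_indicator)
  qed (auto simp: b_def norm_mult indicator_def)
  have Gw: "(\<lambda>p. of_real (G p) * wave l n p) \<in> borel_measurable borel" for n
  proof (rule borel_measurable_times)
    show "(\<lambda>p. of_real (G p) :: complex) \<in> borel_measurable borel" using Gm by measurable
  qed (rule borel_measurable_continuous_onI[OF continuous_on_wave])
  have e: "indicator (torus2 l) p *\<^sub>R (of_real (G p) * wave l n p) = (case p of (x, y) \<Rightarrow> a (fst n) x * b (snd n) y)" for n p
    by (cases p) (auto simp: a_def b_def G_def torus2_def torus1_def wave_def indicator_def cis_mult[symmetric])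
  have "integrable TT (\<lambda>p. of_real (G p) * wave l 0 p)"
    unfolding TT_borel(1)[OF Gw] e using prod_int[OF ai bi] by (simp add: case_prod_unfold)
  then have Gi: "integrable TT (\<lambda>p. of_real (G p) :: complex)" by simp
  from integrable_Re[OF this] have "integrable TT G" by simp
  then show vi: "integrable TT (\<lambda>p. v (snd p))"
    by (rule integrable_cong_AE_imp[OF _ vm]) (use aeT in eventually_elim, simp)
  have "(LINT p|TT. of_real (G p) * wave l (- (j, k)) p) = integral\<^sup>L (lborel \<Otimes>\<^sub>M lborel) (\<lambda>(x, y). a (- j) x * b (- k) y)"
    unfolding TT_borel(2)[OF Gw] e by (simp add: case_prod_unfold)
  also have "\<dots> = (LINT y|lborel. LINT x|lborel. a (- j) x * b (- k) y)"
    by (rule lborel_pair.integral_snd[symmetric]) (use prod_int[OF ai bi] in simp)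
  also have "\<dots> = integral\<^sup>L lborel (a (- j)) * integral\<^sup>L lborel (b (- k))"
    by simp
  also have "integral\<^sup>L lborel (a (- j)) = (if j = 0 then of_real l else 0)"
    unfolding a_def integral_cis_period[OF l_pos] by simp
  also have "integral\<^sup>L lborel (b (- k)) = of_real l * fcoeff1 l v k"
  proof -
    have bm: "b (- k) \<in> borel_measurable lborel" using bi by auto
    have fm: "f \<in> borel_measurable lebesgue" using fi by auto
    have cl: "(\<lambda>y. cis (- (wavenum l k * y))) \<in> borel_measurable lebesgue"
      by (rule measurable_completion) (use cism[of "- wavenum l k"] in simp)
    have "integral\<^sup>L lborel (b (- k)) = integral\<^sup>L lebesgue (b (- k))"
      by (rule integral_completion[OF bm, symmetric])
    also have "\<dots> = (LINT y|lebesgue. of_real (f y) * cis (- (wavenum l k * y)))"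
    proof (rule integral_cong_AE)
      show "AE y in lebesgue. b (- k) y = of_real (f y) * cis (- (wavenum l k * y))"
        using AE_completion[OF fg] by eventually_elim (auto simp: b_def f_def wavenum_uminus indicator_def split: if_splits)
      show "b (- k) \<in> borel_measurable lebesgue" by (rule measurable_completion[OF bm])
      show "(\<lambda>y. of_real (f y) * cis (- (wavenum l k * y))) \<in> borel_measurable lebesgue"
        using fm cl by (intro borel_measurable_times borel_measurable_of_real) auto
    qed
    also have "\<dots> = (LINT y|lebesgue. indicator (torus1 l) y *\<^sub>R (of_real (v y) * cis (- (wavenum l k * y))))"
      by (intro Bochner_Integration.integral_cong) (auto simp: f_def indicator_def)
    also have "\<dots> = (LINT y|T1. of_real (v y) * cis (- (wavenum l k * y)))"
      by (rule integral_restrict_space[OF torus1_lebesgue(2), symmetric])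
    also have "\<dots> = of_real l * fcoeff1 l v k"
      using l_pos by (simp add: fcoeff1_def)
    finally show ?thesis .
  qed
  finally have "(LINT p|TT. of_real (G p) * wave l (- (j, k)) p) = of_real (l\<^sup>2) * (if j = 0 then fcoeff1 l v k else 0)"
    by (simp add: power2_eq_square)
  then have "fc (\<lambda>p. of_real (G p)) (j, k) = (if j = 0 then fcoeff1 l v k else 0)"
    using l_pos by (simp add: fc_def)
  moreover have "fc (\<lambda>p. of_real (G p)) (j, k) = coef (\<lambda>p. v (snd p)) (j, k)"
    unfolding coef_eq_fc
    by (rule fc_AE_cong) (use aeT Gi vm in \<open>auto elim: eventually_mono intro!: borel_measurable_of_real\<close>)
  ultimately show "coef (\<lambda>p. v (snd p)) (j, k) = (if j = 0 then fcoeff1 l v k else 0)" by simp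
qed

end

section \<open>Sobolev spaces and the zonal flow\<close>

text \<open>Sequences on the line are placed on the zonal row, so that \<open>hbound\<close> serves
  the spaces on both tori.\<close>

definition axis :: "(int \<Rightarrow> complex) \<Rightarrow> int \<times> int \<Rightarrow> complex" where
  "axis a n = (if fst n = 0 then a (snd n) else 0)"

lemma hbound_axis:
  "hbound s (axis a) B \<longleftrightarrow> 0 \<le> B \<and> (\<forall>G. finite G \<longrightarrow> (\<Sum>k\<in>G. (1 + (of_int k)\<^sup>2) powr s * (cmod (a k))\<^sup>2) \<le> B\<^sup>2)"
proof -
  have 1: "(\<Sum>n\<in>Pair 0 ` G. jap n powr s * (cmod (axis a n))\<^sup>2) = (\<Sum>k\<in>G. (1 + (of_int k)\<^sup>2) powr s * (cmod (a k))\<^sup>2)" for G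
    by (subst sum.reindex) (auto simp: inj_on_def axis_def jap_def)
  have 2: "(\<Sum>n\<in>F. jap n powr s * (cmod (axis a n))\<^sup>2) = (\<Sum>n\<in>Pair 0 ` {k. (0, k) \<in> F}. jap n powr s * (cmod (axis a n))\<^sup>2)"
    if "finite F" for F
    by (rule sum.mono_neutral_right) (use that in \<open>auto simp: axis_def\<close>)
  have fin: "finite {k. (0, k) \<in> F}" if "finite F" for F :: "(int \<times> int) set"
    by (rule finite_subset[of _ "snd ` F"]) (use that in \<open>auto intro: rev_image_eqI\<close>)
  show ?thesis
    unfolding hbound_def
  proof (intro conj_cong refl iffI allI impI)
    fix G :: "int set"
    assume h: "\<forall>F. finite F \<longrightarrow> (\<Sum>n\<in>F. jap n powr s * (cmod (axis a n))\<^sup>2) \<le> B\<^sup>2" and G: "finite G"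
    have "finite (Pair (0::int) ` G)" using G by simp
    then show "(\<Sum>k\<in>G. (1 + (of_int k)\<^sup>2) powr s * (cmod (a k))\<^sup>2) \<le> B\<^sup>2"
      using h unfolding 1[symmetric] by blast
  next
    fix F :: "(int \<times> int) set"
    assume h: "\<forall>G. finite G \<longrightarrow> (\<Sum>k\<in>G. (1 + (of_int k)\<^sup>2) powr s * (cmod (a k))\<^sup>2) \<le> B\<^sup>2" and F: "finite F"
    show "(\<Sum>n\<in>F. jap n powr s * (cmod (axis a n))\<^sup>2) \<le> B\<^sup>2"
      unfolding 2[OF F] 1 using h fin[OF F] by blast
  qed
qed

lemma hbound_iff_summable:
  "(\<exists>B. hbound s a B) \<longleftrightarrow> (\<lambda>n. jap n powr s * (cmod (a n))\<^sup>2) summable_on UNIV"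
proof
  assume "\<exists>B. hbound s a B"
  then obtain B where "hbound s a B" ..
  then show "(\<lambda>n. jap n powr s * (cmod (a n))\<^sup>2) summable_on UNIV"
    by (intro nonneg_bdd_above_summable_on) (auto simp: hbound_def bdd_above_def)
next
  assume s: "(\<lambda>n. jap n powr s * (cmod (a n))\<^sup>2) summable_on UNIV"
  show "\<exists>B. hbound s a B"
  proof (intro exI hboundI)
    fix F :: "(int \<times> int) set" assume "finite F"
    then have "(\<Sum>n\<in>F. jap n powr s * (cmod (a n))\<^sup>2) \<le> (\<Sum>\<^sub>\<infinity>n. jap n powr s * (cmod (a n))\<^sup>2)"
      using s by (intro finite_sum_le_infsum) auto
    then show "(\<Sum>n\<in>F. jap n powr s * (cmod (a n))\<^sup>2) \<le> (sqrt (\<Sum>\<^sub>\<infinity>n. jap n powr s * (cmod (a n))\<^sup>2))\<^sup>2"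
      by (simp add: infsum_nonneg)
  qed (simp add: infsum_nonneg)
qed

context torus
begin

lemma sobolev2_iff: "f \<in> sobolev2 l s \<longleftrightarrow> sq_integrable (torus2 l) f \<and> (\<exists>B. hbound s (coef f) B)"
  by (simp add: sobolev2_def hbound_iff_summable jap_def coef_def case_prod_unfold)

lemma sobolev2_norm_le:
  assumes "hbound s (coef f) B"
  shows "sobolev2_norm l s f \<le> B"
proof -
  have s: "(\<lambda>n. jap n powr s * (cmod (coef f n))\<^sup>2) summable_on UNIV"
    using assms hbound_iff_summable by blast
  have "(\<Sum>\<^sub>\<infinity>n. jap n powr s * (cmod (coef f n))\<^sup>2) \<le> B\<^sup>2"
    by (rule infsum_le_finite_sums[OF s]) (use assms in \<open>auto simp: hbound_def\<close>)
  then have "sqrt (\<Sum>\<^sub>\<infinity>n. jap n powr s * (cmod (coef f n))\<^sup>2) \<le> B"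
    using hbound_nonneg[OF assms] by (intro real_le_lsqrt) auto
  then show ?thesis by (simp add: sobolev2_norm_def jap_def coef_def case_prod_unfold)
qed

lemma hbound_sobolev2:
  assumes "f \<in> sobolev2 l s"
  shows "hbound s (coef f) (sobolev2_norm l s f)"
proof -
  have s: "(\<lambda>n. jap n powr s * (cmod (coef f n))\<^sup>2) summable_on UNIV"
    using assms hbound_iff_summable by (auto simp: sobolev2_iff)
  have e: "sobolev2_norm l s f = sqrt (\<Sum>\<^sub>\<infinity>n. jap n powr s * (cmod (coef f n))\<^sup>2)"
    by (simp add: sobolev2_norm_def jap_def coef_def case_prod_unfold)
  show ?thesis
    unfolding e
  proof (rule hboundI)
    fix F :: "(int \<times> int) set" assume "finite F"
    then have "(\<Sum>n\<in>F. jap n powr s * (cmod (coef f n))\<^sup>2) \<le> (\<Sum>\<^sub>\<infinity>n. jap n powr s * (cmod (coef f n))\<^sup>2)"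
      using s by (intro finite_sum_le_infsum) auto
    then show "(\<Sum>n\<in>F. jap n powr s * (cmod (coef f n))\<^sup>2) \<le> (sqrt (\<Sum>\<^sub>\<infinity>n. jap n powr s * (cmod (coef f n))\<^sup>2))\<^sup>2"
      by (simp add: infsum_nonneg)
  qed (simp add: infsum_nonneg)
qed

lemma sobolev1_summable:
  assumes "hbound s (axis (fcoeff1 l f)) B"
  shows "(\<lambda>k. (1 + (of_int k)\<^sup>2) powr s * (cmod (fcoeff1 l f k))\<^sup>2) summable_on UNIV"
  using assms by (intro nonneg_bdd_above_summable_on) (auto simp: hbound_axis bdd_above_def)

lemma hbound_sobolev1:
  assumes "f \<in> sobolev1 l s"
  shows "hbound s (axis (fcoeff1 l f)) (sobolev1_norm l s f)"
  unfolding hbound_axis sobolev1_norm_def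
proof (intro conjI allI impI)
  have s: "(\<lambda>k. (1 + (of_int k)\<^sup>2) powr s * (cmod (fcoeff1 l f k))\<^sup>2) summable_on UNIV"
    using assms by (simp add: sobolev1_def)
  fix G :: "int set" assume "finite G"
  then have "(\<Sum>k\<in>G. (1 + (of_int k)\<^sup>2) powr s * (cmod (fcoeff1 l f k))\<^sup>2) \<le> (\<Sum>\<^sub>\<infinity>k. (1 + (of_int k)\<^sup>2) powr s * (cmod (fcoeff1 l f k))\<^sup>2)"
    using s by (intro finite_sum_le_infsum) auto
  then show "(\<Sum>k\<in>G. (1 + (of_int k)\<^sup>2) powr s * (cmod (fcoeff1 l f k))\<^sup>2) \<le> (sqrt (\<Sum>\<^sub>\<infinity>k. (1 + (of_int k)\<^sup>2) powr s * (cmod (fcoeff1 l f k))\<^sup>2))\<^sup>2"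
    by (simp add: infsum_nonneg)
qed (simp add: infsum_nonneg)

lemma sobolev1_iff: "f \<in> sobolev1 l s \<longleftrightarrow> sq_integrable (torus1 l) f \<and> (\<exists>B. hbound s (axis (fcoeff1 l f)) B)"
  using hbound_sobolev1 sobolev1_summable by (auto simp: sobolev1_def)

lemma sobolev1_norm_le:
  assumes "hbound s (axis (fcoeff1 l f)) B"
  shows "sobolev1_norm l s f \<le> B"
proof -
  have "(\<Sum>\<^sub>\<infinity>k. (1 + (of_int k)\<^sup>2) powr s * (cmod (fcoeff1 l f k))\<^sup>2) \<le> B\<^sup>2"
    by (rule infsum_le_finite_sums[OF sobolev1_summable[OF assms]]) (use assms in \<open>auto simp: hbound_axis\<close>)
  then show ?thesis
    unfolding sobolev1_norm_def using hbound_nonneg[OF assms] by (intro real_le_lsqrt) auto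
qed

lemma sq_integrable_T1: "sq_integrable (torus1 l) f \<longleftrightarrow> f \<in> borel_measurable T1 \<and> integrable T1 (\<lambda>y. (f y)\<^sup>2)"
  by (simp add: sq_integrable_def)

lemma sq_integrable_imp_integrable1:
  assumes "sq_integrable (torus1 l) f"
  shows "integrable T1 f"
proof (rule Bochner_Integration.integrable_bound)
  show "integrable T1 (\<lambda>p. 1 + (f p)\<^sup>2)"
    using assms Bochner_Integration.integrable_add[OF finite_measure.integrable_const[OF finite_measure_T1, of "1::real"], of "\<lambda>p. (f p)\<^sup>2"]
    by (simp add: sq_integrable_T1)
  have "\<bar>x\<bar> \<le> 1 + x\<^sup>2" for x :: real
  proof -
    have "2 * \<bar>x\<bar> \<le> x\<^sup>2 + 1"
      using zero_le_power2[of "\<bar>x\<bar> - 1"] by (simp add: power2_diff)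
    then show ?thesis by linarith
  qed
  then show "AE p in T1. norm (f p) \<le> norm (1 + (f p)\<^sup>2)" by simp
qed (use assms in \<open>simp add: sq_integrable_T1\<close>)

lemma sq_integrable_snd:
  assumes "sq_integrable (torus1 l) v"
  shows "sq_integrable (torus2 l) (\<lambda>p. v (snd p))"
  using integrable_snd_TT(1)[OF sq_integrable_imp_integrable1[OF assms]]
    integrable_snd_TT(1)[of "\<lambda>y. (v y)\<^sup>2"] assms
  by (auto simp: sq_integrable_TT sq_integrable_T1)

lemma coef_snd:
  assumes "integrable T1 v"
  shows "coef (\<lambda>p. v (snd p)) = axis (fcoeff1 l v)"
proof
  fix n show "coef (\<lambda>p. v (snd p)) n = axis (fcoeff1 l v) n"
    using integrable_snd_TT(2)[OF assms, of "fst n" "snd n"] by (simp add: axis_def)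
qed

lemma fcoeff1_unique:
  assumes v: "integrable T1 v" and w: "integrable T1 w" and eq: "\<And>k. fcoeff1 l v k = fcoeff1 l w k"
  shows "AE y in T1. v y = w y"
proof -
  have "AE p in TT. v (snd p) = w (snd p)"
    by (intro coef_unique integrable_snd_TT v w) (simp add: coef_snd v w axis_def eq)
  then have "AE p in lebesgue. p \<in> torus2 l \<longrightarrow> v (snd p) = w (snd p)"
    by (simp add: AE_restrict_space_iff)
  then have "AE p in lborel \<Otimes>\<^sub>M lborel. p \<in> torus2 l \<longrightarrow> v (snd p) = w (snd p)"
    unfolding AE_completion_iff lborel_prod .
  from lborel_pair.AE_pair[OF this]
  have ae: "AE x in lborel. AE y in lborel. (x, y) \<in> torus2 l \<longrightarrow> v y = w y" by simp
  have "AE y in lborel. y \<in> torus1 l \<longrightarrow> v y = w y"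
  \<comment> \<open>If the claim failed, almost no \<open>x\<close> could lie in the cell, whose
    measure is the positive number \<open>l\<close>.\<close>
  proof (rule ccontr)
    assume contra: "\<not> (AE y in lborel. y \<in> torus1 l \<longrightarrow> v y = w y)"
    have "AE x in lborel. x \<notin> {0..<l}"
      using ae
    proof eventually_elim
      case (elim x)
      show ?case
      proof
        assume x: "x \<in> {0..<l}"
        from elim have "AE y in lborel. y \<in> torus1 l \<longrightarrow> v y = w y"
          by eventually_elim (use x in \<open>auto simp: torus2_def torus1_def\<close>)
        with contra show False ..
      qed
    qed
    then have "emeasure lborel {0..<l} = 0"
      by (subst (asm) AE_iff_measurable[of "{0..<l}"]) auto
    then show False using l_pos by simp
  qed
  then have "AE y in lebesgue. y \<in> torus1 l \<longrightarrow> v y = w y" by (rule AE_completion)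
  then show ?thesis by (simp add: AE_restrict_space_iff)
qed

lemma zero_zonal_mean_iff:
  assumes f: "integrable TT f"
  shows "zero_zonal_mean l f \<longleftrightarrow> (\<forall>k. coef f (0, k) = 0)"
proof -
  note z = zonal_coef[OF f]
  have z0: "fcoeff1 l (\<lambda>_. 0) k = 0" for k by (simp add: fcoeff1_def)
  show ?thesis
  proof
    assume "zero_zonal_mean l f"
    then have ae: "AE y in T1. zonal_mean l f y = 0" by (simp add: zero_zonal_mean_def)
    show "\<forall>k. coef f (0, k) = 0"
    proof
      fix k
      have "(LINT y|T1. of_real (zonal_mean l f y) * cis (- (wavenum l k * y))) = (LINT y|T1. 0)"
      proof (rule integral_cong_AE)
        have "(\<lambda>y. cis (- (wavenum l k * y))) \<in> borel_measurable borel"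
          by (intro borel_measurable_continuous_onI continuous_intros)
        then have "(\<lambda>y. cis (- (wavenum l k * y))) \<in> borel_measurable T1"
          by (intro measurable_restrict_space1 measurable_completion) simp
        then show "(\<lambda>y. of_real (zonal_mean l f y) * cis (- (wavenum l k * y))) \<in> borel_measurable T1"
          using z(1) by (intro borel_measurable_times borel_measurable_of_real) auto
        show "AE y in T1. of_real (zonal_mean l f y) * cis (- (wavenum l k * y)) = 0"
          using ae by eventually_elim simp
      qed simp
      then show "coef f (0, k) = 0" unfolding z(2)[symmetric] fcoeff1_def by simp
    qed
  next
    assume "\<forall>k. coef f (0, k) = 0"
    then have "AE y in T1. zonal_mean l f y = 0"
      by (intro fcoeff1_unique[where w="\<lambda>_. 0"] z) (auto simp: z z0)
    then show "zero_zonal_mean l f" by (simp add: zero_zonal_mean_def)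
  qed
qed

text \<open>The zonal mean of the plane function with these coefficients. Its lift agrees with that
  function almost everywhere and is therefore square-integrable; taking the zonal mean of the lifted
  square brings this back to the line.\<close>

lemma riesz_fischer1:
  assumes b: "hermitian (axis a)" "hbound 0 (axis a) B"
  shows "\<exists>u. sq_integrable (torus1 l) u \<and> (\<forall>k. fcoeff1 l u k = a k)"
proof -
  obtain g where g: "sq_integrable (torus2 l) g" "coef g = axis a"
    using riesz_fischer[OF b] by blast
  note gi = sq_integrable_imp_integrable[OF g(1)]
  define u where "u = zonal_mean l g"
  have ui: "integrable T1 u" and uc: "fcoeff1 l u k = a k" for k
    using zonal_coef[OF gi] by (auto simp: u_def g(2) axis_def)
  have ae: "AE p in TT. u (snd p) = g p"
    by (intro coef_unique integrable_snd_TT ui gi) (simp add: coef_snd ui g(2) axis_def uc)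
  have um: "(\<lambda>p. u (snd p)) \<in> borel_measurable TT" using integrable_snd_TT(1)[OF ui] by auto
  have "integrable TT (\<lambda>p. (u (snd p))\<^sup>2)"
  proof (rule integrable_cong_AE_imp)
    show "integrable TT (\<lambda>p. (g p)\<^sup>2)" using g(1) by (simp add: sq_integrable_TT)
    show "(\<lambda>p. (u (snd p))\<^sup>2) \<in> borel_measurable TT" using um by measurable
    show "AE p in TT. (g p)\<^sup>2 = (u (snd p))\<^sup>2" using ae by eventually_elim simp
  qed
  moreover have "zonal_mean l (\<lambda>p. (u (snd p))\<^sup>2) = (\<lambda>y. (u y)\<^sup>2)"
    by (rule ext, rule zonal_mean_const)
  ultimately have "integrable T1 (\<lambda>y. (u y)\<^sup>2)"
    using zonal_coef(1)[of "\<lambda>p. (u (snd p))\<^sup>2"] by simp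
  then have "sq_integrable (torus1 l) u" using ui by (auto simp: sq_integrable_T1)
  with uc show ?thesis by blast
qed

end

text \<open>Lebesgue measure is complete, so measurability, too, passes along equality almost
  everywhere. In this way the integrands of the Duhamel identities are exchanged for those of the
  mild equation.\<close>

lemma set_integral_AE_cong:
  fixes f g :: "real \<Rightarrow> complex"
  assumes ae: "AE r in lebesgue. r \<in> S \<longrightarrow> f r = g r"
  shows "set_integrable lebesgue S f \<longleftrightarrow> set_integrable lebesgue S g"
    and "(LINT r:S|lebesgue. f r) = (LINT r:S|lebesgue. g r)"
proof -
  have *: "integrable lebesgue (\<lambda>r. indicator S r *\<^sub>R q r) \<and>
      (LINT r|lebesgue. indicator S r *\<^sub>R q r) = (LINT r|lebesgue. indicator S r *\<^sub>R p r)"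
    if p: "integrable lebesgue (\<lambda>r. indicator S r *\<^sub>R p r)" and pq: "AE r in lebesgue. r \<in> S \<longrightarrow> p r = q r" for p q :: "real \<Rightarrow> complex"
  proof -
    have ae': "AE r in lebesgue. indicator S r *\<^sub>R q r = indicator S r *\<^sub>R p r"
      using pq by eventually_elim (auto simp: indicator_def)
    have qm: "(\<lambda>r. indicator S r *\<^sub>R q r) \<in> borel_measurable lebesgue"
      by (rule lebesgue_measurable_AE[OF borel_measurable_integrable[OF p] ae'])
    have "integrable lebesgue (\<lambda>r. indicator S r *\<^sub>R q r)"
      by (rule integrable_cong_AE_imp[OF p qm]) (use ae' in eventually_elim, rule sym)
    moreover have "(LINT r|lebesgue. indicator S r *\<^sub>R q r) = (LINT r|lebesgue. indicator S r *\<^sub>R p r)"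
      by (rule integral_cong_AE[OF qm borel_measurable_integrable[OF p] ae'])
    ultimately show ?thesis ..
  qed
  have ae2: "AE r in lebesgue. r \<in> S \<longrightarrow> g r = f r" using ae by eventually_elim auto
  show iff: "set_integrable lebesgue S f \<longleftrightarrow> set_integrable lebesgue S g"
    unfolding set_integrable_def using *[OF _ ae] *[OF _ ae2] by blast
  show "(LINT r:S|lebesgue. f r) = (LINT r:S|lebesgue. g r)"
  proof (cases "set_integrable lebesgue S f")
    case True
    then show ?thesis
      unfolding set_integrable_def set_lebesgue_integral_def using *[OF _ ae] by simp
  next
    \<comment> \<open>Neither side is integrable, and both integrals are 0 by convention.\<close>
    case False
    with iff show ?thesis
      unfolding set_integrable_def set_lebesgue_integral_def by (simp add: not_integrable_integral_eq)
  qed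
qed

lemma hbound_nonzonal: "hbound \<sigma> a A \<Longrightarrow> hbound \<sigma> (nonzonal a) A"
  by (erule hbound_cmod_le) (simp add: nonzonal_def)

lemma hermitian_add: "hermitian a \<Longrightarrow> hermitian b \<Longrightarrow> hermitian (\<lambda>n. a n + b n)"
  by (simp add: hermitian_def del: split_paired_All)

lemma hermitian_nonzonal: "hermitian a \<Longrightarrow> hermitian (nonzonal a)"
  by (simp add: hermitian_def nonzonal_def del: split_paired_All)

section \<open>The nonlinearities in terms of Fourier coefficients\<close>

context torus
begin

text \<open>The \<open>\<kappa>\<close> at which \<open>kern\<close> is used.\<close>

definition wave_unit :: real where "wave_unit = 2 * pi / l"

lemma wave_unit_pos: "wave_unit > 0"
  using l_pos by (simp add: wave_unit_def)

lemma wavenum_eq: "wavenum l k = wave_unit * of_int k"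
  by (simp add: wavenum_def wave_unit_def)

lemma lap_symbol_eq: "lap_symbol l (fst n) (snd n) = - (wave_unit\<^sup>2 * (jap n - 1))"
  by (simp add: lap_symbol_def wavenum_eq jap_def power_mult_distrib algebra_simps)

lemma inv_lap_symbol_eq: "inv_lap_symbol l (fst n) (snd n) = - (1 / (wave_unit\<^sup>2 * (jap n - 1)))"
  by (simp add: inv_lap_symbol_def lap_symbol_eq inverse_eq_divide)

text \<open>Riesz--Fischer supplies a function with the prescribed coefficients, which gives the
  choice in \<open>fourier_mult\<close> its meaning.\<close>

lemma fourier_mult_bounded:
  assumes f: "sq_integrable (torus2 l) f"
    and m: "\<And>n. m (- fst n) (- snd n) = cnj (m (fst n) (snd n))" "\<And>n. cmod (m (fst n) (snd n)) \<le> C"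
  shows "sq_integrable (torus2 l) (fourier_mult l m f)"
    and "coef (fourier_mult l m f) n = m (fst n) (snd n) * coef f n"
proof -
  define b where "b n = m (fst n) (snd n) * coef f n" for n
  have "hermitian b"
    using coef_hermitian[of f] m(1) by (simp add: b_def hermitian_def del: split_paired_All)
  moreover have "hbound 0 b (cmod (of_real C) * (sqrt (LINT p|TT. (f p)\<^sup>2) / l))"
  proof (rule hbound_cmod_le[OF hbound_cmult[OF coef_hbound[OF f]]])
    fix n
    have "0 \<le> C" using m(2)[of n] norm_ge_zero order_trans by blast
    then show "cmod (b n) \<le> cmod (of_real C * coef f n)"
      using m(2)[of n] by (simp add: b_def norm_mult mult_right_mono)
  qed
  ultimately obtain g where g: "sq_integrable (torus2 l) g" "coef g = b"
    using riesz_fischer by blast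
  have "fcoeff2 l g j k = m j k * fcoeff2 l f j k" for j k
    using fun_cong[OF g(2), of "(j, k)"] by (simp add: coef_def b_def)
  with g(1) have "\<exists>g. sq_integrable (torus2 l) g \<and> (\<forall>j k. fcoeff2 l g j k = m j k * fcoeff2 l f j k)" by blast
  from someI_ex[OF this]
  show "sq_integrable (torus2 l) (fourier_mult l m f)" "coef (fourier_mult l m f) n = m (fst n) (snd n) * coef f n"
    unfolding fourier_mult_def coef_def by blast+
qed

lemma jap_int_bounds:
  "of_int \<bar>fst n\<bar> \<le> jap n - 1" "of_int \<bar>snd n\<bar> \<le> jap n - 1" "jap n \<noteq> 1 \<Longrightarrow> 1 \<le> jap n - 1"
proof -
  have sq: "(of_int \<bar>i\<bar> :: real) \<le> (of_int i)\<^sup>2" for i :: int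
  proof -
    have "\<bar>i\<bar> \<le> \<bar>i\<bar>\<^sup>2"
    proof (cases "i = 0")
      case False
      then have "\<bar>i\<bar> * 1 \<le> \<bar>i\<bar> * \<bar>i\<bar>" by (intro mult_left_mono) auto
      then show ?thesis unfolding power2_eq_square by simp
    qed simp
    then have "(of_int \<bar>i\<bar> :: real) \<le> of_int (\<bar>i\<bar>\<^sup>2)" by (simp only: of_int_le_iff)
    then show ?thesis by simp
  qed
  show "of_int \<bar>fst n\<bar> \<le> jap n - 1" using sq[of "fst n"] by (simp add: jap_def add_increasing2)
  show "of_int \<bar>snd n\<bar> \<le> jap n - 1" using sq[of "snd n"] by (simp add: jap_def add_increasing)
  assume "jap n \<noteq> 1"
  moreover have e: "jap n - 1 = of_int ((fst n)\<^sup>2 + (snd n)\<^sup>2)" by (simp add: jap_def)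
  ultimately have "(fst n)\<^sup>2 + (snd n)\<^sup>2 \<noteq> 0" by auto
  then have "1 \<le> (fst n)\<^sup>2 + (snd n)\<^sup>2"
    by (smt (verit) zero_le_power2)
  then show "1 \<le> jap n - 1" unfolding e by linarith
qed

text \<open>The derivatives alone have unbounded symbols, but after \<open>inv_lap\<close> the
  combined symbol is at most \<open>1 / wave_unit\<close>; so the functions are produced from the
  combined symbol. At the mode 0 the quotient is a division by 0, hence 0, in agreement with
  \<open>inv_lap_symbol\<close>.\<close>

lemma stream_function:
  assumes f: "sq_integrable (torus2 l) f"
  shows "sq_integrable (torus2 l) (inv_lap l f)"
    and "sq_integrable (torus2 l) (deriv_x l (inv_lap l f))"
    and "sq_integrable (torus2 l) (deriv_y l (inv_lap l f))"
    and "coef (deriv_x l (inv_lap l f)) n = - (\<i> * of_real (of_int (fst n) / (wave_unit * (jap n - 1)))) * coef f n"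
    and "coef (deriv_y l (inv_lap l f)) n = - (\<i> * of_real (of_int (snd n) / (wave_unit * (jap n - 1)))) * coef f n"
proof -
  note k = wave_unit_pos
  define C where "C = 1 / wave_unit\<^sup>2"
  have C: "C > 0" using k by (simp add: C_def)
  have inv_le: "\<bar>inv_lap_symbol l (fst n) (snd n)\<bar> \<le> C" for n
  proof (cases "jap n = 1")
    case False
    then have "1 \<le> jap n - 1" by (rule jap_int_bounds)
    then have "wave_unit\<^sup>2 * 1 \<le> wave_unit\<^sup>2 * (jap n - 1)" by (intro mult_left_mono) auto
    then show ?thesis using k by (simp add: inv_lap_symbol_eq C_def frac_le)
  qed (use C in \<open>simp add: inv_lap_symbol_eq\<close>)
  have inv_even: "inv_lap_symbol l (- j) (- i) = inv_lap_symbol l j i" for j i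
    by (simp add: inv_lap_symbol_def lap_symbol_def wavenum_uminus)
  have \<psi>: "sq_integrable (torus2 l) (inv_lap l f)"
    "coef (inv_lap l f) n = of_real (inv_lap_symbol l (fst n) (snd n)) * coef f n" for n
    unfolding inv_lap_def by (rule fourier_mult_bounded[OF f, of _ C]; use inv_le inv_even in simp)+
  show "sq_integrable (torus2 l) (inv_lap l f)" by (rule \<psi>)
  have deriv: "sq_integrable (torus2 l) (fourier_mult l m (inv_lap l f)) \<and>
      coef (fourier_mult l m (inv_lap l f)) n = - (\<i> * of_real (of_int (c n) / (wave_unit * (jap n - 1)))) * coef f n"
    if m: "m = (\<lambda>j i. \<i> * of_real (wavenum l (c (j, i))))" and odd: "\<And>n. c (- n) = - c n"
      and c_le: "\<And>n. of_int \<bar>c n\<bar> \<le> jap n - 1" for m c n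
  proof -
    define b where "b n = \<i> * of_real (wavenum l (c n)) * (of_real (inv_lap_symbol l (fst n) (snd n)) * coef f n)" for n
    have b_eq: "b n = - (\<i> * of_real (of_int (c n) / (wave_unit * (jap n - 1)))) * coef f n" for n
    proof -
      have "wavenum l (c n) * inv_lap_symbol l (fst n) (snd n) = - (of_int (c n) / (wave_unit * (jap n - 1)))"
        using k by (simp add: wavenum_eq inv_lap_symbol_eq power2_eq_square)
      then have "(of_real (wavenum l (c n)) * of_real (inv_lap_symbol l (fst n) (snd n)) :: complex) = - of_real (of_int (c n) / (wave_unit * (jap n - 1)))"
        by (simp only: of_real_mult[symmetric] of_real_minus[symmetric])
      then show ?thesis unfolding b_def by (simp only: mult.assoc[symmetric]) (simp add: mult.assoc)
    qed
    have bh: "hermitian b"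
    proof -
      have "b (- n) = cnj (b n)" for n
        using coef_hermitian[of f] odd[of n]
        unfolding b_def by (simp add: wavenum_uminus inv_even hermitian_def del: split_paired_All)
      then show ?thesis by (simp add: hermitian_def del: split_paired_All)
    qed
    have bb: "hbound 0 b (cmod (of_real (1 / wave_unit)) * (sqrt (LINT p|TT. (f p)\<^sup>2) / l))"
    proof (rule hbound_cmod_le[OF hbound_cmult[OF coef_hbound[OF f]]])
      fix n
      have "of_int \<bar>c n\<bar> / (wave_unit * (jap n - 1)) \<le> 1 / wave_unit"
      proof (cases "jap n = 1")
        case False
        then have "1 \<le> jap n - 1" by (rule jap_int_bounds)
        then show ?thesis using k c_le[of n] by (simp add: divide_simps)
      qed (use k in simp)
      moreover have "cmod (b n) = of_int \<bar>c n\<bar> / (wave_unit * (jap n - 1)) * cmod (coef f n)"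
        using k jap_ge_1[of n] unfolding b_eq norm_mult norm_minus_cancel norm_of_real by simp
      moreover have "cmod (of_real (1 / wave_unit) * coef f n) = 1 / wave_unit * cmod (coef f n)"
        unfolding norm_mult norm_of_real using k by simp
      ultimately show "cmod (b n) \<le> cmod (of_real (1 / wave_unit) * coef f n)"
        by (metis mult_right_mono norm_ge_zero)
    qed
    obtain g where g: "sq_integrable (torus2 l) g" "coef g = b"
      using riesz_fischer[OF bh bb] by blast
    have "fcoeff2 l g j i = m j i * fcoeff2 l (inv_lap l f) j i" for j i
      using fun_cong[OF g(2), of "(j, i)"] \<psi>(2)[of "(j, i)"] by (simp add: coef_def b_def m)
    with g(1) have "\<exists>g. sq_integrable (torus2 l) g \<and> (\<forall>j i. fcoeff2 l g j i = m j i * fcoeff2 l (inv_lap l f) j i)" by blast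
    from someI_ex[OF this]
    have 1: "sq_integrable (torus2 l) (fourier_mult l m (inv_lap l f))"
      "coef (fourier_mult l m (inv_lap l f)) n = m (fst n) (snd n) * coef (inv_lap l f) n"
      unfolding fourier_mult_def coef_def by blast+
    moreover have "m (fst n) (snd n) * coef (inv_lap l f) n = b n"
      unfolding \<psi>(2) b_def m by simp
    ultimately show ?thesis unfolding b_eq by simp
  qed
  show "sq_integrable (torus2 l) (deriv_x l (inv_lap l f))"
    "coef (deriv_x l (inv_lap l f)) n = - (\<i> * of_real (of_int (fst n) / (wave_unit * (jap n - 1)))) * coef f n"
    unfolding deriv_x_def using deriv[where c=fst, OF _ _ jap_int_bounds(1)] by simp_all
  show "sq_integrable (torus2 l) (deriv_y l (inv_lap l f))"
    "coef (deriv_y l (inv_lap l f)) n = - (\<i> * of_real (of_int (snd n) / (wave_unit * (jap n - 1)))) * coef f n"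
    unfolding deriv_y_def using deriv[where c=snd, OF _ _ jap_int_bounds(2)] by simp_all
qed

definition state :: "(real \<Rightarrow> real) \<Rightarrow> (real \<times> real \<Rightarrow> real) \<Rightarrow> int \<times> int \<Rightarrow> complex" where
  "state u \<zeta> n = (if fst n = 0 then fcoeff1 l u (snd n) else coef \<zeta> n)"

text \<open>Enough for the products in both nonlinearities to be integrable and for
  \<open>state\<close> to determine the pair up to null sets.\<close>

definition admissible :: "(real \<Rightarrow> real) \<Rightarrow> (real \<times> real \<Rightarrow> real) \<Rightarrow> bool" where
  "admissible u \<zeta> \<longleftrightarrow> sq_integrable (torus1 l) u \<and> sq_integrable (torus2 l) \<zeta> \<and> zero_zonal_mean l \<zeta>"

lemma state_split: "state u \<zeta> = (\<lambda>n. axis (fcoeff1 l u) n + nonzonal (coef \<zeta>) n)"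
  by (auto simp: state_def axis_def nonzonal_def)

lemma admissible_coef:
  assumes "admissible u \<zeta>"
  shows "coef \<zeta> n = nonzonal (state u \<zeta>) n"
proof -
  have "coef \<zeta> (0, k) = 0" for k
    using assms zero_zonal_mean_iff[OF sq_integrable_imp_integrable] by (auto simp: admissible_def)
  then show ?thesis by (cases n) (auto simp: nonzonal_def state_def)
qed

text \<open>On the row \<open>j = 0\<close> the x-derivatives vanish and the zonal mean cancels the
  remaining advection term. Elsewhere the three products are convolutions, compared with
  \<open>kern\<close> mode by mode; where \<open>fst n = fst m\<close> the second factor is a zonal
  mode of the vorticity, which is 0.\<close>

lemma F_coeff_eq:
  assumes adm: "admissible u \<zeta>"
  shows "F_coeff l u \<zeta> j k = (if j = 0 then 0 else nonlin wave_unit (state u \<zeta>) (state u \<zeta>) (j, k))"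
proof -
  have u: "sq_integrable (torus1 l) u" and z: "sq_integrable (torus2 l) \<zeta>"
    using adm by (auto simp: admissible_def)
  define \<psi>x where "\<psi>x = deriv_x l (inv_lap l \<zeta>)"
  define \<psi>y where "\<psi>y = deriv_y l (inv_lap l \<zeta>)"
  define w where "w p = u (snd p)" for p :: "real \<times> real"
  note \<psi> = stream_function[OF z, folded \<psi>x_def \<psi>y_def]
  have w: "sq_integrable (torus2 l) w" unfolding w_def by (rule sq_integrable_snd[OF u])
  have wc: "coef w = axis (fcoeff1 l u)" unfolding w_def by (rule coef_snd[OF sq_integrable_imp_integrable1[OF u]])
  define n where "n = (j, k)"
  define dx :: complex where "dx = \<i> * of_real (wavenum l j)"
  define dy :: complex where "dy = \<i> * of_real (wavenum l k)"
  have F: "F_coeff l u \<zeta> j k = dx * coef (\<lambda>p. \<psi>y p * \<zeta> p) n - dy * coef (\<lambda>p. \<psi>x p * \<zeta> p) n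
     - dx * coef (\<lambda>p. w p * \<zeta> p) n + dy * coef (\<lambda>p. zonal_mean l (\<lambda>q. \<psi>x q * \<zeta> q) (snd p)) n"
    by (simp add: F_coeff_def Let_def coef_def n_def dx_def dy_def w_def \<psi>x_def \<psi>y_def)
  note zi = zonal_coef[OF sq_integrable_mult[OF \<psi>(2) z]]
  have zon: "coef (\<lambda>p. zonal_mean l (\<lambda>q. \<psi>x q * \<zeta> q) (snd p)) n = (if j = 0 then coef (\<lambda>p. \<psi>x p * \<zeta> p) n else 0)"
    unfolding coef_snd[OF zi(1)] by (simp add: axis_def n_def zi(2))
  show ?thesis
  proof (cases "j = 0")
    case True
    then have "dx = 0" by (simp add: dx_def wavenum_def)
    then show ?thesis unfolding F zon using True by simp
  next
    case False
    define c where "c = state u \<zeta>"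
    have cz: "coef \<zeta> m = (if fst m = 0 then 0 else c m)" for m
      unfolding admissible_coef[OF adm] by (simp add: nonzonal_def c_def)
    have s: "(\<lambda>m. coef f m * coef \<zeta> (n - m)) summable_on UNIV" if f: "sq_integrable (torus2 l) f" for f
    proof -
      have "(\<lambda>m. norm (coef f m * coef \<zeta> (n - m))) summable_on UNIV"
        unfolding norm_mult by (rule convolution_abs_summable(1)[OF coef_hbound[OF f] coef_hbound[OF z]])
      then show ?thesis by (rule Infinite_Sum.abs_summable_summable)
    qed
    note sa = summable_on_cmult_right[OF s[OF \<psi>(3)], of dx] and sb = summable_on_cmult_right[OF s[OF \<psi>(2)], of "- dy"]
      and sc = summable_on_cmult_right[OF s[OF w], of "- dx"]
    have "F_coeff l u \<zeta> j k = dx * (\<Sum>\<^sub>\<infinity>m. coef \<psi>y m * coef \<zeta> (n - m)) - dy * (\<Sum>\<^sub>\<infinity>m. coef \<psi>x m * coef \<zeta> (n - m))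
       - dx * (\<Sum>\<^sub>\<infinity>m. coef w m * coef \<zeta> (n - m))"
      unfolding F zon coef_mult[OF \<psi>(3) z] coef_mult[OF \<psi>(2) z] coef_mult[OF w z] using False by simp
    also have "\<dots> = dx * (\<Sum>\<^sub>\<infinity>m. coef \<psi>y m * coef \<zeta> (n - m)) + (- dy) * (\<Sum>\<^sub>\<infinity>m. coef \<psi>x m * coef \<zeta> (n - m))
       + (- dx) * (\<Sum>\<^sub>\<infinity>m. coef w m * coef \<zeta> (n - m))"
      by simp
    also have "\<dots> = (\<Sum>\<^sub>\<infinity>m. dx * (coef \<psi>y m * coef \<zeta> (n - m)) + (- dy) * (coef \<psi>x m * coef \<zeta> (n - m)) + (- dx) * (coef w m * coef \<zeta> (n - m)))"
      by (simp only: infsum_add[OF summable_on_add[OF sa sb] sc] infsum_add[OF sa sb] infsum_cmult_right')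
    also have "\<dots> = (\<Sum>\<^sub>\<infinity>m. dx * (coef \<psi>y m * coef \<zeta> (n - m)) - dy * (coef \<psi>x m * coef \<zeta> (n - m)) - dx * (coef w m * coef \<zeta> (n - m)))"
      by simp
    also have "\<dots> = nonlin wave_unit c c n"
      unfolding nonlin_def
    proof (rule infsum_cong)
      fix m
      define \<kappa> where "\<kappa> = wave_unit"
      have \<kappa>: "\<kappa> \<noteq> 0" using wave_unit_pos by (simp add: \<kappa>_def)
      have d: "dx = \<i> * of_real (\<kappa> * of_int (fst n))" "dy = \<i> * of_real (\<kappa> * of_int (snd n))"
        by (simp_all add: dx_def dy_def wavenum_eq n_def \<kappa>_def)
      show "dx * (coef \<psi>y m * coef \<zeta> (n - m)) - dy * (coef \<psi>x m * coef \<zeta> (n - m)) - dx * (coef w m * coef \<zeta> (n - m))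
         = kern wave_unit n m * c m * c (n - m)"
      proof (cases "fst n = fst m")
        case True
        then have "coef \<zeta> (n - m) = 0" by (simp add: cz)
        then show ?thesis using True by (simp add: kern_def)
      next
        case nm: False
        then have zc: "coef \<zeta> (n - m) = c (n - m)" by (simp add: cz)
        show ?thesis
        proof (cases "fst m = 0")
          case True
          then have "coef \<zeta> m = 0" by (simp add: cz)
          then have "coef \<psi>x m = 0" "coef \<psi>y m = 0" unfolding \<psi>(4,5) by simp_all
          moreover have "coef w m = c m" using True by (simp add: wc axis_def c_def state_def)
          ultimately show ?thesis using True nm zc by (simp add: kern_def d \<kappa>_def)
        next
          case m0: False
          have n0: "fst n \<noteq> 0" using False by (simp add: n_def)
          have w0: "coef w m = 0" using m0 by (simp add: wc axis_def)
          have zm: "coef \<zeta> m = c m" using m0 by (simp add: cz)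
          define q where "q = jap m - 1"
          have "of_real (\<kappa> * of_int (fst n)) * of_real (of_int (snd m) / (\<kappa> * q)) - of_real (\<kappa> * of_int (snd n)) * of_real (of_int (fst m) / (\<kappa> * q))
             = (of_real (of_int (fst n * snd m - snd n * fst m) / q) :: complex)"
            unfolding of_real_mult[symmetric] of_real_diff[symmetric]
            using \<kappa> by (intro arg_cong[where f=of_real]) (simp add: diff_divide_distrib)
          moreover have "kern wave_unit n m = of_real (of_int (fst n * snd m - snd n * fst m) / q)"
            using nm m0 n0 by (simp add: kern_def q_def)
          moreover have "dx * (coef \<psi>y m * coef \<zeta> (n - m)) - dy * (coef \<psi>x m * coef \<zeta> (n - m)) - dx * (coef w m * coef \<zeta> (n - m))
             = (of_real (\<kappa> * of_int (fst n)) * of_real (of_int (snd m) / (\<kappa> * q)) - of_real (\<kappa> * of_int (snd n)) * of_real (of_int (fst m) / (\<kappa> * q))) * c m * c (n - m)"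
            unfolding d \<psi>(4,5) zc w0 zm q_def[symmetric] \<kappa>_def[symmetric]
            by (simp add: algebra_simps del: of_real_mult of_real_divide)
          ultimately show ?thesis by simp
        qed
      qed
    qed
    finally show ?thesis using False by (simp add: c_def n_def)
  qed
qed

text \<open>The zonal mean selects the row 0 of the product of the two velocity components, and in
  that convolution the x-derivative of the stream function removes the zonal modes.\<close>

lemma G_coeff_eq:
  assumes adm: "admissible u \<zeta>"
  shows "G_coeff l \<zeta> k = nonlin wave_unit (state u \<zeta>) (state u \<zeta>) (0, k)"
proof -
  have z: "sq_integrable (torus2 l) \<zeta>" using adm by (auto simp: admissible_def)
  define \<psi>x where "\<psi>x = deriv_x l (inv_lap l \<zeta>)"
  define \<psi>y where "\<psi>y = deriv_y l (inv_lap l \<zeta>)"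
  note \<psi> = stream_function[OF z, folded \<psi>x_def \<psi>y_def]
  define n :: "int \<times> int" where "n = (0, k)"
  define c where "c = state u \<zeta>"
  have cz: "coef \<zeta> m = (if fst m = 0 then 0 else c m)" for m
    unfolding admissible_coef[OF adm] by (simp add: nonzonal_def c_def)
  have "G_coeff l \<zeta> k = \<i> * of_real (wavenum l k) * coef (\<lambda>p. \<psi>x p * \<psi>y p) n"
    by (simp add: G_coeff_def Let_def n_def zonal_coef(2)[OF sq_integrable_mult[OF \<psi>(2,3)]] flip: \<psi>x_def \<psi>y_def)
  also have "\<dots> = (\<Sum>\<^sub>\<infinity>m. \<i> * of_real (wavenum l k) * (coef \<psi>x m * coef \<psi>y (n - m)))"
    unfolding coef_mult[OF \<psi>(2,3)] infsum_cmult_right' ..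
  also have "\<dots> = nonlin wave_unit c c n"
    unfolding nonlin_def
  proof (rule infsum_cong)
    fix m
    define \<kappa> where "\<kappa> = wave_unit"
    have \<kappa>: "\<kappa> \<noteq> 0" using wave_unit_pos by (simp add: \<kappa>_def)
    show "\<i> * of_real (wavenum l k) * (coef \<psi>x m * coef \<psi>y (n - m)) = kern wave_unit n m * c m * c (n - m)"
    proof (cases "fst m = 0")
      case True
      then show ?thesis unfolding \<psi>(4) by (simp add: cz kern_def n_def)
    next
      case m0: False
      have nm: "fst n \<noteq> fst m" using m0 by (simp add: n_def)
      have zc: "coef \<zeta> m = c m" "coef \<zeta> (n - m) = c (n - m)" using m0 nm by (simp_all add: cz)
      define q where "q = jap m - 1"
      define r where "r = jap (n - m) - 1"
      define A where "A = of_int (snd n) * of_int (fst m) * of_int (snd n - snd m) / (\<kappa> * q * r)"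
      have K: "kern wave_unit n m = - (\<i> * of_real A)"
        using nm m0 by (simp add: kern_def n_def A_def q_def r_def \<kappa>_def)
      have "\<i> * of_real (wavenum l k) * (coef \<psi>x m * coef \<psi>y (n - m))
         = - (\<i> * of_real (\<kappa> * of_int (snd n) * (of_int (fst m) / (\<kappa> * q)) * (of_int (snd (n - m)) / (\<kappa> * r)))) * c m * c (n - m)"
        unfolding \<psi>(4,5) zc wavenum_eq \<kappa>_def[symmetric] q_def[symmetric] r_def[symmetric] of_real_mult
        by (simp add: n_def mult_ac del: of_real_divide)
      also have "\<kappa> * of_int (snd n) * (of_int (fst m) / (\<kappa> * q)) * (of_int (snd (n - m)) / (\<kappa> * r)) = A"
        using \<kappa> by (simp add: A_def)
      finally show ?thesis unfolding K .
    qed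
  qed
  finally show ?thesis by (simp add: c_def n_def)
qed

end

section \<open>From sequences to solutions\<close>

text \<open>Strong measurability asks for simple functions of time. Rounding \<open>t\<close> down
  to a grid of mesh \<open>h\<close> takes finitely many values on a bounded interval, and the
  uniform continuity of the finitely many modes determines \<open>h\<close>.\<close>

lemma time_discretization:
  fixes c :: "real \<Rightarrow> int \<times> int \<Rightarrow> complex"
  assumes cont: "\<And>n. continuous_on {0..} (\<lambda>t. c t n)"
  shows "\<exists>\<tau>. simple_function (lebesgue_on {0<..}) \<tau> \<and> (\<forall>t. 0 \<le> \<tau> t) \<and>
    (\<forall>t. 0 < t \<longrightarrow> t \<le> real M \<longrightarrow> hbound s (trunc M (\<lambda>n. c t n - c (\<tau> t) n)) (1 / (real M + 1)))"
proof -
  \<comment> \<open>The total weight of the modes plus 1 for positivity. The estimate (K - 1) e^2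
    \<le> (K e)^2 then spares a square root.\<close>
  define K where "K = (\<Sum>n\<in>modes M. jap n powr s) + 1"
  have K: "K > 0" unfolding K_def by (intro add_nonneg_pos sum_nonneg) auto
  define e where "e = 1 / (real M + 1) / K"
  have e: "e > 0" using K by (simp add: e_def)
  have "\<exists>d>0. \<forall>t\<in>{0..real M}. \<forall>t'\<in>{0..real M}. dist t' t < d \<longrightarrow> dist (c t' n) (c t n) < e" for n
    using compact_uniformly_continuous[OF continuous_on_subset[OF cont[of n]], of "{0..real M}"] e
    unfolding uniformly_continuous_on_def by auto
  then have "\<forall>n. \<exists>d>0. \<forall>t\<in>{0..real M}. \<forall>t'\<in>{0..real M}. dist t' t < d \<longrightarrow> dist (c t' n) (c t n) < e" by blast
  from choice[OF this] obtain d where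
    d: "\<And>n. d n > 0" "\<And>n t t'. t \<in> {0..real M} \<Longrightarrow> t' \<in> {0..real M} \<Longrightarrow> dist t' t < d n \<Longrightarrow> dist (c t' n) (c t n) < e"
    by blast
  define h where "h = Min (d ` modes M)"
  have ne: "modes M \<noteq> {}" by (auto simp: modes_def)
  have h: "h > 0" "\<And>n. n \<in> modes M \<Longrightarrow> h \<le> d n"
    unfolding h_def using d(1) ne by auto
  \<comment> \<open>The value 0 beyond \<open>M\<close> keeps the range finite.\<close>
  define \<tau> where "\<tau> t = (if 0 < t \<and> t \<le> real M then h * of_int \<lfloor>t / h\<rfloor> else 0)" for t
  have \<tau>0: "0 \<le> \<tau> t" for t using h by (simp add: \<tau>_def)
  have "simple_function (lebesgue_on {0<..}) \<tau>"
  proof (rule simple_function_borel_measurable)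
    have "\<tau> \<in> borel_measurable borel" unfolding \<tau>_def by measurable
    then show "\<tau> \<in> borel_measurable (lebesgue_on {0<..})"
      by (intro measurable_restrict_space1 measurable_completion) simp
    have "\<tau> ` space (lebesgue_on {0<..}) \<subseteq> insert 0 ((\<lambda>i. h * of_int i) ` {0..\<lfloor>real M / h\<rfloor>})"
      using h by (auto simp: \<tau>_def intro!: imageI floor_mono divide_right_mono)
    then show "finite (\<tau> ` space (lebesgue_on {0<..}))" by (rule finite_subset) simp
  qed
  moreover have "hbound s (trunc M (\<lambda>n. c t n - c (\<tau> t) n)) (1 / (real M + 1))" if t: "0 < t" "t \<le> real M" for t
  proof (rule hboundI)
    have fl: "of_int \<lfloor>t / h\<rfloor> \<le> t / h" "t / h < of_int \<lfloor>t / h\<rfloor> + 1" by linarith+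
    have "h * of_int \<lfloor>t / h\<rfloor> \<le> h * (t / h)" "h * (t / h) < h * (of_int \<lfloor>t / h\<rfloor> + 1)"
      using fl h(1) by (intro mult_left_mono mult_strict_left_mono; simp)+
    then have "\<tau> t \<le> t" "t < \<tau> t + h"
      using h(1) t by (simp_all add: \<tau>_def distrib_left)
    then have near: "\<tau> t \<in> {0..real M}" "dist (\<tau> t) t < h" using \<tau>0[of t] t by (auto simp: dist_real_def)
    have ce: "cmod (c t n - c (\<tau> t) n) \<le> e" if "n \<in> modes M" for n
      using d(2)[of t "\<tau> t" n] near h(2)[OF that] t by (simp add: dist_norm norm_minus_commute)
    fix F :: "(int \<times> int) set" assume F: "finite F"
    have "(\<Sum>n\<in>F. jap n powr s * (cmod (trunc M (\<lambda>n. c t n - c (\<tau> t) n) n))\<^sup>2)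
      = (\<Sum>n\<in>F \<inter> modes M. jap n powr s * (cmod (c t n - c (\<tau> t) n))\<^sup>2)"
      by (rule sum.mono_neutral_cong_right) (use F in \<open>auto simp: trunc_def\<close>)
    also have "\<dots> \<le> (\<Sum>n\<in>F \<inter> modes M. jap n powr s * e\<^sup>2)"
      using ce by (intro sum_mono mult_left_mono power_mono) auto
    also have "\<dots> \<le> (\<Sum>n\<in>modes M. jap n powr s * e\<^sup>2)"
      by (rule sum_mono2) auto
    also have "\<dots> = (K - 1) * e\<^sup>2" by (simp add: K_def sum_distrib_right)
    also have "\<dots> \<le> K\<^sup>2 * e\<^sup>2"
    proof (rule mult_right_mono)
      have "0 \<le> (K - 1)\<^sup>2" by simp
      then show "K - 1 \<le> K\<^sup>2" using K by (simp add: power2_diff)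
    qed simp
    also have "\<dots> = (K * e)\<^sup>2" by (simp add: power_mult_distrib)
    also have "K * e = 1 / (real M + 1)" using K by (simp add: e_def)
    finally show "(\<Sum>n\<in>F. jap n powr s * (cmod (trunc M (\<lambda>n. c t n - c (\<tau> t) n) n))\<^sup>2) \<le> (1 / (real M + 1))\<^sup>2" .
  qed simp
  ultimately show ?thesis using \<tau>0 by blast
qed

lemma hbound_tail_weighted:
  assumes "hbound s a B" "\<epsilon> > 0"
  shows "\<forall>\<^sub>F M in sequentially. hbound s (\<lambda>n. a n - trunc M a n) \<epsilon>"
proof -
  define b where "b n = of_real (jap n powr (s/2)) * a n" for n
  have sq: "(jap n powr (s/2))\<^sup>2 = jap n powr s" for n
    by (simp add: power2_eq_square flip: powr_add)
  have bb: "hbound 0 b B"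
    using assms(1) unfolding hbound0 unfolding hbound_def b_def by (auto simp: norm_mult power_mult_distrib sq)
  obtain M0 where M0: "\<And>M N. M0 \<le> M \<Longrightarrow> M0 \<le> N \<Longrightarrow> hbound 0 (\<lambda>n. trunc M b n - trunc N b n) \<epsilon>"
    using hbound_tail[OF bb assms(2)] by blast
  have "hbound s (\<lambda>n. a n - trunc M a n) \<epsilon>" if M: "M0 \<le> M" for M
  proof -
    have h: "hbound 0 (\<lambda>n. b n - trunc M b n) \<epsilon>"
    proof (rule hbound_limit[where a="\<lambda>i n. trunc (i + M0) b n - trunc M b n"])
      fix n
      have "(\<lambda>i. trunc (i + M0) b n) \<longlonglongrightarrow> b n"
        by (rule LIMSEQ_ignore_initial_segment) (rule trunc_tendsto, rule tendsto_const)
      then show "(\<lambda>i. trunc (i + M0) b n - trunc M b n) \<longlonglongrightarrow> b n - trunc M b n"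
        by (intro tendsto_intros)
    qed (use M0 M in auto)
    have "(cmod (b n - trunc M b n))\<^sup>2 = jap n powr s * (cmod (a n - trunc M a n))\<^sup>2" for n
      by (simp add: b_def trunc_def norm_mult power_mult_distrib sq)
    then show ?thesis using h unfolding hbound0 unfolding hbound_def by simp
  qed
  then show ?thesis by (auto simp: eventually_sequentially)
qed

text \<open>The one index \<open>M\<close> governs truncation, time horizon and accuracy. Continuity
  of each coefficient and a uniform bound thus yield approximation in the full norm at every time,
  without continuity in that norm.\<close>

lemma time_approximation:
  fixes c :: "real \<Rightarrow> int \<times> int \<Rightarrow> complex"
  assumes cont: "\<And>n. continuous_on {0..} (\<lambda>t. c t n)" and bnd: "\<And>t. 0 \<le> t \<Longrightarrow> hbound s (c t) B"
  shows "\<exists>\<tau>. (\<forall>M::nat. simple_function (lebesgue_on {0<..}) (\<tau> M)) \<and> (\<forall>M t. 0 \<le> \<tau> M t) \<and>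
    (\<forall>t>0. \<forall>\<epsilon>>0. \<forall>\<^sub>F M in sequentially. hbound s (\<lambda>n. c t n - trunc M (c (\<tau> M t)) n) \<epsilon>)"
proof -
  have "\<forall>M. \<exists>\<tau>. simple_function (lebesgue_on {0<..}) \<tau> \<and> (\<forall>t. 0 \<le> \<tau> t) \<and>
    (\<forall>t. 0 < t \<longrightarrow> t \<le> real M \<longrightarrow> hbound s (trunc M (\<lambda>n. c t n - c (\<tau> t) n)) (1 / (real M + 1)))"
    by (intro allI time_discretization cont)
  from choice[OF this] obtain \<tau> where \<tau>: "\<forall>M. simple_function (lebesgue_on {0<..}) (\<tau> M) \<and> (\<forall>t. 0 \<le> \<tau> M t) \<and>
    (\<forall>t. 0 < t \<longrightarrow> t \<le> real M \<longrightarrow> hbound s (trunc M (\<lambda>n. c t n - c (\<tau> M t) n)) (1 / (real M + 1)))" ..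
  have "\<forall>\<^sub>F M in sequentially. hbound s (\<lambda>n. c t n - trunc M (c (\<tau> M t)) n) \<epsilon>"
    if t: "t > 0" and \<epsilon>: "\<epsilon> > 0" for t \<epsilon> :: real
  proof -
    have e2: "0 < \<epsilon> / 2" using \<epsilon> by simp
    have "(\<lambda>M. 1 / (real M + 1)) \<longlonglongrightarrow> 0"
      using LIMSEQ_inverse_real_of_nat by (simp add: inverse_eq_divide add.commute)
    then have "\<forall>\<^sub>F M in sequentially. 1 / (real M + 1) < \<epsilon> / 2"
      using e2 by (rule order_tendstoD)
    moreover have "\<forall>\<^sub>F M in sequentially. t \<le> real M"
      using filterlim_real_sequentially by (simp add: filterlim_at_top)
    moreover have "\<forall>\<^sub>F M in sequentially. hbound s (\<lambda>n. c t n - trunc M (c t) n) (\<epsilon> / 2)"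
      using t by (intro hbound_tail_weighted[OF bnd e2]) simp
    ultimately show ?thesis
    proof eventually_elim
      case (elim M)
      have "hbound s (trunc M (\<lambda>n. c t n - c (\<tau> M t) n)) (1 / (real M + 1))"
        using \<tau> t elim(2) by blast
      then have "hbound s (trunc M (\<lambda>n. c t n - c (\<tau> M t) n)) (\<epsilon> / 2)"
        by (rule hbound_mono[OF _ less_imp_le[OF elim(1)]])
      from hbound_add[OF elim(3) this]
      have "hbound s (\<lambda>n. (c t n - trunc M (c t) n) + trunc M (\<lambda>n. c t n - c (\<tau> M t) n) n) \<epsilon>" by simp
      moreover have "(\<lambda>n. (c t n - trunc M (c t) n) + trunc M (\<lambda>n. c t n - c (\<tau> M t) n) n) = (\<lambda>n. c t n - trunc M (c (\<tau> M t)) n)"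
        by (auto simp: trunc_def fun_eq_iff)
      ultimately show ?case by simp
    qed
  qed
  with \<tau> show ?thesis by blast
qed

section \<open>The Duhamel system as a mild equation for the coefficients\<close>

locale zonal_flow = torus +
  fixes \<nu> C1 :: real
  assumes \<nu>_pos: "\<nu> > 0"
begin

definition symbol :: "int \<times> int \<Rightarrow> complex" where
  "symbol n = D_symbol l \<nu> C1 (fst n) (snd n)"

sublocale spectral_system wave_unit "\<nu> * wave_unit\<^sup>2" symbol
proof
  show "wave_unit > 0" by (rule wave_unit_pos)
  show "damping (\<nu> * wave_unit\<^sup>2) symbol"
    unfolding damping_def
  proof (intro conjI allI)
    show "0 < \<nu> * wave_unit\<^sup>2" using \<nu>_pos wave_unit_pos by simp
    show "Re (symbol n) = - (\<nu> * wave_unit\<^sup>2) * (jap n - 1)" for n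
      by (simp add: symbol_def D_symbol_def lap_symbol_eq)
  qed
  show "symbol (- n) = cnj (symbol n)" for n
    by (simp add: symbol_def D_symbol_def lap_symbol_def inv_lap_symbol_def wavenum_uminus)
qed

lemma symbol_zonal: "symbol (0, k) = heat_symbol l \<nu> k"
  by (simp add: symbol_def D_symbol_def heat_symbol_def lap_symbol_def wavenum_def)

text \<open>The row 0 is the equation for \<open>u\<close>, the other rows are the one for
  \<open>\<zeta>\<close>. The row 0 of the latter reads 0 = 0, because the forcing and the zonal
  modes of the vorticity vanish there.\<close>

lemma duhamel_iff_mild:
  assumes adm: "AE r in lebesgue. r \<in> {0..t} \<longrightarrow> admissible (u r) (\<zeta> r)"
    and admt: "admissible (u t) (\<zeta> t)" and adm0: "admissible u0 \<zeta>0"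
  shows "duhamel_u l \<nu> u0 u \<zeta> t \<and> duhamel_zeta l \<nu> C1 \<zeta>0 u \<zeta> t \<longleftrightarrow>
    mild (state u0 \<zeta>0) (\<lambda>r. nonlin wave_unit (state (u r) (\<zeta> r)) (state (u r) (\<zeta> r))) t (state (u t) (\<zeta> t))"
proof -
  define N where "N r = nonlin wave_unit (state (u r) (\<zeta> r)) (state (u r) (\<zeta> r))" for r
  define P where "P n \<longleftrightarrow> set_integrable lebesgue {0..t} (\<lambda>r. exp (of_real (t - r) * symbol n) * N r n) \<and>
     state (u t) (\<zeta> t) n = exp (of_real t * symbol n) * state u0 \<zeta>0 n
       + (LINT r:{0..t}|lebesgue. exp (of_real (t - r) * symbol n) * N r n)" for n
  have aeG: "AE r in lebesgue. r \<in> {0..t} \<longrightarrow>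
      exp (of_real (t - r) * heat_symbol l \<nu> k) * G_coeff l (\<zeta> r) k = exp (of_real (t - r) * symbol (0, k)) * N r (0, k)" for k
    using adm by eventually_elim (auto simp: G_coeff_eq symbol_zonal N_def)
  have U: "duhamel_u l \<nu> u0 u \<zeta> t \<longleftrightarrow> (\<forall>k. P (0, k))"
    unfolding duhamel_u_def P_def set_integral_AE_cong[OF aeG] by (simp add: state_def symbol_zonal)
  have aeF: "AE r in lebesgue. r \<in> {0..t} \<longrightarrow>
      exp (of_real (t - r) * D_symbol l \<nu> C1 j k) * F_coeff l (u r) (\<zeta> r) j k
      = (if j = 0 then 0 else exp (of_real (t - r) * symbol (j, k)) * N r (j, k))" for j k
    using adm by eventually_elim (auto simp: F_coeff_eq symbol_def N_def)
  have c0: "coef (\<zeta> t) (0, k) = 0" "coef \<zeta>0 (0, k) = 0" for k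
    using admissible_coef[OF admt] admissible_coef[OF adm0] by (auto simp: nonzonal_def)
  have Z: "duhamel_zeta l \<nu> C1 \<zeta>0 u \<zeta> t \<longleftrightarrow> (\<forall>j k. j \<noteq> 0 \<longrightarrow> P (j, k))"
    unfolding duhamel_zeta_def set_integral_AE_cong[OF aeF] P_def
  proof (intro all_cong1)
    fix j k
    show "(set_integrable lebesgue {0..t} (\<lambda>r. if j = 0 then 0 else exp (of_real (t - r) * symbol (j, k)) * N r (j, k)) \<and>
        fcoeff2 l (\<zeta> t) j k = exp (of_real t * D_symbol l \<nu> C1 j k) * fcoeff2 l \<zeta>0 j k
          + (LINT r:{0..t}|lebesgue. if j = 0 then 0 else exp (of_real (t - r) * symbol (j, k)) * N r (j, k)))
      \<longleftrightarrow> (j \<noteq> 0 \<longrightarrow> set_integrable lebesgue {0..t} (\<lambda>r. exp (of_real (t - r) * symbol (j, k)) * N r (j, k)) \<and>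
        state (u t) (\<zeta> t) (j, k) = exp (of_real t * symbol (j, k)) * state u0 \<zeta>0 (j, k)
          + (LINT r:{0..t}|lebesgue. exp (of_real (t - r) * symbol (j, k)) * N r (j, k)))"
    proof (cases "j = 0")
      case True
      then show ?thesis using c0[of k] by (simp add: set_integrable_def coef_def)
    next
      case False
      then show ?thesis by (simp add: state_def coef_def symbol_def)
    qed
  qed
  have "mild (state u0 \<zeta>0) N t (state (u t) (\<zeta> t)) \<longleftrightarrow> (\<forall>n. P n)"
    unfolding mild_def P_def ..
  also have "\<dots> \<longleftrightarrow> (\<forall>k. P (0, k)) \<and> (\<forall>j k. j \<noteq> 0 \<longrightarrow> P (j, k))"
    by (metis prod.collapse)
  finally show ?thesis unfolding U Z N_def by blast
qed

text \<open>A function is chosen for each coefficient sequence rather than for each time, so that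
  composing with a simple function of time gives a simple function again.\<close>

definition realize_u :: "(int \<times> int \<Rightarrow> complex) \<Rightarrow> real \<Rightarrow> real" where
  "realize_u a = (SOME u. sq_integrable (torus1 l) u \<and> (\<forall>k. fcoeff1 l u k = a (0, k)))"

definition realize_\<zeta> :: "(int \<times> int \<Rightarrow> complex) \<Rightarrow> real \<times> real \<Rightarrow> real" where
  "realize_\<zeta> a = (SOME g. sq_integrable (torus2 l) g \<and> coef g = nonzonal a)"

lemma realize:
  assumes a: "hermitian a" "hbound 0 a B"
  shows "sq_integrable (torus1 l) (realize_u a)" "fcoeff1 l (realize_u a) k = a (0, k)"
    and "sq_integrable (torus2 l) (realize_\<zeta> a)" "coef (realize_\<zeta> a) = nonzonal a"
proof -
  have "hermitian (axis (\<lambda>k. a (0, k)))"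
  proof -
    have "axis (\<lambda>k. a (0, k)) (- n) = cnj (axis (\<lambda>k. a (0, k)) n)" for n
      using a(1)[unfolded hermitian_def, rule_format, of "(0, snd n)"] by (simp add: axis_def)
    then show ?thesis by (simp add: hermitian_def del: split_paired_All)
  qed
  moreover have "hbound 0 (axis (\<lambda>k. a (0, k))) B"
  proof (rule hbound_cmod_le[OF a(2)])
    show "cmod (axis (\<lambda>k. a (0, k)) n) \<le> cmod (a n)" for n by (cases n) (simp add: axis_def)
  qed
  ultimately have "\<exists>u. sq_integrable (torus1 l) u \<and> (\<forall>k. fcoeff1 l u k = a (0, k))"
    by (rule riesz_fischer1)
  from someI_ex[OF this] show "sq_integrable (torus1 l) (realize_u a)" "fcoeff1 l (realize_u a) k = a (0, k)"
    unfolding realize_u_def by blast+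
  have "\<exists>g. sq_integrable (torus2 l) g \<and> coef g = nonzonal a"
    using riesz_fischer[OF hermitian_nonzonal[OF a(1)] hbound_nonzonal[OF a(2)]] by blast
  from someI_ex[OF this] show "sq_integrable (torus2 l) (realize_\<zeta> a)" "coef (realize_\<zeta> a) = nonzonal a"
    unfolding realize_\<zeta>_def by blast+
qed

lemma realize_state:
  assumes a: "hermitian a" "hbound 0 a B"
  shows "admissible (realize_u a) (realize_\<zeta> a)" "state (realize_u a) (realize_\<zeta> a) = a"
proof -
  note r = realize[OF a]
  show "admissible (realize_u a) (realize_\<zeta> a)"
    unfolding admissible_def
    using r zero_zonal_mean_iff[OF sq_integrable_imp_integrable[OF r(3)]] by (simp add: nonzonal_def)
  show "state (realize_u a) (realize_\<zeta> a) = a"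
    by (auto simp: fun_eq_iff state_def r nonzonal_def)
qed

lemma realize_sobolev:
  assumes a: "hermitian a" "hbound s a B" "0 \<le> s"
  shows "realize_u a \<in> sobolev1 l s" "realize_\<zeta> a \<in> sobolev2 l s"
    and "sobolev1_norm l s (realize_u a) \<le> B" "sobolev2_norm l s (realize_\<zeta> a) \<le> B"
proof -
  note r = realize[OF a(1) hbound_le_index[OF a(2,3)]]
  have 1: "hbound s (axis (fcoeff1 l (realize_u a))) B"
  proof (rule hbound_cmod_le[OF a(2)])
    show "cmod (axis (fcoeff1 l (realize_u a)) n) \<le> cmod (a n)" for n by (cases n) (simp add: axis_def r)
  qed
  have 2: "hbound s (coef (realize_\<zeta> a)) B" unfolding r by (rule hbound_nonzonal[OF a(2)])
  show "realize_u a \<in> sobolev1 l s" "realize_\<zeta> a \<in> sobolev2 l s"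
    using 1 2 r by (auto simp: sobolev1_iff sobolev2_iff)
  show "sobolev1_norm l s (realize_u a) \<le> B" "sobolev2_norm l s (realize_\<zeta> a) \<le> B"
    by (rule sobolev1_norm_le[OF 1], rule sobolev2_norm_le[OF 2])
qed

lemma fcoeff1_diff:
  assumes "sq_integrable (torus1 l) u" "sq_integrable (torus1 l) v"
  shows "fcoeff1 l (\<lambda>y. u y - v y) k = fcoeff1 l u k - fcoeff1 l v k"
proof -
  note i = sq_integrable_imp_integrable1[OF assms(1)] sq_integrable_imp_integrable1[OF assms(2)]
  have "axis (fcoeff1 l (\<lambda>y. u y - v y)) (0, k) = coef (\<lambda>p. u (snd p) - v (snd p)) (0, k)"
    using coef_snd[of "\<lambda>y. u y - v y"] i by auto
  also have "\<dots> = coef (\<lambda>p. u (snd p)) (0, k) - coef (\<lambda>p. v (snd p)) (0, k)"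
    by (rule coef_diff) (intro integrable_snd_TT i)+
  finally show ?thesis unfolding coef_snd[OF i(1)] coef_snd[OF i(2)] by (simp add: axis_def)
qed

text \<open>The approximants realize truncated states at rounded times. Their distance to the
  solution is read off from the coefficients, because realization is linear up to null sets.\<close>

lemma realize_Linfty:
  assumes cont: "\<And>n. continuous_on {0..} (\<lambda>t. c t n)" and s: "0 \<le> s"
    and herm: "\<And>t. 0 \<le> t \<Longrightarrow> hermitian (c t)" and bnd: "\<And>t. 0 \<le> t \<Longrightarrow> hbound s (c t) B"
  shows "Linfty_time (sobolev1 l s) (sobolev1_norm l s) (\<lambda>t. realize_u (c t))"
    and "Linfty_time (sobolev2 l s) (sobolev2_norm l s) (\<lambda>t. realize_\<zeta> (c t))"
proof -
  obtain \<tau> where \<tau>: "\<And>M::nat. simple_function (lebesgue_on {0<..}) (\<tau> M)" "\<And>M t. 0 \<le> \<tau> M t"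
    and ap: "\<And>t \<epsilon>. t > 0 \<Longrightarrow> \<epsilon> > 0 \<Longrightarrow> \<forall>\<^sub>F M in sequentially. hbound s (\<lambda>n. c t n - trunc M (c (\<tau> M t)) n) \<epsilon>"
    using time_approximation[OF cont bnd] by blast
  define b where "b M t = trunc M (c (\<tau> M t))" for M t
  have bh: "hermitian (b M t)" and bb: "hbound s (b M t) B" for M t
    unfolding b_def using herm[OF \<tau>(2)] bnd[OF \<tau>(2)] by (auto intro: hermitian_trunc hbound_trunc)
  note rb = realize[OF bh hbound_le_index[OF bb s]]
  have rc: "sq_integrable (torus1 l) (realize_u (c t))" "fcoeff1 l (realize_u (c t)) k = c t (0, k)"
    "sq_integrable (torus2 l) (realize_\<zeta> (c t))" "coef (realize_\<zeta> (c t)) = nonzonal (c t)" if "0 < t" for t k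
    using realize[OF herm hbound_le_index[OF bnd s]] that by auto
  have lim: "(\<lambda>M. f M) \<longlonglongrightarrow> 0" if "\<And>M. 0 \<le> f M" "\<And>\<epsilon>. \<epsilon> > 0 \<Longrightarrow> \<forall>\<^sub>F M in sequentially. f M \<le> \<epsilon>" for f :: "nat \<Rightarrow> real"
  proof (rule tendstoI)
    fix e :: real assume "e > 0"
    then have "\<forall>\<^sub>F M in sequentially. f M \<le> e / 2" by (intro that(2)) simp
    then show "\<forall>\<^sub>F M in sequentially. dist (f M) 0 < e"
      by eventually_elim (use that(1) \<open>e > 0\<close> in \<open>auto simp: dist_real_def intro: le_less_trans\<close>)
  qed
  have n1: "sobolev1_norm l s (\<lambda>y. realize_u (c t) y - realize_u (b M t) y) \<le> \<epsilon>"
    if t: "0 < t" and h: "hbound s (\<lambda>n. c t n - b M t n) \<epsilon>" for t M \<epsilon>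
  proof (rule sobolev1_norm_le, rule hbound_cmod_le[OF h])
    fix n
    show "cmod (axis (fcoeff1 l (\<lambda>y. realize_u (c t) y - realize_u (b M t) y)) n) \<le> cmod (c t n - b M t n)"
      by (cases n) (simp add: axis_def fcoeff1_diff rc[OF t] rb)
  qed
  have n2: "sobolev2_norm l s (\<lambda>p. realize_\<zeta> (c t) p - realize_\<zeta> (b M t) p) \<le> \<epsilon>"
    if t: "0 < t" and h: "hbound s (\<lambda>n. c t n - b M t n) \<epsilon>" for t M \<epsilon>
  proof (rule sobolev2_norm_le, rule hbound_cmod_le[OF h])
    fix n
    have "coef (\<lambda>p. realize_\<zeta> (c t) p - realize_\<zeta> (b M t) p) n = nonzonal (c t) n - nonzonal (b M t) n"
      using coef_diff[OF sq_integrable_imp_integrable[OF rc(3)[OF t]] sq_integrable_imp_integrable[OF rb(3)]] rc(4)[OF t] rb(4) by simp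
    then show "cmod (coef (\<lambda>p. realize_\<zeta> (c t) p - realize_\<zeta> (b M t) p) n) \<le> cmod (c t n - b M t n)"
      by (simp add: nonzonal_def)
  qed
  have simp_b: "simple_function (lebesgue_on {0<..}) (\<lambda>t. g (b M t))" for g :: "(int \<times> int \<Rightarrow> complex) \<Rightarrow> 'z" and M
    unfolding b_def by (rule simple_function_compose1[OF \<tau>(1)])
  show "Linfty_time (sobolev1 l s) (sobolev1_norm l s) (\<lambda>t. realize_u (c t))"
    unfolding Linfty_time_def
  proof (intro conjI exI[of _ "\<lambda>M t. realize_u (b M t)"] exI[of _ B] allI impI)
    show "simple_function (lebesgue_on {0<..}) (\<lambda>t. realize_u (b M t))" for M by (rule simp_b)
    show "realize_u (b M t) \<in> sobolev1 l s" for M t by (rule realize_sobolev[OF bh bb s])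
    show "AE t in lebesgue_on {0<..}. (\<lambda>M. sobolev1_norm l s (\<lambda>x. realize_u (c t) x - realize_u (b M t) x)) \<longlonglongrightarrow> 0"
    proof (rule AE_I2, rule lim)
      fix t :: real assume "t \<in> space (lebesgue_on {0<..})"
      then have t: "0 < t" by (simp add: space_restrict_space)
      fix \<epsilon> :: real assume "\<epsilon> > 0"
      from ap[OF t this] show "\<forall>\<^sub>F M in sequentially. sobolev1_norm l s (\<lambda>x. realize_u (c t) x - realize_u (b M t) x) \<le> \<epsilon>"
        by eventually_elim (intro n1 t, simp add: b_def)
    qed (simp add: sobolev1_norm_def infsum_nonneg)
    show "AE t in lebesgue_on {0<..}. realize_u (c t) \<in> sobolev1 l s \<and> sobolev1_norm l s (realize_u (c t)) \<le> B"
    proof (rule AE_I2)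
      fix t :: real assume "t \<in> space (lebesgue_on {0<..})"
      then have t: "0 \<le> t" by (simp add: space_restrict_space)
      show "realize_u (c t) \<in> sobolev1 l s \<and> sobolev1_norm l s (realize_u (c t)) \<le> B"
        using realize_sobolev[OF herm[OF t] bnd[OF t] s] by blast
    qed
  qed
  show "Linfty_time (sobolev2 l s) (sobolev2_norm l s) (\<lambda>t. realize_\<zeta> (c t))"
    unfolding Linfty_time_def
  proof (intro conjI exI[of _ "\<lambda>M t. realize_\<zeta> (b M t)"] exI[of _ B] allI impI)
    show "simple_function (lebesgue_on {0<..}) (\<lambda>t. realize_\<zeta> (b M t))" for M by (rule simp_b)
    show "realize_\<zeta> (b M t) \<in> sobolev2 l s" for M t by (rule realize_sobolev[OF bh bb s])
    show "AE t in lebesgue_on {0<..}. (\<lambda>M. sobolev2_norm l s (\<lambda>x. realize_\<zeta> (c t) x - realize_\<zeta> (b M t) x)) \<longlonglongrightarrow> 0"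
    proof (rule AE_I2, rule lim)
      fix t :: real assume "t \<in> space (lebesgue_on {0<..})"
      then have t: "0 < t" by (simp add: space_restrict_space)
      fix \<epsilon> :: real assume "\<epsilon> > 0"
      from ap[OF t this] show "\<forall>\<^sub>F M in sequentially. sobolev2_norm l s (\<lambda>x. realize_\<zeta> (c t) x - realize_\<zeta> (b M t) x) \<le> \<epsilon>"
        by eventually_elim (intro n2 t, simp add: b_def)
    qed (simp add: sobolev2_norm_def infsum_nonneg case_prod_unfold)
    show "AE t in lebesgue_on {0<..}. realize_\<zeta> (c t) \<in> sobolev2 l s \<and> sobolev2_norm l s (realize_\<zeta> (c t)) \<le> B"
    proof (rule AE_I2)
      fix t :: real assume "t \<in> space (lebesgue_on {0<..})"
      then have t: "0 \<le> t" by (simp add: space_restrict_space)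
      show "realize_\<zeta> (c t) \<in> sobolev2 l s \<and> sobolev2_norm l s (realize_\<zeta> (c t)) \<le> B"
        using realize_sobolev[OF herm[OF t] bnd[OF t] s] by blast
    qed
  qed
qed

end

section \<open>Existence and uniqueness for the initial value problem\<close>

context zonal_flow
begin

lemma state_initial:
  assumes s: "0 \<le> s" and u0: "u0 \<in> sobolev1 l s" and z0: "\<zeta>0 \<in> sobolev2 l s"
  shows "hermitian (state u0 \<zeta>0)"
    and "hbound s (state u0 \<zeta>0) (sobolev1_norm l s u0 + sobolev2_norm l s \<zeta>0)"
proof -
  have u: "integrable T1 u0" using u0 sq_integrable_imp_integrable1 by (auto simp: sobolev1_iff)
  show "hermitian (state u0 \<zeta>0)"
    unfolding state_split using coef_hermitian[of "\<lambda>p. u0 (snd p)"]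
    by (intro hermitian_add hermitian_nonzonal coef_hermitian) (simp add: coef_snd[OF u])
  show "hbound s (state u0 \<zeta>0) (sobolev1_norm l s u0 + sobolev2_norm l s \<zeta>0)"
    unfolding state_split by (intro hbound_add hbound_sobolev1 hbound_nonzonal hbound_sobolev2 u0 z0)
qed

lemma solves_at_iff:
  assumes adm0: "admissible u0 \<zeta>0" and adm: "AE r in lebesgue. r \<in> {0..t} \<longrightarrow> admissible (u r) (\<zeta> r)"
  shows "solves_at l \<nu> C1 s u0 \<zeta>0 u \<zeta> t \<longleftrightarrow>
    u t \<in> sobolev1 l s \<and> \<zeta> t \<in> sobolev2 l s \<and> zero_zonal_mean l (\<zeta> t) \<and>
    mild (state u0 \<zeta>0) (\<lambda>r. nonlin wave_unit (state (u r) (\<zeta> r)) (state (u r) (\<zeta> r))) t (state (u t) (\<zeta> t))"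
proof (cases "u t \<in> sobolev1 l s \<and> \<zeta> t \<in> sobolev2 l s \<and> zero_zonal_mean l (\<zeta> t)")
  case True
  then have "admissible (u t) (\<zeta> t)" by (auto simp: admissible_def sobolev1_iff sobolev2_iff)
  from duhamel_iff_mild[OF adm this adm0] show ?thesis by (auto simp: solves_at_def)
qed (auto simp: solves_at_def)

lemma greaterThan_sets_lebesgue: "{0<..} \<inter> space lebesgue \<in> sets (lebesgue :: real measure)"
  by simp

text \<open>A solution known at almost every time is brought into the form that
  \<open>mild_unique\<close> expects. The regularity of order \<open>s\<close> enters through the
  bound of order 0 that it implies, which is where uniqueness is decided.\<close>

lemma global_solution_state:
  assumes s: "0 \<le> s" and adm0: "admissible u0 \<zeta>0" and sol: "global_solution l \<nu> C1 s u0 \<zeta>0 v \<eta>"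
  shows "\<exists>R. AE t in lebesgue. 0 < t \<longrightarrow> admissible (v t) (\<eta> t) \<and> hbound 0 (state (v t) (\<eta> t)) R \<and>
    mild (state u0 \<zeta>0) (\<lambda>r. nonlin wave_unit (state (v r) (\<eta> r)) (state (v r) (\<eta> r))) t (state (v t) (\<eta> t))"
proof -
  obtain B1 B2 where
    B1: "AE t in lebesgue_on {0<..}. v t \<in> sobolev1 l s \<and> sobolev1_norm l s (v t) \<le> B1" and
    B2: "AE t in lebesgue_on {0<..}. \<eta> t \<in> sobolev2 l s \<and> sobolev2_norm l s (\<eta> t) \<le> B2" and
    S: "AE t in lebesgue_on {0<..}. solves_at l \<nu> C1 s u0 \<zeta>0 v \<eta> t"
    using sol by (auto simp: global_solution_def Linfty_time_def)
  note ae = B1[unfolded AE_restrict_space_iff[OF greaterThan_sets_lebesgue]] B2[unfolded AE_restrict_space_iff[OF greaterThan_sets_lebesgue]] S[unfolded AE_restrict_space_iff[OF greaterThan_sets_lebesgue]]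
  have AE0: "AE r in lebesgue. r \<noteq> (0::real)"
    by (rule AE_I'[of "{0}"]) (auto simp: null_sets_def)
  have adm: "AE r in lebesgue. 0 \<le> r \<longrightarrow> admissible (v r) (\<eta> r)"
    using ae(3) AE0 by eventually_elim (auto simp: solves_at_def admissible_def sobolev1_iff sobolev2_iff)
  have adm_t: "AE r in lebesgue. r \<in> {0..t} \<longrightarrow> admissible (v r) (\<eta> r)" for t
    using adm by eventually_elim auto
  have "AE t in lebesgue. 0 < t \<longrightarrow> admissible (v t) (\<eta> t) \<and> hbound 0 (state (v t) (\<eta> t)) (B1 + B2) \<and>
    mild (state u0 \<zeta>0) (\<lambda>r. nonlin wave_unit (state (v r) (\<eta> r)) (state (v r) (\<eta> r))) t (state (v t) (\<eta> t))"
    using ae adm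
  proof eventually_elim
    case (elim t)
    show ?case
    proof
      assume t: "0 < t"
      have "hbound s (state (v t) (\<eta> t)) (B1 + B2)"
        unfolding state_split using elim t
        by (intro hbound_add hbound_nonzonal hbound_mono[OF hbound_sobolev1] hbound_mono[OF hbound_sobolev2]) auto
      then show "admissible (v t) (\<eta> t) \<and> hbound 0 (state (v t) (\<eta> t)) (B1 + B2) \<and>
        mild (state u0 \<zeta>0) (\<lambda>r. nonlin wave_unit (state (v r) (\<eta> r)) (state (v r) (\<eta> r))) t (state (v t) (\<eta> t))"
        using elim t s solves_at_iff[OF adm0 adm_t] by (auto intro: hbound_le_index)
    qed
  qed
  then show ?thesis by (rule exI[of _ "B1 + B2"])
qed

lemma state_eq_AE:
  assumes "admissible v \<eta>" "admissible u \<zeta>" "state v \<eta> = state u \<zeta>"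
  shows "AE y in T1. v y = u y" and "AE p in TT. \<eta> p = \<zeta> p"
proof -
  have "fcoeff1 l v k = fcoeff1 l u k" for k
    using fun_cong[OF assms(3), of "(0, k)"] by (simp add: state_def)
  then show "AE y in T1. v y = u y"
    using assms by (intro fcoeff1_unique sq_integrable_imp_integrable1) (auto simp: admissible_def)
  have "coef \<eta> n = coef \<zeta> n" for n
    unfolding admissible_coef[OF assms(1)] admissible_coef[OF assms(2)] assms(3) ..
  then show "AE p in TT. \<eta> p = \<zeta> p"
    using assms by (intro coef_unique sq_integrable_imp_integrable) (auto simp: admissible_def)
qed

lemma well_posed:
  assumes s: "0 \<le> s" and u0: "u0 \<in> sobolev1 l s" and z0: "\<zeta>0 \<in> sobolev2 l s" and zz: "zero_zonal_mean l \<zeta>0"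
  shows "\<exists>u \<zeta>. global_solution l \<nu> C1 s u0 \<zeta>0 u \<zeta> \<and>
    (\<forall>t\<ge>0. solves_at l \<nu> C1 s u0 \<zeta>0 u \<zeta> t) \<and>
    (AE y in lebesgue_on (torus1 l). u 0 y = u0 y) \<and>
    (AE p in lebesgue_on (torus2 l). \<zeta> 0 p = \<zeta>0 p) \<and>
    (\<forall>v \<eta>. global_solution l \<nu> C1 s u0 \<zeta>0 v \<eta> \<longrightarrow>
       (AE t in lebesgue_on {0<..}.
          (AE y in lebesgue_on (torus1 l). v t y = u t y) \<and>
          (AE p in lebesgue_on (torus2 l). \<eta> t p = \<zeta> t p)))"
proof -
  have adm0: "admissible u0 \<zeta>0"
    using u0 z0 zz by (auto simp: admissible_def sobolev1_iff sobolev2_iff)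
  obtain c R B where R: "0 < R" and cont: "\<And>n. continuous_on {0..} (\<lambda>t. c t n)"
    and c: "\<And>t. 0 \<le> t \<Longrightarrow> hermitian (c t) \<and> hbound 0 (c t) R \<and> hbound s (c t) B \<and>
       mild (state u0 \<zeta>0) (\<lambda>r. nonlin wave_unit (c r) (c r)) t (c t)"
    using mild_solution_exists[OF state_initial[OF s u0 z0] s] by blast
  define u where "u t = realize_u (c t)" for t
  define \<zeta> where "\<zeta> t = realize_\<zeta> (c t)" for t
  have adm: "admissible (u t) (\<zeta> t)" and st: "state (u t) (\<zeta> t) = c t" if "0 \<le> t" for t
    unfolding u_def \<zeta>_def using realize_state[of "c t" R] c[OF that] by auto
  have solves: "solves_at l \<nu> C1 s u0 \<zeta>0 u \<zeta> t" if t: "0 \<le> t" for t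
  proof -
    have ae: "AE r in lebesgue. r \<in> {0..t} \<longrightarrow> admissible (u r) (\<zeta> r)"
      by (intro AE_I2) (use adm in auto)
    \<comment> \<open>The state is known to be \<open>c\<close> at nonnegative times, and the
      indicator hides the others.\<close>
    have e: "indicator {0..t} r *\<^sub>R (exp (of_real (t - r) * symbol n) * nonlin wave_unit (state (u r) (\<zeta> r)) (state (u r) (\<zeta> r)) n)
      = indicator {0..t} r *\<^sub>R (exp (of_real (t - r) * symbol n) * nonlin wave_unit (c r) (c r) n)" for r n
      by (auto simp: indicator_def st)
    have "mild (state u0 \<zeta>0) (\<lambda>r. nonlin wave_unit (state (u r) (\<zeta> r)) (state (u r) (\<zeta> r))) t (state (u t) (\<zeta> t))"
      using c[OF t] unfolding mild_def set_integrable_def set_lebesgue_integral_def e st[OF t] by blast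
    then show ?thesis
      unfolding solves_at_iff[OF adm0 ae]
      using realize_sobolev[of "c t" s B] c[OF t] s adm[OF t] by (auto simp: u_def \<zeta>_def admissible_def)
  qed
  have "Linfty_time (sobolev1 l s) (sobolev1_norm l s) u" "Linfty_time (sobolev2 l s) (sobolev2_norm l s) \<zeta>"
    unfolding u_def \<zeta>_def by (rule realize_Linfty[OF cont s], use c in blast, use c in blast)+
  then have sol_u: "global_solution l \<nu> C1 s u0 \<zeta>0 u \<zeta>"
    unfolding global_solution_def using solves by (auto intro!: AE_I2 simp: space_restrict_space)
  have "state (u 0) (\<zeta> 0) = state u0 \<zeta>0"
  proof -
    have "c 0 n = state u0 \<zeta>0 n" for n
    proof -
      \<comment> \<open>At time 0 the Duhamel integral runs over a single point. So the trajectory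
        starts exactly at the state of the data, and the functions attain the data up to null
        sets.\<close>
      have "AE r in lebesgue. r \<noteq> (0::real)"
        by (rule AE_I'[of "{0}"]) (auto simp: null_sets_def)
      then have "AE r in lebesgue. indicator {0..0::real} r *\<^sub>R
          (exp (of_real (0 - r) * symbol n) * nonlin wave_unit (c r) (c r) n) = 0"
        by eventually_elim simp
      then have "(LINT r:{0..0}|lebesgue. exp (of_real (0 - r) * symbol n) * nonlin wave_unit (c r) (c r) n) = 0"
        unfolding set_lebesgue_integral_def by (rule integral_eq_zero_AE)
      moreover have "mild (state u0 \<zeta>0) (\<lambda>r. nonlin wave_unit (c r) (c r)) 0 (c 0)"
        using c[OF order_refl] by blast
      then have "c 0 n = exp (of_real 0 * symbol n) * state u0 \<zeta>0 n +
          (LINT r:{0..0}|lebesgue. exp (of_real (0 - r) * symbol n) * nonlin wave_unit (c r) (c r) n)"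
        unfolding mild_def by blast
      ultimately show ?thesis by simp
    qed
    then have "c 0 = state u0 \<zeta>0" by (rule ext)
    with st[OF order_refl] show ?thesis by (rule trans)
  qed
  note init = state_eq_AE[OF adm[OF order_refl] adm0 this]
  have unique: "AE t in lebesgue_on {0<..}. (AE y in T1. v t y = u t y) \<and> (AE p in TT. \<eta> t p = \<zeta> t p)"
    if sol: "global_solution l \<nu> C1 s u0 \<zeta>0 v \<eta>" for v \<eta>
  proof -
    obtain R' where v: "AE t in lebesgue. 0 < t \<longrightarrow> admissible (v t) (\<eta> t) \<and> hbound 0 (state (v t) (\<eta> t)) R' \<and>
      mild (state u0 \<zeta>0) (\<lambda>r. nonlin wave_unit (state (v r) (\<eta> r)) (state (v r) (\<eta> r))) t (state (v t) (\<eta> t))"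
      using global_solution_state[OF s adm0 sol] by blast
    have "AE t in lebesgue. 0 < t \<longrightarrow> state (v t) (\<eta> t) = c t"
    proof (rule mild_unique)
      show "AE t in lebesgue. 0 < t \<longrightarrow> hbound 0 (state (v t) (\<eta> t)) (max R R') \<and>
        mild (state u0 \<zeta>0) (\<lambda>r. nonlin wave_unit (state (v r) (\<eta> r)) (state (v r) (\<eta> r))) t (state (v t) (\<eta> t))"
        using v
      proof eventually_elim
        case (elim t)
        show ?case
        proof (intro impI conjI)
          assume "0 < t"
          then have e: "hbound 0 (state (v t) (\<eta> t)) R'"
            "mild (state u0 \<zeta>0) (\<lambda>r. nonlin wave_unit (state (v r) (\<eta> r)) (state (v r) (\<eta> r))) t (state (v t) (\<eta> t))"
            using elim by blast+
          show "hbound 0 (state (v t) (\<eta> t)) (max R R')"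
            by (rule hbound_mono[OF e(1) max.cobounded2])
          show "mild (state u0 \<zeta>0) (\<lambda>r. nonlin wave_unit (state (v r) (\<eta> r)) (state (v r) (\<eta> r))) t (state (v t) (\<eta> t))"
            by (rule e(2))
        qed
      qed
      show "AE t in lebesgue. 0 < t \<longrightarrow> hbound 0 (c t) (max R R') \<and>
        mild (state u0 \<zeta>0) (\<lambda>r. nonlin wave_unit (c r) (c r)) t (c t)"
      proof (intro AE_I2 impI conjI)
        fix t :: real assume "0 < t"
        then have e: "hbound 0 (c t) R" "mild (state u0 \<zeta>0) (\<lambda>r. nonlin wave_unit (c r) (c r)) t (c t)"
          using c[of t] by auto
        show "hbound 0 (c t) (max R R')" by (rule hbound_mono[OF e(1) max.cobounded1])
        show "mild (state u0 \<zeta>0) (\<lambda>r. nonlin wave_unit (c r) (c r)) t (c t)" by (rule e(2))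
      qed
      show "0 < max R R'" using R by simp
    qed
    with v have "AE t in lebesgue. 0 < t \<longrightarrow> (AE y in T1. v t y = u t y) \<and> (AE p in TT. \<eta> t p = \<zeta> t p)"
    proof eventually_elim
      case (elim t)
      show ?case
      proof
        assume t: "0 < t"
        then have "admissible (v t) (\<eta> t)" "state (v t) (\<eta> t) = state (u t) (\<zeta> t)" using elim st[of t] by simp_all
        from state_eq_AE[OF this(1) adm this(2)] t
        show "(AE y in T1. v t y = u t y) \<and> (AE p in TT. \<eta> t p = \<zeta> t p)" by simp
      qed
    qed
    then show ?thesis
      unfolding AE_restrict_space_iff[OF greaterThan_sets_lebesgue] greaterThan_iff .
  qed
  show ?thesis
  proof (rule exI[of _ u], rule exI[of _ \<zeta>], intro conjI)
    show "global_solution l \<nu> C1 s u0 \<zeta>0 u \<zeta>" by (rule sol_u)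
    show "\<forall>t\<ge>0. solves_at l \<nu> C1 s u0 \<zeta>0 u \<zeta> t" using solves by blast
    show "AE y in T1. u 0 y = u0 y" "AE p in TT. \<zeta> 0 p = \<zeta>0 p" by (rule init)+
    show "\<forall>v \<eta>. global_solution l \<nu> C1 s u0 \<zeta>0 v \<eta> \<longrightarrow>
      (AE t in lebesgue_on {0<..}. (AE y in T1. v t y = u t y) \<and> (AE p in TT. \<eta> t p = \<zeta> t p))"
    proof (intro allI impI)
      fix v \<eta> assume "global_solution l \<nu> C1 s u0 \<zeta>0 v \<eta>"
      then show "AE t in lebesgue_on {0<..}. (AE y in T1. v t y = u t y) \<and> (AE p in TT. \<eta> t p = \<zeta> t p)"
        by (rule unique)
    qed
  qed
qed

end

theorem theorem1p1:
  fixes l \<nu> C1 s :: real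
    and u0 :: "real \<Rightarrow> real" and \<zeta>0 :: "real \<times> real \<Rightarrow> real"
  assumes "l > 0" and "\<nu> > 0" and "s \<ge> 0"
    and "u0 \<in> sobolev1 l s" and "\<zeta>0 \<in> sobolev2 l s" and "zero_zonal_mean l \<zeta>0"
  shows "\<exists>u \<zeta>. global_solution l \<nu> C1 s u0 \<zeta>0 u \<zeta> \<and>
    (\<forall>t\<ge>0. solves_at l \<nu> C1 s u0 \<zeta>0 u \<zeta> t) \<and>
    (AE y in lebesgue_on (torus1 l). u 0 y = u0 y) \<and>
    (AE p in lebesgue_on (torus2 l). \<zeta> 0 p = \<zeta>0 p) \<and>
    (\<forall>v \<eta>. global_solution l \<nu> C1 s u0 \<zeta>0 v \<eta> \<longrightarrow>
       (AE t in lebesgue_on {0<..}.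
          (AE y in lebesgue_on (torus1 l). v t y = u t y) \<and>
          (AE p in lebesgue_on (torus2 l). \<eta> t p = \<zeta> t p)))"
proof -
  interpret zonal_flow l \<nu> C1 by unfold_locales (use assms in auto)
  show ?thesis by (rule well_posed[OF assms(3-6)])
qed

end
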